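(* Let $n,m,p\in\mathbb{N}$ with $m\ge p$, $A\in\mathbb{R}^{n\times n}$, $B\in\mathbb{R}^{n\times m}$, $C\in\mathbb{R}^{p\times n}$, $x^0\in\mathbb{R}^n$, let $f:\mathbb{R}\times\mathbb{R}^n\times\mathbb{R}^m\to\mathbb{R}^n$ be continuous and bounded, and consider the system $$\dot x(t)=Ax(t)+BL(t)u(t)+f(t,x(t),u(t)),\quad x(0)=x^0,\qquad y(t)=Cx(t).$$ Assume: (P1) $L\in\mathcal{C}^\infty(\mathbb{R}\to\mathbb{R}^{m\times m})$ is such that $L,\dot L,\ldots,L^{(n)}$ are bounded and there is $q\in\mathbb{N}$ with $\operatorname{rk}BL(t)=q\ge p$ for all $t\in\mathbb{R}$; (P2) there is $r\in\mathbb{N}$ such that $CA^kBL(t)=0$ for all $t$ and $CA^kf(t,x,u)=0$ for all $(t,x,u)$, for $k=0,\ldots,r-2$, and $\Gamma:=CA^{r-1}B$ satisfies $\operatorname{rk}\Gamma L(t)=p$ for all $t\in\mathbb{R}$; (P3) $U$ (defined in the context) is a Lyapunov transformation; (P4) the linear time-varying system $\dot\eta(t)=Q(t)\eta(t)$, with $Q$ defined in the context, is uniformly exponentially stable. Let $y_{\rm ref}\in\mathcal{W}^{r,\infty}(\mathbb{R}_{\ge0}\to\mathbb{R}^p)$ and $\varphi_i\in\Phi_{r-i}$ for $i=0,\ldots,r-1$. Assume there exists a bounded $K\in\mathcal{C}^\infty(\mathbb{R}\to\mathbb{R}^{m\times p})$ and $\alpha>0$ such that $\Gamma L(t)K(t)+(\Gamma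 L(t)K(t))^\top\ge\alpha I_p$ and $N(t)K(t)=0$ for all $t\in\mathbb{R}$, with $N$ as in the context. Consider the controller $$e_0(t)=y(t)-y_{\rm ref}(t),\quad e_{i+1}(t)=\dot e_i(t)+k_i(t)e_i(t)\ (i=0,\ldots,r-2),\quad k_i(t)=\frac{1}{1-\varphi_i(t)^2\|e_i(t)\|^2}\ (i=0,\ldots,r-1),$$ $$u(t)=-k_{r-1}(t)K(t)e_{r-1}(t),$$ and assume $x^0$ is such that $\varphi_i(0)\|e_i(0)\|<1$ for $i=0,\ldots,r-1$. Then the closed-loop initial value problem has a solution, every solution can be extended to a maximal solution $x:[0,\omega)\to\mathbb{R}^n$, $\omega\in(0,\infty]$, and every maximal solution satisfies: (i) $\omega=\infty$; (ii) $u$, $k_0,\ldots,k_{r-1}$ and $x$ are bounded on $\mathbb{R}_{\ge0}$; (iii) for each $i=0,\ldots,r-1$ there exists $\varepsilon_i>0$ such that $\|e_i(t)\|\le\varphi_i(t)^{-1}-\varepsilon_i$ for all $t>0$; in particular, the tracking error $e(t)=y(t)-y_{\rm ref}(t)$ satisfies $\varphi_0(t)\|e(t)\|<1$ for all $t\ge0$ and stays uniformly away from the boundary $\varphi_0(t)^{-1}$.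
   Context: $M^\dagger$ denotes the Moore–Penrose pseudoinverse. For a matrix function $M$, $(\tfrac{d}{dt}-A)(M(t)):=\dot M(t)-AM(t)$, applied iteratively for powers. Define $\mathcal{B}(t):=\big[BL(t),(\tfrac{d}{dt}-A)(BL(t)),\ldots,(\tfrac{d}{dt}-A)^{r-1}(BL(t))\big]\in\mathbb{R}^{n\times rm}$; $\mathcal{C}:=[C^\top,(CA)^\top,\ldots,(CA^{r-1})^\top]^\top\in\mathbb{R}^{rp\times n}$; $V\in\mathbb{R}^{n\times(n-pr)}$ any matrix with $\operatorname{im}V=\ker\mathcal{C}$ (under (P1),(P2) one has $\operatorname{rk}\mathcal{C}=pr$); $\mathcal{N}(t):=V^\dagger[I_n-\mathcal{B}(t)(\mathcal{C}\mathcal{B}(t))^\dagger\mathcal{C}]\in\mathbb{R}^{(n-pr)\times n}$; $U(t):=\begin{bmatrix}\mathcal{C}\\ \mathcal{N}(t)\end{bmatrix}\in\mathbb{R}^{n\times n}$; $N(t):=\mathcal{N}(t)BL(t)\in\mathbb{R}^{(n-pr)\times m}$; $Q(t):=\big(\mathcal{N}(t)A+\dot{\mathcal{N}}(t)\big)V\in\mathbb{R}^{(n-pr)\times(n-pr)}$ (i.e. $N$ and $Q$ are the lower-right blocks of $U(t)BL(t)$ and $(U(t)A+\dot U(t))U(t)^{-1}$, resp.). A map $M\in\mathcal{C}^1(\mathbb{R}\to\mathbf{Gl}_n(\mathbb{R}))$ is a Lyapunov transformation if $M$, $M^{-1}$, $\dot M$ are bounded. $\dot\eta=Q(t)\eta$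 is uniformly exponentially stable if there exist $M,\mu>0$ such that every solution satisfies $\|\eta(t)\|\le Me^{-\mu(t-t_0)}\|\eta(t_0)\|$ for all $t\ge t_0\ge0$. For $k\in\mathbb{N}$, $\Phi_k$ is the set of $\varphi\in\mathcal{C}^k(\mathbb{R}_{\ge0}\to\mathbb{R})$ such that $\varphi,\dot\varphi,\ldots,\varphi^{(k)}$ are bounded, $\varphi(\tau)>0$ for all $\tau>0$, and $\liminf_{\tau\to\infty}\varphi(\tau)>0$. $\mathcal{W}^{r,\infty}$ denotes $r$-times weakly differentiable functions with essentially bounded derivatives up to order $r$. A solution of the closed loop on $[0,\omega)$ is a weakly differentiable $x:[0,\omega)\to\mathbb{R}^n$ with $x(0)=x^0$ satisfying the differential equation, with $u$ given by the controller, for almost all $t\in[0,\omega)$; it is maximal if it has no right extension that is also a solution. *)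

theory Defs
  imports "HOL-Analysis.Analysis" "Jordan_Normal_Form.DL_Rank" "Jordan_Normal_Form.Matrix_Kernel"
begin

definition vnorm :: "real vec \<Rightarrow> real" where
  "vnorm v = sqrt (\<Sum>i<dim_vec v. (vec_index v i)\<^sup>2)"

definition rank_mat :: "real mat \<Rightarrow> nat" where
  "rank_mat M = vec_space.rank (dim_row M) M"

definition is_pinv :: "real mat \<Rightarrow> real mat \<Rightarrow> bool" where
  "is_pinv M X \<longleftrightarrow> X \<in> carrier_mat (dim_col M) (dim_row M) \<and> M * X * M = M \<and> X * M * X = X
     \<and> transpose_mat (M * X) = M * X \<and> transpose_mat (X * M) = X * M"

definition pinv :: "real mat \<Rightarrow> real mat" where
  "pinv M = (THE X. is_pinv M X)"

definition minv :: "real mat \<Rightarrow> real mat" where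
  "minv M = (SOME X. X \<in> carrier_mat (dim_row M) (dim_row M) \<and> M * X = 1\<^sub>m (dim_row M) \<and> X * M = 1\<^sub>m (dim_row M))"

definition smooth_fun :: "(real \<Rightarrow> real) \<Rightarrow> bool" where
  "smooth_fun g \<longleftrightarrow> (\<forall>k t. ((deriv ^^ k) g) differentiable (at t))"

definition smooth_matfun :: "nat \<Rightarrow> nat \<Rightarrow> (real \<Rightarrow> real mat) \<Rightarrow> bool" where
  "smooth_matfun r c M \<longleftrightarrow> (\<forall>t. M t \<in> carrier_mat r c) \<and> (\<forall>i<r. \<forall>j<c. smooth_fun (\<lambda>t. M t $$ (i,j)))"

definition mat_bounded :: "(real \<Rightarrow> real mat) \<Rightarrow> real set \<Rightarrow> bool" where
  "mat_bounded M S \<longleftrightarrow> (\<exists>c. \<forall>t\<in>S. \<forall>i<dim_row (M t). \<forall>j<dim_col (M t). \<bar>M t $$ (i,j)\<bar> \<le> c)"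

definition mderiv :: "(real \<Rightarrow> real mat) \<Rightarrow> real \<Rightarrow> real mat" where
  "mderiv M = (\<lambda>t. mat (dim_row (M t)) (dim_col (M t)) (\<lambda>(i,j). deriv (\<lambda>s. M s $$ (i,j)) t))"

definition dA :: "real mat \<Rightarrow> (real \<Rightarrow> real mat) \<Rightarrow> real \<Rightarrow> real mat" where
  "dA A M = (\<lambda>t. mderiv M t - A * M t)"

definition C1_matfun :: "nat \<Rightarrow> (real \<Rightarrow> real mat) \<Rightarrow> bool" where
  "C1_matfun n M \<longleftrightarrow> (\<forall>t. M t \<in> carrier_mat n n) \<and>
     (\<forall>i<n. \<forall>j<n. (\<forall>t. (\<lambda>s. M s $$ (i,j)) differentiable (at t))
                   \<and> continuous_on UNIV (deriv (\<lambda>s. M s $$ (i,j))))"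

definition lyapunov_transformation :: "nat \<Rightarrow> (real \<Rightarrow> real mat) \<Rightarrow> bool" where
  "lyapunov_transformation n M \<longleftrightarrow> C1_matfun n M \<and> (\<forall>t. invertible_mat (M t))
     \<and> mat_bounded M UNIV \<and> mat_bounded (\<lambda>t. minv (M t)) UNIV \<and> mat_bounded (mderiv M) UNIV"

definition vec_has_deriv :: "(real \<Rightarrow> real vec) \<Rightarrow> real vec \<Rightarrow> real filter \<Rightarrow> bool" where
  "vec_has_deriv x v F \<longleftrightarrow> (\<forall>i<dim_vec v. ((\<lambda>s. vec_index (x s) i) has_real_derivative (vec_index v i)) F)"

definition vderiv :: "real set \<Rightarrow> (real \<Rightarrow> real vec) \<Rightarrow> real \<Rightarrow> real vec" where
  "vderiv S g t = vec (dim_vec (g t)) (\<lambda>i. vector_derivative (\<lambda>s. vec_index (g s) i) (at t within S))"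

definition unif_exp_stable :: "nat \<Rightarrow> (real \<Rightarrow> real mat) \<Rightarrow> bool" where
  "unif_exp_stable d Q \<longleftrightarrow> (\<exists>M \<mu>. M > 0 \<and> \<mu> > 0 \<and>
     (\<forall>\<eta> t0. t0 \<ge> 0 \<and> (\<forall>t\<ge>t0. \<eta> t \<in> carrier_vec d \<and> vec_has_deriv \<eta> (Q t *\<^sub>v \<eta> t) (at t within {t0..}))
        \<longrightarrow> (\<forall>t\<ge>t0. vnorm (\<eta> t) \<le> M * exp (- \<mu> * (t - t0)) * vnorm (\<eta> t0))))"

primrec hderiv :: "real set \<Rightarrow> nat \<Rightarrow> (real \<Rightarrow> real) \<Rightarrow> real \<Rightarrow> real" where
  "hderiv S 0 g = g"
| "hderiv S (Suc k) g = (\<lambda>t. vector_derivative (hderiv S k g) (at t within S))"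

definition Phi :: "nat \<Rightarrow> (real \<Rightarrow> real) set" where
  "Phi k = {\<phi>. (\<forall>j<k. \<forall>t\<ge>0. (hderiv {0..} j \<phi>) differentiable (at t within {0..}))
      \<and> continuous_on {0..} (hderiv {0..} k \<phi>)
      \<and> (\<forall>j\<le>k. \<exists>c. \<forall>t\<ge>0. \<bar>hderiv {0..} j \<phi> t\<bar> \<le> c)
      \<and> (\<forall>\<tau>>0. \<phi> \<tau> > 0)
      \<and> Liminf at_top (\<lambda>\<tau>. ereal (\<phi> \<tau>)) > 0}"

text \<open>\<open>y \<in> W^{r,\<infinity>}(\<real>_{\<ge>0} \<rightarrow> \<real>^p)\<close> (continuous representative, \<open>r \<ge> 1\<close>):
  derivatives up to order \<open>r-1\<close> exist classically and are bounded, and the \<open>(r-1)\<close>-th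
  derivative is Lipschitz (i.e. absolutely continuous with essentially bounded derivative).\<close>
definition W_inf :: "nat \<Rightarrow> nat \<Rightarrow> (real \<Rightarrow> real vec) \<Rightarrow> bool" where
  "W_inf r p y \<longleftrightarrow> (\<forall>t\<ge>0. y t \<in> carrier_vec p) \<and>
     (\<forall>i<p. (\<forall>j. j + 1 < r \<longrightarrow> (\<forall>t\<ge>0. (hderiv {0..} j (\<lambda>s. vec_index (y s) i)) differentiable (at t within {0..})))
       \<and> (\<forall>j<r. \<exists>c. \<forall>t\<ge>0. \<bar>hderiv {0..} j (\<lambda>s. vec_index (y s) i) t\<bar> \<le> c)
       \<and> (\<exists>Lc. lipschitz_on Lc {0..} (hderiv {0..} (r - 1) (\<lambda>s. vec_index (y s) i))))"

definition abs_cont_on :: "real set \<Rightarrow> (real \<Rightarrow> real) \<Rightarrow> bool" where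
  "abs_cont_on S g \<longleftrightarrow> (\<forall>\<epsilon>>0. \<exists>\<delta>>0. \<forall>(k::nat) (a::nat \<Rightarrow> real) b.
      (\<forall>i<k. a i \<le> b i \<and> {a i..b i} \<subseteq> S) \<and> (\<forall>i<k. \<forall>j<k. i \<noteq> j \<longrightarrow> b i \<le> a j \<or> b j \<le> a i)
      \<and> (\<Sum>i<k. b i - a i) < \<delta> \<longrightarrow> (\<Sum>i<k. \<bar>g (b i) - g (a i)\<bar>) < \<epsilon>)"

definition vfun_continuous :: "nat \<Rightarrow> nat \<Rightarrow> (real \<Rightarrow> real vec \<Rightarrow> real vec \<Rightarrow> real vec) \<Rightarrow> bool" where
  "vfun_continuous n m f \<longleftrightarrow> (\<forall>t x u. x \<in> carrier_vec n \<longrightarrow> u \<in> carrier_vec m \<longrightarrow>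
     (\<forall>\<epsilon>>0. \<exists>\<delta>>0. \<forall>t' x' u'. x' \<in> carrier_vec n \<and> u' \<in> carrier_vec m \<and> \<bar>t' - t\<bar> < \<delta>
        \<and> vnorm (x' - x) < \<delta> \<and> vnorm (u' - u) < \<delta> \<longrightarrow> vnorm (f t' x' u' - f t x u) < \<epsilon>))"

definition calB :: "nat \<Rightarrow> nat \<Rightarrow> nat \<Rightarrow> real mat \<Rightarrow> real mat \<Rightarrow> (real \<Rightarrow> real mat) \<Rightarrow> real \<Rightarrow> real mat" where
  "calB n m r A B L t = mat n (r * m) (\<lambda>(i,c). ((dA A ^^ (c div m)) (\<lambda>s. B * L s)) t $$ (i, c mod m))"

definition calC :: "nat \<Rightarrow> nat \<Rightarrow> nat \<Rightarrow> real mat \<Rightarrow> real mat \<Rightarrow> real mat" where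
  "calC p n r A C = mat (r * p) n (\<lambda>(a,j). (C * A ^\<^sub>m (a div p)) $$ (a mod p, j))"

definition calN :: "nat \<Rightarrow> nat \<Rightarrow> nat \<Rightarrow> nat \<Rightarrow> real mat \<Rightarrow> real mat \<Rightarrow> real mat \<Rightarrow> real mat
    \<Rightarrow> (real \<Rightarrow> real mat) \<Rightarrow> real \<Rightarrow> real mat" where
  "calN n m p r A B C V L t = pinv V * (1\<^sub>m n - calB n m r A B L t
       * pinv (calC p n r A C * calB n m r A B L t) * calC p n r A C)"

definition calU :: "nat \<Rightarrow> nat \<Rightarrow> nat \<Rightarrow> nat \<Rightarrow> real mat \<Rightarrow> real mat \<Rightarrow> real mat \<Rightarrow> real mat
    \<Rightarrow> (real \<Rightarrow> real mat) \<Rightarrow> real \<Rightarrow> real mat" where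
  "calU n m p r A B C V L t = calC p n r A C @\<^sub>r calN n m p r A B C V L t"

definition Nfun :: "nat \<Rightarrow> nat \<Rightarrow> nat \<Rightarrow> nat \<Rightarrow> real mat \<Rightarrow> real mat \<Rightarrow> real mat \<Rightarrow> real mat
    \<Rightarrow> (real \<Rightarrow> real mat) \<Rightarrow> real \<Rightarrow> real mat" where
  "Nfun n m p r A B C V L t = calN n m p r A B C V L t * (B * L t)"

definition Qfun :: "nat \<Rightarrow> nat \<Rightarrow> nat \<Rightarrow> nat \<Rightarrow> real mat \<Rightarrow> real mat \<Rightarrow> real mat \<Rightarrow> real mat
    \<Rightarrow> (real \<Rightarrow> real mat) \<Rightarrow> real \<Rightarrow> real mat" where
  "Qfun n m p r A B C V L t =
     (calN n m p r A B C V L t * A + mderiv (calN n m p r A B C V L) t) * V"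

definition tdom :: "ereal \<Rightarrow> real set" where
  "tdom w = {t. 0 \<le> t \<and> ereal t < w}"

fun err :: "(real \<Rightarrow> real vec) \<Rightarrow> (nat \<Rightarrow> real \<Rightarrow> real) \<Rightarrow> real set \<Rightarrow> (real \<Rightarrow> real vec)
    \<Rightarrow> nat \<Rightarrow> real \<Rightarrow> real vec" where
  "err yref \<phi> S y 0 = (\<lambda>t. y t - yref t)"
| "err yref \<phi> S y (Suc i) = (\<lambda>t. vderiv S (err yref \<phi> S y i) t
     + (1 / (1 - (\<phi> i t)\<^sup>2 * (vnorm (err yref \<phi> S y i t))\<^sup>2)) \<cdot>\<^sub>v err yref \<phi> S y i t)"

definition gain :: "(real \<Rightarrow> real vec) \<Rightarrow> (nat \<Rightarrow> real \<Rightarrow> real) \<Rightarrow> real set \<Rightarrow> (real \<Rightarrow> real vec)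
    \<Rightarrow> nat \<Rightarrow> real \<Rightarrow> real" where
  "gain yref \<phi> S y i t = 1 / (1 - (\<phi> i t)\<^sup>2 * (vnorm (err yref \<phi> S y i t))\<^sup>2)"

definition ctrl :: "(real \<Rightarrow> real vec) \<Rightarrow> (nat \<Rightarrow> real \<Rightarrow> real) \<Rightarrow> (real \<Rightarrow> real mat) \<Rightarrow> nat
    \<Rightarrow> real set \<Rightarrow> (real \<Rightarrow> real vec) \<Rightarrow> real \<Rightarrow> real vec" where
  "ctrl yref \<phi> K r S y t = (- gain yref \<phi> S y (r - 1) t) \<cdot>\<^sub>v (K t *\<^sub>v err yref \<phi> S y (r - 1) t)"

text \<open>Solutions of the closed loop on \<open>[0,\<omega>)\<close>: \<open>x(0)=x^0\<close>, \<open>x\<close> (locally) absolutely continuous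
  (= weakly differentiable, continuous representative), the controller well defined
  (the needed derivatives of \<open>e_i\<close> exist and \<open>(t,x(t))\<close> lies in the domain \<open>\<phi>_i(t)\<parallel>e_i(t)\<parallel> < 1\<close>),
  and the ODE holds for almost all \<open>t \<in> [0,\<omega>)\<close>.\<close>
definition cl_solution :: "nat \<Rightarrow> real mat \<Rightarrow> real mat \<Rightarrow> real mat \<Rightarrow> (real \<Rightarrow> real mat)
    \<Rightarrow> (real \<Rightarrow> real vec \<Rightarrow> real vec \<Rightarrow> real vec) \<Rightarrow> (real \<Rightarrow> real vec) \<Rightarrow> (nat \<Rightarrow> real \<Rightarrow> real)
    \<Rightarrow> (real \<Rightarrow> real mat) \<Rightarrow> nat \<Rightarrow> real vec \<Rightarrow> ereal \<Rightarrow> (real \<Rightarrow> real vec) \<Rightarrow> bool" where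
  "cl_solution n A B C L f yref \<phi> K r x0 w x \<longleftrightarrow>
     (let S = tdom w; y = (\<lambda>t. C *\<^sub>v x t); u = ctrl yref \<phi> K r S y in
     w > 0 \<and> x 0 = x0 \<and> (\<forall>t\<in>S. x t \<in> carrier_vec n)
     \<and> (\<forall>T\<in>S. \<forall>i<n. abs_cont_on {0..T} (\<lambda>t. vec_index (x t) i))
     \<and> (\<forall>i. i + 1 < r \<longrightarrow> (\<forall>t\<in>S. \<forall>j<dim_vec (err yref \<phi> S y i t).
           (\<lambda>s. vec_index (err yref \<phi> S y i s) j) differentiable (at t within S)))
     \<and> (\<forall>i<r. \<forall>t\<in>S. \<phi> i t * vnorm (err yref \<phi> S y i t) < 1)
     \<and> (AE t in lborel. t \<in> S \<longrightarrow>
          vec_has_deriv x (A *\<^sub>v x t + (B * L t) *\<^sub>v u t + f t (x t) (u t)) (at t)))"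

definition cl_maximal :: "nat \<Rightarrow> real mat \<Rightarrow> real mat \<Rightarrow> real mat \<Rightarrow> (real \<Rightarrow> real mat)
    \<Rightarrow> (real \<Rightarrow> real vec \<Rightarrow> real vec \<Rightarrow> real vec) \<Rightarrow> (real \<Rightarrow> real vec) \<Rightarrow> (nat \<Rightarrow> real \<Rightarrow> real)
    \<Rightarrow> (real \<Rightarrow> real mat) \<Rightarrow> nat \<Rightarrow> real vec \<Rightarrow> ereal \<Rightarrow> (real \<Rightarrow> real vec) \<Rightarrow> bool" where
  "cl_maximal n A B C L f yref \<phi> K r x0 w x \<longleftrightarrow> cl_solution n A B C L f yref \<phi> K r x0 w x \<and>
     \<not> (\<exists>w' x'. w < w' \<and> cl_solution n A B C L f yref \<phi> K r x0 w' x' \<and> (\<forall>t\<in>tdom w. x' t = x t))"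

text \<open>An output signal with \<open>y^{(j)}(0) = C A^j x^0\<close> for \<open>j < r\<close> (Taylor polynomial); any
  solution has exactly these output derivatives at \<open>t = 0\<close>, and \<open>e_i(0)\<close> depends only on them.\<close>
definition init_out :: "real mat \<Rightarrow> real mat \<Rightarrow> nat \<Rightarrow> real vec \<Rightarrow> real \<Rightarrow> real vec" where
  "init_out A C r x0 = (\<lambda>t. vec (dim_row C)
      (\<lambda>i. \<Sum>j<r. t ^ j / fact j * vec_index (C * A ^\<^sub>m j *\<^sub>v x0) i))"

end

theory Submission imports Defs "HOL-Complex_Analysis.Great_Picard" begin

unbundle no vec_syntax

text \<open>Along a solution \<open>CA^k x\<close> is the \<open>k\<close>-th output derivative for \<open>k < r\<close>, so each \<open>e_i\<close> is a function of
  \<open>(t,x)\<close>, rational in these derivatives, and the closed loop becomes an ordinary differential equation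
  with continuous right-hand side on the open set \<open>\<phi>_i(t)\<parallel>e_i\<parallel> < 1\<close>; Peano's theorem gives local solutions.

  For a priori bounds, \<open>\<eta> = \<N>x\<close> satisfies \<open>\<eta>' = Q\<eta> +\<close> a term bounded by the output derivatives, because
  \<open>N K = 0\<close> removes the input. The funnel bounds the output derivatives in terms of the gains, \<open>\<phi>_i\<close> and \<open>y_ref\<close>.
  Since \<open>e_i' = e_{i+1} - k_i e_i\<close> for \<open>i < r - 1\<close>, the gain term dominates near the funnel boundary, which bounds
  \<open>k_0,\<dots>,k_{r-2}\<close> successively; this bounds the output derivatives, hence \<open>\<eta>\<close> by exponential stability and
  then \<open>x\<close>. In \<open>e_{r-1}' = -k_{r-1} \<Gamma>LK e_{r-1} +\<close> bounded terms positivity of \<open>\<Gamma>LK\<close> finally bounds \<open>k_{r-1}\<close>.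
  All bounds are independent of the length of the interval of existence, so every solution extends to \<open>\<infinity>\<close>.\<close>

section \<open>Absolutely continuous functions\<close>

text \<open>Three obstacles shape the proof. A solution is only absolutely continuous and its
  controller contains derivatives of the errors, so the right-hand side is not known to be
  continuous beforehand; the integral form of the output derivatives of order below r, where the
  input cancels, breaks this circle and shows that every solution is classical. The reference
  derivative of order r-1 is merely Lipschitz, so e_{r-1} cannot be differentiated and its norm is
  compared with a differentiable majorant. A funnel function may vanish at 0, where the funnel is
  then unbounded; bounds therefore start at some T > 0, and a first stretch of the solution is
  obtained separately from the strict initial inequalities. The a priori constants depend only on
  the point (T, x(T)) and hold for every solution through it, hence also for extensions still to be
  constructed: the equation is truncated outside the bounds, Peano's theorem solves the truncated
  equation for all times, and the bounds show that the truncation never acts.\<close>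

lemma sum_disjoint_open_intervals_le_measure:
  fixes l u :: "'a \<Rightarrow> real"
  assumes fin: "finite I" and lu: "\<And>i. i \<in> I \<Longrightarrow> l i < u i" "\<And>i. i \<in> I \<Longrightarrow> {l i<..<u i} \<subseteq> U"
    and disj: "\<And>i j. i \<in> I \<Longrightarrow> j \<in> I \<Longrightarrow> i \<noteq> j \<Longrightarrow> {l i<..<u i} \<inter> {l j<..<u j} = {}"
    and U: "U \<in> lmeasurable"
  shows "(\<Sum>i\<in>I. u i - l i) \<le> measure lebesgue U"
proof -
  have "(\<Sum>i\<in>I. u i - l i) = (\<Sum>i\<in>I. measure lebesgue {l i<..<u i})"
    using lu(1) by (intro sum.cong refl) (simp add: less_imp_le)
  also have "\<dots> = measure lebesgue (\<Union>i\<in>I. {l i<..<u i})"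
    using disj fin by (intro measure_UNION'[symmetric]) (auto simp: pairwise_def disjnt_def)
  also have "\<dots> \<le> measure lebesgue U"
    using lu(2) U fin by (intro measure_mono_fmeasurable) auto
  finally show ?thesis .
qed

text \<open>The definition numbers its intervals; an arbitrary finite index set lets it act directly
  on the cells of a tagged division.\<close>

lemma abs_cont_on_finite:
  assumes "abs_cont_on S g" "\<epsilon> > 0"
  shows "\<exists>\<delta>>0. \<forall>(I::'a set) l u. finite I \<and> (\<forall>i\<in>I. l i \<le> u i \<and> {l i..u i} \<subseteq> S)
       \<and> (\<forall>i\<in>I. \<forall>j\<in>I. i \<noteq> j \<longrightarrow> u i \<le> l j \<or> u j \<le> l i)
       \<and> (\<Sum>i\<in>I. u i - l i) < \<delta> \<longrightarrow> (\<Sum>i\<in>I. \<bar>g (u i) - g (l i)\<bar>) < \<epsilon>"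
proof -
  obtain \<delta> where \<delta>: "\<delta> > 0" "\<forall>(k::nat) a b. (\<forall>i<k. a i \<le> b i \<and> {a i..b i} \<subseteq> S) \<and> (\<forall>i<k. \<forall>j<k. i \<noteq> j \<longrightarrow> b i \<le> a j \<or> b j \<le> a i)
      \<and> (\<Sum>i<k. b i - a i) < \<delta> \<longrightarrow> (\<Sum>i<k. \<bar>g (b i) - g (a i)\<bar>) < \<epsilon>"
    using assms(1)[unfolded abs_cont_on_def, rule_format, OF assms(2)] by (elim exE conjE) (rule that)
  show ?thesis
  proof (intro exI[of _ \<delta>] conjI \<delta>(1) allI impI, elim conjE)
    fix I :: "'a set" and l u
    assume fin: "finite I" and lu: "\<forall>i\<in>I. l i \<le> u i \<and> {l i..u i} \<subseteq> S"
      and sep: "\<forall>i\<in>I. \<forall>j\<in>I. i \<noteq> j \<longrightarrow> u i \<le> l j \<or> u j \<le> l i"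
      and s: "(\<Sum>i\<in>I. u i - l i) < \<delta>"
    obtain h where h: "bij_betw h {..<card I} I"
      using fin ex_bij_betw_nat_finite[of I] by (auto simp: atLeast0LessThan)
    have hI: "h i \<in> I" if "i < card I" for i using h that by (auto simp: bij_betw_def)
    have hs: "(\<Sum>i<card I. u (h i) - l (h i)) < \<delta>"
      using s sum.reindex_bij_betw[OF h, of "\<lambda>i. u i - l i"] by simp
    have hne: "h i \<noteq> h j" if "i < card I" "j < card I" "i \<noteq> j" for i j
      using h that by (auto simp: bij_betw_def inj_on_def)
    have "(\<Sum>i<card I. \<bar>g (u (h i)) - g (l (h i))\<bar>) < \<epsilon>"
      by (rule \<delta>(2)[THEN spec[of _ "card I"], THEN spec[of _ "\<lambda>i. l (h i)"], THEN spec[of _ "\<lambda>i. u (h i)"], THEN mp])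
        (intro conjI allI impI, simp_all add: lu[rule_format, OF hI] sep[rule_format, OF hI hI hne] hs)
    then show "(\<Sum>i\<in>I. \<bar>g (u i) - g (l i)\<bar>) < \<epsilon>"
      using sum.reindex_bij_betw[OF h, of "\<lambda>i. \<bar>g (u i) - g (l i)\<bar>"] by simp
  qed
qed

text \<open>A Henstock-Kurzweil argument. Off the exceptional null set \<open>N\<close> the gauge
  comes from differentiability, and each cell has an error proportional to its length. On
  \<open>N\<close> the gauge forces the cells into an open set whose measure is below the \<delta>
  of absolute continuity, so the increments of \<open>g\<close> over them sum to less than half of
  the tolerance.\<close>

lemma abs_cont_has_integral:
  fixes g h :: "real \<Rightarrow> real"
  assumes ac: "abs_cont_on {a..b} g" and ab: "a \<le> b"
    and ae: "AE t in lborel. t \<in> {a..b} \<longrightarrow> (g has_real_derivative h t) (at t)"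
  shows "(h has_integral (g b - g a)) {a..b}"
proof -
  obtain N where N: "N \<in> null_sets lborel" and Nd: "\<And>t. t \<in> {a..b} \<Longrightarrow> t \<notin> N \<Longrightarrow> (g has_real_derivative h t) (at t)"
    using AE_E3[OF ae] by (metis (mono_tags, lifting) Diff_iff UNIV_I space_borel space_lborel)
  have negN: "negligible N"
    using N null_sets_completionI[OF N] by (simp add: negligible_iff_null_sets)
  \<comment> \<open>Zero on \<open>N\<close>, where \<open>h\<close> is arbitrary: a cell tagged
    there contributes only the increment of \<open>g\<close>, and the integral is
    unaffected.\<close>
  define k where "k t = (if t \<in> N then 0 else h t)" for t
  have "(k has_integral (g b - g a)) {a..b}"
    unfolding has_integral_real
  proof (intro allI impI)
    fix e :: real assume e: "e > 0"
    define e1 where "e1 = e / (2 * (b - a + 1))"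
    have e1: "e1 > 0" "e1 * (b - a) < e / 2"
      using e ab by (auto simp: e1_def divide_simps)
    obtain \<delta> where \<delta>: "\<delta> > 0" and \<delta>s: "\<forall>(I::(real \<times> real set) set) l u. finite I \<and> (\<forall>i\<in>I. l i \<le> u i \<and> {l i..u i} \<subseteq> {a..b})
       \<and> (\<forall>i\<in>I. \<forall>j\<in>I. i \<noteq> j \<longrightarrow> u i \<le> l j \<or> u j \<le> l i)
       \<and> (\<Sum>i\<in>I. u i - l i) < \<delta> \<longrightarrow> (\<Sum>i\<in>I. \<bar>g (u i) - g (l i)\<bar>) < e/2"
      using abs_cont_on_finite[OF ac half_gt_zero[OF e]] by (elim exE conjE) (rule that)
    have Nleb: "N \<in> sets lebesgue" using negN negligible_imp_sets by blast
    obtain O' where O': "open O'" "N \<subseteq> O'" "O' - N \<in> lmeasurable" "emeasure lebesgue (O' - N) < ennreal \<delta>"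
      using sets_lebesgue_outer_open[OF Nleb \<delta>] by metis
    have negO: "negligible (sym_diff O' (O' - N))"
      by (rule negligible_subset[OF negN]) (use O'(2) in auto)
    have Om: "O' \<in> lmeasurable"
      using lmeasurable_negligible_symdiff[OF O'(3), of O'] negO by (simp add: Un_commute)
    have "measure lebesgue O' = measure lebesgue (O' - N)"
      using measure_negligible_symdiff[of O' "O' - N"] negO Om by (simp add: fmeasurableD Un_commute)
    then have Omeas: "measure lebesgue O' < \<delta>"
      using O'(3,4) \<delta> by (simp add: emeasure_eq_measure2 ennreal_less_iff)
    have "\<exists>d>0. \<forall>y. \<bar>y - t\<bar> < d \<longrightarrow> \<bar>g y - g t - h t * (y - t)\<bar> \<le> e1 * \<bar>y - t\<bar>" if "t \<in> {a..b}" "t \<notin> N" for t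
      using Nd[OF that] e1(1) unfolding has_field_derivative_def has_derivative_within_alt by auto
    then obtain d where d: "\<And>t. t \<in> {a..b} \<Longrightarrow> t \<notin> N \<Longrightarrow> d t > 0"
      "\<And>t y. t \<in> {a..b} \<Longrightarrow> t \<notin> N \<Longrightarrow> \<bar>y - t\<bar> < d t \<Longrightarrow> \<bar>g y - g t - h t * (y - t)\<bar> \<le> e1 * \<bar>y - t\<bar>"
      by metis
    define \<gamma> where "\<gamma> t = (if t \<in> N then O' else if t \<in> {a..b} then ball t (d t) else UNIV)" for t
    have gau: "gauge \<gamma>"
      unfolding gauge_def \<gamma>_def using d(1) O' by auto
    have main: "norm ((\<Sum>(x,K)\<in>\<D>. measure lborel K *\<^sub>R k x) - (g b - g a)) < e"
      if D: "\<D> tagged_division_of {a..b}" and fine: "\<gamma> fine \<D>" for \<D>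
    proof -
      have finD: "finite \<D>" using D by auto
      have K: "\<exists>c' d'. c' \<le> d' \<and> K = {c'..d'} \<and> x \<in> K \<and> K \<subseteq> {a..b}" if "(x,K) \<in> \<D>" for x K
        using tagged_division_ofD(2,3,4)[OF D that] by fastforce
      have KK: "x \<in> K" "K \<subseteq> {a..b}" "Inf K \<le> Sup K" "K = {Inf K..Sup K}" "measure lborel K = Sup K - Inf K" "K \<subseteq> \<gamma> x"
        if "(x,K) \<in> \<D>" for x K
        using K[OF that] fine that by (auto simp: fine_def)
      define E where "E = (\<lambda>(x,K). measure lborel K * k x - (g (Sup K) - g (Inf K)))"
      have "(\<Sum>(x,K)\<in>\<D>. measure lborel K *\<^sub>R k x) - (g b - g a) = (\<Sum>z\<in>\<D>. E z)"
        unfolding E_def additive_tagged_division_1[OF ab D, of g, symmetric] sum_subtractf[symmetric]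
        by (intro sum.cong) auto
      also have "\<dots> = (\<Sum>z\<in>{z\<in>\<D>. fst z \<in> N}. E z) + (\<Sum>z\<in>{z\<in>\<D>. fst z \<notin> N}. E z)"
        using finD by (subst sum.union_disjoint[symmetric]) (auto intro!: sum.cong)
      finally have eq: "(\<Sum>(x,K)\<in>\<D>. measure lborel K *\<^sub>R k x) - (g b - g a) = \<dots>" .
      have "\<bar>\<Sum>z\<in>{z\<in>\<D>. fst z \<notin> N}. E z\<bar> \<le> (\<Sum>z\<in>{z\<in>\<D>. fst z \<notin> N}. \<bar>E z\<bar>)" by (rule sum_abs)
      also have "\<dots> \<le> (\<Sum>z\<in>{z\<in>\<D>. fst z \<notin> N}. e1 * (Sup (snd z) - Inf (snd z)))"
      proof (rule sum_mono, clarsimp)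
        fix x K assume xK: "(x,K) \<in> \<D>" and x: "x \<notin> N"
        note k = KK[OF xK]
        have xab: "x \<in> {a..b}" using k(1,2) by auto
        have in1: "Inf K \<in> K" "Sup K \<in> K" "Inf K \<le> x" "x \<le> Sup K"
          using k(1,3,4) by (metis atLeastAtMost_iff order_refl)+
        have ba: "K \<subseteq> ball x (d x)" using k(6) x xab by (auto simp: \<gamma>_def)
        have "\<bar>g (Sup K) - g x - h x * (Sup K - x)\<bar> \<le> e1 * \<bar>Sup K - x\<bar>"
          using ba in1 by (intro d(2)[OF xab x]) (auto simp: dist_real_def abs_minus_commute subset_iff)
        moreover have "\<bar>g (Inf K) - g x - h x * (Inf K - x)\<bar> \<le> e1 * \<bar>Inf K - x\<bar>"
          using ba in1 by (intro d(2)[OF xab x]) (auto simp: dist_real_def abs_minus_commute subset_iff)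
        ultimately show "\<bar>E (x, K)\<bar> \<le> e1 * (Sup K - Inf K)"
          using in1 x by (simp add: E_def k_def k(5) abs_le_iff algebra_simps)
      qed
      also have "\<dots> \<le> (\<Sum>z\<in>\<D>. e1 * (Sup (snd z) - Inf (snd z)))"
        using finD e1 KK(3) by (intro sum_mono2) auto
      also have "\<dots> = e1 * (b - a)"
        using additive_tagged_division_1[OF ab D, of "\<lambda>x. x"] by (simp add: sum_distrib_left[symmetric] case_prod_beta')
      also have "\<dots> < e/2" by (rule e1)
      finally have A: "\<bar>\<Sum>z\<in>{z\<in>\<D>. fst z \<notin> N}. E z\<bar> < e/2" .
      \<comment> \<open>Degenerate cells contribute nothing and are discarded: for nondegenerate
        ones disjoint interiors imply that one lies to the left of the other, as absolute continuity
        requires.\<close>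
      define I where "I = {z\<in>\<D>. fst z \<in> N \<and> Inf (snd z) < Sup (snd z)}"
      have finI: "finite I" using finD by (auto simp: I_def)
      have int: "interior K = {Inf K<..<Sup K}" if "(x,K) \<in> \<D>" for x K
        by (subst KK(4)[OF that]) (rule interior_atLeastAtMost_real)
      have dis: "{Inf (snd i)<..<Sup (snd i)} \<inter> {Inf (snd j)<..<Sup (snd j)} = {}"
        if "i \<in> I" "j \<in> I" "i \<noteq> j" for i j
        using tagged_division_ofD(5)[OF D, of "fst i" "snd i" "fst j" "snd j"] that int[of "fst i" "snd i"] int[of "fst j" "snd j"]
        by (auto simp: I_def)
      have sep: "Sup (snd i) \<le> Inf (snd j) \<or> Sup (snd j) \<le> Inf (snd i)" if "i \<in> I" "j \<in> I" "i \<noteq> j" for i j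
      proof (rule ccontr)
        assume "\<not> ?thesis"
        then have "(max (Inf (snd i)) (Inf (snd j)) + min (Sup (snd i)) (Sup (snd j))) / 2 \<in> {Inf (snd i)<..<Sup (snd i)} \<inter> {Inf (snd j)<..<Sup (snd j)}"
          using that by (auto simp: I_def max_def min_def)
        then show False using dis[OF that] by blast
      qed
      have "(\<Sum>i\<in>I. Sup (snd i) - Inf (snd i)) \<le> measure lebesgue O'"
      proof (rule sum_disjoint_open_intervals_le_measure[OF finI _ _ dis Om])
        fix i assume i: "i \<in> I"
        then show "Inf (snd i) < Sup (snd i)" by (auto simp: I_def)
        have "(fst i, snd i) \<in> \<D>" using i by (auto simp: I_def)
        from KK(4,6)[OF this] show "{Inf (snd i)<..<Sup (snd i)} \<subseteq> O'"
          using i by (auto simp: I_def \<gamma>_def subset_iff)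
      qed auto
      then have small: "(\<Sum>i\<in>I. Sup (snd i) - Inf (snd i)) < \<delta>" using Omeas by simp
      have "\<bar>\<Sum>z\<in>{z\<in>\<D>. fst z \<in> N}. E z\<bar> \<le> (\<Sum>z\<in>{z\<in>\<D>. fst z \<in> N}. \<bar>E z\<bar>)" by (rule sum_abs)
      also have "\<dots> = (\<Sum>z\<in>I. \<bar>E z\<bar>)"
      proof (rule sum.mono_neutral_right)
        show "\<forall>i\<in>{z \<in> \<D>. fst z \<in> N} - I. \<bar>E i\<bar> = 0"
          using KK(3) by (force simp: I_def E_def k_def not_less)
      qed (use finD in \<open>auto simp: I_def\<close>)
      also have "\<dots> = (\<Sum>z\<in>I. \<bar>g (Sup (snd z)) - g (Inf (snd z))\<bar>)"
        by (intro sum.cong refl) (auto simp: I_def E_def k_def)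
      also have "\<dots> < e/2"
      proof (intro \<delta>s[rule_format] conjI finI small ballI impI sep)
        fix i assume i: "i \<in> I"
        then have D': "(fst i, snd i) \<in> \<D>" by (auto simp: I_def)
        show "Inf (snd i) \<le> Sup (snd i)" by (rule KK(3)[OF D'])
        show "{Inf (snd i)..Sup (snd i)} \<subseteq> {a..b}" using KK(2,4)[OF D'] by metis
      qed auto
      finally have B: "\<bar>\<Sum>z\<in>{z\<in>\<D>. fst z \<in> N}. E z\<bar> < e/2" .
      show ?thesis unfolding eq using A B by simp
    qed
    show "\<exists>\<gamma>. gauge \<gamma> \<and> (\<forall>\<D>. \<D> tagged_division_of {a..b} \<and> \<gamma> fine \<D> \<longrightarrow>
         norm ((\<Sum>(x,K)\<in>\<D>. measure lborel K *\<^sub>R k x) - (g b - g a)) < e)"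
      using main by (intro exI[of _ \<gamma>] conjI gau allI impI) (elim conjE, assumption)
  qed
  then show ?thesis
    by (rule has_integral_spike[OF negN, rotated]) (auto simp: k_def)
qed

primrec euler :: "(real \<Rightarrow> (nat \<Rightarrow> real) \<Rightarrow> nat \<Rightarrow> real) \<Rightarrow> real \<Rightarrow> (nat \<Rightarrow> real) \<Rightarrow> real \<Rightarrow> nat \<Rightarrow> nat \<Rightarrow> real" where
  "euler F a x0 h 0 = x0"
| "euler F a x0 h (Suc j) = (\<lambda>i. euler F a x0 h j i + h * F (a + real j * h) (euler F a x0 h j) i)"

section \<open>Peano existence theorem\<close>

text \<open>An Euler increment is \<open>h\<close> times a sum of slopes. With s = 0 this gives a
  Lipschitz bound up to the step size, with \<open>s\<close> the limit slope it gives
  differentiability of the limit.\<close>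

lemma euler_slope:
  assumes "j1 \<le> j2" "h \<ge> 0"
    and "\<And>j. j1 \<le> j \<Longrightarrow> j < j2 \<Longrightarrow> \<bar>F (a + real j * h) (euler F a x0 h j) i - s\<bar> \<le> e"
  shows "\<bar>euler F a x0 h j2 i - euler F a x0 h j1 i - (real j2 - real j1) * h * s\<bar> \<le> (real j2 - real j1) * h * e"
  using assms(1,3)
proof (induction j2 rule: dec_induct)
  case base then show ?case by simp
next
  case (step k)
  let ?d = "F (a + real k * h) (euler F a x0 h k) i - s"
  have "\<bar>h * ?d\<bar> \<le> h * e"
    using step assms(2) by (simp add: abs_mult mult_left_mono)
  moreover have "\<bar>euler F a x0 h k i - euler F a x0 h j1 i - (real k - real j1) * h * s\<bar> \<le> (real k - real j1) * h * e"
    using step by auto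
  moreover have "euler F a x0 h (Suc k) i - euler F a x0 h j1 i - (real (Suc k) - real j1) * h * s
     = (euler F a x0 h k i - euler F a x0 h j1 i - (real k - real j1) * h * s) + h * ?d"
    by (simp add: algebra_simps)
  moreover have "(real (Suc k) - real j1) * h * e = (real k - real j1) * h * e + h * e"
    by (simp add: algebra_simps)
  ultimately show ?case by linarith
qed

definition eidx :: "real \<Rightarrow> real \<Rightarrow> real \<Rightarrow> nat" where
  "eidx a h t = nat \<lfloor>(t - a) / h\<rfloor>"

lemma eidx_bounds:
  assumes "h > 0" "a \<le> t"
  shows "a + real (eidx a h t) * h \<le> t" "t < a + real (eidx a h t) * h + h"
proof -
  have q: "0 \<le> (t - a) / h" using assms by simp
  have "real (eidx a h t) = of_int \<lfloor>(t - a) / h\<rfloor>" using q by (simp add: eidx_def)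
  then have "real (eidx a h t) \<le> (t - a)/h" "(t - a)/h < real (eidx a h t) + 1" by linarith+
  then show "a + real (eidx a h t) * h \<le> t" "t < a + real (eidx a h t) * h + h"
    using assms by (simp_all add: field_simps)
qed

lemma eidx_mono: "h > 0 \<Longrightarrow> s \<le> t \<Longrightarrow> eidx a h s \<le> eidx a h t"
  unfolding eidx_def by (intro nat_mono floor_mono divide_right_mono) auto

lemma eidx_grid: "h > 0 \<Longrightarrow> eidx a h (a + real j * h) = j"
  unfolding eidx_def by simp

text \<open>The right-hand side is bounded on bounded time intervals uniformly in the state, so
  nothing escapes and one solution serves the whole half-line. Euler approximations converge along a
  subsequence at rational times, then at all times because they are Lipschitz up to the step size.
  The limit is differentiated directly through the slope estimate, without an integral
  equation.\<close>

theorem peano_existence: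
  fixes F :: "real \<Rightarrow> (nat \<Rightarrow> real) \<Rightarrow> nat \<Rightarrow> real"
  assumes cont: "\<And>(\<tau>::nat \<Rightarrow> real) t X x i. (\<And>k. a \<le> \<tau> k) \<Longrightarrow> \<tau> \<longlonglongrightarrow> t \<Longrightarrow> (\<And>j. j < n \<Longrightarrow> (\<lambda>k. X k j) \<longlonglongrightarrow> x j)
        \<Longrightarrow> i < n \<Longrightarrow> (\<lambda>k. F (\<tau> k) (X k) i) \<longlonglongrightarrow> F t x i"
    and bdd: "\<And>T. \<exists>c. \<forall>t\<in>{a..T}. \<forall>x. \<forall>i<n. \<bar>F t x i\<bar> \<le> c"
  obtains x :: "real \<Rightarrow> nat \<Rightarrow> real" where "\<And>i. i < n \<Longrightarrow> x a i = x0 i"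
    "\<And>t i. a \<le> t \<Longrightarrow> i < n \<Longrightarrow> ((\<lambda>s. x s i) has_real_derivative F t (x t) i) (at t within {a..})"
proof -
  obtain c0 where c0: "\<And>T t x i. t \<in> {a..T} \<Longrightarrow> i < n \<Longrightarrow> \<bar>F t x i\<bar> \<le> c0 T" using bdd by metis
  define c where "c T = max 0 (c0 T)" for T
  have c: "\<And>T t x i. t \<in> {a..T} \<Longrightarrow> i < n \<Longrightarrow> \<bar>F t x i\<bar> \<le> c T" "\<And>T. c T \<ge> 0"
    using c0 unfolding c_def by (auto intro: le_max_iff_disj[THEN iffD2])
  define h where "h k = 1 / (real k + 1)" for k :: nat
  have h: "h k > 0" for k by (simp add: h_def)
  have h0: "h \<longlonglongrightarrow> 0" unfolding h_def using LIMSEQ_inverse_real_of_nat by (simp add: inverse_eq_divide add.commute)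
  define J where "J k t = eidx a (h k) t" for k t
  \<comment> \<open>Step functions instead of polygons: the value at \<open>t\<close> is that at the
    last grid point up to \<open>t\<close>, so every value is an exact Euler iterate.\<close>
  define X where "X k t = euler F a x0 (h k) (J k t)" for k t
  have Jb: "a + real (J k t) * h k \<le> t" "t < a + real (J k t) * h k + h k" if "a \<le> t" for t k
    using eidx_bounds[OF h that] by (simp_all add: J_def)
  have Jm: "J k s \<le> J k t" if "s \<le> t" for k s t using eidx_mono[OF h that] by (simp add: J_def)
  have slope: "\<bar>X k t i - X k s i - (real (J k t) - real (J k s)) * h k * \<sigma>\<bar> \<le> (real (J k t) - real (J k s)) * h k * e"
    if "a \<le> s" "s \<le> t" "\<And>j. s - h k < a + real j * h k \<Longrightarrow> a + real j * h k \<le> t \<Longrightarrow>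
        \<bar>F (a + real j * h k) (euler F a x0 (h k) j) i - \<sigma>\<bar> \<le> e" for k s t i \<sigma> e
    unfolding X_def
  proof (rule euler_slope[OF Jm[OF that(2)]])
    fix j assume j: "J k s \<le> j" "j < J k t"
    have "real (J k s) * h k \<le> real j * h k" "real j * h k \<le> real (J k t) * h k"
      using j h[of k] by (auto intro!: mult_right_mono)
    then show "\<bar>F (a + real j * h k) (euler F a x0 (h k) j) i - \<sigma>\<bar> \<le> e"
      using Jb[of s k] Jb[of t k] that(1,2) by (intro that(3)) linarith+
  qed (simp add: h less_imp_le)
  have Jd: "(real (J k t) - real (J k s)) * h k \<le> t - s + h k" "t - s - h k \<le> (real (J k t) - real (J k s)) * h k"
    if "a \<le> s" "s \<le> t" for k s t
    using Jb[of s k] Jb[of t k] that by (auto simp: algebra_simps)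
  have incr: "\<bar>X k t i - X k s i\<bar> \<le> c T * (t - s + h k)" if "a \<le> s" "s \<le> t" "t \<le> T" "i < n" for k s t T i
  proof -
    have "\<bar>X k t i - X k s i - (real (J k t) - real (J k s)) * h k * 0\<bar> \<le> (real (J k t) - real (J k s)) * h k * c T"
      using that by (intro slope) (auto intro!: c(1)[of _ T i] simp: h less_imp_le)
    also have "\<dots> \<le> (t - s + h k) * c T"
      using Jd[OF that(1,2)] c(2) by (intro mult_right_mono) auto
    finally show ?thesis by (simp add: mult.commute)
  qed
  have X0: "X k a = x0" for k by (simp add: X_def J_def eidx_def)
  \<comment> \<open>Dividing by a bound that depends on time and coordinate brings all functions
    under one common bound, as the diagonal selection requires.\<close>
  define Bd where "Bd i q = \<bar>x0 i\<bar> + c q * (q - a + 1) + 1" for i q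
  have hle: "h k \<le> 1" for k by (simp add: h_def)
  have Bd: "\<bar>X k q i\<bar> \<le> Bd i q" "Bd i q > 0" if "i < n" "a \<le> q" for k i q
  proof -
    have "c q * (q - a + h k) \<le> c q * (q - a + 1)" using c(2) hle by (intro mult_left_mono) auto
    then show "\<bar>X k q i\<bar> \<le> Bd i q" using incr[of a q q i k] that by (simp add: X0 Bd_def)
    have "c q * (q - a + 1) \<ge> 0" using c(2) that by simp
    then show "Bd i q > 0" by (simp add: Bd_def)
  qed
  define S where "S = {..<n} \<times> (\<rat> \<inter> {a..})"
  have cntS: "countable S" unfolding S_def using countable_rat by (auto intro!: countable_SIGMA countable_Int1)
  have bndS: "norm (X k (snd z) (fst z) / Bd (fst z) (snd z)) \<le> 1" if "z \<in> S" for k z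
  proof -
    have "fst z < n" "a \<le> snd z" using that by (auto simp: S_def)
    from Bd(1)[OF this, of k] Bd(2)[OF this] show ?thesis by (simp add: abs_mult)
  qed
  have "\<exists>\<rho>. strict_mono (\<rho>::nat \<Rightarrow> nat) \<and> (\<forall>z\<in>S. \<exists>l. (\<lambda>k. X (\<rho> k) (snd z) (fst z) / Bd (fst z) (snd z)) \<longlonglongrightarrow> l)"
    by (rule function_convergent_subsequence[of S "\<lambda>k z. X k (snd z) (fst z) / Bd (fst z) (snd z)" 1, OF cntS bndS])
      (assumption, blast)
  then obtain \<rho> where \<rho>: "strict_mono (\<rho>::nat \<Rightarrow> nat)"
    and conv: "\<And>z. z \<in> S \<Longrightarrow> \<exists>l. (\<lambda>k. X (\<rho> k) (snd z) (fst z) / Bd (fst z) (snd z)) \<longlonglongrightarrow> l"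
    by auto
  have convq: "Cauchy (\<lambda>k. X (\<rho> k) q i)" if q: "q \<in> \<rat>" "a \<le> q" "i < n" for q i
  proof -
    obtain l where "(\<lambda>k. X (\<rho> k) q i / Bd i q) \<longlonglongrightarrow> l" using conv[of "(i,q)"] q by (auto simp: S_def)
    from tendsto_mult_right[OF this, of "Bd i q"] Bd(2)[OF q(3,2)] show ?thesis
      by (auto intro: LIMSEQ_imp_Cauchy)
  qed
  have \<rho>h: "(\<lambda>k. h (\<rho> k)) \<longlonglongrightarrow> 0" using LIMSEQ_subseq_LIMSEQ[OF h0 \<rho>] by (simp add: o_def)
  \<comment> \<open>Comparison with a rational time \<open>q\<close> shortly after \<open>t\<close>:
    late approximations change by at most e/4 between the two times and form a Cauchy sequence at
    \<open>q\<close>.\<close>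
  have "convergent (\<lambda>k. X (\<rho> k) t i)" if t: "a \<le> t" and i: "i < n" for t i
  proof (rule Cauchy_convergent, rule CauchyI)
    fix e :: real assume e: "e > 0"
    define d where "d = min 1 (e / (8 * (c (t+1) + 1)))"
    have d: "d > 0" "d \<le> 1" using e c(2)[of "t+1"] by (auto simp: d_def)
    have "c (t+1) * (2*d) \<le> (c (t+1) + 1) * (2 * (e / (8 * (c (t+1) + 1))))"
      using c(2)[of "t+1"] d by (intro mult_mono) (auto simp: d_def)
    also have "\<dots> = e/4" using c(2)[of "t+1"] by (simp add: field_simps)
    finally have cd: "c (t+1) * (2*d) \<le> e/4" .
    obtain q where q: "q \<in> \<rat>" "t < q" "q < t + d" using Rats_dense_in_real[of t "t+d"] d by auto
    obtain N1 where N1: "\<And>m k. m \<ge> N1 \<Longrightarrow> k \<ge> N1 \<Longrightarrow> \<bar>X (\<rho> m) q i - X (\<rho> k) q i\<bar> < e/4"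
      using CauchyD[OF convq[OF q(1) _ i], of "e/4"] q t e by auto
    obtain N2 where N2: "\<And>k. k \<ge> N2 \<Longrightarrow> h (\<rho> k) < d"
      using order_tendstoD(2)[OF \<rho>h d(1)] by (auto simp: eventually_sequentially)
    have near: "\<bar>X (\<rho> k) q i - X (\<rho> k) t i\<bar> \<le> e/4" if "k \<ge> N2" for k
    proof -
      have "\<bar>X (\<rho> k) q i - X (\<rho> k) t i\<bar> \<le> c (t+1) * (q - t + h (\<rho> k))"
        using q t d i by (intro incr) auto
      also have "\<dots> \<le> c (t+1) * (2*d)" using N2[OF that] q c(2) by (intro mult_left_mono) auto
      finally show ?thesis using cd by simp
    qed
    show "\<exists>M. \<forall>m\<ge>M. \<forall>k\<ge>M. norm (X (\<rho> m) t i - X (\<rho> k) t i) < e"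
    proof (intro exI[of _ "max N1 N2"] allI impI)
      fix m k assume "max N1 N2 \<le> m" "max N1 N2 \<le> k"
      then have 1: "\<bar>X (\<rho> m) q i - X (\<rho> m) t i\<bar> \<le> e/4" "\<bar>X (\<rho> k) q i - X (\<rho> k) t i\<bar> \<le> e/4" "\<bar>X (\<rho> m) q i - X (\<rho> k) q i\<bar> < e/4"
        using near N1 by auto
      have "\<bar>u - v\<bar> < e" if "\<bar>p - u\<bar> \<le> e/4" "\<bar>q - v\<bar> \<le> e/4" "\<bar>p - q\<bar> < e/4" for p q u v :: real
        using that by linarith
      from this[OF 1] show "norm (X (\<rho> m) t i - X (\<rho> k) t i) < e" by simp
    qed
  qed note conv_all = this
  define x where "x t i = lim (\<lambda>k. X (\<rho> k) t i)" for t i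
  have xl: "(\<lambda>k. X (\<rho> k) t i) \<longlonglongrightarrow> x t i" if "a \<le> t" "i < n" for t i
    using conv_all[OF that] unfolding x_def by (simp add: convergent_LIMSEQ_iff)
  show ?thesis
  proof (rule that)
    fix i assume "i < n"
    from xl[OF order_refl this] show "x a i = x0 i" by (simp add: X0 LIMSEQ_const_iff)
  next
    fix t i assume t: "a \<le> t" and i: "i < n"
    let ?s = "F t (x t) i"
    define bad where "bad e \<delta> k j \<longleftrightarrow> \<bar>a + real j * h (\<rho> k) - t\<bar> < \<delta> \<and>
      \<not> \<bar>F (a + real j * h (\<rho> k)) (euler F a x0 (h (\<rho> k)) j) i - ?s\<bar> \<le> e" for e \<delta> k j
    \<comment> \<open>Near \<open>t\<close> all late Euler slopes are close to the slope of the
      limit. Otherwise offending grid points would tend to \<open>t\<close> while the iterates at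
      them tend to \<open>x t\<close> by the near-Lipschitz bound, against the continuity of
      \<open>F\<close>.\<close>
    have key: "\<exists>\<delta>>0. \<exists>N. \<forall>k\<ge>N. \<forall>j. \<not> bad e \<delta> k j" if e: "e > 0" for e
    proof (rule ccontr)
      assume "\<not> ?thesis"
      then have "\<forall>\<delta>>0. \<forall>N. \<exists>k\<ge>N. \<exists>j. bad e \<delta> k j" by blast
      then have "\<forall>m. \<exists>k\<ge>m. \<exists>j. bad e (h m) k j" using h by blast
      then obtain k j where k: "\<And>m. k m \<ge> m" and bad: "\<And>m. bad e (h m) (k m) (j m)"
        by metis
      have j: "\<And>m. \<bar>a + real (j m) * h (\<rho> (k m)) - t\<bar> < h m"
        and bad: "\<And>m. \<not> \<bar>F (a + real (j m) * h (\<rho> (k m))) (euler F a x0 (h (\<rho> (k m))) (j m)) i - ?s\<bar> \<le> e"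
        using bad by (simp_all add: bad_def)
      define \<tau> where "\<tau> m = a + real (j m) * h (\<rho> (k m))" for m
      have \<tau>a: "a \<le> \<tau> m" for m using h by (simp add: \<tau>_def less_imp_le)
      have \<tau>d: "(\<lambda>m. \<bar>\<tau> m - t\<bar>) \<longlonglongrightarrow> 0"
        by (rule tendsto_sandwich[OF _ _ tendsto_const h0]) (use j in \<open>auto simp: \<tau>_def less_imp_le intro!: always_eventually\<close>)
      then have \<tau>t: "\<tau> \<longlonglongrightarrow> t" using tendsto_rabs_zero_iff LIM_zero_iff by blast
      have ktop: "filterlim k at_top sequentially" by (rule filterlim_at_top_mono[OF filterlim_ident]) (use k in auto)
      have E: "euler F a x0 (h (\<rho> (k m))) (j m) = X (\<rho> (k m)) (\<tau> m)" for m
        by (simp add: X_def J_def \<tau>_def eidx_grid[OF h])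
      have "(\<lambda>m. X (\<rho> (k m)) (\<tau> m) l) \<longlonglongrightarrow> x t l" if l: "l < n" for l
      proof -
        have "(\<lambda>m. c (t+1) * (\<bar>\<tau> m - t\<bar> + h (\<rho> (k m)))) \<longlonglongrightarrow> c (t+1) * (0 + 0)"
          by (intro tendsto_intros \<tau>d filterlim_compose[OF \<rho>h ktop])
        then have z: "(\<lambda>m. c (t+1) * (\<bar>\<tau> m - t\<bar> + h (\<rho> (k m)))) \<longlonglongrightarrow> 0" by simp
        have le: "\<bar>X (\<rho> (k m)) (\<tau> m) l - X (\<rho> (k m)) t l\<bar> \<le> c (t+1) * (\<bar>\<tau> m - t\<bar> + h (\<rho> (k m)))" for m
        proof (cases "\<tau> m \<le> t")
          case True
          then show ?thesis using incr[of "\<tau> m" t "t+1" l "\<rho> (k m)"] \<tau>a l by (simp add: abs_minus_commute)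
        next
          case False
          have "\<tau> m \<le> t + 1" using j[of m] hle[of m] by (simp add: \<tau>_def)
          then show ?thesis using False incr[of t "\<tau> m" "t+1" l "\<rho> (k m)"] t l by simp
        qed
        have "(\<lambda>m. X (\<rho> (k m)) (\<tau> m) l - X (\<rho> (k m)) t l) \<longlonglongrightarrow> 0"
          by (rule Lim_null_comparison[OF _ z]) (use le in auto)
        from tendsto_add[OF this filterlim_compose[OF xl[OF t l] ktop]] show ?thesis by simp
      qed
      then have "(\<lambda>m. F (\<tau> m) (X (\<rho> (k m)) (\<tau> m)) i) \<longlonglongrightarrow> ?s"
        by (intro cont[OF \<tau>a \<tau>t _ i]) auto
      then have "eventually (\<lambda>m. \<bar>F (\<tau> m) (X (\<rho> (k m)) (\<tau> m)) i - ?s\<bar> < e) sequentially"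
        using e tendstoD[of _ ?s sequentially e] by (simp add: dist_real_def)
      then obtain m where "\<bar>F (\<tau> m) (X (\<rho> (k m)) (\<tau> m)) i - ?s\<bar> < e" by (auto simp: eventually_sequentially)
      with bad[of m] show False unfolding E \<tau>_def by simp
    qed
    show "((\<lambda>s. x s i) has_real_derivative F t (x t) i) (at t within {a..})"
      unfolding has_field_derivative_def has_derivative_within_alt
    proof (intro conjI allI impI)
      fix e :: real assume e: "e > 0"
      obtain \<delta> N where \<delta>: "\<delta> > 0" and N: "\<And>k j. k \<ge> N \<Longrightarrow> \<bar>a + real j * h (\<rho> k) - t\<bar> < \<delta> \<Longrightarrow> \<bar>F (a + real j * h (\<rho> k)) (euler F a x0 (h (\<rho> k)) j) i - ?s\<bar> \<le> e"
        using key[OF e] unfolding bad_def by blast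
      have lim: "\<bar>x v i - x u i - (v - u) * ?s\<bar> \<le> (v - u) * e"
        if uv: "a \<le> u" "u \<le> v" "\<bar>u - t\<bar> < \<delta>/2" "\<bar>v - t\<bar> < \<delta>/2" for u v
      proof -
        have "eventually (\<lambda>k. h (\<rho> k) < \<delta>/2) sequentially" using order_tendstoD(2)[OF \<rho>h, of "\<delta>/2"] \<delta> by simp
        then have ev: "eventually (\<lambda>k. \<bar>X (\<rho> k) v i - X (\<rho> k) u i - (v - u) * ?s\<bar> \<le> (v - u + h (\<rho> k)) * e + h (\<rho> k) * \<bar>?s\<bar>) sequentially"
          using eventually_ge_at_top[of N]
        proof eventually_elim
          case (elim k)
          let ?w = "(real (J (\<rho> k) v) - real (J (\<rho> k) u)) * h (\<rho> k)"
          have "\<bar>X (\<rho> k) v i - X (\<rho> k) u i - ?w * ?s\<bar> \<le> ?w * e"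
            by (intro slope N uv elim) (use uv elim in linarith)
          moreover have "?w * e \<le> (v - u + h (\<rho> k)) * e"
            using Jd(1)[OF uv(1,2)] e by (intro mult_right_mono) auto
          moreover have "\<bar>(?w - (v - u)) * ?s\<bar> \<le> h (\<rho> k) * \<bar>?s\<bar>"
            unfolding abs_mult using Jd[OF uv(1,2), of "\<rho> k"] by (intro mult_right_mono) (auto simp: abs_le_iff)
          moreover have "X (\<rho> k) v i - X (\<rho> k) u i - (v - u) * ?s = (X (\<rho> k) v i - X (\<rho> k) u i - ?w * ?s) + (?w - (v - u)) * ?s"
            by (simp add: algebra_simps)
          ultimately show ?case by linarith
        qed
        have A: "(\<lambda>k. \<bar>X (\<rho> k) v i - X (\<rho> k) u i - (v - u) * ?s\<bar>) \<longlonglongrightarrow> \<bar>x v i - x u i - (v - u) * ?s\<bar>"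
          using uv t i by (intro tendsto_intros xl) auto
        have B: "(\<lambda>k. (v - u + h (\<rho> k)) * e + h (\<rho> k) * \<bar>?s\<bar>) \<longlonglongrightarrow> (v - u + 0) * e + 0 * \<bar>?s\<bar>"
          by (intro tendsto_intros \<rho>h)
        show ?thesis using tendsto_le[OF trivial_limit_sequentially B A ev] by simp
      qed
      show "\<exists>d>0. \<forall>y\<in>{a..}. norm (y - t) < d \<longrightarrow> norm (x y i - x t i - ?s * (y - t)) \<le> e * norm (y - t)"
      proof (intro exI[of _ "\<delta>/2"] conjI ballI impI)
        fix y assume y: "y \<in> {a..}" "norm (y - t) < \<delta>/2"
        show "norm (x y i - x t i - ?s * (y - t)) \<le> e * norm (y - t)"
        proof (cases "t \<le> y")
          case True
          then show ?thesis using lim[of t y] t y \<delta> by (simp add: mult.commute)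
        next
          case False
          then have "\<bar>x t i - x y i - (t - y) * ?s\<bar> \<le> (t - y) * e" using lim[of y t] t y \<delta> by simp
          moreover have "x y i - x t i - ?s * (y - t) = - (x t i - x y i - (t - y) * ?s)" by (simp add: algebra_simps)
          ultimately show ?thesis using False by (simp add: mult.commute)
        qed
      qed (use \<delta> in auto)
    qed (rule bounded_linear_mult_right)
  qed
qed

section \<open>Funnel invariance and exponentially stable systems\<close>

text \<open>A one-sided local descent condition above the level \<open>\<rho>\<close> suffices; it does not require differentiability,
  which is needed because the top-order reference derivative is merely Lipschitz.\<close>
lemma barrier:
  fixes z :: "real \<Rightarrow> real"
  assumes cont: "continuous_on {a..b} z" and ini: "z a \<le> \<rho>" and ab: "a \<le> b"
    and desc: "\<And>t. a \<le> t \<Longrightarrow> t < b \<Longrightarrow> z t > \<rho> \<Longrightarrow> \<exists>\<epsilon>>0. \<forall>s. t < s \<and> s < t + \<epsilon> \<and> s \<le> b \<longrightarrow> z s \<le> z t"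
  shows "z b \<le> \<rho>"
proof (rule ccontr)
  assume "\<not> z b \<le> \<rho>"
  then have zb: "z b > \<rho>" by simp
  \<comment> \<open>A level strictly between: after its last time at or below \<sigma> the function
    stays above \<rho>, so descent is available there and yields z b <= z t. Letting
    \<open>t\<close> decrease to that last time contradicts \<sigma> < z b.\<close>
  define \<sigma> where "\<sigma> = (\<rho> + z b) / 2"
  have \<sigma>: "\<rho> < \<sigma>" "\<sigma> < z b" using zb by (auto simp: \<sigma>_def)
  define S where "S = {a..b} \<inter> z -` {..\<sigma>}"
  have clS: "closed S" unfolding S_def using cont by (intro continuous_closed_preimage) auto
  have aS: "a \<in> S" using ini ab \<sigma> by (auto simp: S_def)
  have bddS: "bdd_above S" by (auto simp: S_def)
  define t0 where "t0 = Sup S"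
  have t0: "t0 \<in> S" unfolding t0_def using closed_contains_Sup[OF _ bddS clS] aS by auto
  then have t0b: "a \<le> t0" "t0 < b" "z t0 \<le> \<sigma>" using \<sigma> by (auto simp: S_def intro: le_neq_trans)
  have above: "z t > \<sigma>" if "t0 < t" "t \<le> b" for t
  proof (rule ccontr)
    assume "\<not> z t > \<sigma>"
    then have "t \<in> S" using that t0b by (auto simp: S_def)
    then show False using cSup_upper[OF _ bddS] that unfolding t0_def by force
  qed
  have "z b \<le> z t" if t: "t0 < t" "t \<le> b" for t
  proof -
    define W where "W = {t..b} \<inter> z -` {..z t}"
    have clW: "closed W" unfolding W_def
      using continuous_on_subset[OF cont, of "{t..b}"] t t0b by (intro continuous_closed_preimage) auto
    have tW: "t \<in> W" using t by (auto simp: W_def)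
    have bddW: "bdd_above W" by (auto simp: W_def)
    define w where "w = Sup W"
    have w: "w \<in> W" unfolding w_def using closed_contains_Sup[OF _ bddW clW] tW by auto
    have "w = b"
    proof (rule ccontr)
      assume "w \<noteq> b"
      then have wb: "w < b" "t \<le> w" "z w \<le> z t" using w by (auto simp: W_def)
      have "z w > \<rho>" using above[of w] wb t \<sigma> by auto
      then obtain \<epsilon> where \<epsilon>: "\<epsilon> > 0" "\<And>s. w < s \<Longrightarrow> s < w + \<epsilon> \<Longrightarrow> s \<le> b \<Longrightarrow> z s \<le> z w"
        using desc[of w] wb t t0b by auto
      define s where "s = min b (w + \<epsilon>/2)"
      have s: "w < s" "s < w + \<epsilon>" "s \<le> b" using \<epsilon> wb by (auto simp: s_def)
      then have "s \<in> W" using \<epsilon>(2)[OF s] wb by (auto simp: W_def)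
      then show False using cSup_upper[OF _ bddW] s unfolding w_def by force
    qed
    then show ?thesis using w by (auto simp: W_def)
  qed note desc' = this
  have "((\<lambda>t. z t) \<longlongrightarrow> z t0) (at t0 within {t0..b})"
    by (rule tendsto_within_subset[where S = "{a..b}"]) (use cont t0b in \<open>auto simp: continuous_on_def\<close>)
  then have lim: "(z \<longlongrightarrow> z t0) (at_right t0)"
    using at_within_Icc_at_right[OF t0b(2)] by simp
  have "eventually (\<lambda>t. z b \<le> z t) (at_right t0)"
    using desc' t0b unfolding eventually_at_right[OF t0b(2)] by (intro exI[of _ b]) auto
  from tendsto_lowerbound[OF lim this] have "z b \<le> z t0" by simp
  then show False using t0b \<sigma> by simp
qed

lemma gronwall_affine:
  fixes v :: "real \<Rightarrow> real"
  assumes ab: "a \<le> b" and cont: "continuous_on {a..b} v"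
    and der: "\<And>t. a < t \<Longrightarrow> t < b \<Longrightarrow> (v has_real_derivative v' t) (at t)"
    and le: "\<And>t. a < t \<Longrightarrow> t < b \<Longrightarrow> v' t \<le> c * v t + d" and c: "c > 0"
  shows "v b \<le> (v a + d / c) * exp (c * (b - a)) - d / c"
proof -
  define w where "w t = (v t + d / c) * exp (- c * (t - a))" for t
  have "w b \<le> w a"
  proof (cases "a = b")
    case False
    then have "a < b" using ab by simp
    have wd: "(w has_real_derivative (v' t - c * (v t + d/c)) * exp (- c * (t - a))) (at t)" if "a < t" "t < b" for t
      unfolding w_def using der[OF that] by (auto intro!: derivative_eq_intros simp: algebra_simps)
    have "continuous_on {a..b} w" unfolding w_def using cont by (intro continuous_intros)
    moreover have "v' t - c * (v t + d/c) \<le> 0" if "a < t" "t < b" for t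
      using le[OF that] c by (simp add: distrib_left)
    then have "(v' t - c * (v t + d/c)) * exp (- c * (t - a)) \<le> 0" if "a < t" "t < b" for t
      using that by (intro mult_nonpos_nonneg) auto
    ultimately show ?thesis using wd by (intro DERIV_nonpos_imp_decreasing_open[OF ab]) blast
  qed simp
  then have "(v b + d/c) * exp (- c * (b - a)) \<le> v a + d/c" by (simp add: w_def)
  then have "(v b + d/c) * exp (- c * (b - a)) * exp (c * (b - a)) \<le> (v a + d/c) * exp (c * (b - a))"
    by (intro mult_right_mono) auto
  moreover have "exp (- c * (b - a)) * exp (c * (b - a)) = 1"
    unfolding exp_add[symmetric] by simp
  ultimately show ?thesis by (simp only: mult.assoc) simp
qed

text \<open>The denominator bounds every term in the derivative estimate for z = \<phi>^2 E except
  the gain term -2 \<beta> z / (1 - z). Above 1/2 that term is below -\<beta> / (1 - z), and above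
  the second level this is below minus the denominator, so z descends.\<close>

definition funnel_level :: "nat \<Rightarrow> real \<Rightarrow> real \<Rightarrow> real \<Rightarrow> real \<Rightarrow> real \<Rightarrow> real" where
  "funnel_level p lam Lam c B \<beta> = max (1/2) (1 - \<beta> / (2 * Lam\<^sup>2 / lam\<^sup>2 + 2 * Lam\<^sup>2 * B + 1 + Lam\<^sup>2 * real p * c\<^sup>2))"

lemma funnel_level_denominator_pos:
  fixes lam Lam B c :: real
  assumes "B \<ge> 0"
  shows "2 * Lam\<^sup>2 / lam\<^sup>2 + 2 * Lam\<^sup>2 * B + 1 + Lam\<^sup>2 * real p * c\<^sup>2 > 0"
proof -
  have "2 * Lam\<^sup>2 / lam\<^sup>2 \<ge> 0" "2 * Lam\<^sup>2 * B \<ge> 0" "Lam\<^sup>2 * real p * c\<^sup>2 \<ge> 0"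
    using assms by simp_all
  then show ?thesis by linarith
qed

lemma funnel_level_less_1: "\<beta> > 0 \<Longrightarrow> B \<ge> 0 \<Longrightarrow> funnel_level p lam Lam c B \<beta> < 1"
  unfolding funnel_level_def using funnel_level_denominator_pos[of B Lam lam p c] by simp

text \<open>The error is split into a differentiable part \<open>g\<close> and a part
  \<open>h\<close> that is only Lipschitz, so z = \<phi>^2 E need not be differentiable and reaches
  \<open>barrier\<close> through a majorant. The hypothesis \<open>eg\<close> is the dissipation
  estimate: the gain 1 / (1 - z) outweighs all other terms once z exceeds
  \<open>funnel_level\<close>.\<close>

lemma funnel_invariance:
  fixes g g' h e :: "real \<Rightarrow> nat \<Rightarrow> real"
  assumes E_def: "\<And>t. E t = (\<Sum>l<p. (e t l)\<^sup>2)" and ab: "a \<le> b" and lam: "lam > 0" and \<beta>: "\<beta> > 0" and B: "B \<ge> 0"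
    and e: "\<And>t l. a \<le> t \<Longrightarrow> t \<le> b \<Longrightarrow> l < p \<Longrightarrow> e t l = g t l - h t l"
    and g: "\<And>t l. a \<le> t \<Longrightarrow> t \<le> b \<Longrightarrow> l < p \<Longrightarrow> ((\<lambda>s. g s l) has_real_derivative g' t l) (at t within {a..b})"
    and h: "\<And>s t l. a \<le> t \<Longrightarrow> t \<le> s \<Longrightarrow> s \<le> b \<Longrightarrow> l < p \<Longrightarrow> \<bar>h s l - h t l\<bar> \<le> c * (s - t)"
    and \<phi>: "\<And>t. a \<le> t \<Longrightarrow> t \<le> b \<Longrightarrow> (\<phi> has_real_derivative \<phi>' t) (at t within {a..b})"
    and \<phi>b: "\<And>t. a \<le> t \<Longrightarrow> t \<le> b \<Longrightarrow> lam \<le> \<phi> t \<and> \<phi> t \<le> Lam \<and> \<bar>\<phi>' t\<bar> \<le> Lam"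
    and z1: "\<And>t. a \<le> t \<Longrightarrow> t \<le> b \<Longrightarrow> (\<phi> t)\<^sup>2 * E t < 1"
    and eg: "\<And>t. a \<le> t \<Longrightarrow> t \<le> b \<Longrightarrow> (\<Sum>l<p. e t l * g' t l) \<le> B - \<beta> * (1 / (1 - (\<phi> t)\<^sup>2 * E t)) * E t"
  shows "(\<phi> b)\<^sup>2 * E b \<le> max ((\<phi> a)\<^sup>2 * E a) (funnel_level p lam Lam c B \<beta>)"
proof -
  define z where "z t = (\<phi> t)\<^sup>2 * E t" for t
  define D where "D = 2 * Lam\<^sup>2 / lam\<^sup>2 + 2 * Lam\<^sup>2 * B + 1 + Lam\<^sup>2 * real p * c\<^sup>2"
  define \<rho> where "\<rho> = max (z a) (funnel_level p lam Lam c B \<beta>)"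
  have D: "D > 0" unfolding D_def by (rule funnel_level_denominator_pos[OF B])
  have hc: "continuous_on {a..b} (\<lambda>s. h s l)" if "l < p" for l
  proof -
    have "(max c 0)-lipschitz_on {a..b} (\<lambda>s. h s l)"
    proof (rule lipschitz_onI)
      have *: "\<bar>h s l - h t l\<bar> \<le> max c 0 * (s - t)" if "a \<le> t" "t \<le> s" "s \<le> b" for s t
        using h[OF that \<open>l < p\<close>] mult_right_mono[of c "max c 0" "s - t"] that by auto
      fix x y assume xy: "x \<in> {a..b}" "y \<in> {a..b}"
      show "dist (h x l) (h y l) \<le> max c 0 * dist x y"
      proof (cases "x \<le> y")
        case True then show ?thesis using *[of x y] xy by (simp add: dist_real_def abs_minus_commute)
      next
        case False then show ?thesis using *[of y x] xy by (simp add: dist_real_def abs_minus_commute)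
      qed
    qed simp
    then show "continuous_on {a..b} (\<lambda>s. h s l)" by (rule lipschitz_on_continuous_on)
  qed
  have gc: "continuous_on {a..b} (\<lambda>s. g s l)" if "l < p" for l
    using g[OF _ _ that] by (intro DERIV_continuous_on) auto
  have \<phi>c: "continuous_on {a..b} \<phi>"
    using \<phi> by (intro DERIV_continuous_on) auto
  have "continuous_on {a..b} (\<lambda>t. (\<phi> t)\<^sup>2 * (\<Sum>l<p. (g t l - h t l)\<^sup>2))"
    by (intro continuous_intros \<phi>c gc hc) auto
  then have zc: "continuous_on {a..b} z"
    by (rule continuous_on_eq) (simp add: z_def E_def e)
  have "z b \<le> \<rho>"
  proof (rule barrier[OF zc _ ab])
    show "z a \<le> \<rho>" by (simp add: \<rho>_def)
    fix t assume t: "a \<le> t" "t < b" and zt: "z t > \<rho>"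
    have tb: "t \<le> b" using t by simp
    define w where "w s l = g s l - h t l" for s l
    \<comment> \<open>Freezing \<open>h\<close> at time \<open>t\<close> makes \<open>w\<close>
      differentiable. The resulting deviation d = h s - h t satisfies |d| <= c (s - t), and 2 |w d|
      <= (w^2 + c^2) (s - t). Thus to the right of \<open>t\<close> the function \<open>M\<close> is
      a differentiable majorant of \<open>z\<close> with equality at \<open>t\<close>, and a
      negative derivative of \<open>M\<close> there makes \<open>z\<close> descend.\<close>
    define M where "M s = (\<phi> s)\<^sup>2 * (\<Sum>l<p. (w s l)\<^sup>2 + ((w s l)\<^sup>2 + c\<^sup>2) * (s - t) + c\<^sup>2 * (s - t)\<^sup>2)" for s
    have we: "w t l = e t l" if "l < p" for l using e[OF t(1) tb that] by (simp add: w_def)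
    have Et: "(\<Sum>l<p. (w t l)\<^sup>2) = E t" unfolding E_def using we by simp
    have Mt: "M t = z t" using Et by (simp add: M_def z_def)
    have zM: "z s \<le> M s" if s: "t < s" "s \<le> b" for s
    proof -
      have "(e s l)\<^sup>2 \<le> (w s l)\<^sup>2 + ((w s l)\<^sup>2 + c\<^sup>2) * (s - t) + c\<^sup>2 * (s - t)\<^sup>2" if l: "l < p" for l
      proof -
        define d where "d = h s l - h t l"
        have d: "\<bar>d\<bar> \<le> c * (s - t)" using h[OF t(1) _ s(2) l] s by (simp add: d_def)
        have es: "e s l = w s l - d" using e[of s l] s t l by (simp add: w_def d_def)
        have "d\<^sup>2 \<le> (c * (s - t))\<^sup>2" using d by (simp add: abs_le_square_iff[symmetric])
        moreover have "\<bar>2 * w s l * d\<bar> \<le> ((w s l)\<^sup>2 + c\<^sup>2) * (s - t)"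
        proof -
          have "\<bar>2 * w s l * d\<bar> = 2 * \<bar>w s l\<bar> * \<bar>d\<bar>" by (simp add: abs_mult)
          also have "\<dots> \<le> 2 * \<bar>w s l\<bar> * (c * (s - t))" using d by (intro mult_left_mono) auto
          also have "\<dots> = (2 * \<bar>w s l\<bar> * c) * (s - t)" by simp
          also have "\<dots> \<le> ((w s l)\<^sup>2 + c\<^sup>2) * (s - t)"
            using sum_squares_bound[of "\<bar>w s l\<bar>" c] s by (intro mult_right_mono) auto
          finally show ?thesis .
        qed
        moreover have "(e s l)\<^sup>2 = (w s l)\<^sup>2 - 2 * w s l * d + d\<^sup>2"
          unfolding es by (simp add: power2_eq_square algebra_simps)
        ultimately show ?thesis unfolding power_mult_distrib by linarith
      qed
      then show ?thesis unfolding z_def M_def E_def by (intro mult_left_mono sum_mono) auto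
    qed
    have wd: "((\<lambda>s. w s l) has_real_derivative g' t l) (at t within {a..b})" if "l < p" for l
      unfolding w_def using g[OF t(1) tb that] by (auto intro!: derivative_eq_intros)
    have "((\<lambda>s. (w s l)\<^sup>2 + ((w s l)\<^sup>2 + c\<^sup>2) * (s - t) + c\<^sup>2 * (s - t)\<^sup>2)
        has_real_derivative (2 * (e t l * g' t l) + ((e t l)\<^sup>2 + c\<^sup>2))) (at t within {a..b})" if "l < p" for l
      by (rule derivative_eq_intros wd[OF that] refl)+ (simp add: we[OF that])
    then have "((\<lambda>s. \<Sum>l<p. (w s l)\<^sup>2 + ((w s l)\<^sup>2 + c\<^sup>2) * (s - t) + c\<^sup>2 * (s - t)\<^sup>2)
        has_real_derivative (\<Sum>l<p. 2 * (e t l * g' t l) + ((e t l)\<^sup>2 + c\<^sup>2))) (at t within {a..b})"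
      by (intro DERIV_sum) auto
    from DERIV_mult[OF DERIV_power[OF \<phi>[OF t(1) tb], of 2] this]
    have Md: "(M has_real_derivative (2 * \<phi> t * \<phi>' t * E t
        + (\<phi> t)\<^sup>2 * (\<Sum>l<p. 2 * (e t l * g' t l) + ((e t l)\<^sup>2 + c\<^sup>2)))) (at t within {a..b})"
      unfolding M_def by (rule DERIV_cong) (simp add: Et algebra_simps)
    have E0: "E t \<ge> 0" unfolding E_def by (intro sum_nonneg) auto
    have z1t: "z t < 1" using z1[OF t(1) tb] by (simp add: z_def)
    have \<phi>t: "lam \<le> \<phi> t" "\<phi> t \<le> Lam" "\<bar>\<phi>' t\<bar> \<le> Lam" using \<phi>b[OF t(1) tb] by auto
    have "lam\<^sup>2 * E t \<le> z t" unfolding z_def using \<phi>t lam E0 by (intro mult_right_mono power_mono) auto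
    then have "E t * lam\<^sup>2 \<le> 1" using z1t by (simp add: mult.commute)
    then have El: "E t \<le> 1 / lam\<^sup>2" using lam by (subst pos_le_divide_eq) auto
    have ph2: "(\<phi> t)\<^sup>2 \<le> Lam\<^sup>2" using \<phi>t lam by (intro power_mono) auto
    have T1: "2 * \<phi> t * \<phi>' t * E t \<le> 2 * Lam\<^sup>2 / lam\<^sup>2"
    proof -
      have "\<phi> t * \<phi>' t \<le> Lam * Lam"
      proof -
        have "\<phi> t * \<phi>' t \<le> \<phi> t * Lam" using \<phi>t lam by (intro mult_left_mono) auto
        also have "\<dots> \<le> Lam * Lam" using \<phi>t lam by (intro mult_right_mono) auto
        finally show ?thesis .
      qed
      then have "\<phi> t * \<phi>' t * E t \<le> Lam * Lam * E t" using E0 by (intro mult_right_mono)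
      also have "\<dots> \<le> Lam * Lam * (1 / lam\<^sup>2)" using El by (intro mult_left_mono) auto
      finally show ?thesis by (simp add: power2_eq_square)
    qed
    define k where "k = 1 / (1 - z t)"
    have T2: "(\<Sum>l<p. 2 * (e t l * g' t l) + ((e t l)\<^sup>2 + c\<^sup>2)) \<le> 2 * B - 2 * \<beta> * k * E t + E t + real p * c\<^sup>2"
    proof -
      have "(\<Sum>l<p. 2 * (e t l * g' t l) + ((e t l)\<^sup>2 + c\<^sup>2)) = 2 * (\<Sum>l<p. e t l * g' t l) + (E t + real p * c\<^sup>2)"
        unfolding E_def by (simp add: sum.distrib sum_distrib_left)
      moreover have "(\<Sum>l<p. e t l * g' t l) \<le> B - \<beta> * k * E t"
        using eg[OF t(1) tb] unfolding k_def z_def .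
      ultimately show ?thesis by simp
    qed
    have T3: "(\<phi> t)\<^sup>2 * (\<Sum>l<p. 2 * (e t l * g' t l) + ((e t l)\<^sup>2 + c\<^sup>2))
      \<le> 2 * Lam\<^sup>2 * B - 2 * \<beta> * k * z t + 1 + Lam\<^sup>2 * real p * c\<^sup>2"
    proof -
      have "(\<phi> t)\<^sup>2 * (\<Sum>l<p. 2 * (e t l * g' t l) + ((e t l)\<^sup>2 + c\<^sup>2))
        \<le> (\<phi> t)\<^sup>2 * (2 * B - 2 * \<beta> * k * E t + E t + real p * c\<^sup>2)" using T2 by (intro mult_left_mono) auto
      also have "\<dots> = (\<phi> t)\<^sup>2 * (2 * B + real p * c\<^sup>2) - 2 * \<beta> * k * z t + z t"
        by (simp add: z_def algebra_simps)
      also have "\<dots> \<le> Lam\<^sup>2 * (2 * B + real p * c\<^sup>2) - 2 * \<beta> * k * z t + 1"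
        using mult_right_mono[OF ph2, of "2 * B + real p * c\<^sup>2"] B z1t by simp
      finally show ?thesis by (simp add: algebra_simps)
    qed
    have half: "z t > 1/2" and lev: "z t > 1 - \<beta> / D"
      using zt by (auto simp: \<rho>_def funnel_level_def D_def)
    have "1 - z t < \<beta> / D" using lev by simp
    then have "D * (1 - z t) < \<beta>" using D by (simp add: field_simps)
    then have "D < \<beta> * k" using z1t by (simp add: k_def field_simps)
    also have "\<dots> \<le> \<beta> * k * (2 * z t)"
      using half \<beta> z1t mult_left_mono[of 1 "2 * z t" "\<beta> * k"] by (simp add: k_def)
    finally have neg: "D - 2 * \<beta> * k * z t < 0" by simp
    have "2 * \<phi> t * \<phi>' t * E t + (\<phi> t)\<^sup>2 * (\<Sum>l<p. 2 * (e t l * g' t l) + ((e t l)\<^sup>2 + c\<^sup>2)) < 0"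
      using T1 T3 neg unfolding D_def by linarith
    from has_real_derivative_neg_dec_right[OF Md this]
    obtain d where d: "d > 0" "\<And>\<eta>. \<eta> > 0 \<Longrightarrow> t + \<eta> \<in> {a..b} \<Longrightarrow> \<eta> < d \<Longrightarrow> M (t + \<eta>) < M t" by auto
    show "\<exists>\<epsilon>>0. \<forall>s. t < s \<and> s < t + \<epsilon> \<and> s \<le> b \<longrightarrow> z s \<le> z t"
    proof (intro exI[of _ d] conjI d(1) allI impI, elim conjE)
      fix s assume "t < s" "s < t + d" "s \<le> b"
      then show "z s \<le> z t" using d(2)[of "s - t"] zM[of s] Mt t by simp
    qed
  qed
  then show ?thesis by (simp add: z_def \<rho>_def)
qed

text \<open>Peano's theorem above asks for a bounded right-hand side, so the state is clamped to the
  growing radius \<open>R t\<close>. Clamping does not increase absolute values, hence the Gronwall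
  estimate of the linear system survives; it bounds the solution by exactly \<open>R t\<close>, and
  the clamp is never active.\<close>

lemma linear_ode_exists:
  fixes Q :: "real \<Rightarrow> nat \<Rightarrow> nat \<Rightarrow> real"
  assumes Qc: "\<And>i j. i < d \<Longrightarrow> j < d \<Longrightarrow> continuous_on {a..} (\<lambda>t. Q t i j)"
    and Qb: "\<And>t i j. a \<le> t \<Longrightarrow> i < d \<Longrightarrow> j < d \<Longrightarrow> \<bar>Q t i j\<bar> \<le> q" and q: "q \<ge> 0"
  obtains z where "\<And>i. i < d \<Longrightarrow> z a i = z0 i"
    "\<And>t i. a \<le> t \<Longrightarrow> i < d \<Longrightarrow> ((\<lambda>s. z s i) has_real_derivative (\<Sum>j<d. Q t i j * z t j)) (at t within {a..})"
proof -
  define c where "c = q * real d + 1"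
  have c: "c > 0" using q by (simp add: c_def add_nonneg_pos)
  define v0 where "v0 = (\<Sum>i<d. (z0 i)\<^sup>2)"
  define R where "R t = sqrt v0 * exp (c * (t - a))" for t
  have v00: "v0 \<ge> 0" unfolding v0_def by (intro sum_nonneg) auto
  have R0: "R t \<ge> 0" for t using v00 by (simp add: R_def)
  define cl where "cl t y = max (- R t) (min (R t) y)" for t y :: real
  have cl: "\<bar>cl t y\<bar> \<le> \<bar>y\<bar>" "\<bar>cl t y\<bar> \<le> R t" for t y using R0[of t] by (auto simp: cl_def)
  define F where "F t x i = (\<Sum>j<d. Q t i j * cl t (x j))" for t x i
  have "\<exists>z. (\<forall>i<d. z a i = z0 i) \<and> (\<forall>t i. a \<le> t \<longrightarrow> i < d \<longrightarrow> ((\<lambda>s. z s i) has_real_derivative F t (z t) i) (at t within {a..}))"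
  proof (rule peano_existence[of a d F z0])
    fix \<tau> :: "nat \<Rightarrow> real" and t and X :: "nat \<Rightarrow> nat \<Rightarrow> real" and x :: "nat \<Rightarrow> real" and i
    assume \<tau>: "\<And>k. a \<le> \<tau> k" "\<tau> \<longlonglongrightarrow> t" and X: "\<And>j. j < d \<Longrightarrow> (\<lambda>k. X k j) \<longlonglongrightarrow> x j" and i: "i < d"
    have ta: "a \<le> t" using \<tau>(1) by (intro LIMSEQ_le_const[OF \<tau>(2)]) auto
    have Qt: "(\<lambda>k. Q (\<tau> k) i j) \<longlonglongrightarrow> Q t i j" if "j < d" for j
      using \<tau>(1) ta by (intro continuous_on_tendsto_compose[OF Qc[OF i that] \<tau>(2)]) auto
    have Rt: "(\<lambda>k. R (\<tau> k)) \<longlonglongrightarrow> R t" unfolding R_def by (intro tendsto_intros \<tau>(2))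
    show "(\<lambda>k. F (\<tau> k) (X k) i) \<longlonglongrightarrow> F t x i"
      unfolding F_def cl_def by (intro tendsto_sum tendsto_mult tendsto_max tendsto_min tendsto_minus Rt Qt X) auto
  next
    fix T
    show "\<exists>k. \<forall>t\<in>{a..T}. \<forall>x. \<forall>i<d. \<bar>F t x i\<bar> \<le> k"
    proof (intro exI ballI allI impI)
      fix t i and x :: "nat \<Rightarrow> real" assume t: "t \<in> {a..T}" and i: "i < d"
      have RT: "R t \<le> R T" using t c v00 by (auto simp: R_def intro!: mult_left_mono)
      have "\<bar>F t x i\<bar> \<le> (\<Sum>j<d. \<bar>Q t i j * cl t (x j)\<bar>)" unfolding F_def by (rule sum_abs)
      also have "\<dots> \<le> (\<Sum>j<d. q * R T)"
        unfolding abs_mult using t i q RT cl(2) by (intro sum_mono mult_mono Qb) (auto intro: order_trans)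
      finally show "\<bar>F t x i\<bar> \<le> (\<Sum>j<d. q * R T)" .
    qed
  next
    fix x :: "real \<Rightarrow> nat \<Rightarrow> real" assume "\<And>i. i < d \<Longrightarrow> x a i = z0 i" "\<And>t i. a \<le> t \<Longrightarrow> i < d \<Longrightarrow> ((\<lambda>s. x s i) has_real_derivative F t (x t) i) (at t within {a..})"
    then show ?thesis by blast
  qed
  then obtain z where z0: "\<And>i. i < d \<Longrightarrow> z a i = z0 i"
    and z: "\<And>t i. a \<le> t \<Longrightarrow> i < d \<Longrightarrow> ((\<lambda>s. z s i) has_real_derivative F t (z t) i) (at t within {a..})" by blast
  have inR: "\<bar>z t i\<bar> \<le> R t" if t: "a \<le> t" and i: "i < d" for t i
  proof -
    define v where "v s = (\<Sum>i<d. (z s i)\<^sup>2)" for s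
    have vd: "(v has_real_derivative (\<Sum>i<d. 2 * z s i * F s (z s) i)) (at s within {a..})" if "a \<le> s" for s
      unfolding v_def using z[OF that] by (auto intro!: derivative_eq_intros simp: ac_simps)
    have "v t \<le> (v a + 0 / (2*c)) * exp (2*c * (t - a)) - 0 / (2*c)"
    proof (rule gronwall_affine[OF t])
      show "continuous_on {a..t} v"
        by (rule continuous_on_subset[of "{a..}"], rule DERIV_continuous_on) (use vd in auto)
      show "(v has_real_derivative (\<Sum>i<d. 2 * z s i * F s (z s) i)) (at s)" if "a < s" "s < t" for s
        using vd[of s] that at_within_interior[of s "{a..}"] by simp
      show "(\<Sum>i<d. 2 * z s i * F s (z s) i) \<le> 2*c * v s + 0" if "a < s" "s < t" for s
      proof -
        have "(\<Sum>i<d. 2 * z s i * F s (z s) i) \<le> (\<Sum>i<d. 2 * \<bar>z s i\<bar> * (\<Sum>j<d. q * \<bar>z s j\<bar>))"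
        proof (rule sum_mono)
          fix i assume i: "i \<in> {..<d}"
          have "\<bar>F s (z s) i\<bar> \<le> (\<Sum>j<d. \<bar>Q s i j * cl s (z s j)\<bar>)" unfolding F_def by (rule sum_abs)
          also have "\<dots> \<le> (\<Sum>j<d. q * \<bar>z s j\<bar>)"
            unfolding abs_mult using that i q cl(1) by (intro sum_mono mult_mono Qb) auto
          finally have "\<bar>2 * z s i * F s (z s) i\<bar> \<le> 2 * \<bar>z s i\<bar> * (\<Sum>j<d. q * \<bar>z s j\<bar>)"
            unfolding abs_mult by (intro mult_mono) auto
          then show "2 * z s i * F s (z s) i \<le> 2 * \<bar>z s i\<bar> * (\<Sum>j<d. q * \<bar>z s j\<bar>)" by linarith
        qed
        also have "\<dots> = 2 * q * (\<Sum>i<d. \<bar>z s i\<bar>)\<^sup>2"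
          by (simp add: power2_eq_square sum_distrib_left sum_distrib_right ac_simps)
        also have "\<dots> \<le> 2 * q * (real d * v s)"
          using sum_squared_le_sum_of_squares[of "\<lambda>i. \<bar>z s i\<bar>" "{..<d}"] q by (intro mult_left_mono) (auto simp: v_def mult.commute)
        also have "\<dots> \<le> 2 * c * v s" by (simp add: c_def algebra_simps v_def sum_nonneg)
        finally show ?thesis by simp
      qed
    qed (use c in auto)
    then have vt: "v t \<le> v0 * exp (2*c*(t-a))" using z0 by (simp add: v_def v0_def)
    have "\<bar>z t i\<bar> = sqrt ((z t i)\<^sup>2)" by simp
    also have "\<dots> \<le> sqrt (v t)" unfolding v_def using i by (intro real_sqrt_le_mono member_le_sum) auto
    also have "\<dots> \<le> sqrt (v0 * exp (2*c*(t-a)))" using vt by (rule real_sqrt_le_mono)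
    also have "\<dots> = R t"
    proof -
      have "exp (2*c*(t-a)) = (exp (c * (t-a)))\<^sup>2" by (simp add: power2_eq_square exp_add[symmetric] algebra_simps)
      then show ?thesis by (simp add: R_def real_sqrt_mult)
    qed
    finally show ?thesis .
  qed
  have "cl t (z t j) = z t j" if "a \<le> t" "j < d" for t j
    using inR[OF that] by (auto simp: cl_def)
  then have Feq: "F t (z t) i = (\<Sum>j<d. Q t i j * z t j)" if "a \<le> t" for t i
    unfolding F_def using that by simp
  show ?thesis
    by (rule that[of z]) (simp_all add: z0 z Feq[symmetric])
qed

text \<open>Stability speaks of the homogeneous system only. On a window of length \<open>T\<close>
  the solution is compared with the homogeneous one from the same value: the latter at least halves
  over the window, and the distance of the two is bounded by a Gronwall estimate. The norms at the
  window ends are therefore controlled by iterating y -> y/2 + W.\<close>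

lemma exp_stable_bounded_input:
  fixes Q :: "real \<Rightarrow> nat \<Rightarrow> nat \<Rightarrow> real"
  assumes Qc: "\<And>i j. i < d \<Longrightarrow> j < d \<Longrightarrow> continuous_on {0..} (\<lambda>t. Q t i j)"
    and Qb: "\<And>t i j. 0 \<le> t \<Longrightarrow> i < d \<Longrightarrow> j < d \<Longrightarrow> \<bar>Q t i j\<bar> \<le> q" and q: "q \<ge> 0"
    and M: "M > 0" "\<mu> > 0"
    and stab: "\<And>z t0 t. 0 \<le> t0 \<Longrightarrow> (\<And>t i. t0 \<le> t \<Longrightarrow> i < d \<Longrightarrow>
        ((\<lambda>s. z s i) has_real_derivative (\<Sum>j<d. Q t i j * z t j)) (at t within {t0..})) \<Longrightarrow> t0 \<le> t \<Longrightarrow>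
        L2_set (z t) {..<d} \<le> M * exp (- \<mu> * (t - t0)) * L2_set (z t0) {..<d}"
  shows "\<exists>Y. \<forall>a b y u. 0 \<le> a \<and> a \<le> b \<and> L2_set (y a) {..<d} \<le> Y0 \<and> (\<forall>t\<in>{a..b}. \<forall>i<d. \<bar>u t i\<bar> \<le> D \<and>
        ((\<lambda>s. y s i) has_real_derivative (\<Sum>j<d. Q t i j * y t j) + u t i) (at t within {a..b}))
        \<longrightarrow> L2_set (y b) {..<d} \<le> Y"
proof -
  \<comment> \<open>Chosen so that M exp(-\<mu> T) <= 1/2; the absolute value and the 1 keep
    \<open>T\<close> positive when 2 M is below 1.\<close>
  define T where "T = (ln (2 * M) + \<bar>ln (2 * M)\<bar> + 1) / \<mu>"
  have T: "T > 0" using M by (simp add: T_def)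
  have "ln (2 * M) \<le> \<mu> * T" using M by (simp add: T_def)
  then have "exp (ln (2 * M)) \<le> exp (\<mu> * T)" by simp
  then have "2 * M \<le> exp (\<mu> * T)" using M by simp
  then have MT: "M * exp (- \<mu> * T) \<le> 1/2"
    using M by (simp add: exp_minus field_simps)
  define c where "c = 2 * q * real d + 1"
  have c: "c > 0" "c \<ge> 1" using q by (simp_all add: c_def add_nonneg_pos)
  \<comment> \<open>Gronwall bound over one window for the distance to the homogeneous solution. The
    extra 1 in \<open>c\<close> and the term with \<open>D\<close> come from 2 w u <= w^2 +
    u^2.\<close>
  define W where "W = sqrt (real d * D\<^sup>2 * exp (c * T))"
  have step: "L2_set (y t) {..<d} \<le> M * exp (- \<mu> * (t - t0)) * L2_set (y t0) {..<d} + W"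
    if "0 \<le> a" and y: "\<And>t i. a \<le> t \<Longrightarrow> t \<le> b \<Longrightarrow> i < d \<Longrightarrow> \<bar>u t i\<bar> \<le> D \<and>
        ((\<lambda>s. y s i) has_real_derivative (\<Sum>j<d. Q t i j * y t j) + u t i) (at t within {a..b})"
      and t: "a \<le> t0" "t0 \<le> t" "t \<le> t0 + T" "t \<le> b" for a b t0 t y u
  proof -
    have t00: "0 \<le> t0" using that by simp
    obtain z where zi: "\<And>i. i < d \<Longrightarrow> z t0 i = y t0 i"
      and z: "\<And>t i. t0 \<le> t \<Longrightarrow> i < d \<Longrightarrow> ((\<lambda>s. z s i) has_real_derivative (\<Sum>j<d. Q t i j * z t j)) (at t within {t0..})"
      by (rule linear_ode_exists[of d t0 Q q "y t0"]) (use Qc Qb q t00 in \<open>auto intro: continuous_on_subset\<close>)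
    have "L2_set (z t) {..<d} \<le> M * exp (- \<mu> * (t - t0)) * L2_set (z t0) {..<d}"
      by (rule stab[OF t00 z t(2)])
    moreover have "L2_set (z t0) {..<d} = L2_set (y t0) {..<d}" using zi by (auto simp: L2_set_def)
    moreover have "L2_set (\<lambda>i. y t i - z t i) {..<d} \<le> W"
    proof -
      define w where "w s i = y s i - z s i" for s i
      define v where "v s = (\<Sum>i<d. (w s i)\<^sup>2)" for s
      define v' where "v' s = (\<Sum>i<d. 2 * w s i * ((\<Sum>j<d. Q s i j * w s j) + u s i))" for s
      have wd: "((\<lambda>s. w s i) has_real_derivative ((\<Sum>j<d. Q s i j * w s j) + u s i)) (at s within {t0..t})"
        if "t0 \<le> s" "s \<le> t" "i < d" for s i
      proof -
        have "((\<lambda>s. y s i) has_real_derivative (\<Sum>j<d. Q s i j * y s j) + u s i) (at s within {t0..t})"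
          by (rule has_field_derivative_subset[where s = "{a..b}"]) (use y[of s i] that t in auto)
        moreover have "((\<lambda>s. z s i) has_real_derivative (\<Sum>j<d. Q s i j * z s j)) (at s within {t0..t})"
          by (rule has_field_derivative_subset[where s = "{t0..}"]) (use z[of s i] that t in auto)
        ultimately show ?thesis unfolding w_def
          by (auto intro!: derivative_eq_intros simp: sum_subtractf right_diff_distrib)
      qed
      have vd: "(v has_real_derivative v' s) (at s within {t0..t})" if "t0 \<le> s" "s \<le> t" for s
        unfolding v_def v'_def using wd[OF that] by (auto intro!: derivative_eq_intros simp: ac_simps)
      have "v t \<le> (v t0 + real d * D\<^sup>2 / c) * exp (c * (t - t0)) - real d * D\<^sup>2 / c"
      proof (rule gronwall_affine[OF t(2) _ _ _ c(1)])
        show "continuous_on {t0..t} v"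
          by (rule DERIV_continuous_on) (use vd in auto)
        show "(v has_real_derivative v' s) (at s)" if "t0 < s" "s < t" for s
          using vd[of s] that at_within_interior[of s "{t0..t}"] by simp
        show "v' s \<le> c * v s + real d * D\<^sup>2" if s: "t0 < s" "s < t" for s
        proof -
          have s0: "0 \<le> s" "a \<le> s" "s \<le> b" using s t t00 by auto
          have "v' s \<le> (\<Sum>i<d. 2 * \<bar>w s i\<bar> * (\<Sum>j<d. q * \<bar>w s j\<bar>) + ((w s i)\<^sup>2 + D\<^sup>2))"
            unfolding v'_def
          proof (rule sum_mono)
            fix i assume i: "i \<in> {..<d}"
            have "\<bar>\<Sum>j<d. Q s i j * w s j\<bar> \<le> (\<Sum>j<d. \<bar>Q s i j * w s j\<bar>)" by (rule sum_abs)
            also have "\<dots> \<le> (\<Sum>j<d. q * \<bar>w s j\<bar>)"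
              unfolding abs_mult using s0 i q by (intro sum_mono mult_mono Qb) auto
            finally have "\<bar>2 * w s i * (\<Sum>j<d. Q s i j * w s j)\<bar> \<le> 2 * \<bar>w s i\<bar> * (\<Sum>j<d. q * \<bar>w s j\<bar>)"
              unfolding abs_mult by (intro mult_mono) auto
            moreover have "2 * w s i * u s i \<le> (w s i)\<^sup>2 + D\<^sup>2"
            proof -
              have "(u s i)\<^sup>2 \<le> D\<^sup>2" using y[of s i] s0 i abs_le_square_iff[of "u s i" D] by auto
              then show ?thesis using sum_squares_bound[of "w s i" "u s i"] by linarith
            qed
            moreover have "2 * w s i * ((\<Sum>j<d. Q s i j * w s j) + u s i) = 2 * w s i * (\<Sum>j<d. Q s i j * w s j) + 2 * w s i * u s i"
              by (simp add: distrib_left)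
            ultimately show "2 * w s i * ((\<Sum>j<d. Q s i j * w s j) + u s i)
               \<le> 2 * \<bar>w s i\<bar> * (\<Sum>j<d. q * \<bar>w s j\<bar>) + ((w s i)\<^sup>2 + D\<^sup>2)" by linarith
          qed
          also have "\<dots> = 2 * q * (\<Sum>i<d. \<bar>w s i\<bar>)\<^sup>2 + (v s + real d * D\<^sup>2)"
            by (simp add: power2_eq_square sum_distrib_left sum_distrib_right ac_simps sum.distrib v_def)
          also have "\<dots> \<le> 2 * q * (real d * v s) + (v s + real d * D\<^sup>2)"
            using sum_squared_le_sum_of_squares[of "\<lambda>i. \<bar>w s i\<bar>" "{..<d}"] q by (intro add_right_mono mult_left_mono) (auto simp: v_def mult.commute)
          also have "\<dots> = c * v s + real d * D\<^sup>2" by (simp add: c_def algebra_simps)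
          finally show ?thesis .
        qed
      qed
      moreover have "v t0 = 0" using zi by (simp add: v_def w_def)
      ultimately have "v t \<le> (real d * D\<^sup>2 / c) * exp (c * (t - t0)) - real d * D\<^sup>2 / c" by simp
      also have "\<dots> \<le> (real d * D\<^sup>2 / c) * exp (c * (t - t0))" using c by simp
      also have "\<dots> \<le> (real d * D\<^sup>2 / 1) * exp (c * T)"
        using c t by (intro mult_mono divide_left_mono) auto
      finally show ?thesis unfolding W_def L2_set_def v_def w_def by (intro real_sqrt_le_mono) simp
    qed
    moreover have "L2_set (y t) {..<d} \<le> L2_set (\<lambda>i. y t i - z t i) {..<d} + L2_set (z t) {..<d}"
      using L2_set_triangle_ineq[of "\<lambda>i. y t i - z t i" "z t" "{..<d}"] by simp
    ultimately show ?thesis by simp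
  qed
  \<comment> \<open>2 W is the fixed point of y -> y/2 + W, so the maximum with the initial bound is
    preserved from window to window.\<close>
  define Y1 where "Y1 = max Y0 (2 * W)"
  have W0: "W \<ge> 0" unfolding W_def by simp
  show ?thesis
  proof (intro exI[of _ "M * Y1 + W"] allI impI, elim conjE)
    fix a b y u
    assume ab: "0 \<le> a" "a \<le> b" and ya: "L2_set (y a) {..<d} \<le> Y0" and "\<forall>t\<in>{a..b}. \<forall>i<d. \<bar>u t i\<bar> \<le> D \<and>
        ((\<lambda>s. y s i) has_real_derivative (\<Sum>j<d. Q t i j * y t j) + u t i) (at t within {a..b})"
    then have y: "\<And>t i. a \<le> t \<Longrightarrow> t \<le> b \<Longrightarrow> i < d \<Longrightarrow> \<bar>u t i\<bar> \<le> D \<and>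
        ((\<lambda>s. y s i) has_real_derivative (\<Sum>j<d. Q t i j * y t j) + u t i) (at t within {a..b})" by auto
    note st = step[where a = a and b = b and y = y and u = u, OF ab(1) y]
    have samp: "a + real k * T \<le> b \<Longrightarrow> L2_set (y (a + real k * T)) {..<d} \<le> Y1" for k
    proof (induction k)
      case 0 then show ?case using ya by (simp add: Y1_def)
    next
      case (Suc k)
      have "a + real (Suc k) * T = (a + real k * T) + T" by (simp add: algebra_simps)
      then have eq: "a + real (Suc k) * T - (a + real k * T) = T" by simp
      have kb: "a + real k * T \<le> b" using Suc.prems T by (simp add: algebra_simps)
      have "L2_set (y (a + real (Suc k) * T)) {..<d} \<le> M * exp (- \<mu> * T) * L2_set (y (a + real k * T)) {..<d} + W"
        using st[where ?t0.0 = "a + real k * T" and t = "a + real (Suc k) * T"] Suc.prems T ab(1) unfolding eq by (simp add: distrib_right)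
      also have "\<dots> \<le> 1/2 * Y1 + W"
        using Suc.IH[OF kb] MT by (intro add_right_mono mult_mono) (auto simp: Y1_def W0 le_max_iff_disj)
      also have "\<dots> \<le> Y1" using W0 by (simp add: Y1_def)
      finally show ?case .
    qed
    define k where "k = eidx a T b"
    have k: "a + real k * T \<le> b" "b < a + real k * T + T" using eidx_bounds[OF T ab(2)] by (simp_all add: k_def)
    have "L2_set (y b) {..<d} \<le> M * exp (- \<mu> * (b - (a + real k * T))) * L2_set (y (a + real k * T)) {..<d} + W"
      using st[where ?t0.0 = "a + real k * T" and t = b] k T by simp
    also have "\<dots> \<le> M * 1 * Y1 + W"
      using samp[OF k(1)] k M by (intro add_right_mono mult_mono) (auto simp: mult_nonneg_nonneg)
    finally show "L2_set (y b) {..<d} \<le> M * Y1 + W" by simp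
  qed
qed

section \<open>Error signals as rational expressions\<close>

text \<open>Indices of \<open>EOut\<close>, \<open>ERef\<close> are (order of derivative, component), those of \<open>EPhi\<close> are (funnel, order of
  derivative). \<open>EInv\<close> stands for the gains. Its interpretation is a parameter of the evaluation, so that the true
  inverse can be replaced by a truncated one without singularities.\<close>
datatype expr = ECst real | EOut nat nat | ERef nat nat | EPhi nat nat
  | EAdd expr expr | EMul expr expr | EInv expr

primrec ev :: "(real \<Rightarrow> real) \<Rightarrow> (nat \<Rightarrow> nat \<Rightarrow> real) \<Rightarrow> (nat \<Rightarrow> nat \<Rightarrow> real) \<Rightarrow> (nat \<Rightarrow> nat \<Rightarrow> real) \<Rightarrow> expr \<Rightarrow> real" where
  "ev iv Y R P (ECst c) = c"
| "ev iv Y R P (EOut k l) = Y k l"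
| "ev iv Y R P (ERef k l) = R k l"
| "ev iv Y R P (EPhi j k) = P j k"
| "ev iv Y R P (EAdd a b) = ev iv Y R P a + ev iv Y R P b"
| "ev iv Y R P (EMul a b) = ev iv Y R P a * ev iv Y R P b"
| "ev iv Y R P (EInv a) = iv (ev iv Y R P a)"

primrec ediff :: "expr \<Rightarrow> expr" where
  "ediff (ECst c) = ECst 0"
| "ediff (EOut k l) = EOut (Suc k) l"
| "ediff (ERef k l) = ERef (Suc k) l"
| "ediff (EPhi j k) = EPhi j (Suc k)"
| "ediff (EAdd a b) = EAdd (ediff a) (ediff b)"
| "ediff (EMul a b) = EAdd (EMul (ediff a) b) (EMul a (ediff b))"
| "ediff (EInv a) = EMul (EMul (ECst (-1)) (ediff a)) (EMul (EInv a) (EInv a))"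

text \<open>A bound on the orders that occur. For funnel functions the index counts as well:
  \<phi>_j has r - j derivatives, so j + k < r guarantees that its derivative of order k can be
  differentiated once more.\<close>

primrec lower :: "nat \<Rightarrow> nat \<Rightarrow> expr \<Rightarrow> bool" where
  "lower p i (ECst c) = True"
| "lower p i (EOut k l) = (k < i \<and> l < p)"
| "lower p i (ERef k l) = (k < i \<and> l < p)"
| "lower p i (EPhi j k) = (j + k < i)"
| "lower p i (EAdd a b) = (lower p i a \<and> lower p i b)"
| "lower p i (EMul a b) = (lower p i a \<and> lower p i b)"
| "lower p i (EInv a) = lower p i a"

text \<open>A condition on the arguments of all inverses, to be instantiated with nonvanishing, with
  continuity or boundedness of the inverse there, and with agreement of two interpretations of the
  inverse.\<close>

primrec all_inv :: "(expr \<Rightarrow> bool) \<Rightarrow> expr \<Rightarrow> bool" where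
  "all_inv Q (ECst c) = True"
| "all_inv Q (EOut k l) = True"
| "all_inv Q (ERef k l) = True"
| "all_inv Q (EPhi j k) = True"
| "all_inv Q (EAdd a b) = (all_inv Q a \<and> all_inv Q b)"
| "all_inv Q (EMul a b) = (all_inv Q a \<and> all_inv Q b)"
| "all_inv Q (EInv a) = (Q a \<and> all_inv Q a)"

lemma lower_mono: "lower p i e \<Longrightarrow> i \<le> j \<Longrightarrow> lower p j e"
  by (induction e) auto

lemma lower_ediff: "lower p i e \<Longrightarrow> lower p (Suc i) (ediff e)"
  by (induction e) (auto intro: lower_mono)

lemma all_inv_ediff: "all_inv Q e \<Longrightarrow> all_inv Q (ediff e)"
  by (induction e) auto

lemma ev_has_derivative:
  assumes "\<And>k l. k < i \<Longrightarrow> l < p \<Longrightarrow> ((\<lambda>s. Y s k l) has_real_derivative Y t (Suc k) l) (at t within S)"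
    and "\<And>k l. k < i \<Longrightarrow> l < p \<Longrightarrow> ((\<lambda>s. R s k l) has_real_derivative R t (Suc k) l) (at t within S)"
    and "\<And>j k. j + k < i \<Longrightarrow> ((\<lambda>s. P s j k) has_real_derivative P t j (Suc k)) (at t within S)"
    and "lower p i e" "all_inv (\<lambda>a. ev inverse (Y t) (R t) (P t) a \<noteq> 0) e"
  shows "((\<lambda>s. ev inverse (Y s) (R s) (P s) e) has_real_derivative ev inverse (Y t) (R t) (P t) (ediff e)) (at t within S)"
  using assms(4,5)
proof (induction e)
  case (EMul a b)
  then show ?case by (auto intro!: derivative_eq_intros)
next
  case (EInv a)
  then have "((\<lambda>s. inverse (ev inverse (Y s) (R s) (P s) a)) has_real_derivative
     - (inverse (ev inverse (Y t) (R t) (P t) a) * ev inverse (Y t) (R t) (P t) (ediff a) * inverse (ev inverse (Y t) (R t) (P t) a))) (at t within S)"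
    by (intro DERIV_inverse') auto
  then show ?case by (simp add: ac_simps)
qed (use assms(1-3) in \<open>auto intro!: derivative_eq_intros\<close>)

lemma ev_tendsto:
  assumes "\<And>k l. k < i \<Longrightarrow> l < p \<Longrightarrow> ((\<lambda>s. Y s k l) \<longlongrightarrow> Y0 k l) F"
    and "\<And>k l. k < i \<Longrightarrow> l < p \<Longrightarrow> ((\<lambda>s. R s k l) \<longlongrightarrow> R0 k l) F"
    and "\<And>j k. j + k < i \<Longrightarrow> ((\<lambda>s. P s j k) \<longlongrightarrow> P0 j k) F"
    and "lower p i e" "all_inv (\<lambda>a. isCont iv (ev iv Y0 R0 P0 a)) e"
  shows "((\<lambda>s. ev iv (Y s) (R s) (P s) e) \<longlongrightarrow> ev iv Y0 R0 P0 e) F"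
  using assms(4,5)
proof (induction e)
  case (EInv a)
  then show ?case by (auto intro: isCont_tendsto_compose)
qed (use assms(1-3) in \<open>auto intro!: tendsto_intros\<close>)

text \<open>The bound \<open>M\<close> depends only on the expression, on \<open>i\<close>,
  \<open>p\<close> and on \<open>c\<close>, and serves all valuations at once. This is what makes
  the later bounds uniform over solutions.\<close>

lemma ev_bounded:
  assumes "lower p i e"
  shows "\<exists>M. \<forall>iv Y R P. (\<forall>k<i. \<forall>l<p. \<bar>Y k l\<bar> \<le> c \<and> \<bar>R k l\<bar> \<le> c) \<and> (\<forall>j k. j + k < i \<longrightarrow> \<bar>P j k\<bar> \<le> c)
      \<and> all_inv (\<lambda>a. \<bar>iv (ev iv Y R P a)\<bar> \<le> c) e \<longrightarrow> \<bar>ev iv Y R P e\<bar> \<le> M"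
  using assms
proof (induction e)
  case (ECst x)
  show ?case by (rule exI[of _ "\<bar>x\<bar>"]) simp
next
  case (EAdd a b)
  then obtain M1 M2 where M: 
    "\<And>iv Y R P. (\<forall>k<i. \<forall>l<p. \<bar>Y k l\<bar> \<le> c \<and> \<bar>R k l\<bar> \<le> c) \<and> (\<forall>j k. j + k < i \<longrightarrow> \<bar>P j k\<bar> \<le> c)
      \<and> all_inv (\<lambda>a. \<bar>iv (ev iv Y R P a)\<bar> \<le> c) a \<Longrightarrow> \<bar>ev iv Y R P a\<bar> \<le> M1"
    "\<And>iv Y R P. (\<forall>k<i. \<forall>l<p. \<bar>Y k l\<bar> \<le> c \<and> \<bar>R k l\<bar> \<le> c) \<and> (\<forall>j k. j + k < i \<longrightarrow> \<bar>P j k\<bar> \<le> c)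
      \<and> all_inv (\<lambda>a. \<bar>iv (ev iv Y R P a)\<bar> \<le> c) b \<Longrightarrow> \<bar>ev iv Y R P b\<bar> \<le> M2" by (auto simp del: split_paired_All)
  show ?case
  proof (intro exI[of _ "M1 + M2"] allI impI, elim conjE)
    fix iv Y R P
    assume "\<forall>k<i. \<forall>l<p. \<bar>Y k l\<bar> \<le> c \<and> \<bar>R k l\<bar> \<le> c" "\<forall>j k. j + k < i \<longrightarrow> \<bar>P j k\<bar> \<le> c"
      "all_inv (\<lambda>a. \<bar>iv (ev iv Y R P a)\<bar> \<le> c) (EAdd a b)"
    then have "\<bar>ev iv Y R P a\<bar> \<le> M1" "\<bar>ev iv Y R P b\<bar> \<le> M2" by (auto intro!: M)
    then show "\<bar>ev iv Y R P (EAdd a b)\<bar> \<le> M1 + M2" by simp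
  qed
next
  case (EMul a b)
  then obtain M1 M2 where M: 
    "\<And>iv Y R P. (\<forall>k<i. \<forall>l<p. \<bar>Y k l\<bar> \<le> c \<and> \<bar>R k l\<bar> \<le> c) \<and> (\<forall>j k. j + k < i \<longrightarrow> \<bar>P j k\<bar> \<le> c)
      \<and> all_inv (\<lambda>a. \<bar>iv (ev iv Y R P a)\<bar> \<le> c) a \<Longrightarrow> \<bar>ev iv Y R P a\<bar> \<le> M1"
    "\<And>iv Y R P. (\<forall>k<i. \<forall>l<p. \<bar>Y k l\<bar> \<le> c \<and> \<bar>R k l\<bar> \<le> c) \<and> (\<forall>j k. j + k < i \<longrightarrow> \<bar>P j k\<bar> \<le> c)
      \<and> all_inv (\<lambda>a. \<bar>iv (ev iv Y R P a)\<bar> \<le> c) b \<Longrightarrow> \<bar>ev iv Y R P b\<bar> \<le> M2" by (auto simp del: split_paired_All)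
  show ?case
  proof (intro exI[of _ "M1 * M2"] allI impI, elim conjE)
    fix iv Y R P
    assume "\<forall>k<i. \<forall>l<p. \<bar>Y k l\<bar> \<le> c \<and> \<bar>R k l\<bar> \<le> c" "\<forall>j k. j + k < i \<longrightarrow> \<bar>P j k\<bar> \<le> c"
      "all_inv (\<lambda>a. \<bar>iv (ev iv Y R P a)\<bar> \<le> c) (EMul a b)"
    then have "\<bar>ev iv Y R P a\<bar> \<le> M1" "\<bar>ev iv Y R P b\<bar> \<le> M2" by (auto intro!: M)
    then have "\<bar>ev iv Y R P a\<bar> * \<bar>ev iv Y R P b\<bar> \<le> M1 * M2" by (intro mult_mono) auto
    then show "\<bar>ev iv Y R P (EMul a b)\<bar> \<le> M1 * M2" by (simp add: abs_mult)
  qed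
qed (auto intro!: exI[of _ c])

lemma ev_cong_inv:
  assumes "all_inv (\<lambda>a. iv' (ev iv Y R P a) = iv (ev iv Y R P a)) e"
  shows "ev iv' Y R P e = ev iv Y R P e"
  using assms by (induction e) auto

lemma ev_cong:
  assumes "lower p i e" "\<And>k l. k < i \<Longrightarrow> l < p \<Longrightarrow> Y k l = Y' k l"
  shows "ev iv Y R P e = ev iv Y' R P e"
  using assms by (induction e) auto

section \<open>Expressions for the errors and the gains\<close>

primrec esum :: "(nat \<Rightarrow> expr) \<Rightarrow> nat \<Rightarrow> expr" where
  "esum g 0 = ECst 0"
| "esum g (Suc k) = EAdd (esum g k) (g k)"

lemma ev_esum: "ev iv Y R P (esum g k) = (\<Sum>l<k. ev iv Y R P (g l))"
  by (induction k) auto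

lemma lower_esum: "(\<And>l. l < k \<Longrightarrow> lower p i (g l)) \<Longrightarrow> lower p i (esum g k)"
  by (induction k) auto

lemma all_inv_esum: "(\<And>l. l < k \<Longrightarrow> all_inv Q (g l)) \<Longrightarrow> all_inv Q (esum g k)"
  by (induction k) auto

definition err_expr :: "nat \<Rightarrow> (nat \<Rightarrow> expr) \<Rightarrow> nat \<Rightarrow> expr" where
  "err_expr i g l = EAdd (EOut i l) (EAdd (EMul (ECst (-1)) (ERef i l)) (g l))"

text \<open>The reciprocal of the gain \<open>k_i\<close>. Like \<open>err_expr\<close> it takes the
  remainder \<open>g\<close> as a parameter, because both occur in the recursion that defines the
  remainder.\<close>

definition margin_expr :: "nat \<Rightarrow> nat \<Rightarrow> (nat \<Rightarrow> expr) \<Rightarrow> expr" where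
  "margin_expr p i g = EAdd (ECst 1) (EMul (ECst (-1)) (EMul (EMul (EPhi i 0) (EPhi i 0))
     (esum (\<lambda>l. EMul (err_expr i g l) (err_expr i g l)) p)))"

text \<open>Since \<open>e\<^sub>i = y\<^sup>(\<^sup>i\<^sup>) - y\<^sub>r\<^sub>e\<^sub>f\<^sup>(\<^sup>i\<^sup>) + \<close> remainder, the remainder involves only output and reference
  derivatives of order below \<open>i\<close>; this is what makes \<open>e\<^sub>i\<close> differentiable along solutions.\<close>
primrec rem_expr :: "nat \<Rightarrow> nat \<Rightarrow> nat \<Rightarrow> expr" where
  "rem_expr p 0 = (\<lambda>l. ECst 0)"
| "rem_expr p (Suc i) = (\<lambda>l. EAdd (ediff (rem_expr p i l))
     (EMul (EInv (margin_expr p i (rem_expr p i))) (err_expr i (rem_expr p i) l)))"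

definition errx :: "nat \<Rightarrow> nat \<Rightarrow> nat \<Rightarrow> expr" where
  "errx p i l = err_expr i (rem_expr p i) l"

definition margx :: "nat \<Rightarrow> nat \<Rightarrow> expr" where
  "margx p i = margin_expr p i (rem_expr p i)"

lemma rem_expr_Suc: "rem_expr p (Suc i) l = EAdd (ediff (rem_expr p i l)) (EMul (EInv (margx p i)) (errx p i l))"
  by (simp add: margx_def errx_def)

declare rem_expr.simps(2) [simp del]

lemma ev_errx: "ev iv Y R P (errx p i l) = Y i l - R i l + ev iv Y R P (rem_expr p i l)"
  by (simp add: errx_def err_expr_def)

lemma ev_ediff_errx: "ev iv Y R P (ediff (errx p i l)) = Y (Suc i) l - R (Suc i) l + ev iv Y R P (ediff (rem_expr p i l))"
  by (simp add: errx_def err_expr_def)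

lemma ev_errx_Suc: "ev iv Y R P (errx p (Suc i) l) = ev iv Y R P (ediff (errx p i l)) + iv (ev iv Y R P (margx p i)) * ev iv Y R P (errx p i l)"
  by (simp add: ev_errx rem_expr_Suc ev_ediff_errx)

lemma ev_margx: "ev iv Y R P (margx p i) = 1 - (P i 0)\<^sup>2 * (\<Sum>l<p. (ev iv Y R P (errx p i l))\<^sup>2)"
  by (simp add: margx_def margin_expr_def ev_esum power2_eq_square flip: errx_def)

lemma lower_err_margin:
  assumes "\<And>l. l < p \<Longrightarrow> lower p i (g l)"
  shows "l < p \<Longrightarrow> lower p (Suc i) (err_expr i g l)" "lower p (Suc i) (margin_expr p i g)"
proof -
  show *: "lower p (Suc i) (err_expr i g l)" if "l < p" for l
    using assms[OF that] that by (auto simp: err_expr_def intro: lower_mono)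
  show "lower p (Suc i) (margin_expr p i g)"
    using * by (auto simp: margin_expr_def intro!: lower_esum)
qed

lemma lower_rem: "l < p \<Longrightarrow> lower p i (rem_expr p i l)"
proof (induction i arbitrary: l)
  case (Suc i)
  then show ?case using lower_err_margin[of p i "rem_expr p i"]
    by (auto simp: rem_expr_Suc margx_def errx_def intro: lower_ediff)
qed simp

lemma lower_errx: "l < p \<Longrightarrow> lower p (Suc i) (errx p i l)"
  and lower_margx: "lower p (Suc i) (margx p i)"
  unfolding errx_def margx_def by (auto intro!: lower_err_margin lower_rem)

text \<open>The only inverses in the remainder of index \<open>i\<close> are the gains of smaller
  index; formal differentiation repeats an inverse but creates no new argument.\<close>

lemma all_inv_rem:
  assumes "\<And>j. j < i \<Longrightarrow> Q (margx p j)"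
  shows "all_inv Q (rem_expr p i l)"
  using assms
proof (induction i arbitrary: l)
  case (Suc i)
  then have *: "all_inv Q (rem_expr p i l)" for l by auto
  then have **: "all_inv Q (errx p i l)" for l by (simp add: errx_def err_expr_def)
  then have "all_inv Q (margx p i)" unfolding margx_def margin_expr_def by (auto intro!: all_inv_esum simp: errx_def)
  then show ?case using Suc.prems * ** by (simp add: rem_expr_Suc all_inv_ediff)
qed simp

lemma all_inv_errx: "(\<And>j. j < i \<Longrightarrow> Q (margx p j)) \<Longrightarrow> all_inv Q (errx p i l)"
  unfolding errx_def err_expr_def using all_inv_rem[of i Q p l] by simp

lemma all_inv_margx: "(\<And>j. j < i \<Longrightarrow> Q (margx p j)) \<Longrightarrow> all_inv Q (margx p i)"
  using all_inv_errx[of i Q p, unfolded errx_def]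
  by (subst margx_def, subst margin_expr_def) (auto intro!: all_inv_esum)

section \<open>Intervals of existence and coordinatewise calculus\<close>

lemma zero_in_tdom: "0 < w \<Longrightarrow> 0 \<in> tdom w"
  by (simp add: tdom_def zero_ereal_def)

lemma tdom_at_nontrivial:
  assumes "t \<in> tdom w"
  shows "at t within tdom w \<noteq> bot"
proof -
  have "\<exists>b>t. {t..b} \<subseteq> tdom w"
  proof (cases w)
    case (real c)
    then have "t < c" using assms by (simp add: tdom_def)
    then show ?thesis using assms real by (intro exI[of _ "(t+c)/2"]) (auto simp: tdom_def)
  next
    case PInf
    then show ?thesis using assms by (intro exI[of _ "t+1"]) (auto simp: tdom_def)
  next
    case MInf then show ?thesis using assms by (simp add: tdom_def)
  qed
  then obtain b where b: "b > t" "{t..b} \<subseteq> tdom w" by blast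
  have "at t within {t..b} \<noteq> bot" using at_within_Icc_at_right[OF b(1)] trivial_limit_at_right_real by simp
  then show ?thesis using at_le[OF b(2), of t] by (metis bot.extremum_uniqueI)
qed

lemma tdom_interior:
  assumes "t \<in> tdom w" "t > 0"
  shows "at t within tdom w = at t"
proof -
  have "open {s. ereal s < w}" using open_vimage[OF open_lessThan continuous_on_ereal[OF continuous_on_id], of w]
    by (simp add: vimage_def lessThan_def)
  then have "open ({0<..} \<inter> {s. ereal s < w})" by (intro open_Int) auto
  moreover have "{0<..} \<inter> {s. ereal s < w} \<subseteq> tdom w" by (auto simp: tdom_def)
  ultimately show ?thesis using assms by (intro at_within_interior) (auto simp: tdom_def interior_def)
qed

lemma vec_has_deriv_iff: "v \<in> carrier_vec n \<Longrightarrow> vec_has_deriv x v F \<longleftrightarrow> (\<forall>i<n. ((\<lambda>s. vec_index (x s) i) has_real_derivative vec_index v i) F)"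
  by (auto simp: vec_has_deriv_def)

lemma vnorm_eq: "v \<in> carrier_vec n \<Longrightarrow> vnorm v = L2_set (vec_index v) {..<n}"
  by (auto simp: vnorm_def L2_set_def)

lemma mult_mat_vec_index:
  fixes M :: "real mat"
  assumes "M \<in> carrier_mat a n" "v \<in> carrier_vec n" "l < a"
  shows "vec_index (M *\<^sub>v v) l = (\<Sum>j<n. M $$ (l,j) * vec_index v j)"
  using assms by (auto simp: scalar_prod_def atLeast0LessThan intro!: sum.cong)

lemma mult_mat_vec_has_derivative:
  fixes M :: "real mat"
  assumes M: "M \<in> carrier_mat a n" and x: "\<And>s. s \<in> I \<Longrightarrow> x s \<in> carrier_vec n" and v: "v \<in> carrier_vec n"
    and d: "\<And>i. i < n \<Longrightarrow> ((\<lambda>s. vec_index (x s) i) has_real_derivative vec_index v i) (at t within I)"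
    and t: "t \<in> I" and l: "l < a"
  shows "((\<lambda>s. vec_index (M *\<^sub>v x s) l) has_real_derivative vec_index (M *\<^sub>v v) l) (at t within I)"
proof -
  have "((\<lambda>s. \<Sum>j<n. M $$ (l,j) * vec_index (x s) j) has_real_derivative (\<Sum>j<n. M $$ (l,j) * vec_index v j)) (at t within I)"
    using d by (auto intro!: derivative_eq_intros sum.cong)
  then show ?thesis unfolding mult_mat_vec_index[OF M v l] has_field_derivative_def
    by (rule has_derivative_transform[OF t, rotated]) (simp add: mult_mat_vec_index[OF M x l])
qed

lemma tendsto_mult_mat_vec:
  fixes M' :: "'a \<Rightarrow> real mat"
  assumes M: "\<And>s. M' s \<in> carrier_mat a n" "M0 \<in> carrier_mat a n" and x: "\<And>s. x s \<in> carrier_vec n" "x0 \<in> carrier_vec n"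
    and t: "\<And>j. j < n \<Longrightarrow> ((\<lambda>s. M' s $$ (l,j)) \<longlongrightarrow> M0 $$ (l,j)) F" "\<And>j. j < n \<Longrightarrow> ((\<lambda>s. vec_index (x s) j) \<longlongrightarrow> vec_index x0 j) F"
    and l: "l < a"
  shows "((\<lambda>s. vec_index (M' s *\<^sub>v x s) l) \<longlongrightarrow> vec_index (M0 *\<^sub>v x0) l) F"
  unfolding mult_mat_vec_index[OF M(1) x(1) l] mult_mat_vec_index[OF M(2) x(2) l]
  using t by (intro tendsto_intros) auto

lemma abs_le_vnorm: "v \<in> carrier_vec n \<Longrightarrow> i < n \<Longrightarrow> \<bar>vec_index v i\<bar> \<le> vnorm v"
  unfolding vnorm_eq L2_set_def real_sqrt_abs[symmetric] by (intro real_sqrt_le_mono member_le_sum) auto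

lemma vfun_continuous_tendsto:
  assumes f: "vfun_continuous n m f" and dim: "\<And>t x u. x \<in> carrier_vec n \<Longrightarrow> u \<in> carrier_vec m \<Longrightarrow> f t x u \<in> carrier_vec n"
    and X: "\<And>s. X s \<in> carrier_vec n" "x \<in> carrier_vec n" "\<And>i. i < n \<Longrightarrow> ((\<lambda>s. vec_index (X s) i) \<longlongrightarrow> vec_index x i) F"
    and U: "\<And>s. U s \<in> carrier_vec m" "u \<in> carrier_vec m" "\<And>i. i < m \<Longrightarrow> ((\<lambda>s. vec_index (U s) i) \<longlongrightarrow> vec_index u i) F"
    and \<tau>: "(\<tau> \<longlongrightarrow> t) F" and i: "i < n"
  shows "((\<lambda>s. vec_index (f (\<tau> s) (X s) (U s)) i) \<longlongrightarrow> vec_index (f t x u) i) F"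
proof (rule tendstoI)
  fix e :: real assume e: "e > 0"
  have "\<exists>\<delta>>0. \<forall>t' x' u'. x' \<in> carrier_vec n \<and> u' \<in> carrier_vec m \<and> \<bar>t' - t\<bar> < \<delta>
        \<and> vnorm (x' - x) < \<delta> \<and> vnorm (u' - u) < \<delta> \<longrightarrow> vnorm (f t' x' u' - f t x u) < e"
    using f X(2) U(2) e unfolding vfun_continuous_def by blast
  then obtain \<delta> where \<delta>: "\<delta> > 0" "\<And>t' x' u'. x' \<in> carrier_vec n \<Longrightarrow> u' \<in> carrier_vec m \<Longrightarrow> \<bar>t' - t\<bar> < \<delta> \<Longrightarrow>
      vnorm (x' - x) < \<delta> \<Longrightarrow> vnorm (u' - u) < \<delta> \<Longrightarrow> vnorm (f t' x' u' - f t x u) < e"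
    by blast
  have norm0: "((\<lambda>s. vnorm (Z s - z)) \<longlongrightarrow> 0) F"
    if "\<And>s. Z s \<in> carrier_vec k" "z \<in> carrier_vec k" "\<And>i. i < k \<Longrightarrow> ((\<lambda>s. vec_index (Z s) i) \<longlongrightarrow> vec_index z i) F" for k and Z :: "'a \<Rightarrow> real vec" and z
  proof -
    have "((\<lambda>s. sqrt (\<Sum>i<k. (vec_index (Z s) i - vec_index z i)\<^sup>2)) \<longlongrightarrow> sqrt (\<Sum>i<k. (vec_index z i - vec_index z i)\<^sup>2)) F"
      using that(3) by (intro tendsto_intros) auto
    moreover have "vnorm (Z s - z) = sqrt (\<Sum>i<k. (vec_index (Z s) i - vec_index z i)\<^sup>2)" for s
      unfolding vnorm_def using that(1)[of s] that(2) by (auto intro!: sum.cong)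
    ultimately show ?thesis by simp
  qed
  have "eventually (\<lambda>s. \<bar>\<tau> s - t\<bar> < \<delta>) F" using tendstoD[OF \<tau> \<delta>(1)] by (simp add: dist_real_def)
  moreover have "eventually (\<lambda>s. vnorm (X s - x) < \<delta>) F" using order_tendstoD(2)[OF norm0[OF X] \<delta>(1)] .
  moreover have "eventually (\<lambda>s. vnorm (U s - u) < \<delta>) F" using order_tendstoD(2)[OF norm0[OF U] \<delta>(1)] .
  ultimately show "eventually (\<lambda>s. dist (vec_index (f (\<tau> s) (X s) (U s)) i) (vec_index (f t x u) i) < e) F"
  proof eventually_elim
    case (elim s)
    have fd: "f (\<tau> s) (X s) (U s) \<in> carrier_vec n" "f t x u \<in> carrier_vec n" using dim X U by auto
    have "\<bar>vec_index (f (\<tau> s) (X s) (U s) - f t x u) i\<bar> \<le> vnorm (f (\<tau> s) (X s) (U s) - f t x u)"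
      using fd i by (intro abs_le_vnorm) auto
    also have "\<dots> < e" using \<delta>(2)[OF X(1) U(1)] elim by auto
    finally show ?case using fd i by (simp add: dist_real_def)
  qed
qed

lemma lipschitz_imp_abs_cont_on:
  assumes lip: "\<And>s t. s \<in> S \<Longrightarrow> t \<in> S \<Longrightarrow> \<bar>g s - g t\<bar> \<le> c * \<bar>s - t\<bar>"
  shows "abs_cont_on S g"
  unfolding abs_cont_on_def
proof (intro allI impI)
  fix e :: real assume e: "e > 0"
  define c' where "c' = max c 0 + 1"
  have c': "c' > 0" "c \<le> c'" by (auto simp: c'_def)
  show "\<exists>\<delta>>0. \<forall>(k::nat) (a::nat \<Rightarrow> real) b. (\<forall>i<k. a i \<le> b i \<and> {a i..b i} \<subseteq> S) \<and> (\<forall>i<k. \<forall>j<k. i \<noteq> j \<longrightarrow> b i \<le> a j \<or> b j \<le> a i)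
      \<and> (\<Sum>i<k. b i - a i) < \<delta> \<longrightarrow> (\<Sum>i<k. \<bar>g (b i) - g (a i)\<bar>) < e"
  proof (intro exI[of _ "e / c'"] conjI allI impI)
    show "e / c' > 0" using e c' by simp
    fix k :: nat and a b :: "nat \<Rightarrow> real"
    assume "(\<forall>i<k. a i \<le> b i \<and> {a i..b i} \<subseteq> S) \<and> (\<forall>i<k. \<forall>j<k. i \<noteq> j \<longrightarrow> b i \<le> a j \<or> b j \<le> a i)
      \<and> (\<Sum>i<k. b i - a i) < e / c'"
    then have ab: "\<forall>i<k. a i \<le> b i \<and> {a i..b i} \<subseteq> S" and s: "(\<Sum>i<k. b i - a i) < e / c'" by auto
    have "(\<Sum>i<k. \<bar>g (b i) - g (a i)\<bar>) \<le> (\<Sum>i<k. c' * (b i - a i))"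
    proof (rule sum_mono)
      fix i assume "i \<in> {..<k}"
      then have i: "a i \<le> b i" "{a i..b i} \<subseteq> S" using ab by auto
      then have "\<bar>g (b i) - g (a i)\<bar> \<le> c * \<bar>b i - a i\<bar>" by (intro lip) auto
      also have "\<dots> \<le> c' * \<bar>b i - a i\<bar>" using c' by (intro mult_right_mono) auto
      finally show "\<bar>g (b i) - g (a i)\<bar> \<le> c' * (b i - a i)" using i by simp
    qed
    also have "\<dots> = c' * (\<Sum>i<k. b i - a i)" by (simp add: sum_distrib_left)
    also have "\<dots> < c' * (e / c')" using s c' by (intro mult_strict_left_mono) auto
    finally show "(\<Sum>i<k. \<bar>g (b i) - g (a i)\<bar>) < e" using c' by simp
  qed
qed

section \<open>The closed loop as an ordinary differential equation\<close>

lemma uniform_bound_finite: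
  fixes g :: "'i \<Rightarrow> 'a \<Rightarrow> real"
  assumes "finite I" "\<And>i. i \<in> I \<Longrightarrow> \<exists>c. \<forall>t\<in>S. \<bar>g i t\<bar> \<le> c"
  shows "\<exists>c. \<forall>i\<in>I. \<forall>t\<in>S. \<bar>g i t\<bar> \<le> c"
  using assms
proof (induction I rule: finite_induct)
  case (insert j I)
  then obtain c1 c2 where "\<forall>i\<in>I. \<forall>t\<in>S. \<bar>g i t\<bar> \<le> c1" "\<forall>t\<in>S. \<bar>g j t\<bar> \<le> c2" by blast
  then show ?case by (intro exI[of _ "max c1 c2"]) (auto simp: le_max_iff_disj)
qed simp

lemma hderiv_has_derivative:
  assumes "hderiv S k g differentiable (at t within S)"
  shows "(hderiv S k g has_real_derivative hderiv S (Suc k) g t) (at t within S)"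
  using assms by (simp add: has_real_derivative_iff_has_vector_derivative vector_derivative_works)

lemma tdom_subinterval:
  assumes "t \<in> tdom w"
  obtains b where "b > t" "b \<in> tdom w" "{0..b} \<subseteq> tdom w"
proof -
  have "\<exists>b>t. b \<in> tdom w"
  proof (cases w)
    case (real c)
    then have "t < c" using assms by (simp add: tdom_def)
    then show ?thesis using assms real by (intro exI[of _ "(t+c)/2"]) (auto simp: tdom_def)
  next
    case PInf
    then show ?thesis using assms by (intro exI[of _ "t+1"]) (auto simp: tdom_def)
  next
    case MInf then show ?thesis using assms by (simp add: tdom_def)
  qed
  then obtain b where b: "b > t" "b \<in> tdom w" by blast
  have sub: "s \<in> tdom w" if "0 \<le> s" "s \<le> b" for s
  proof -
    have "ereal s \<le> ereal b" using that by simp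
    also have "\<dots> < w" using b by (simp add: tdom_def)
    finally show ?thesis using that by (simp add: tdom_def)
  qed
  show ?thesis by (rule that[OF b]) (use sub in auto)
qed

lemma at_within_tdom:
  assumes "t < b" "0 \<le> t" "{0..b} \<subseteq> tdom w"
  shows "at t within tdom w = at t within {0..b}"
proof (rule at_within_nhd[of _ "{..<b}"])
  show "tdom w \<inter> {..<b} - {t} = {0..b} \<inter> {..<b} - {t}"
    using assms(3) by (auto simp: tdom_def)
qed (use assms in auto)

text \<open>The integral identity alone gives continuity of \<open>g\<close>; differentiability
  follows once the integrand is continuous. The two parts are separate because continuity of the
  state is used to prove continuity of the integrand.\<close>

lemma tdom_integral_has_derivative:
  assumes int: "\<And>t. t \<in> tdom w \<Longrightarrow> (h has_integral g t - g 0) {0..t}" and t: "t \<in> tdom w"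
  shows "continuous (at t within tdom w) g"
    and "continuous_on (tdom w) h \<Longrightarrow> (g has_real_derivative h t) (at t within tdom w)"
proof -
  obtain b where b: "b > t" "b \<in> tdom w" "{0..b} \<subseteq> tdom w" using tdom_subinterval[OF t] .
  have t0: "0 \<le> t" using t by (simp add: tdom_def)
  have gi: "g s = g 0 + integral {0..s} h" if "s \<in> {0..b}" for s
    using integral_unique[OF int[of s]] that b by auto
  have eq: "at t within tdom w = at t within {0..b}" using at_within_tdom[OF b(1) t0 b(3)] .
  have tb: "t \<in> {0..b}" using t0 b by auto
  have "h integrable_on {0..b}" using int[OF b(2)] by blast
  from indefinite_integral_continuous_1[OF this]
  have "continuous_on {0..b} (\<lambda>s. g 0 + integral {0..s} h)" by (intro continuous_intros)
  then have "continuous_on {0..b} g" by (rule continuous_on_eq) (rule gi[symmetric])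
  then show "continuous (at t within tdom w) g" using tb unfolding eq by (simp add: continuous_on_eq_continuous_within)
  assume "continuous_on (tdom w) h"
  then have "continuous_on {0..b} h" using b(3) by (rule continuous_on_subset)
  from integral_has_real_derivative[OF this tb]
  have "((\<lambda>s. g 0 + integral {0..s} h) has_real_derivative h t) (at t within {0..b})"
    by (auto intro!: derivative_eq_intros)
  then show "(g has_real_derivative h t) (at t within tdom w)"
    unfolding eq has_field_derivative_def by (rule has_derivative_transform[OF tb, rotated]) (rule gi)
qed

locale funnel_system =
  fixes n m p r :: nat
    and A B C V :: "real mat" and x0 :: "real vec"
    and f :: "real \<Rightarrow> real vec \<Rightarrow> real vec \<Rightarrow> real vec"
    and L K :: "real \<Rightarrow> real mat"
    and yref :: "real \<Rightarrow> real vec"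
    and \<phi> :: "nat \<Rightarrow> real \<Rightarrow> real"
    and \<alpha> :: real
  assumes dims: "A \<in> carrier_mat n n" "B \<in> carrier_mat n m" "C \<in> carrier_mat p n" "x0 \<in> carrier_vec n"
    and f_dim: "\<And>t x u. x \<in> carrier_vec n \<Longrightarrow> u \<in> carrier_vec m \<Longrightarrow> f t x u \<in> carrier_vec n"
    and f_cont: "vfun_continuous n m f"
    and f_bdd: "\<exists>c. \<forall>t x u. x \<in> carrier_vec n \<longrightarrow> u \<in> carrier_vec m \<longrightarrow> vnorm (f t x u) \<le> c"
    and L_smooth: "smooth_matfun m m L"
    and L_bdd: "\<And>i j. i < m \<Longrightarrow> j < m \<Longrightarrow> \<exists>c. \<forall>t. \<bar>L t $$ (i,j)\<bar> \<le> c"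
    and r_pos: "r \<ge> 1"
    and P2_BL: "\<And>k t. k + 2 \<le> r \<Longrightarrow> C * A ^\<^sub>m k * (B * L t) = 0\<^sub>m p m"
    and P2_f: "\<And>k t x u. k + 2 \<le> r \<Longrightarrow> x \<in> carrier_vec n \<Longrightarrow> u \<in> carrier_vec m
                  \<Longrightarrow> (C * A ^\<^sub>m k) *\<^sub>v f t x u = 0\<^sub>v p"
    and V_dim: "V \<in> carrier_mat n (n - p * r)"
    and V_im: "{V *\<^sub>v v | v. v \<in> carrier_vec (n - p * r)} = mat_kernel (calC p n r A C)"
    and P3: "lyapunov_transformation n (calU n m p r A B C V L)"
    and P4: "unif_exp_stable (n - p * r) (Qfun n m p r A B C V L)"
    and yref_W: "W_inf r p yref"
    and phi_Phi: "\<And>i. i < r \<Longrightarrow> \<phi> i \<in> Phi (r - i)"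
    and K_smooth: "smooth_matfun m p K"
    and K_bdd: "mat_bounded K UNIV"
    and alpha_pos: "\<alpha> > 0"
    and K_pos: "\<And>t v. v \<in> carrier_vec p \<Longrightarrow>
        scalar_prod v ((C * A ^\<^sub>m (r - 1) * B * L t * K t + transpose_mat (C * A ^\<^sub>m (r - 1) * B * L t * K t)
                        - \<alpha> \<cdot>\<^sub>m 1\<^sub>m p) *\<^sub>v v) \<ge> 0"
    and K_N: "\<And>t. Nfun n m p r A B C V L t * K t = 0\<^sub>m (n - p * r) p"
begin

section \<open>Regularity and bounds of reference and funnel functions\<close>

definition Rt :: "real \<Rightarrow> nat \<Rightarrow> nat \<Rightarrow> real" where
  "Rt t k l = hderiv {0..} k (\<lambda>s. vec_index (yref s) l) t"

definition Pt :: "real \<Rightarrow> nat \<Rightarrow> nat \<Rightarrow> real" where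
  "Pt t i k = hderiv {0..} k (\<phi> i) t"

lemma yref_dim: "t \<ge> 0 \<Longrightarrow> yref t \<in> carrier_vec p"
  using yref_W by (simp add: W_inf_def)

lemma Rt_0: "Rt t 0 l = vec_index (yref t) l"
  by (simp add: Rt_def)

lemma Pt_0: "Pt t i 0 = \<phi> i t"
  by (simp add: Pt_def)

lemma Rt_deriv:
  assumes "0 \<le> t" "Suc k < r" "l < p"
  shows "((\<lambda>s. Rt s k l) has_real_derivative Rt t (Suc k) l) (at t within {0..})"
proof -
  have "hderiv {0..} k (\<lambda>s. vec_index (yref s) l) differentiable (at t within {0..})"
    using yref_W assms unfolding W_inf_def by auto
  from hderiv_has_derivative[OF this] show ?thesis by (simp add: Rt_def)
qed

lemma Pt_deriv:
  assumes "0 \<le> t" "j + k < r"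
  shows "((\<lambda>s. Pt s j k) has_real_derivative Pt t j (Suc k)) (at t within {0..})"
proof -
  have "hderiv {0..} k (\<phi> j) differentiable (at t within {0..})"
    using phi_Phi[of j] assms unfolding Phi_def by auto
  from hderiv_has_derivative[OF this] show ?thesis by (simp add: Pt_def)
qed

lemma Rt_lipschitz: "\<exists>c\<ge>0. \<forall>s\<ge>0. \<forall>t\<ge>0. \<forall>l<p. \<bar>Rt s (r - 1) l - Rt t (r - 1) l\<bar> \<le> c * \<bar>s - t\<bar>"
proof -
  have "\<forall>l. \<exists>c. l < p \<longrightarrow> c-lipschitz_on {0..} (\<lambda>t. Rt t (r - 1) l)"
    using yref_W unfolding W_inf_def Rt_def by blast
  then obtain c where lip: "\<forall>l. l < p \<longrightarrow> (c l)-lipschitz_on {0..} (\<lambda>t. Rt t (r - 1) l)"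
    by (elim choice[THEN exE])
  have c: "\<bar>Rt s (r - 1) l - Rt t (r - 1) l\<bar> \<le> c l * \<bar>s - t\<bar>" if "l < p" "0 \<le> s" "0 \<le> t" for l s t
    using lipschitz_onD[OF lip[rule_format, OF that(1)], of s t] that by (simp add: dist_real_def)
  show ?thesis
  proof (intro exI[of _ "\<Sum>l<p. \<bar>c l\<bar>"] conjI allI impI)
    show "(\<Sum>l<p. \<bar>c l\<bar>) \<ge> 0" by (intro sum_nonneg) auto
    fix s t :: real and l assume st: "0 \<le> s" "0 \<le> t" "l < p"
    have "\<bar>c l\<bar> \<le> (\<Sum>l<p. \<bar>c l\<bar>)" using st by (intro member_le_sum) auto
    then have "c l * \<bar>s - t\<bar> \<le> (\<Sum>l<p. \<bar>c l\<bar>) * \<bar>s - t\<bar>" by (intro mult_right_mono) auto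
    then show "\<bar>Rt s (r - 1) l - Rt t (r - 1) l\<bar> \<le> (\<Sum>l<p. \<bar>c l\<bar>) * \<bar>s - t\<bar>" using c[OF st(3,1,2)] by linarith
  qed
qed

lemma Rt_cont:
  assumes "k < r" "l < p"
  shows "continuous_on {0..} (\<lambda>t. Rt t k l)"
proof (cases "Suc k < r")
  case True
  then show ?thesis by (intro DERIV_continuous_on[OF Rt_deriv[OF _ True assms(2)]]) auto
next
  case False
  then have k: "k = r - 1" using assms by simp
  obtain c where c: "c \<ge> 0" "\<And>s t. s \<ge> 0 \<Longrightarrow> t \<ge> 0 \<Longrightarrow> \<bar>Rt s (r - 1) l - Rt t (r - 1) l\<bar> \<le> c * \<bar>s - t\<bar>"
    using Rt_lipschitz assms(2) by blast
  have "c-lipschitz_on {0..} (\<lambda>t. Rt t k l)" unfolding k using c by (intro lipschitz_onI) (auto simp: dist_real_def)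
  then show ?thesis by (rule lipschitz_on_continuous_on)
qed

lemma Pt_cont: "j + k < r \<Longrightarrow> continuous_on {0..} (\<lambda>t. Pt t j k)"
  by (rule DERIV_continuous_on[OF Pt_deriv]) auto

lemma Rt_bdd: "\<exists>c. \<forall>t\<ge>0. \<forall>k<r. \<forall>l<p. \<bar>Rt t k l\<bar> \<le> c"
proof -
  have "\<exists>c. \<forall>z\<in>{..<r} \<times> {..<p}. \<forall>t\<in>{0..}. \<bar>Rt t (fst z) (snd z)\<bar> \<le> c"
  proof (rule uniform_bound_finite)
    fix z assume "z \<in> {..<r} \<times> {..<p}"
    then have "\<exists>c. \<forall>t\<ge>0. \<bar>Rt t (fst z) (snd z)\<bar> \<le> c"
      using yref_W unfolding W_inf_def Rt_def by auto
    then show "\<exists>c. \<forall>t\<in>{0..}. \<bar>Rt t (fst z) (snd z)\<bar> \<le> c" by (simp only: Ball_def atLeast_iff)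
  qed simp
  then obtain c where c: "\<forall>z\<in>{..<r} \<times> {..<p}. \<forall>t\<in>{0..}. \<bar>Rt t (fst z) (snd z)\<bar> \<le> c" by blast
  then have "\<bar>Rt t k l\<bar> \<le> c" if "t \<ge> 0" "k < r" "l < p" for t k l
    using c[THEN bspec, of "(k,l)"] that by simp
  then show ?thesis by blast
qed

lemma Pt_bdd: "\<exists>c. \<forall>t\<ge>0. \<forall>j<r. \<forall>k. j + k \<le> r \<longrightarrow> \<bar>Pt t j k\<bar> \<le> c"
proof -
  have "\<exists>c. \<forall>z\<in>{(j,k). j < r \<and> j + k \<le> r}. \<forall>t\<in>{0..}. \<bar>Pt t (fst z) (snd z)\<bar> \<le> c"
  proof (rule uniform_bound_finite)
    show "finite {(j,k). j < r \<and> j + k \<le> r}"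
      by (rule finite_subset[of _ "{..r} \<times> {..r}"]) auto
    fix z assume "z \<in> {(j,k). j < r \<and> j + k \<le> r}"
    then have z: "fst z < r" "snd z \<le> r - fst z" by auto
    then have "\<exists>c. \<forall>t\<ge>0. \<bar>Pt t (fst z) (snd z)\<bar> \<le> c"
      using phi_Phi[OF z(1)] unfolding Phi_def Pt_def by blast
    then show "\<exists>c. \<forall>t\<in>{0..}. \<bar>Pt t (fst z) (snd z)\<bar> \<le> c" by (simp only: Ball_def atLeast_iff)
  qed
  then obtain c where c: "\<forall>z\<in>{(j,k). j < r \<and> j + k \<le> r}. \<forall>t\<in>{0..}. \<bar>Pt t (fst z) (snd z)\<bar> \<le> c" by blast
  then have "\<bar>Pt t j k\<bar> \<le> c" if "t \<ge> 0" "j < r" "j + k \<le> r" for t j k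
    using c[THEN bspec, of "(j,k)"] that by simp
  then show ?thesis by blast
qed

lemma phi_pos: "i < r \<Longrightarrow> t > 0 \<Longrightarrow> \<phi> i t > 0"
  using phi_Phi by (auto simp: Phi_def)

lemma phi_cont: "i < r \<Longrightarrow> continuous_on {0..} (\<phi> i)"
  using Pt_cont[of i 0] by (simp add: Pt_0)

text \<open>Positivity is assumed for positive times only; at 0 the sign comes from continuity from
  the right.\<close>

lemma phi_nonneg:
  assumes "i < r" "t \<ge> 0"
  shows "\<phi> i t \<ge> 0"
proof (cases "t = 0")
  case True
  have "((\<lambda>t. \<phi> i t) \<longlongrightarrow> \<phi> i 0) (at 0 within {0..})" using phi_cont[OF assms(1)] by (simp add: continuous_on_def)
  then have "(\<phi> i \<longlongrightarrow> \<phi> i 0) (at_right 0)" by (rule tendsto_within_subset) auto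
  moreover have "eventually (\<lambda>t. 0 \<le> \<phi> i t) (at_right 0)"
    using phi_pos[OF assms(1)] by (auto simp: eventually_at_filter intro!: always_eventually less_imp_le)
  ultimately show ?thesis using True tendsto_lowerbound by fastforce
qed (use phi_pos[OF assms(1)] assms(2) in \<open>auto intro: less_imp_le\<close>)

text \<open>The bound must start at a positive time, as \<phi>_i(0) may be 0. The lower limit at
  infinity covers late times, compactness the bounded rest.\<close>

lemma phi_lower:
  assumes "T > 0"
  shows "\<exists>lam>0. \<forall>t\<ge>T. \<forall>i<r. lam \<le> \<phi> i t"
proof -
  have one: "\<exists>lam>0. \<forall>t\<ge>T. lam \<le> \<phi> i t" if i: "i < r" for i
  proof -
    have "0 < Liminf at_top (\<lambda>\<tau>. ereal (\<phi> i \<tau>))" using phi_Phi[OF i] by (simp add: Phi_def)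
    then obtain c where c: "0 < ereal c" "ereal c < Liminf at_top (\<lambda>\<tau>. ereal (\<phi> i \<tau>))" using ereal_dense2 by blast
    then have "eventually (\<lambda>\<tau>. c < \<phi> i \<tau>) at_top" using less_LiminfD by fastforce
    then obtain t1 where t1: "\<And>t. t \<ge> t1 \<Longrightarrow> c < \<phi> i t" by (auto simp: eventually_at_top_linorder)
    define t2 where "t2 = max t1 T"
    have "continuous_on {T..t2} (\<phi> i)" using phi_cont[OF i] assms by (auto intro: continuous_on_subset)
    then obtain s where s: "s \<in> {T..t2}" "\<And>t. t \<in> {T..t2} \<Longrightarrow> \<phi> i s \<le> \<phi> i t"
      using continuous_attains_inf[of "{T..t2}" "\<phi> i"] by (auto simp: t2_def)
    have "\<phi> i s > 0" using s assms phi_pos[OF i] by auto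
    moreover have "min c (\<phi> i s) \<le> \<phi> i t" if "t \<ge> T" for t
    proof (cases "t \<le> t2")
      case True
      then show ?thesis using s(2)[of t] that by (simp add: min.coboundedI2)
    next
      case False
      then have "c < \<phi> i t" using t1[of t] by (simp add: t2_def)
      then show ?thesis by (simp add: min.coboundedI1)
    qed
    ultimately show ?thesis using c by (intro exI[of _ "min c (\<phi> i s)"]) auto
  qed
  then obtain lam where lam: "\<And>i. i < r \<Longrightarrow> lam i > 0" "\<And>i t. i < r \<Longrightarrow> t \<ge> T \<Longrightarrow> lam i \<le> \<phi> i t" by metis
  show ?thesis
  proof (intro exI[of _ "Min (lam ` {..<r})"] conjI allI impI)
    have ne: "lam ` {..<r} \<noteq> {}" using r_pos by (auto simp: lessThan_empty_iff)
    show "Min (lam ` {..<r}) > 0" using lam(1) ne by (subst Min_gr_iff) auto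
    fix t i assume "T \<le> t" "i < r"
    moreover from this have "Min (lam ` {..<r}) \<le> lam i" by (intro Min_le) auto
    ultimately show "Min (lam ` {..<r}) \<le> \<phi> i t" using lam(2)[of i t] by linarith
  qed
qed

lemma CA_dim: "C * A ^\<^sub>m k \<in> carrier_mat p n"
  using dims by auto

lemma L_dim: "L t \<in> carrier_mat m m" and K_dim: "K t \<in> carrier_mat m p"
  using L_smooth K_smooth by (auto simp: smooth_matfun_def)

lemma BL_dim: "B * L t \<in> carrier_mat n m"
  by (rule mult_carrier_mat[OF dims(2) L_dim])

lemma smooth_matfun_cont: "smooth_matfun a b M \<Longrightarrow> i < a \<Longrightarrow> j < b \<Longrightarrow> isCont (\<lambda>t. M t $$ (i,j)) t"
proof -
  assume "smooth_matfun a b M" "i < a" "j < b"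
  then have "((deriv ^^ 0) (\<lambda>t. M t $$ (i,j))) differentiable (at t)"
    unfolding smooth_matfun_def smooth_fun_def by blast
  then show ?thesis using differentiable_imp_continuous_within by force
qed

lemma BL_index: "i < n \<Longrightarrow> j < m \<Longrightarrow> (B * L t) $$ (i,j) = (\<Sum>k<m. B $$ (i,k) * L t $$ (k,j))"
  using dims L_dim[of t] by (auto simp: scalar_prod_def atLeast0LessThan intro!: sum.cong)

lemma BL_cont:
  assumes "i < n" "j < m"
  shows "isCont (\<lambda>t. (B * L t) $$ (i,j)) t"
proof -
  have "isCont (\<lambda>t. \<Sum>k<m. B $$ (i,k) * L t $$ (k,j)) t"
    by (intro continuous_intros smooth_matfun_cont[OF L_smooth]) (use assms in auto)
  then show ?thesis unfolding BL_index[OF assms] .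
qed

section \<open>Errors and right-hand side as functions of time and state\<close>

definition outd :: "real vec \<Rightarrow> nat \<Rightarrow> nat \<Rightarrow> real" where
  "outd x k l = vec_index (C * A ^\<^sub>m k *\<^sub>v x) l"

definition evx :: "(real \<Rightarrow> real) \<Rightarrow> real \<Rightarrow> real vec \<Rightarrow> expr \<Rightarrow> real" where
  "evx iv t x e = ev iv (outd x) (Rt t) (Pt t) e"

text \<open>\<open>Er\<close>, \<open>mg\<close>, \<open>Uc\<close>, \<open>Gc\<close> are \<open>e_i\<close>, \<open>1 - \<phi>_i\<^sup>2\<parallel>e_i\<parallel>\<^sup>2\<close>, \<open>u\<close> and the right-hand side of the closed loop as
  functions of \<open>(t,x)\<close>, with \<open>iv\<close> in place of the inverse in the gains.\<close>
definition Er :: "(real \<Rightarrow> real) \<Rightarrow> real \<Rightarrow> real vec \<Rightarrow> nat \<Rightarrow> real vec" where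
  "Er iv t x i = vec p (\<lambda>l. evx iv t x (errx p i l))"

definition mg :: "(real \<Rightarrow> real) \<Rightarrow> real \<Rightarrow> real vec \<Rightarrow> nat \<Rightarrow> real" where
  "mg iv t x i = evx iv t x (margx p i)"

definition Uc :: "(real \<Rightarrow> real) \<Rightarrow> real \<Rightarrow> real vec \<Rightarrow> real vec" where
  "Uc iv t x = (- iv (mg iv t x (r - 1))) \<cdot>\<^sub>v (K t *\<^sub>v Er iv t x (r - 1))"

definition Gc :: "(real \<Rightarrow> real) \<Rightarrow> real \<Rightarrow> real vec \<Rightarrow> real vec" where
  "Gc iv t x = A *\<^sub>v x + (B * L t) *\<^sub>v Uc iv t x + f t x (Uc iv t x)"

text \<open>The classical counterpart of \<open>cl_solution\<close> on an arbitrary interval: no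
  recursion through time derivatives of errors, and the domain condition is positivity of the
  margins. On \<open>tdom w\<close>, with the initial value, the two notions agree.\<close>

definition sol :: "real set \<Rightarrow> (real \<Rightarrow> real vec) \<Rightarrow> bool" where
  "sol I x \<longleftrightarrow> (\<forall>t\<in>I. x t \<in> carrier_vec n)
    \<and> (\<forall>t\<in>I. \<forall>i<n. ((\<lambda>s. vec_index (x s) i) has_real_derivative vec_index (Gc inverse t (x t)) i) (at t within I))
    \<and> (\<forall>t\<in>I. \<forall>i<r. mg inverse t (x t) i > 0)"

lemma Er_dim: "Er iv t x i \<in> carrier_vec p" by (simp add: Er_def)

lemma Uc_dim: "Uc iv t x \<in> carrier_vec m"
  unfolding Uc_def by (intro smult_carrier_vec[THEN iffD2] mult_mat_vec_carrier[OF K_dim Er_dim])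

lemma mg_eq: "mg iv t x i = 1 - (\<phi> i t)\<^sup>2 * (vnorm (Er iv t x i))\<^sup>2"
proof -
  have "(vnorm (Er iv t x i))\<^sup>2 = (\<Sum>l<p. (evx iv t x (errx p i l))\<^sup>2)"
    by (simp add: vnorm_def Er_def sum_nonneg)
  then show ?thesis by (simp add: mg_def evx_def ev_margx Pt_0)
qed

lemma Gc_dim: "x \<in> carrier_vec n \<Longrightarrow> Gc iv t x \<in> carrier_vec n"
  unfolding Gc_def
  by (intro add_carrier_vec mult_mat_vec_carrier[OF dims(1)] mult_mat_vec_carrier[OF BL_dim Uc_dim] f_dim[OF _ Uc_dim])

lemma Gc_index:
  assumes "x \<in> carrier_vec n" "i < n"
  shows "vec_index (Gc iv t x) i = vec_index (A *\<^sub>v x) i + vec_index ((B * L t) *\<^sub>v Uc iv t x) i + vec_index (f t x (Uc iv t x)) i"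
proof -
  have "dim_vec (f t x (Uc iv t x)) = n" "dim_vec ((B * L t) *\<^sub>v Uc iv t x) = n"
    using f_dim[OF assms(1) Uc_dim] mult_mat_vec_carrier[OF BL_dim Uc_dim] carrier_vecD by blast+
  then show ?thesis unfolding Gc_def using assms(2) by (simp del: index_mult_mat_vec)
qed

lemma outd_tendsto:
  assumes "\<And>s. X s \<in> carrier_vec n" "x \<in> carrier_vec n" "\<And>i. i < n \<Longrightarrow> ((\<lambda>s. vec_index (X s) i) \<longlongrightarrow> vec_index x i) F" "l < p"
  shows "((\<lambda>s. outd (X s) k l) \<longlongrightarrow> outd x k l) F"
  unfolding outd_def by (rule tendsto_mult_mat_vec[where M' = "\<lambda>_. C * A ^\<^sub>m k", OF CA_dim CA_dim assms(1,2) tendsto_const assms(3,4)])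

text \<open>Sequential continuity is the form that \<open>peano_existence\<close> demands, and times
  are kept nonnegative because reference and funnel data are continuous on the half-line
  only.\<close>

lemma evx_tendsto:
  fixes \<tau> :: "nat \<Rightarrow> real"
  assumes X: "\<And>s. X s \<in> carrier_vec n" "x \<in> carrier_vec n" "\<And>i. i < n \<Longrightarrow> (\<lambda>s. vec_index (X s) i) \<longlonglongrightarrow> vec_index x i"
    and \<tau>: "\<And>s. 0 \<le> \<tau> s" "\<tau> \<longlonglongrightarrow> t"
    and e: "lower p r e" "all_inv (\<lambda>a. isCont iv (evx iv t x a)) e"
  shows "(\<lambda>s. evx iv (\<tau> s) (X s) e) \<longlonglongrightarrow> evx iv t x e"
  unfolding evx_def
proof (rule ev_tendsto[where i = r and p = p])
  have t0: "0 \<le> t" by (rule LIMSEQ_le_const[OF \<tau>(2)]) (use \<tau>(1) in auto)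
  show "(\<lambda>s. outd (X s) k l) \<longlonglongrightarrow> outd x k l" if "k < r" "l < p" for k l using outd_tendsto[OF X that(2)] .
  show "(\<lambda>s. Rt (\<tau> s) k l) \<longlonglongrightarrow> Rt t k l" if "k < r" "l < p" for k l
    by (rule continuous_on_tendsto_compose[OF Rt_cont[OF that] \<tau>(2)]) (use t0 \<tau>(1) in auto)
  show "(\<lambda>s. Pt (\<tau> s) j k) \<longlonglongrightarrow> Pt t j k" if "j + k < r" for j k
    by (rule continuous_on_tendsto_compose[OF Pt_cont[OF that] \<tau>(2)]) (use t0 \<tau>(1) in auto)
qed (use e in \<open>auto simp: evx_def\<close>)

lemma mg_tendsto:
  fixes \<tau> :: "nat \<Rightarrow> real"
  assumes X: "\<And>s. X s \<in> carrier_vec n" "x \<in> carrier_vec n" "\<And>i. i < n \<Longrightarrow> (\<lambda>s. vec_index (X s) i) \<longlonglongrightarrow> vec_index x i"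
    and \<tau>: "\<And>s. 0 \<le> \<tau> s" "\<tau> \<longlonglongrightarrow> t" and iv: "\<And>j. j < i \<Longrightarrow> isCont iv (mg iv t x j)" and i: "i < r"
  shows "(\<lambda>s. mg iv (\<tau> s) (X s) i) \<longlonglongrightarrow> mg iv t x i"
    and "l < p \<Longrightarrow> (\<lambda>s. evx iv (\<tau> s) (X s) (errx p i l)) \<longlonglongrightarrow> evx iv t x (errx p i l)"
proof -
  show "(\<lambda>s. mg iv (\<tau> s) (X s) i) \<longlonglongrightarrow> mg iv t x i" unfolding mg_def
  proof (rule evx_tendsto[OF X \<tau>])
    show "lower p r (margx p i)" using lower_mono[OF lower_margx[of p i]] i by simp
    show "all_inv (\<lambda>a. isCont iv (evx iv t x a)) (margx p i)"
      by (rule all_inv_margx) (use iv in \<open>simp add: mg_def\<close>)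
  qed
  show "(\<lambda>s. evx iv (\<tau> s) (X s) (errx p i l)) \<longlonglongrightarrow> evx iv t x (errx p i l)" if l: "l < p"
  proof (rule evx_tendsto[OF X \<tau>])
    show "lower p r (errx p i l)" using lower_mono[OF lower_errx[OF l, of i]] i by simp
    show "all_inv (\<lambda>a. isCont iv (evx iv t x a)) (errx p i l)"
      by (rule all_inv_errx) (use iv in \<open>simp add: mg_def\<close>)
  qed
qed

lemma Uc_tendsto:
  fixes \<tau> :: "nat \<Rightarrow> real"
  assumes X: "\<And>s. X s \<in> carrier_vec n" "x \<in> carrier_vec n" "\<And>i. i < n \<Longrightarrow> (\<lambda>s. vec_index (X s) i) \<longlonglongrightarrow> vec_index x i"
    and \<tau>: "\<And>s. 0 \<le> \<tau> s" "\<tau> \<longlonglongrightarrow> t" and iv: "\<And>j. j < r \<Longrightarrow> isCont iv (mg iv t x j)"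
    and i: "i < m"
  shows "(\<lambda>s. vec_index (Uc iv (\<tau> s) (X s)) i) \<longlonglongrightarrow> vec_index (Uc iv t x) i"
proof -
  have r1: "r - 1 < r" using r_pos by simp
  have iv': "isCont iv (mg iv t x j)" if "j < r - 1" for j using iv that by simp
  note mgt = mg_tendsto[OF X \<tau> iv' r1]
  have K1: "(\<lambda>s. vec_index (K (\<tau> s) *\<^sub>v Er iv (\<tau> s) (X s) (r - 1)) i) \<longlonglongrightarrow> vec_index (K t *\<^sub>v Er iv t x (r - 1)) i"
  proof (rule tendsto_mult_mat_vec[OF K_dim K_dim Er_dim Er_dim _ _ i])
    show "(\<lambda>s. K (\<tau> s) $$ (i,j)) \<longlonglongrightarrow> K t $$ (i,j)" if "j < p" for j
      by (rule isCont_tendsto_compose[OF smooth_matfun_cont[OF K_smooth i that] \<tau>(2)])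
    show "(\<lambda>s. vec_index (Er iv (\<tau> s) (X s) (r - 1)) j) \<longlonglongrightarrow> vec_index (Er iv t x (r - 1)) j" if "j < p" for j
      using mgt(2)[OF _ _ that] that by (simp add: Er_def)
  qed
  have "(\<lambda>s. - iv (mg iv (\<tau> s) (X s) (r - 1)) * vec_index (K (\<tau> s) *\<^sub>v Er iv (\<tau> s) (X s) (r - 1)) i)
     \<longlonglongrightarrow> - iv (mg iv t x (r - 1)) * vec_index (K t *\<^sub>v Er iv t x (r - 1)) i"
    by (intro tendsto_mult tendsto_minus K1 isCont_tendsto_compose[OF iv[OF r1]] mgt(1))
  moreover have "vec_index (Uc iv t x) i = - iv (mg iv t x (r - 1)) * vec_index (K t *\<^sub>v Er iv t x (r - 1)) i" for t x
    unfolding Uc_def using K_dim[of t] i by (auto simp del: index_mult_mat_vec)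
  ultimately show ?thesis by simp
qed

lemma Gc_tendsto:
  fixes \<tau> :: "nat \<Rightarrow> real"
  assumes X: "\<And>s. X s \<in> carrier_vec n" "x \<in> carrier_vec n" "\<And>i. i < n \<Longrightarrow> (\<lambda>s. vec_index (X s) i) \<longlonglongrightarrow> vec_index x i"
    and \<tau>: "\<And>s. 0 \<le> \<tau> s" "\<tau> \<longlonglongrightarrow> t" and iv: "\<And>j. j < r \<Longrightarrow> isCont iv (mg iv t x j)"
    and i: "i < n"
  shows "(\<lambda>s. vec_index (Gc iv (\<tau> s) (X s)) i) \<longlonglongrightarrow> vec_index (Gc iv t x) i"
  unfolding Gc_index[OF X(1) i] Gc_index[OF X(2) i]
proof (intro tendsto_add)
  note U = Uc_tendsto[OF X \<tau> iv]
  show "(\<lambda>s. vec_index (A *\<^sub>v X s) i) \<longlonglongrightarrow> vec_index (A *\<^sub>v x) i"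
    by (rule tendsto_mult_mat_vec[where M' = "\<lambda>_. A", OF dims(1) dims(1) X(1,2) tendsto_const X(3) i])
  show "(\<lambda>s. vec_index (B * L (\<tau> s) *\<^sub>v Uc iv (\<tau> s) (X s)) i) \<longlonglongrightarrow> vec_index (B * L t *\<^sub>v Uc iv t x) i"
    by (rule tendsto_mult_mat_vec[OF BL_dim BL_dim Uc_dim Uc_dim isCont_tendsto_compose[OF BL_cont[OF i] \<tau>(2)] U i])
  show "(\<lambda>s. vec_index (f (\<tau> s) (X s) (Uc iv (\<tau> s) (X s))) i) \<longlonglongrightarrow> vec_index (f t x (Uc iv t x)) i"
    by (rule vfun_continuous_tendsto[OF f_cont f_dim X Uc_dim Uc_dim U \<tau>(2) i])
qed

lemma tdom_nonneg: "t \<in> tdom w \<Longrightarrow> 0 \<le> t"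
  by (simp add: tdom_def)

lemma tdom_Icc:
  assumes "t \<in> tdom w"
  shows "{0..t} \<subseteq> tdom w"
proof -
  obtain b where "t < b" "{0..b} \<subseteq> tdom w" using tdom_subinterval[OF assms] .
  then show ?thesis by fastforce
qed

lemma tdom_sub: "tdom w \<subseteq> {0..}"
  by (auto simp: tdom_def)

lemma Rt_deriv_tdom: "t \<in> tdom w \<Longrightarrow> Suc k < r \<Longrightarrow> l < p \<Longrightarrow> ((\<lambda>s. Rt s k l) has_real_derivative Rt t (Suc k) l) (at t within tdom w)"
  by (rule has_field_derivative_subset[OF Rt_deriv tdom_sub]) (auto simp: tdom_def)

lemma Pt_deriv_tdom: "t \<in> tdom w \<Longrightarrow> j + k < r \<Longrightarrow> ((\<lambda>s. Pt s j k) has_real_derivative Pt t j (Suc k)) (at t within tdom w)"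
  by (rule has_field_derivative_subset[OF Pt_deriv tdom_sub]) (auto simp: tdom_def)

lemma vderiv_eq:
  assumes t: "t \<in> tdom w" and g: "\<And>s. s \<in> tdom w \<Longrightarrow> g s \<in> carrier_vec p"
    and d: "\<And>l. l < p \<Longrightarrow> ((\<lambda>s. vec_index (g s) l) has_real_derivative d l) (at t within tdom w)"
  shows "vderiv (tdom w) g t = vec p d"
proof -
  have "vector_derivative (\<lambda>s. vec_index (g s) l) (at t within tdom w) = d l" if "l < p" for l
    using d[OF that] tdom_at_nontrivial[OF t]
    by (intro vector_derivative_within) (auto simp: has_real_derivative_iff_has_vector_derivative)
  then show ?thesis unfolding vderiv_def using g[OF t] by auto
qed

section \<open>Error signals along an abstract output jet\<close>

context
  fixes w :: ereal and y :: "real \<Rightarrow> real vec" and Y :: "real \<Rightarrow> nat \<Rightarrow> nat \<Rightarrow> real"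
  assumes y_dim: "\<And>t. t \<in> tdom w \<Longrightarrow> y t \<in> carrier_vec p"
    and y_Y: "\<And>t l. t \<in> tdom w \<Longrightarrow> l < p \<Longrightarrow> vec_index (y t) l = Y t 0 l"
    and Y_deriv: "\<And>t k l. t \<in> tdom w \<Longrightarrow> Suc k < r \<Longrightarrow> l < p \<Longrightarrow> ((\<lambda>s. Y s k l) has_real_derivative Y t (Suc k) l) (at t within tdom w)"
begin

lemma errx_has_derivative:
  assumes "t \<in> tdom w" "Suc i < r" "l < p" "\<And>j. j < i \<Longrightarrow> ev inverse (Y t) (Rt t) (Pt t) (margx p j) \<noteq> 0"
  shows "((\<lambda>s. ev inverse (Y s) (Rt s) (Pt s) (errx p i l)) has_real_derivative
     ev inverse (Y t) (Rt t) (Pt t) (ediff (errx p i l))) (at t within tdom w)"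
proof (rule ev_has_derivative[where i = "Suc i" and p = p])
  show "all_inv (\<lambda>a. ev inverse (Y t) (Rt t) (Pt t) a \<noteq> 0) (errx p i l)"
    by (rule all_inv_errx) (rule assms(4))
qed (use assms in \<open>auto intro!: Y_deriv Rt_deriv_tdom Pt_deriv_tdom lower_errx\<close>)

text \<open>By induction \<open>e_i\<close> is an expression on the whole interval, so its time
  derivative is given by formal differentiation. The jet \<open>Y\<close> is abstract because two
  signals are treated: the output of a solution, and the Taylor polynomial in the initial
  condition.\<close>

lemma err_eq_ev:
  assumes "\<And>t j. t \<in> tdom w \<Longrightarrow> j < i \<Longrightarrow> ev inverse (Y t) (Rt t) (Pt t) (margx p j) \<noteq> 0" "i < r" "t \<in> tdom w"
  shows "err yref \<phi> (tdom w) y i t = vec p (\<lambda>l. ev inverse (Y t) (Rt t) (Pt t) (errx p i l))"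
  using assms
proof (induction i arbitrary: t)
  case 0
  then show ?case
    using y_dim[OF 0(3)] yref_dim[OF tdom_nonneg[OF 0(3)]] y_Y[OF 0(3)]
    by (auto simp: ev_errx Rt_0)
next
  case (Suc i)
  have eq: "err yref \<phi> (tdom w) y i s = vec p (\<lambda>l. ev inverse (Y s) (Rt s) (Pt s) (errx p i l))" if "s \<in> tdom w" for s
    using Suc.IH[of s] Suc.prems that by auto
  have vd: "vderiv (tdom w) (err yref \<phi> (tdom w) y i) t = vec p (\<lambda>l. ev inverse (Y t) (Rt t) (Pt t) (ediff (errx p i l)))"
  proof (rule vderiv_eq[OF Suc.prems(3)])
    show "err yref \<phi> (tdom w) y i s \<in> carrier_vec p" if "s \<in> tdom w" for s
      unfolding eq[OF that] by simp
    fix l assume l: "l < p"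
    have "((\<lambda>s. ev inverse (Y s) (Rt s) (Pt s) (errx p i l)) has_real_derivative
     ev inverse (Y t) (Rt t) (Pt t) (ediff (errx p i l))) (at t within tdom w)"
      by (rule errx_has_derivative) (use Suc.prems l in auto)
    then show "((\<lambda>s. vec_index (err yref \<phi> (tdom w) y i s) l) has_real_derivative
        ev inverse (Y t) (Rt t) (Pt t) (ediff (errx p i l))) (at t within tdom w)"
      unfolding has_field_derivative_def
      by (rule has_derivative_transform[OF Suc.prems(3), rotated]) (simp add: eq l)
  qed
  have "(vnorm (err yref \<phi> (tdom w) y i t))\<^sup>2 = (\<Sum>l<p. (ev inverse (Y t) (Rt t) (Pt t) (errx p i l))\<^sup>2)"
    unfolding eq[OF Suc.prems(3)] by (simp add: vnorm_def sum_nonneg)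
  then have m: "1 - (\<phi> i t)\<^sup>2 * (vnorm (err yref \<phi> (tdom w) y i t))\<^sup>2 = ev inverse (Y t) (Rt t) (Pt t) (margx p i)"
    by (simp add: ev_margx Pt_0)
  show ?case unfolding err.simps vd m unfolding eq[OF Suc.prems(3)]
    by (intro eq_vecI) (auto simp: ev_errx_Suc divide_inverse)
qed

text \<open>Strong induction: \<open>e_i\<close> can be identified with its expression only after
  the margins of smaller index are known not to vanish, and this identification gives the next
  margin.\<close>

lemma margin_pos_of_err:
  assumes "\<And>i t. i < r \<Longrightarrow> t \<in> tdom w \<Longrightarrow> \<phi> i t * vnorm (err yref \<phi> (tdom w) y i t) < 1"
  shows "i < r \<Longrightarrow> t \<in> tdom w \<Longrightarrow> ev inverse (Y t) (Rt t) (Pt t) (margx p i) > 0"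
proof (induction i arbitrary: t rule: less_induct)
  case (less i)
  have eq: "err yref \<phi> (tdom w) y i t = vec p (\<lambda>l. ev inverse (Y t) (Rt t) (Pt t) (errx p i l))"
    by (rule err_eq_ev) (use less in force)+
  have "0 \<le> \<phi> i t * vnorm (err yref \<phi> (tdom w) y i t)"
    using phi_nonneg[OF less.prems(1) tdom_nonneg[OF less.prems(2)]] by (simp add: vnorm_def sum_nonneg)
  then have "(\<phi> i t * vnorm (err yref \<phi> (tdom w) y i t))\<^sup>2 < 1"
    using assms[OF less.prems] by (simp add: power_less_one_iff abs_square_less_1)
  moreover have "(vnorm (err yref \<phi> (tdom w) y i t))\<^sup>2 = (\<Sum>l<p. (ev inverse (Y t) (Rt t) (Pt t) (errx p i l))\<^sup>2)"
    unfolding eq by (simp add: vnorm_def sum_nonneg)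
  ultimately show ?case by (simp add: ev_margx Pt_0 power_mult_distrib)
qed

end

lemma CA_Suc: "C * A ^\<^sub>m k * A = C * A ^\<^sub>m Suc k"
  using assoc_mult_mat[of C p n "A ^\<^sub>m k" n A n] dims by simp

lemma CA_rhs:
  assumes x: "x \<in> carrier_vec n" and u: "u \<in> carrier_vec m"
  shows "(C * A ^\<^sub>m k) *\<^sub>v (A *\<^sub>v x + (B * L t) *\<^sub>v u + f t x u)
    = (C * A ^\<^sub>m Suc k) *\<^sub>v x + (C * A ^\<^sub>m k * (B * L t)) *\<^sub>v u + (C * A ^\<^sub>m k) *\<^sub>v f t x u"
proof -
  have d: "A *\<^sub>v x \<in> carrier_vec n" "(B * L t) *\<^sub>v u \<in> carrier_vec n" "f t x u \<in> carrier_vec n"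
    using mult_mat_vec_carrier[OF dims(1) x] mult_mat_vec_carrier[OF BL_dim u] f_dim[OF x u] by auto
  have "(C * A ^\<^sub>m k) *\<^sub>v (A *\<^sub>v x + (B * L t) *\<^sub>v u + f t x u)
    = (C * A ^\<^sub>m k) *\<^sub>v (A *\<^sub>v x) + (C * A ^\<^sub>m k) *\<^sub>v ((B * L t) *\<^sub>v u) + (C * A ^\<^sub>m k) *\<^sub>v f t x u"
    by (subst mult_add_distrib_mat_vec[OF CA_dim _ d(3)], use d in simp)
      (subst mult_add_distrib_mat_vec[OF CA_dim d(1,2)], rule refl)
  also have "(C * A ^\<^sub>m k) *\<^sub>v (A *\<^sub>v x) = (C * A ^\<^sub>m Suc k) *\<^sub>v x"
    using assoc_mult_mat_vec[OF CA_dim dims(1) x, of k] by (simp only: CA_Suc)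
  also have "(C * A ^\<^sub>m k) *\<^sub>v ((B * L t) *\<^sub>v u) = (C * A ^\<^sub>m k * (B * L t)) *\<^sub>v u"
    using assoc_mult_mat_vec[OF CA_dim BL_dim u, of k t] by simp
  finally show ?thesis .
qed

lemma CA_rhs_low:
  assumes x: "x \<in> carrier_vec n" and u: "u \<in> carrier_vec m" and k: "k + 2 \<le> r"
  shows "(C * A ^\<^sub>m k) *\<^sub>v (A *\<^sub>v x + (B * L t) *\<^sub>v u + f t x u) = (C * A ^\<^sub>m Suc k) *\<^sub>v x"
proof -
  have "(0\<^sub>m p m) *\<^sub>v u = 0\<^sub>v p" using u by (intro eq_vecI) auto
  then show ?thesis unfolding CA_rhs[OF x u] P2_BL[OF k] P2_f[OF k x u]
    using mult_mat_vec_carrier[OF CA_dim x, of "Suc k"] by simp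
qed

lemma outd_has_derivative:
  assumes x: "\<And>s. s \<in> I \<Longrightarrow> x s \<in> carrier_vec n" and t: "t \<in> I" and u: "u \<in> carrier_vec m" and k: "Suc k < r" and l: "l < p"
    and d: "\<And>i. i < n \<Longrightarrow> ((\<lambda>s. vec_index (x s) i) has_real_derivative vec_index (A *\<^sub>v x t + (B * L t) *\<^sub>v u + f t (x t) u) i) (at t within I)"
  shows "((\<lambda>s. outd (x s) k l) has_real_derivative outd (x t) (Suc k) l) (at t within I)"
proof -
  have v: "A *\<^sub>v x t + (B * L t) *\<^sub>v u + f t (x t) u \<in> carrier_vec n"
    by (intro add_carrier_vec mult_mat_vec_carrier[OF dims(1)] mult_mat_vec_carrier[OF BL_dim u] f_dim[OF _ u] x t)
  have k2: "k + 2 \<le> r" using k by simp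
  show ?thesis
    using mult_mat_vec_has_derivative[OF CA_dim x v d t l, of k] unfolding outd_def CA_rhs_low[OF x[OF t] u k2] by blast
qed

lemma continuous_along:
  assumes x: "\<And>s. s \<in> I \<Longrightarrow> x s \<in> carrier_vec n" "\<And>s. s \<in> I \<Longrightarrow> 0 \<le> s"
    and xc: "\<And>i. i < n \<Longrightarrow> continuous_on I (\<lambda>s. vec_index (x s) i)"
    and iv: "\<And>t j. t \<in> I \<Longrightarrow> j < r \<Longrightarrow> isCont iv (mg iv t (x t) j)"
  shows "i < n \<Longrightarrow> continuous_on I (\<lambda>t. vec_index (Gc iv t (x t)) i)"
    and "j < r \<Longrightarrow> continuous_on I (\<lambda>t. mg iv t (x t) j)"
    and "i < m \<Longrightarrow> continuous_on I (\<lambda>t. vec_index (Uc iv t (x t)) i)"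
proof -
  have X: "\<And>s. x (\<tau> s) \<in> carrier_vec n" "x a \<in> carrier_vec n" "\<And>i. i < n \<Longrightarrow> (\<lambda>s. vec_index (x (\<tau> s)) i) \<longlonglongrightarrow> vec_index (x a) i"
    "\<And>s. 0 \<le> \<tau> s"
    if "\<forall>s. \<tau> s \<in> I" "a \<in> I" "\<tau> \<longlonglongrightarrow> a" for \<tau> :: "nat \<Rightarrow> real" and a
    using that x by (auto intro!: continuous_on_tendsto_compose[OF xc])
  show "continuous_on I (\<lambda>t. vec_index (Gc iv t (x t)) i)" if "i < n"
    by (rule continuous_on_sequentiallyI) (rule Gc_tendsto[OF X(1-3) X(4) _ iv that]; assumption)
  show "continuous_on I (\<lambda>t. vec_index (Uc iv t (x t)) i)" if "i < m"
    by (rule continuous_on_sequentiallyI) (rule Uc_tendsto[OF X(1-3) X(4) _ iv that]; assumption)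
  show "continuous_on I (\<lambda>t. mg iv t (x t) j)" if j: "j < r"
  proof (rule continuous_on_sequentiallyI)
    fix \<tau> :: "nat \<Rightarrow> real" and a assume \<tau>: "\<forall>s. \<tau> s \<in> I" "a \<in> I" "\<tau> \<longlonglongrightarrow> a"
    show "(\<lambda>s. mg iv (\<tau> s) (x (\<tau> s)) j) \<longlonglongrightarrow> mg iv a (x a) j"
      by (rule mg_tendsto(1)[OF X(1-3)[OF \<tau>] X(4)[OF \<tau>] \<tau>(3) _ j]) (use iv \<tau>(2) j in auto)
  qed
qed

lemma isCont_inverse_real: "x \<noteq> 0 \<Longrightarrow> isCont inverse (x::real)"
  by (intro continuous_intros) auto

lemma sol_continuous:
  assumes "sol I x" "i < n"
  shows "continuous_on I (\<lambda>s. vec_index (x s) i)"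
  by (rule DERIV_continuous_on) (use assms in \<open>auto simp: sol_def\<close>)

lemma sol_G_continuous:
  assumes s: "sol I x" and I: "\<And>s. s \<in> I \<Longrightarrow> 0 \<le> s"
  shows "i < n \<Longrightarrow> continuous_on I (\<lambda>t. vec_index (Gc inverse t (x t)) i)"
    and "j < r \<Longrightarrow> continuous_on I (\<lambda>t. mg inverse t (x t) j)"
    and "i < m \<Longrightarrow> continuous_on I (\<lambda>t. vec_index (Uc inverse t (x t)) i)"
proof -
  have x: "\<And>s. s \<in> I \<Longrightarrow> x s \<in> carrier_vec n" using s by (simp add: sol_def)
  have iv: "\<And>t j. t \<in> I \<Longrightarrow> j < r \<Longrightarrow> isCont inverse (mg inverse t (x t) j)"
    using s unfolding sol_def by (intro isCont_inverse_real) force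
  note * = continuous_along[OF x I sol_continuous[OF s] iv]
  show "i < n \<Longrightarrow> continuous_on I (\<lambda>t. vec_index (Gc inverse t (x t)) i)"
    and "j < r \<Longrightarrow> continuous_on I (\<lambda>t. mg inverse t (x t) j)"
    and "i < m \<Longrightarrow> continuous_on I (\<lambda>t. vec_index (Uc inverse t (x t)) i)"
    using * by blast+
qed

lemma sol_outd_derivative:
  assumes s: "sol I x" and t: "t \<in> I" and k: "Suc k < r" "l < p"
  shows "((\<lambda>s. outd (x s) k l) has_real_derivative outd (x t) (Suc k) l) (at t within I)"
  by (rule outd_has_derivative[OF _ t Uc_dim[of inverse t "x t"] k]) (use s t in \<open>auto simp: sol_def simp flip: Gc_def\<close>)

lemma output_dim: "x \<in> carrier_vec n \<Longrightarrow> C *\<^sub>v x \<in> carrier_vec p"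
  by (rule mult_mat_vec_carrier[OF dims(3)])

lemma output_jet: "vec_index (C *\<^sub>v x) l = outd x 0 l"
  using dims by (simp add: outd_def)

lemma sol_err:
  assumes s: "sol (tdom w) x" and t: "t \<in> tdom w" and i: "i < r"
  shows "err yref \<phi> (tdom w) (\<lambda>t. C *\<^sub>v x t) i t = Er inverse t (x t) i"
    and "gain yref \<phi> (tdom w) (\<lambda>t. C *\<^sub>v x t) i t = inverse (mg inverse t (x t) i)"
    and "ctrl yref \<phi> K r (tdom w) (\<lambda>t. C *\<^sub>v x t) t = Uc inverse t (x t)"
proof -
  have x: "\<And>s. s \<in> tdom w \<Longrightarrow> x s \<in> carrier_vec n" using s by (simp add: sol_def)
  have nz: "ev inverse (outd (x s)) (Rt s) (Pt s) (margx p j) \<noteq> 0" if "s \<in> tdom w" "j < r" for s j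
    using s that unfolding sol_def mg_def evx_def by force
  have e: "err yref \<phi> (tdom w) (\<lambda>t. C *\<^sub>v x t) i t = Er inverse t (x t) i" if i: "i < r" for i
    unfolding Er_def evx_def
    by (rule err_eq_ev[OF output_dim output_jet sol_outd_derivative[OF s] nz i t]) (use x i in auto)
  show "err yref \<phi> (tdom w) (\<lambda>t. C *\<^sub>v x t) i t = Er inverse t (x t) i" by (rule e[OF i])
  have g: "gain yref \<phi> (tdom w) (\<lambda>t. C *\<^sub>v x t) i t = inverse (mg inverse t (x t) i)" if i: "i < r" for i
    unfolding gain_def e[OF i] mg_eq by (simp add: inverse_eq_divide)
  show "gain yref \<phi> (tdom w) (\<lambda>t. C *\<^sub>v x t) i t = inverse (mg inverse t (x t) i)" by (rule g[OF i])
  have r1: "r - 1 < r" using r_pos by simp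
  show "ctrl yref \<phi> K r (tdom w) (\<lambda>t. C *\<^sub>v x t) t = Uc inverse t (x t)"
    unfolding ctrl_def Uc_def g[OF r1] e[OF r1] by simp
qed

text \<open>The order of the steps matters, since the input is not known to be continuous. First
  \<open>x\<close> is continuous as an integral. For k < r - 1 the derivative of C A^k x is C
  A^(k+1) x almost everywhere, in which the input is absent, so the output derivatives are
  classical. Hence the errors are given by their expressions, input and right-hand side are
  continuous along \<open>x\<close>, and finally \<open>x\<close> itself is classical.\<close>

lemma cl_solution_imp_sol:
  assumes cl: "cl_solution n A B C L f yref \<phi> K r x0 w x"
  shows "w > 0" "x 0 = x0" "sol (tdom w) x"
proof -
  define S where "S = tdom w"
  define u where "u = ctrl yref \<phi> K r S (\<lambda>t. C *\<^sub>v x t)"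
  define h where "h t = A *\<^sub>v x t + (B * L t) *\<^sub>v u t + f t (x t) (u t)" for t
  note cl' = cl[unfolded cl_solution_def Let_def, folded S_def]
  show w: "w > 0" and "x 0 = x0" using cl' by auto
  have x: "\<And>t. t \<in> S \<Longrightarrow> x t \<in> carrier_vec n" using cl' by auto
  have u: "u t \<in> carrier_vec m" for t
    unfolding u_def ctrl_def carrier_vec_def by (simp only: mem_Collect_eq index_smult_vec(2) dim_mult_mat_vec carrier_matD(1)[OF K_dim])
  have hd: "h t \<in> carrier_vec n" if "t \<in> S" for t
    unfolding h_def by (intro add_carrier_vec mult_mat_vec_carrier[OF dims(1)] mult_mat_vec_carrier[OF BL_dim u] f_dim[OF _ u] x that)
  have int: "((\<lambda>t. vec_index (h t) i) has_integral vec_index (x t) i - vec_index (x 0) i) {0..t}" if t: "t \<in> S" and i: "i < n" for t i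
  proof (rule abs_cont_has_integral)
    show "abs_cont_on {0..t} (\<lambda>t. vec_index (x t) i)" using cl' t i by blast
    show "0 \<le> t" using t by (simp add: S_def tdom_def)
    have sub: "{0..t} \<subseteq> S" using tdom_Icc[of t w] t unfolding S_def by blast
    have "AE t in lborel. t \<in> S \<longrightarrow> vec_has_deriv x (h t) (at t)" using cl' unfolding h_def u_def by blast
    then show "AE s in lborel. s \<in> {0..t} \<longrightarrow> ((\<lambda>t. vec_index (x t) i) has_real_derivative vec_index (h s) i) (at s)"
    proof eventually_elim
      case (elim s)
      then show ?case using sub hd[of s] i by (auto simp: vec_has_deriv_iff)
    qed
  qed
  have xc: "continuous_on S (\<lambda>t. vec_index (x t) i)" if "i < n" for i
    unfolding continuous_on_eq_continuous_within
    using tdom_integral_has_derivative(1)[of w, folded S_def, OF int[OF _ that]] by blast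
  have Yd: "((\<lambda>s. outd (x s) k l) has_real_derivative outd (x t) (Suc k) l) (at t within S)"
    if t: "t \<in> S" and k: "Suc k < r" and l: "l < p" for t k l
  proof (rule tdom_integral_has_derivative(2)[of w "\<lambda>t. outd (x t) (Suc k) l" "\<lambda>t. outd (x t) k l", folded S_def, OF _ t])
    have k2: "k + 2 \<le> r" using k by simp
    show "((\<lambda>t. outd (x t) (Suc k) l) has_integral outd (x t) k l - outd (x 0) k l) {0..t}" if t: "t \<in> S" for t
    proof -
      have S0: "0 \<in> S" using zero_in_tdom[OF w] by (simp add: S_def)
      have sub: "{0..t} \<subseteq> S" using tdom_Icc[of t w] t unfolding S_def by blast
      have "((\<lambda>t. \<Sum>j<n. (C * A ^\<^sub>m k) $$ (l,j) * vec_index (h t) j) has_integral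
         (\<Sum>j<n. (C * A ^\<^sub>m k) $$ (l,j) * (vec_index (x t) j - vec_index (x 0) j))) {0..t}"
        using int[OF t] by (intro has_integral_sum has_integral_mult_right) auto
      moreover have "(\<Sum>j<n. (C * A ^\<^sub>m k) $$ (l,j) * (vec_index (x t) j - vec_index (x 0) j)) = outd (x t) k l - outd (x 0) k l"
        unfolding outd_def mult_mat_vec_index[OF CA_dim x[OF t] l] mult_mat_vec_index[OF CA_dim x[OF S0] l]
        by (simp add: sum_subtractf right_diff_distrib)
      moreover have "(\<Sum>j<n. (C * A ^\<^sub>m k) $$ (l,j) * vec_index (h s) j) = outd (x s) (Suc k) l" if "s \<in> {0..t}" for s
      proof -
        have s: "s \<in> S" using sub that by auto
        show ?thesis unfolding outd_def mult_mat_vec_index[OF CA_dim hd[OF s] l, symmetric]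
          unfolding h_def CA_rhs_low[OF x[OF s] u k2] ..
      qed
      ultimately show ?thesis using has_integral_eq[of "{0..t}"] by (metis (no_types, lifting))
    qed
    show "continuous_on S (\<lambda>t. outd (x t) (Suc k) l)"
    proof -
      have "continuous_on S (\<lambda>t. \<Sum>j<n. (C * A ^\<^sub>m Suc k) $$ (l,j) * vec_index (x t) j)"
        by (intro continuous_intros xc) auto
      then show ?thesis by (rule continuous_on_eq) (simp add: outd_def mult_mat_vec_index[OF CA_dim x l] del: pow_mat.simps)
    qed
  qed
  have mgpos: "mg inverse t (x t) i > 0" if "i < r" "t \<in> S" for i t
    unfolding mg_def evx_def
    by (rule margin_pos_of_err[of w "\<lambda>t. C *\<^sub>v x t" "\<lambda>t. outd (x t)", folded S_def])
      (use that x output_dim output_jet Yd cl' in auto)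
  have err: "err yref \<phi> S (\<lambda>t. C *\<^sub>v x t) i t = Er inverse t (x t) i" if i: "i < r" and t: "t \<in> S" for i t
    unfolding Er_def evx_def
  proof (rule err_eq_ev[of w "\<lambda>t. C *\<^sub>v x t" "\<lambda>t. outd (x t)", folded S_def, OF _ _ _ _ i t])
    show "ev inverse (outd (x t)) (Rt t) (Pt t) (margx p j) \<noteq> 0" if "t \<in> S" "j < i" for t j
      using mgpos[of j t] that i unfolding mg_def evx_def by auto
  qed (use x output_dim output_jet Yd in auto)
  have r1: "r - 1 < r" using r_pos by simp
  have uU: "u t = Uc inverse t (x t)" if "t \<in> S" for t
    unfolding u_def ctrl_def Uc_def gain_def err[OF r1 that] mg_eq by (simp add: inverse_eq_divide)
  then have hG: "h t = Gc inverse t (x t)" if "t \<in> S" for t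
    unfolding h_def Gc_def using that by simp
  have I0: "\<And>s. s \<in> S \<Longrightarrow> 0 \<le> s" by (simp add: S_def tdom_def)
  have iv: "\<And>t j. t \<in> S \<Longrightarrow> j < r \<Longrightarrow> isCont inverse (mg inverse t (x t) j)"
    using mgpos by (intro isCont_inverse_real) force
  have hc: "continuous_on S (\<lambda>t. vec_index (h t) i)" if "i < n" for i
    by (rule continuous_on_eq[OF continuous_along(1)[OF x I0 xc iv that]]) (auto simp: hG)
  show "sol (tdom w) x"
    unfolding sol_def S_def[symmetric]
  proof (intro conjI ballI allI impI)
    fix t i assume t: "t \<in> S" and i: "i < n"
    from tdom_integral_has_derivative(2)[of w, folded S_def, OF int[OF _ i] t hc[OF i]]
    show "((\<lambda>s. vec_index (x s) i) has_real_derivative vec_index (Gc inverse t (x t)) i) (at t within S)"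
      by (simp add: hG[OF t])
  qed (use x mgpos in auto)
qed

lemma sol_imp_cl_solution:
  assumes w: "w > 0" and x0: "x 0 = x0" and s: "sol (tdom w) x"
  shows "cl_solution n A B C L f yref \<phi> K r x0 w x"
  unfolding cl_solution_def Let_def
proof (intro conjI ballI allI impI w x0)
  have x: "\<And>s. s \<in> tdom w \<Longrightarrow> x s \<in> carrier_vec n" using s by (simp add: sol_def)
  show "x t \<in> carrier_vec n" if "t \<in> tdom w" for t by (rule x[OF that])
  have nz: "ev inverse (outd (x s)) (Rt s) (Pt s) (margx p j) \<noteq> 0" if "s \<in> tdom w" "j < r" for s j
    using s that unfolding sol_def mg_def evx_def by force
  have G: "continuous_on (tdom w) (\<lambda>t. vec_index (Gc inverse t (x t)) i)" if "i < n" for i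
    by (rule sol_G_continuous(1)[OF s _ that]) (simp add: tdom_def)
  show "abs_cont_on {0..T} (\<lambda>t. vec_index (x t) i)" if T: "T \<in> tdom w" and i: "i < n" for T i
  proof -
    have sub: "{0..T} \<subseteq> tdom w" by (rule tdom_Icc[OF T])
    have "compact ((\<lambda>t. vec_index (Gc inverse t (x t)) i) ` {0..T})"
      by (intro compact_continuous_image continuous_on_subset[OF G[OF i] sub]) auto
    then obtain c where c: "\<And>t. t \<in> {0..T} \<Longrightarrow> \<bar>vec_index (Gc inverse t (x t)) i\<bar> \<le> c"
      using compact_imp_bounded bounded_iff by (metis (no_types, lifting) imageI real_norm_def)
    show ?thesis
    proof (rule lipschitz_imp_abs_cont_on)
      fix a b assume ab: "a \<in> {0..T}" "b \<in> {0..T}"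
      have "norm (vec_index (x a) i - vec_index (x b) i) \<le> c * norm (a - b)"
      proof (rule field_differentiable_bound[of "{0..T}" "\<lambda>t. vec_index (x t) i" "\<lambda>t. vec_index (Gc inverse t (x t)) i"])
        show "((\<lambda>t. vec_index (x t) i) has_field_derivative vec_index (Gc inverse z (x z)) i) (at z within {0..T})" if "z \<in> {0..T}" for z
          by (rule has_field_derivative_subset[OF _ sub]) (use s that sub i in \<open>auto simp: sol_def\<close>)
      qed (use c ab in auto)
      then show "\<bar>vec_index (x a) i - vec_index (x b) i\<bar> \<le> c * \<bar>a - b\<bar>" by simp
    qed
  qed
  show "(\<lambda>s. vec_index (err yref \<phi> (tdom w) (\<lambda>t. C *\<^sub>v x t) i s) j) differentiable (at t within tdom w)"
    if i: "i + 1 < r" and t: "t \<in> tdom w" and j: "j < dim_vec (err yref \<phi> (tdom w) (\<lambda>t. C *\<^sub>v x t) i t)" for i t j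
  proof -
    have ir: "i < r" "Suc i < r" using i by auto
    have jp: "j < p" using j unfolding sol_err(1)[OF s t ir(1)] by (simp add: Er_def)
    have "((\<lambda>s. ev inverse (outd (x s)) (Rt s) (Pt s) (errx p i j)) has_real_derivative
     ev inverse (outd (x t)) (Rt t) (Pt t) (ediff (errx p i j))) (at t within tdom w)"
      by (rule errx_has_derivative[of w "\<lambda>t. C *\<^sub>v x t" "\<lambda>t. outd (x t)"])
        (use x output_dim output_jet sol_outd_derivative[OF s] nz ir jp t in auto)
    then have "((\<lambda>s. vec_index (err yref \<phi> (tdom w) (\<lambda>t. C *\<^sub>v x t) i s) j) has_real_derivative
     ev inverse (outd (x t)) (Rt t) (Pt t) (ediff (errx p i j))) (at t within tdom w)"
      unfolding has_field_derivative_def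
      by (rule has_derivative_transform[OF t, rotated]) (simp add: sol_err(1)[OF s _ ir(1)] Er_def evx_def jp)
    then show ?thesis unfolding real_differentiable_def by blast
  qed
  show "\<phi> i t * vnorm (err yref \<phi> (tdom w) (\<lambda>t. C *\<^sub>v x t) i t) < 1" if i: "i < r" and t: "t \<in> tdom w" for i t
  proof -
    have "mg inverse t (x t) i > 0" using s t i by (auto simp: sol_def)
    then have "(\<phi> i t * vnorm (Er inverse t (x t) i))\<^sup>2 < 1" by (simp add: mg_eq power_mult_distrib)
    then show ?thesis unfolding sol_err(1)[OF s t i] by (simp add: abs_square_less_1)
  qed
  \<comment> \<open>At 0 only a one-sided derivative is available; a single point is
    negligible.\<close>
  have "AE t in lborel. t \<noteq> (0::real)" by (rule AE_lborel_singleton)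
  then show "AE t in lborel. t \<in> tdom w \<longrightarrow> vec_has_deriv x (A *\<^sub>v x t + (B * L t) *\<^sub>v ctrl yref \<phi> K r (tdom w) (\<lambda>t. C *\<^sub>v x t) t
     + f t (x t) (ctrl yref \<phi> K r (tdom w) (\<lambda>t. C *\<^sub>v x t) t)) (at t)"
  proof eventually_elim
    case (elim t)
    show ?case
    proof
      assume t: "t \<in> tdom w"
      then have "t > 0" using elim tdom_nonneg[OF t] by simp
      note at = tdom_interior[OF t this]
      have r0: "0 < r" using r_pos by simp
      show "vec_has_deriv x (A *\<^sub>v x t + (B * L t) *\<^sub>v ctrl yref \<phi> K r (tdom w) (\<lambda>t. C *\<^sub>v x t) t
     + f t (x t) (ctrl yref \<phi> K r (tdom w) (\<lambda>t. C *\<^sub>v x t) t)) (at t)"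
        unfolding sol_err(3)[OF s t r0] Gc_def[symmetric] vec_has_deriv_iff[OF Gc_dim[OF x[OF t]]]
        using s t at unfolding sol_def by metis
    qed
  qed
qed

end

section \<open>Internal dynamics\<close>

lemma inverse_of_injective:
  fixes M :: "real mat"
  assumes M: "M \<in> carrier_mat d d" and inj: "\<And>v. v \<in> carrier_vec d \<Longrightarrow> M *\<^sub>v v = 0\<^sub>v d \<Longrightarrow> v = 0\<^sub>v d"
  obtains X where "X \<in> carrier_mat d d" "X * M = 1\<^sub>m d" "M * X = 1\<^sub>m d"
proof -
  have "det M \<noteq> 0" using inj unfolding det_0_iff_vec_prod_zero[OF M] by blast
  from det_non_zero_imp_unit[OF M this, of undefined] show ?thesis
    using that by (auto simp: Units_def ring_mat_def)
qed

lemma scalar_prod_self_eq_0: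
  fixes v :: "real vec"
  assumes "v \<in> carrier_vec k" "v \<bullet> v = 0"
  shows "v = 0\<^sub>v k"
proof -
  have "(\<Sum>i\<in>{0..<k}. vec_index v i * vec_index v i) = 0" using assms by (auto simp: scalar_prod_def)
  then have "\<forall>i\<in>{0..<k}. vec_index v i * vec_index v i = 0" by (subst (asm) sum_nonneg_eq_0_iff) auto
  then show ?thesis using assms(1) by (intro eq_vecI) auto
qed

text \<open>For full column rank the matrix V^T V is invertible and (V^T V)^(-1) V^T satisfies the
  Penrose equations. Uniqueness is part of the argument because \<open>pinv\<close> is a definite
  description.\<close>

lemma pinv_left_inverse:
  fixes V :: "real mat"
  assumes V: "V \<in> carrier_mat k d" and inj: "\<And>v. v \<in> carrier_vec d \<Longrightarrow> V *\<^sub>v v = 0\<^sub>v k \<Longrightarrow> v = 0\<^sub>v d"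
  shows "pinv V \<in> carrier_mat d k" "pinv V * V = 1\<^sub>m d"
proof -
  let ?T = "transpose_mat V"
  have T: "?T \<in> carrier_mat d k" using V by simp
  have TV: "?T * V \<in> carrier_mat d d" using T V by (rule mult_carrier_mat)
  have "v = 0\<^sub>v d" if v: "v \<in> carrier_vec d" and z: "(?T * V) *\<^sub>v v = 0\<^sub>v d" for v
  proof -
    have Vv: "V *\<^sub>v v \<in> carrier_vec k" using V v by (rule mult_mat_vec_carrier)
    have "(V *\<^sub>v v) \<bullet> (V *\<^sub>v v) = (?T *\<^sub>v (V *\<^sub>v v)) \<bullet> v"
      using transpose_vec_mult_scalar[OF V v Vv] by simp
    also have "?T *\<^sub>v (V *\<^sub>v v) = 0\<^sub>v d" using z assoc_mult_mat_vec[OF T V v] by simp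
    finally have "(V *\<^sub>v v) \<bullet> (V *\<^sub>v v) = 0" using v by simp
    then show ?thesis using inj[OF v scalar_prod_self_eq_0[OF Vv]] by simp
  qed
  then obtain Y where Y: "Y \<in> carrier_mat d d" "Y * (?T * V) = 1\<^sub>m d" "(?T * V) * Y = 1\<^sub>m d"
    using inverse_of_injective[OF TV] by metis
  define X where "X = Y * ?T"
  have X: "X \<in> carrier_mat d k" unfolding X_def using Y(1) T by (rule mult_carrier_mat)
  have XV: "X * V = 1\<^sub>m d" unfolding X_def using assoc_mult_mat[OF Y(1) T V] Y(2) by simp
  have YT: "transpose_mat Y = Y"
  proof -
    have "transpose_mat Y * (?T * V) = transpose_mat ((?T * V) * Y)"
      by (simp only: transpose_mult[OF TV Y(1)] transpose_mult[OF T V] transpose_transpose)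
    then have e: "transpose_mat Y * (?T * V) = 1\<^sub>m d" using Y(3) by simp
    have Yt: "transpose_mat Y \<in> carrier_mat d d" using Y(1) by simp
    have "transpose_mat Y = transpose_mat Y * ((?T * V) * Y)" using Y(3) Yt by simp
    also have "\<dots> = (transpose_mat Y * (?T * V)) * Y" using assoc_mult_mat[OF Yt TV Y(1)] by simp
    finally show ?thesis using e Y(1) by simp
  qed
  have VXs: "transpose_mat (V * X) = V * X"
  proof -
    have "transpose_mat (V * X) = transpose_mat X * ?T" by (rule transpose_mult[OF V X])
    also have "transpose_mat X = V * Y" unfolding X_def using transpose_mult[OF Y(1) T] YT by simp
    also have "V * Y * ?T = V * X" unfolding X_def by (rule assoc_mult_mat[OF V Y(1) T])
    finally show ?thesis .
  qed
  have VXV: "V * X * V = V" using assoc_mult_mat[OF V X V] XV V by simp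
  have pX: "is_pinv V X"
    unfolding is_pinv_def using X V VXs XV VXV by simp
  \<comment> \<open>Any candidate is also a left inverse of \<open>V\<close>. Symmetry of both
    projections forces V X = V X', and multiplying by X' on the left gives X = X'.\<close>
  have uniq: "X' = X" if "is_pinv V X'" for X'
  proof -
    have X': "X' \<in> carrier_mat d k" "V * X' * V = V" "X' * V * X' = X'" "transpose_mat (V * X') = V * X'"
      using that V unfolding is_pinv_def by auto
    have VX: "V * X \<in> carrier_mat k k" "V * X' \<in> carrier_mat k k" using V X X'(1) by auto
    have XV': "X' * V = 1\<^sub>m d"
    proof -
      have X'V: "X' * V \<in> carrier_mat d d" using X'(1) V by auto
      have "X' * V = X * V * (X' * V)" using left_mult_one_mat[OF X'V] XV by simp
      also have "\<dots> = X * (V * (X' * V))" by (rule assoc_mult_mat[OF X V X'V])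
      also have "V * (X' * V) = V" using assoc_mult_mat[OF V X'(1) V] X'(2) by simp
      finally show ?thesis using XV by simp
    qed
    have "V * X = V * X' * V * X" using X'(2) by simp
    also have "\<dots> = (V * X') * (V * X)" by (rule assoc_mult_mat[OF VX(2) V X])
    also have "\<dots> = transpose_mat ((V * X) * (V * X'))"
      unfolding transpose_mult[OF VX] X'(4) VXs ..
    also have "(V * X) * (V * X') = V * X * V * X'" by (rule assoc_mult_mat[OF VX(1) V X'(1), symmetric])
    also have "\<dots> = V * X'" using VXV by simp
    finally have eq: "V * X = V * X'" using X'(4) by simp
    have "X' = X' * V * X'" using X'(3) by simp
    also have "\<dots> = X' * (V * X')" by (rule assoc_mult_mat[OF X'(1) V X'(1)])
    also have "\<dots> = X' * (V * X)" using eq by simp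
    also have "\<dots> = X' * V * X" by (rule assoc_mult_mat[OF X'(1) V X, symmetric])
    finally show ?thesis using XV' X by simp
  qed
  have "pinv V = X" unfolding pinv_def using pX uniq by (rule the_equality)
  then show "pinv V \<in> carrier_mat d k" "pinv V * V = 1\<^sub>m d" using X XV by auto
qed

lemma append_rows_index:
  assumes "M1 \<in> carrier_mat a k" "M2 \<in> carrier_mat b k" "i < a + b" "j < k"
  shows "(M1 @\<^sub>r M2) $$ (i,j) = (if i < a then M1 $$ (i,j) else M2 $$ (i - a, j))"
  using assms unfolding append_rows_def by (subst index_mat_four_block) auto

lemma mult_mat_zero_vec: "(M :: real mat) \<in> carrier_mat a k \<Longrightarrow> M *\<^sub>v 0\<^sub>v k = 0\<^sub>v a"
  by (intro eq_vecI) (auto simp: scalar_prod_def)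

context funnel_system
begin

section \<open>Dimensions and structure of the transformation \<U>\<close>

abbreviation "d \<equiv> n - p * r"
abbreviation "\<C> \<equiv> calC p n r A C"
abbreviation "\<N> \<equiv> calN n m p r A B C V L"
abbreviation "\<U> \<equiv> calU n m p r A B C V L"

lemma C_dim: "\<C> \<in> carrier_mat (r * p) n"
  by (simp add: calC_def)

lemma C_index: "j < r * p \<Longrightarrow> x \<in> carrier_vec n \<Longrightarrow> vec_index (\<C> *\<^sub>v x) j = outd x (j div p) (j mod p)"
proof -
  assume j: "j < r * p" and x: "x \<in> carrier_vec n"
  have "p > 0" using j by (cases p) auto
  then have l: "j mod p < p" by simp
  show ?thesis unfolding mult_mat_vec_index[OF C_dim x j] outd_def mult_mat_vec_index[OF CA_dim x l]
    using j by (intro sum.cong) (auto simp: calC_def)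
qed

lemma U_dim: "\<U> t \<in> carrier_mat n n"
  using P3 by (simp add: lyapunov_transformation_def C1_matfun_def)

lemma N_dim_col: "dim_col (\<N> t) = n"
  by (simp add: calN_def calC_def)

text \<open>The format of \<N> cannot be read off its definition: that of \<open>pinv V\<close> is
  known only after \<open>V\<close> is shown to be injective, and that proof uses the format of
  \<N>. It is taken instead from \<U> being square, which also shows that n - p * r is a genuine
  difference.\<close>

lemma N_dim_row: "r * p + dim_row (\<N> t) = n"
proof -
  have "dim_row (\<U> t) = dim_row \<C> + dim_row (\<N> t)"
    unfolding calU_def append_rows_def by simp
  then have "dim_row (\<U> t) = r * p + dim_row (\<N> t)" unfolding carrier_matD(1)[OF C_dim] .
  then show ?thesis unfolding carrier_matD(1)[OF U_dim] by (rule sym)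
qed

lemma N_dim: "\<N> t \<in> carrier_mat d n"
  using N_dim_row[of t] N_dim_col[of t] by (intro carrier_matI) (auto simp: mult.commute)

lemma rp_d: "r * p + d = n"
  using N_dim_row[of 0] by (simp add: mult.commute)

lemma d_eq: "d = n - r * p"
  by (simp add: mult.commute)

lemma rp_le: "r * p \<le> n"
  by (rule order_trans[OF le_add1 eq_refl[OF N_dim_row]])

lemma rp_bounds: "i < d \<Longrightarrow> r * p + i < n" "i < n \<Longrightarrow> \<not> i < r * p \<Longrightarrow> i - r * p < d" "i < r * p \<Longrightarrow> i < n"
proof -
  show "i < d \<Longrightarrow> r * p + i < n" unfolding d_eq less_diff_conv by (subst add.commute)
  show "i < n \<Longrightarrow> \<not> i < r * p \<Longrightarrow> i - r * p < d" unfolding d_eq not_less by (rule diff_less_mono)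
  show "i < r * p \<Longrightarrow> i < n" by (rule less_le_trans[OF _ rp_le])
qed

definition Wt :: "real \<Rightarrow> real mat" where "Wt t = minv (\<U> t)"

lemma Wt_inverse: "Wt t \<in> carrier_mat n n" "\<U> t * Wt t = 1\<^sub>m n" "Wt t * \<U> t = 1\<^sub>m n"
proof -
  have "invertible_mat (\<U> t)" using P3 by (simp add: lyapunov_transformation_def)
  then obtain X where X: "\<U> t * X = 1\<^sub>m (dim_row (\<U> t))" "X * \<U> t = 1\<^sub>m (dim_row X)"
    unfolding invertible_mat_def inverts_mat_def by blast
  have dU: "dim_row (\<U> t) = n" "dim_col (\<U> t) = n" using U_dim[of t] by auto
  have "dim_col (\<U> t * X) = n" using X(1) dU by simp
  moreover have "dim_col (X * \<U> t) = dim_row X" using X(2) by simp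
  ultimately have "X \<in> carrier_mat n n" using dU by (intro carrier_matI) auto
  then have "\<exists>X. X \<in> carrier_mat (dim_row (\<U> t)) (dim_row (\<U> t)) \<and> \<U> t * X = 1\<^sub>m (dim_row (\<U> t)) \<and> X * \<U> t = 1\<^sub>m (dim_row (\<U> t))"
    using X dU by auto
  from someI_ex[OF this] show "Wt t \<in> carrier_mat n n" "\<U> t * Wt t = 1\<^sub>m n" "Wt t * \<U> t = 1\<^sub>m n"
    unfolding Wt_def minv_def dU by auto
qed

lemma U_index: "i < n \<Longrightarrow> j < n \<Longrightarrow> \<U> t $$ (i,j) = (if i < r * p then \<C> $$ (i,j) else \<N> t $$ (i - r * p, j))"
  unfolding calU_def by (rule append_rows_index[OF C_dim N_dim]) (simp_all only: rp_d)

lemma N_index: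
  assumes "i < d" "j < n"
  shows "\<N> t $$ (i,j) = \<U> t $$ (r * p + i, j)"
  unfolding U_index[OF rp_bounds(1)[OF assms(1)] assms(2)] by (simp only: not_add_less1 if_False diff_add_inverse)

lemma U_mult_vec:
  assumes x: "x \<in> carrier_vec n" and i: "i < n"
  shows "vec_index (\<U> t *\<^sub>v x) i = (if i < r * p then vec_index (\<C> *\<^sub>v x) i else vec_index (\<N> t *\<^sub>v x) (i - r * p))"
proof (cases "i < r * p")
  case True
  then show ?thesis unfolding mult_mat_vec_index[OF U_dim x i] using U_index[OF i]
    by (simp add: mult_mat_vec_index[OF C_dim x] del: index_mult_mat_vec)
next
  case False
  then have "i - r * p < d" by (rule rp_bounds(2)[OF i])
  then show ?thesis using False unfolding mult_mat_vec_index[OF U_dim x i] using U_index[OF i]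
    by (simp add: mult_mat_vec_index[OF N_dim x] del: index_mult_mat_vec)
qed

lemma V_in_kernel: "v \<in> carrier_vec d \<Longrightarrow> V *\<^sub>v v \<in> mat_kernel \<C>"
  by (rule subsetD[OF equalityD1[OF V_im]], rule CollectI, rule exI, rule conjI, rule refl)

lemma kernel_V:
  assumes "h \<in> mat_kernel \<C>"
  obtains z where "z \<in> carrier_vec d" "h = V *\<^sub>v z"
proof -
  have "\<exists>z. h = V *\<^sub>v z \<and> z \<in> carrier_vec d"
    by (rule CollectD[OF subsetD[OF equalityD2[OF V_im] assms]])
  then show ?thesis by (elim exE conjE) (rule that)
qed

lemma C_V_zero: "v \<in> carrier_vec d \<Longrightarrow> \<C> *\<^sub>v (V *\<^sub>v v) = 0\<^sub>v (r * p)"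
  by (rule mat_kernelD(2)[OF C_dim V_in_kernel])

text \<open>The last columns of the inverse of \<open>\<U>\<close> lie in the kernel of \<open>\<C>\<close>, that is in the image of \<open>V\<close>;
  as they are \<open>d\<close> independent vectors, \<open>V\<close> has full column rank.\<close>
lemma V_injective:
  assumes v: "v \<in> carrier_vec d" and Vv: "V *\<^sub>v v = 0\<^sub>v n"
  shows "v = 0\<^sub>v d"
proof -
  define h where "h j = col (Wt 0) (r * p + j)" for j
  have hd: "h j \<in> carrier_vec n" for j unfolding h_def by (rule carrier_vecI) (simp add: carrier_matD(1)[OF Wt_inverse(1)])
  have Uh: "\<U> 0 *\<^sub>v h j = unit_vec n (r * p + j)" if "j < d" for j
  proof -
    have "\<U> 0 *\<^sub>v h j = col (\<U> 0 * Wt 0) (r * p + j)"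
      unfolding h_def by (rule col_mult2[OF U_dim Wt_inverse(1) rp_bounds(1)[OF that], symmetric])
    also have "\<dots> = unit_vec n (r * p + j)"
      unfolding Wt_inverse(2) by (rule col_one[OF rp_bounds(1)[OF that]])
    finally show ?thesis .
  qed
  have "\<exists>z. z \<in> carrier_vec d \<and> h j = V *\<^sub>v z" if j: "j < d" for j
  proof -
    have "\<C> *\<^sub>v h j = 0\<^sub>v (r * p)"
    proof (rule eq_vecI)
      fix i assume "i < dim_vec (0\<^sub>v (r * p) :: real vec)"
      then have i: "i < r * p" "i < n" using rp_bounds(3) by auto
      have "vec_index (\<C> *\<^sub>v h j) i = vec_index (\<U> 0 *\<^sub>v h j) i" using U_mult_vec[OF hd i(2), of 0 j] i(1) by (simp only: if_True)
      also have "\<dots> = 0" unfolding Uh[OF j] using i rp_bounds(1)[OF j] by (subst index_unit_vec) auto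
      finally show "vec_index (\<C> *\<^sub>v h j) i = vec_index (0\<^sub>v (r * p)) i" using i by simp
    qed (use C_dim in simp)
    then have "h j \<in> mat_kernel \<C>" by (intro mat_kernelI[OF C_dim hd])
    from kernel_V[OF this] obtain z where "z \<in> carrier_vec d" "h j = V *\<^sub>v z" .
    then show ?thesis by (intro exI[of _ z] conjI)
  qed
  then have "\<forall>j\<in>{..<d}. \<exists>z. z \<in> carrier_vec d \<and> h j = V *\<^sub>v z" by simp
  from bchoice[OF this] obtain z where z': "\<forall>j\<in>{..<d}. z j \<in> carrier_vec d \<and> h j = V *\<^sub>v z j" ..
  have z: "z j \<in> carrier_vec d" "h j = V *\<^sub>v z j" if "j < d" for j using bspec[OF z', of j] that by simp_all
  \<comment> \<open>The coordinates of the vectors \<open>h j\<close> with respect to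
    \<open>V\<close>. The product of \<N>(0) V with \<open>Z\<close> is the identity, so \<N>(0) V
    is invertible and V v = 0 forces v = 0.\<close>
  define Z where "Z = mat d d (\<lambda>(i,j). vec_index (z j) i)"
  define P where "P = \<N> 0 * V"
  have Z: "Z \<in> carrier_mat d d" by (simp add: Z_def)
  have P: "P \<in> carrier_mat d d" unfolding P_def by (rule mult_carrier_mat[OF N_dim V_dim])
  have colZ: "col Z j = z j" if "j < d" for j using z(1)[OF that] that by (intro eq_vecI) (auto simp: Z_def)
  have "P * Z = 1\<^sub>m d"
  proof (rule eq_matI)
    fix i j assume "i < dim_row (1\<^sub>m d :: real mat)" "j < dim_col (1\<^sub>m d :: real mat)"
    then have ij: "i < d" "j < d" by auto
    have "(P * Z) $$ (i,j) = vec_index (P *\<^sub>v z j) i" using ij P Z colZ[OF ij(2)] by simp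
    also have "P *\<^sub>v z j = \<N> 0 *\<^sub>v h j" unfolding P_def z(2)[OF ij(2)] by (rule assoc_mult_mat_vec[OF N_dim V_dim z(1)[OF ij(2)]])
    also have "vec_index (\<N> 0 *\<^sub>v h j) i = vec_index (\<U> 0 *\<^sub>v h j) (r * p + i)"
    proof -
      have "r * p + i < n" by (rule rp_bounds(1)[OF ij(1)])
      then show ?thesis using U_mult_vec[OF hd, of "r * p + i" 0 j] by (simp del: index_mult_mat_vec)
    qed
    also have "\<dots> = (if i = j then 1 else 0)" unfolding Uh[OF ij(2)] using rp_bounds(1)[OF ij(1)] rp_bounds(1)[OF ij(2)]
      by (subst index_unit_vec) auto
    finally show "(P * Z) $$ (i,j) = 1\<^sub>m d $$ (i,j)" using ij by simp
  qed (use P Z in auto)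
  then have ZP: "Z * P = 1\<^sub>m d" by (rule mat_mult_left_right_inverse[OF P Z])
  have Pv: "P *\<^sub>v v = 0\<^sub>v d"
    unfolding P_def assoc_mult_mat_vec[OF N_dim V_dim v] Vv by (rule mult_mat_zero_vec[OF N_dim])
  have e1: "(Z * P) *\<^sub>v v = Z *\<^sub>v 0\<^sub>v d" using assoc_mult_mat_vec[OF Z P v] unfolding Pv .
  have e2: "(Z * P) *\<^sub>v v = v" unfolding ZP by (rule one_mult_mat_vec[OF v])
  show ?thesis by (rule trans[OF e2[symmetric] trans[OF e1 mult_mat_zero_vec[OF Z]]])
qed

end

text \<open>In a matrix product the scalar products range over the dimension of the columns of the
  right factor. A left factor of unknown width, here one ending in the pseudoinverse of
  \<open>\<C> * calB\<close>, can therefore be replaced by a matrix of the proper format, to which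
  associativity applies.\<close>

lemma mult_mat_row_coeffs:
  fixes D :: "real mat"
  assumes "M \<in> carrier_mat a k"
  shows "D * M = mat (dim_row D) a (\<lambda>(i,j). vec_index (row D i) j) * M"
proof (rule eq_matI)
  fix i j assume "i < dim_row (mat (dim_row D) a (\<lambda>(i,j). vec_index (row D i) j) * M)" "j < dim_col (mat (dim_row D) a (\<lambda>(i,j). vec_index (row D i) j) * M)"
  then have ij: "i < dim_row D" "j < dim_col M" by auto
  show "(D * M) $$ (i,j) = (mat (dim_row D) a (\<lambda>(i,j). vec_index (row D i) j) * M) $$ (i,j)"
    using ij assms by (simp add: scalar_prod_def)
qed simp_all

lemma mult_mat_vec_bound:
  fixes M :: "real mat"
  assumes M: "M \<in> carrier_mat a k" "v \<in> carrier_vec k" "i < a"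
    and b: "\<And>j. j < k \<Longrightarrow> \<bar>M $$ (i,j)\<bar> \<le> cm" "\<And>j. j < k \<Longrightarrow> \<bar>vec_index v j\<bar> \<le> cv" "cm \<ge> 0"
  shows "\<bar>vec_index (M *\<^sub>v v) i\<bar> \<le> real k * (cm * cv)"
proof -
  have "\<bar>vec_index (M *\<^sub>v v) i\<bar> \<le> (\<Sum>j<k. \<bar>M $$ (i,j) * vec_index v j\<bar>)"
    unfolding mult_mat_vec_index[OF M] by (rule sum_abs)
  also have "\<dots> \<le> (\<Sum>j<k. cm * cv)"
    unfolding abs_mult using b by (intro sum_mono mult_mono) auto
  finally show ?thesis by simp
qed

lemma vec_add_diff: "(a :: real vec) \<in> carrier_vec k \<Longrightarrow> b \<in> carrier_vec k \<Longrightarrow> a = b + (a - b)"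
  by (rule eq_vecI) simp_all

lemma mat_entries_bounded:
  fixes M :: "real mat"
  shows "\<exists>c\<ge>0. \<forall>i<a. \<forall>j<b. \<bar>M $$ (i,j)\<bar> \<le> c"
proof (intro exI[of _ "\<Sum>i<a. \<Sum>j<b. \<bar>M $$ (i,j)\<bar>"] conjI allI impI)
  show "(\<Sum>i<a. \<Sum>j<b. \<bar>M $$ (i,j)\<bar>) \<ge> 0" by (intro sum_nonneg) simp
  fix i j assume "i < a" "j < b"
  have "\<bar>M $$ (i,j)\<bar> \<le> (\<Sum>j<b. \<bar>M $$ (i,j)\<bar>)" using \<open>j < b\<close> by (intro member_le_sum) simp_all
  also have "\<dots> \<le> (\<Sum>i<a. \<Sum>j<b. \<bar>M $$ (i,j)\<bar>)" using \<open>i < a\<close> by (intro member_le_sum) (simp_all add: sum_nonneg)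
  finally show "\<bar>M $$ (i,j)\<bar> \<le> (\<Sum>i<a. \<Sum>j<b. \<bar>M $$ (i,j)\<bar>)" .
qed

context funnel_system
begin

text \<open>The correction term of \<N> ends in the factor \<C>, which annihilates the image of
  \<open>V\<close>; what remains is the left inverse property of \<open>pinv V\<close>.\<close>

lemma N_V:
  assumes v: "v \<in> carrier_vec d"
  shows "\<N> t *\<^sub>v (V *\<^sub>v v) = v"
proof -
  define D0 where "D0 = calB n m r A B L t * pinv (\<C> * calB n m r A B L t)"
  define D' where "D' = mat n (r * p) (\<lambda>(i,j). vec_index (row D0 i) j)"
  have "dim_row D0 = n" by (simp add: D0_def calB_def)
  then have eq: "D0 * \<C> = D' * \<C>" unfolding D'_def using mult_mat_row_coeffs[OF C_dim, of D0] by simp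
  have D': "D' \<in> carrier_mat n (r * p)" by (simp add: D'_def)
  have DC: "D' * \<C> \<in> carrier_mat n n" by (rule mult_carrier_mat[OF D' C_dim])
  have X: "1\<^sub>m n - D' * \<C> \<in> carrier_mat n n" by (rule minus_carrier_mat[OF DC])
  have Vv: "V *\<^sub>v v \<in> carrier_vec n" by (rule mult_mat_vec_carrier[OF V_dim v])
  note P = pinv_left_inverse[OF V_dim V_injective]
  have pV: "pinv V \<in> carrier_mat d n" "pinv V * V = 1\<^sub>m d" using P by blast+
  have "\<N> t *\<^sub>v (V *\<^sub>v v) = (pinv V * (1\<^sub>m n - D' * \<C>)) *\<^sub>v (V *\<^sub>v v)"
    unfolding calN_def D0_def[symmetric] eq ..
  also have "\<dots> = pinv V *\<^sub>v ((1\<^sub>m n - D' * \<C>) *\<^sub>v (V *\<^sub>v v))"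
    by (rule assoc_mult_mat_vec[OF pV(1) X Vv])
  also have "(1\<^sub>m n - D' * \<C>) *\<^sub>v (V *\<^sub>v v) = 1\<^sub>m n *\<^sub>v (V *\<^sub>v v) - (D' * \<C>) *\<^sub>v (V *\<^sub>v v)"
    by (rule minus_mult_distrib_mat_vec[OF one_carrier_mat DC Vv])
  also have "1\<^sub>m n *\<^sub>v (V *\<^sub>v v) = V *\<^sub>v v" by (rule one_mult_mat_vec[OF Vv])
  also have "(D' * \<C>) *\<^sub>v (V *\<^sub>v v) = D' *\<^sub>v (\<C> *\<^sub>v (V *\<^sub>v v))" by (rule assoc_mult_mat_vec[OF D' C_dim Vv])
  also have "\<C> *\<^sub>v (V *\<^sub>v v) = 0\<^sub>v (r * p)" by (rule C_V_zero[OF v])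
  also have "D' *\<^sub>v 0\<^sub>v (r * p) = 0\<^sub>v n" by (rule mult_mat_zero_vec[OF D'])
  also have "V *\<^sub>v v - 0\<^sub>v n = V *\<^sub>v v" by (rule minus_zero_vec[OF Vv])
  also have "pinv V *\<^sub>v (V *\<^sub>v v) = (pinv V * V) *\<^sub>v v" by (rule assoc_mult_mat_vec[OF pV(1) V_dim v, symmetric])
  also have "\<dots> = v" unfolding pV(2) by (rule one_mult_mat_vec[OF v])
  finally show ?thesis .
qed

lemma U_C1:
  assumes "i < n" "j < n"
  shows "(\<lambda>s. \<U> s $$ (i,j)) differentiable (at t)" "continuous_on UNIV (deriv (\<lambda>s. \<U> s $$ (i,j)))"
  using P3 assms unfolding lyapunov_transformation_def C1_matfun_def by blast+

lemma N_fun_eq: "i < d \<Longrightarrow> j < n \<Longrightarrow> (\<lambda>s. \<N> s $$ (i,j)) = (\<lambda>s. \<U> s $$ (r * p + i, j))"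
  by (rule ext) (rule N_index)

lemma N_C1:
  assumes "i < d" "j < n"
  shows "((\<lambda>s. \<N> s $$ (i,j)) has_real_derivative deriv (\<lambda>s. \<N> s $$ (i,j)) t) (at t)"
    and "continuous_on UNIV (deriv (\<lambda>s. \<N> s $$ (i,j)))"
    and "continuous_on UNIV (\<lambda>s. \<N> s $$ (i,j))"
proof -
  have df: "(\<lambda>s. \<N> s $$ (i,j)) differentiable (at t)" for t
    unfolding N_fun_eq[OF assms] by (rule U_C1(1)[OF rp_bounds(1)[OF assms(1)] assms(2)])
  show "((\<lambda>s. \<N> s $$ (i,j)) has_real_derivative deriv (\<lambda>s. \<N> s $$ (i,j)) t) (at t)"
    using df[of t] by (simp only: DERIV_deriv_iff_real_differentiable)
  show "continuous_on UNIV (deriv (\<lambda>s. \<N> s $$ (i,j)))"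
    unfolding N_fun_eq[OF assms] by (rule U_C1(2)[OF rp_bounds(1)[OF assms(1)] assms(2)])
  show "continuous_on UNIV (\<lambda>s. \<N> s $$ (i,j))"
    by (rule differentiable_imp_continuous_on) (use df in \<open>auto simp: differentiable_on_def intro: differentiable_at_withinI\<close>)
qed

lemma lyapunov_bounds:
  "\<exists>c\<ge>0. (\<forall>t. \<forall>i<d. \<forall>j<n. \<bar>\<N> t $$ (i,j)\<bar> \<le> c) \<and> (\<forall>t. \<forall>i<d. \<forall>j<n. \<bar>deriv (\<lambda>s. \<N> s $$ (i,j)) t\<bar> \<le> c)
    \<and> (\<forall>t. \<forall>i<n. \<forall>j<n. \<bar>Wt t $$ (i,j)\<bar> \<le> c)"
proof -
  have dU: "dim_row (\<U> t) = n" "dim_col (\<U> t) = n" for t using carrier_matD[OF U_dim[of t]] by blast+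
  have dW: "dim_row (Wt t) = n" "dim_col (Wt t) = n" for t using carrier_matD[OF Wt_inverse(1)[of t]] by blast+
  obtain c1 where c1: "\<forall>t\<in>UNIV. \<forall>i<n. \<forall>j<n. \<bar>\<U> t $$ (i,j)\<bar> \<le> c1"
    using P3 unfolding lyapunov_transformation_def mat_bounded_def dU by blast
  obtain c2 where c2: "\<forall>t\<in>UNIV. \<forall>i<n. \<forall>j<n. \<bar>Wt t $$ (i,j)\<bar> \<le> c2"
    using P3 unfolding lyapunov_transformation_def mat_bounded_def Wt_def[symmetric] dW by blast
  have md: "dim_row (mderiv \<U> t) = n" "dim_col (mderiv \<U> t) = n" for t unfolding mderiv_def dU by simp_all
  have "\<exists>c. \<forall>t\<in>UNIV. \<forall>i<n. \<forall>j<n. \<bar>mderiv \<U> t $$ (i,j)\<bar> \<le> c"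
    using P3 unfolding lyapunov_transformation_def mat_bounded_def md by blast
  then obtain c3 where c3: "\<forall>t\<in>UNIV. \<forall>i<n. \<forall>j<n. \<bar>mderiv \<U> t $$ (i,j)\<bar> \<le> c3" ..
  have mdi: "mderiv \<U> t $$ (i,j) = deriv (\<lambda>s. \<U> s $$ (i,j)) t" if "i < n" "j < n" for t i j
    unfolding mderiv_def dU using that by simp
  define c where "c = max 0 (max c1 (max c2 c3))"
  show ?thesis
  proof (intro exI[of _ c] conjI allI impI)
    show "c \<ge> 0" by (simp add: c_def)
    show "\<bar>\<N> t $$ (i,j)\<bar> \<le> c" if "i < d" "j < n" for t i j
    proof -
      have "\<bar>\<N> t $$ (i,j)\<bar> \<le> c1" unfolding N_index[OF that] using c1 rp_bounds(1)[OF that(1)] that(2) by blast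
      then show ?thesis unfolding c_def by linarith
    qed
    show "\<bar>deriv (\<lambda>s. \<N> s $$ (i,j)) t\<bar> \<le> c" if "i < d" "j < n" for t i j
    proof -
      have "\<bar>mderiv \<U> t $$ (r * p + i,j)\<bar> \<le> c3" using c3 rp_bounds(1)[OF that(1)] that(2) by blast
      then show ?thesis unfolding N_fun_eq[OF that] mdi[OF rp_bounds(1)[OF that(1)] that(2)] c_def by linarith
    qed
    show "\<bar>Wt t $$ (i,j)\<bar> \<le> c" if "i < n" "j < n" for t i j
    proof -
      have "\<bar>Wt t $$ (i,j)\<bar> \<le> c2" using c2 that by blast
      then show ?thesis unfolding c_def by linarith
    qed
  qed
qed

section \<open>Internal dynamics of \<N> x\<close>

definition Mm :: "real \<Rightarrow> real mat" where "Mm t = \<N> t * A + mderiv \<N> t"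

lemma Nd_dim: "mderiv \<N> t \<in> carrier_mat d n"
  unfolding mderiv_def carrier_matD[OF N_dim] by simp

lemma Nd_index: "i < d \<Longrightarrow> j < n \<Longrightarrow> mderiv \<N> t $$ (i,j) = deriv (\<lambda>s. \<N> s $$ (i,j)) t"
  unfolding mderiv_def carrier_matD[OF N_dim] by simp

lemma NA_dim: "\<N> t * A \<in> carrier_mat d n"
  by (rule mult_carrier_mat[OF N_dim dims(1)])

lemma Mm_dim: "Mm t \<in> carrier_mat d n"
  unfolding Mm_def by (rule add_carrier_mat[OF Nd_dim])

lemma mult_mat_index:
  fixes M1 M2 :: "real mat"
  assumes "M1 \<in> carrier_mat a k" "M2 \<in> carrier_mat k b" "i < a" "j < b"
  shows "(M1 * M2) $$ (i,j) = (\<Sum>l<k. M1 $$ (i,l) * M2 $$ (l,j))"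
  using assms by (simp add: scalar_prod_def atLeast0LessThan)

lemma Mm_index:
  assumes "i < d" "j < n"
  shows "Mm t $$ (i,j) = (\<Sum>k<n. \<N> t $$ (i,k) * A $$ (k,j)) + deriv (\<lambda>s. \<N> s $$ (i,j)) t"
proof -
  have "i < dim_row (mderiv \<N> t)" "j < dim_col (mderiv \<N> t)"
    unfolding carrier_matD[OF Nd_dim] by (rule assms)+
  then have "Mm t $$ (i,j) = (\<N> t * A) $$ (i,j) + mderiv \<N> t $$ (i,j)" unfolding Mm_def by (rule index_add_mat(1))
  then show ?thesis unfolding mult_mat_index[OF N_dim dims(1) assms] Nd_index[OF assms] .
qed

lemma Mm_cont:
  assumes "i < d" "j < n"
  shows "continuous_on UNIV (\<lambda>t. Mm t $$ (i,j))"
  unfolding Mm_index[OF assms]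
  by (intro continuous_on_add continuous_on_sum continuous_on_mult_right N_C1(3) N_C1(2)) (use assms in simp_all)

lemma Mm_bdd: "\<exists>c\<ge>0. \<forall>t. \<forall>i<d. \<forall>j<n. \<bar>Mm t $$ (i,j)\<bar> \<le> c"
proof -
  obtain c where c0: "c \<ge> 0" and c': "\<forall>t. \<forall>i<d. \<forall>j<n. \<bar>\<N> t $$ (i,j)\<bar> \<le> c"
    "\<forall>t. \<forall>i<d. \<forall>j<n. \<bar>deriv (\<lambda>s. \<N> s $$ (i,j)) t\<bar> \<le> c"
    using lyapunov_bounds by (elim exE conjE)
  note c = c0 c'(1)[rule_format] c'(2)[rule_format]
  obtain cA where cA0: "cA \<ge> 0" and cA: "\<forall>k<n. \<forall>j<n. \<bar>A $$ (k,j)\<bar> \<le> cA" using mat_entries_bounded[of n n A] by blast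
  show ?thesis
  proof (intro exI[of _ "real n * (c * cA) + c"] conjI allI impI)
    show "real n * (c * cA) + c \<ge> 0" using c(1) cA0 by simp
    fix t i j assume ij: "i < d" "j < n"
    have "\<bar>\<Sum>k<n. \<N> t $$ (i,k) * A $$ (k,j)\<bar> \<le> (\<Sum>k<n. \<bar>\<N> t $$ (i,k) * A $$ (k,j)\<bar>)" by (rule sum_abs)
    also have "\<dots> \<le> (\<Sum>k<n. c * cA)" unfolding abs_mult using c ij cA by (intro sum_mono mult_mono) auto
    finally show "\<bar>Mm t $$ (i,j)\<bar> \<le> real n * (c * cA) + c"
      unfolding Mm_index[OF ij] using c(3)[OF ij, of t] by simp
  qed
qed

lemma Q_eq: "Qfun n m p r A B C V L t = Mm t * V"
  by (simp add: Qfun_def Mm_def)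

lemma Q_dim: "Mm t * V \<in> carrier_mat d d"
  by (rule mult_carrier_mat[OF Mm_dim V_dim])

lemma Q_cont:
  assumes "i < d" "j < d"
  shows "continuous_on UNIV (\<lambda>t. (Mm t * V) $$ (i,j))"
  unfolding mult_mat_index[OF Mm_dim V_dim assms]
  by (intro continuous_on_sum continuous_on_mult_right Mm_cont) (use assms in simp_all)

lemma NBLu:
  assumes "u = c \<cdot>\<^sub>v (K t *\<^sub>v e)" "e \<in> carrier_vec p"
  shows "\<N> t *\<^sub>v ((B * L t) *\<^sub>v u) = 0\<^sub>v d"
proof -
  have Ke: "K t *\<^sub>v e \<in> carrier_vec m" by (rule mult_mat_vec_carrier[OF K_dim assms(2)])
  have NB: "\<N> t * (B * L t) \<in> carrier_mat d m" by (rule mult_carrier_mat[OF N_dim BL_dim])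
  have u: "u \<in> carrier_vec m" unfolding assms(1) by (rule smult_carrier_vec[THEN iffD2, OF Ke])
  have "\<N> t *\<^sub>v ((B * L t) *\<^sub>v u) = (\<N> t * (B * L t)) *\<^sub>v u" by (rule assoc_mult_mat_vec[OF N_dim BL_dim u, symmetric])
  also have "\<dots> = c \<cdot>\<^sub>v ((\<N> t * (B * L t)) *\<^sub>v (K t *\<^sub>v e))" unfolding assms(1) by (rule mult_mat_vec[OF NB Ke])
  also have "(\<N> t * (B * L t)) *\<^sub>v (K t *\<^sub>v e) = (\<N> t * (B * L t) * K t) *\<^sub>v e" by (rule assoc_mult_mat_vec[OF NB K_dim assms(2), symmetric])
  also have "\<N> t * (B * L t) * K t = 0\<^sub>m d p" using K_N[of t] unfolding Nfun_def .
  also have "0\<^sub>m d p *\<^sub>v e = 0\<^sub>v d" by (rule eq_vecI) (use assms(2) in \<open>simp_all add: scalar_prod_def\<close>)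
  also have "c \<cdot>\<^sub>v 0\<^sub>v d = 0\<^sub>v d" by (rule eq_vecI) simp_all
  finally show ?thesis .
qed

text \<open>The part of the state determined by the output derivatives; \<open>\<N>x\<close> is the state of the internal dynamics.\<close>
definition wv :: "real \<Rightarrow> real vec \<Rightarrow> real vec" where
  "wv t x = x - V *\<^sub>v (\<N> t *\<^sub>v x)"

context
  fixes t :: real and x :: "real vec" assumes x: "x \<in> carrier_vec n"
begin

lemma Nx_dim: "\<N> t *\<^sub>v x \<in> carrier_vec d"
  by (rule mult_mat_vec_carrier[OF N_dim x])

lemma VNx_dim: "V *\<^sub>v (\<N> t *\<^sub>v x) \<in> carrier_vec n"
  by (rule mult_mat_vec_carrier[OF V_dim Nx_dim])

lemma wv_dim: "wv t x \<in> carrier_vec n"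
  unfolding wv_def by (rule minus_carrier_vec[OF x VNx_dim])

lemma x_split: "x = V *\<^sub>v (\<N> t *\<^sub>v x) + wv t x"
  unfolding wv_def by (rule vec_add_diff[OF x VNx_dim])

text \<open>Since \<C> V = 0 and \<N> V = 1, the transformation \<U> maps \<open>wv t x\<close> to
  the vector with upper part \<C> x and lower part 0. The bounded inverse of \<U> recovers it from
  the output derivatives alone.\<close>

lemma wv_bound:
  assumes c: "\<And>i j. i < n \<Longrightarrow> j < n \<Longrightarrow> \<bar>Wt t $$ (i,j)\<bar> \<le> c" "c \<ge> 0" and o: "\<And>k l. k < r \<Longrightarrow> l < p \<Longrightarrow> \<bar>outd x k l\<bar> \<le> co" "co \<ge> 0"
    and i: "i < n"
  shows "\<bar>vec_index (wv t x) i\<bar> \<le> real n * (c * co)"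
proof -
  have Uw: "\<U> t *\<^sub>v wv t x \<in> carrier_vec n" by (rule mult_mat_vec_carrier[OF U_dim wv_dim])
  have "\<C> *\<^sub>v wv t x = \<C> *\<^sub>v x - \<C> *\<^sub>v (V *\<^sub>v (\<N> t *\<^sub>v x))"
    unfolding wv_def by (rule mult_minus_distrib_mat_vec[OF C_dim x VNx_dim])
  also have "\<dots> = \<C> *\<^sub>v x - 0\<^sub>v (r * p)" unfolding C_V_zero[OF Nx_dim] ..
  also have "\<dots> = \<C> *\<^sub>v x" by (rule minus_zero_vec[OF mult_mat_vec_carrier[OF C_dim x]])
  finally have Cw: "\<C> *\<^sub>v wv t x = \<C> *\<^sub>v x" .
  have "\<N> t *\<^sub>v wv t x = \<N> t *\<^sub>v x - \<N> t *\<^sub>v (V *\<^sub>v (\<N> t *\<^sub>v x))"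
    unfolding wv_def by (rule mult_minus_distrib_mat_vec[OF N_dim x VNx_dim])
  also have "\<dots> = \<N> t *\<^sub>v x - \<N> t *\<^sub>v x" unfolding N_V[OF Nx_dim] ..
  also have "\<dots> = 0\<^sub>v d" by (rule minus_cancel_vec[OF Nx_dim])
  finally have Nw: "\<N> t *\<^sub>v wv t x = 0\<^sub>v d" .
  have ub: "\<bar>vec_index (\<U> t *\<^sub>v wv t x) j\<bar> \<le> co" if j: "j < n" for j
  proof (cases "j < r * p")
    case True
    then have "vec_index (\<U> t *\<^sub>v wv t x) j = outd x (j div p) (j mod p)"
      unfolding U_mult_vec[OF wv_dim j] Cw using C_index[OF True x] by (simp only: if_True)
    moreover have "p > 0" using True by (cases "p = 0") simp_all
    then have "j div p < r" "j mod p < p" using True by (simp_all only: less_mult_imp_div_less mod_less_divisor)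
    ultimately show ?thesis using o(1) by simp
  next
    case False
    have "j - r * p < d" by (rule rp_bounds(2)[OF j False])
    then have "vec_index (\<U> t *\<^sub>v wv t x) j = 0"
      unfolding U_mult_vec[OF wv_dim j] Nw using False by (simp only: if_False index_zero_vec(1))
    then show ?thesis using o(2) by simp
  qed
  have "wv t x = (Wt t * \<U> t) *\<^sub>v wv t x" unfolding Wt_inverse(3) by (rule one_mult_mat_vec[OF wv_dim, symmetric])
  also have "\<dots> = Wt t *\<^sub>v (\<U> t *\<^sub>v wv t x)" by (rule assoc_mult_mat_vec[OF Wt_inverse(1) U_dim wv_dim])
  finally have e: "wv t x = Wt t *\<^sub>v (\<U> t *\<^sub>v wv t x)" .
  show ?thesis
    by (subst e, rule mult_mat_vec_bound[OF Wt_inverse(1) Uw i c(1)[OF i] ub c(2)])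
qed

end

lemma f_bound: "\<exists>c\<ge>0. \<forall>t x u i. x \<in> carrier_vec n \<longrightarrow> u \<in> carrier_vec m \<longrightarrow> i < n \<longrightarrow> \<bar>vec_index (f t x u) i\<bar> \<le> c"
proof -
  obtain c where c: "\<forall>t x u. x \<in> carrier_vec n \<longrightarrow> u \<in> carrier_vec m \<longrightarrow> vnorm (f t x u) \<le> c" using f_bdd ..
  show ?thesis
  proof (intro exI[of _ "max 0 c"] conjI allI impI)
    fix t :: real and x u :: "real vec" and i assume a: "x \<in> carrier_vec n" "u \<in> carrier_vec m" "i < n"
    have "\<bar>vec_index (f t x u) i\<bar> \<le> vnorm (f t x u)" by (rule abs_le_vnorm[OF f_dim[OF a(1,2)] a(3)])
    also have "\<dots> \<le> c" using c a by blast
    finally show "\<bar>vec_index (f t x u) i\<bar> \<le> max 0 c" by simp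
  qed simp
qed

text \<open>The product rule gives Mm x + \<N> f, the input having dropped out. Splitting x into V
  \<N> x and \<open>wv\<close> turns Mm x into Q \<N> x plus a term that the output derivatives
  control.\<close>

lemma Nx_derivative:
  assumes s: "sol I x" and t: "t \<in> I" and i: "i < d"
  shows "((\<lambda>s. vec_index (\<N> s *\<^sub>v x s) i) has_real_derivative
     vec_index ((Mm t * V) *\<^sub>v (\<N> t *\<^sub>v x t)) i
     + (vec_index (Mm t *\<^sub>v wv t (x t)) i + vec_index (\<N> t *\<^sub>v f t (x t) (Uc inverse t (x t))) i)) (at t within I)"
proof -
  have x: "x s \<in> carrier_vec n" if "s \<in> I" for s using s that by (simp add: sol_def)
  have xd: "((\<lambda>s. vec_index (x s) j) has_real_derivative vec_index (Gc inverse t (x t)) j) (at t within I)" if "j < n" for j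
    using s t that by (simp add: sol_def)
  define u where "u = Uc inverse t (x t)"
  have u: "u \<in> carrier_vec m" unfolding u_def by (rule Uc_dim)
  have Ax: "A *\<^sub>v x t \<in> carrier_vec n" by (rule mult_mat_vec_carrier[OF dims(1) x[OF t]])
  have Bu: "(B * L t) *\<^sub>v u \<in> carrier_vec n" by (rule mult_mat_vec_carrier[OF BL_dim u])
  have fu: "f t (x t) u \<in> carrier_vec n" by (rule f_dim[OF x[OF t] u])
  have AB: "A *\<^sub>v x t + (B * L t) *\<^sub>v u \<in> carrier_vec n" by (rule add_carrier_vec[OF Ax Bu])
  have G: "Gc inverse t (x t) = A *\<^sub>v x t + (B * L t) *\<^sub>v u + f t (x t) u" by (simp only: Gc_def u_def)
  have eq: "vec_index (\<N> s *\<^sub>v x s) i = (\<Sum>j<n. \<N> s $$ (i,j) * vec_index (x s) j)" if "s \<in> I" for s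
    by (rule mult_mat_vec_index[OF N_dim x[OF that] i])
  have "((\<lambda>s. \<Sum>j<n. \<N> s $$ (i,j) * vec_index (x s) j) has_real_derivative
     (\<Sum>j<n. deriv (\<lambda>s. \<N> s $$ (i,j)) t * vec_index (x t) j + vec_index (Gc inverse t (x t)) j * \<N> t $$ (i,j))) (at t within I)"
    by (intro DERIV_sum DERIV_mult has_field_derivative_at_within[OF N_C1(1)[OF i]] xd) simp_all
  then have D1: "((\<lambda>s. vec_index (\<N> s *\<^sub>v x s) i) has_real_derivative
     (\<Sum>j<n. deriv (\<lambda>s. \<N> s $$ (i,j)) t * vec_index (x t) j + vec_index (Gc inverse t (x t)) j * \<N> t $$ (i,j))) (at t within I)"
    unfolding has_field_derivative_def by (rule has_derivative_transform[OF t, rotated]) (rule eq)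
  have d1: "(\<Sum>j<n. deriv (\<lambda>s. \<N> s $$ (i,j)) t * vec_index (x t) j) = vec_index (mderiv \<N> t *\<^sub>v x t) i"
    unfolding mult_mat_vec_index[OF Nd_dim x[OF t] i] by (rule sum.cong[OF refl]) (simp add: Nd_index[OF i])
  have d2: "(\<Sum>j<n. vec_index (Gc inverse t (x t)) j * \<N> t $$ (i,j)) = vec_index (\<N> t *\<^sub>v Gc inverse t (x t)) i"
    unfolding mult_mat_vec_index[OF N_dim Gc_dim[OF x[OF t]] i] by (rule sum.cong[OF refl]) (rule mult.commute)
  have NG: "\<N> t *\<^sub>v Gc inverse t (x t) = (\<N> t * A) *\<^sub>v x t + 0\<^sub>v d + \<N> t *\<^sub>v f t (x t) u"
    unfolding G mult_add_distrib_mat_vec[OF N_dim AB fu] mult_add_distrib_mat_vec[OF N_dim Ax Bu]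
      NBLu[OF u_def[unfolded Uc_def] Er_dim] assoc_mult_mat_vec[OF N_dim dims(1) x[OF t]] ..
  define w where "w = wv t (x t)"
  have w: "w \<in> carrier_vec n" unfolding w_def by (rule wv_dim[OF x[OF t]])
  have Ne: "\<N> t *\<^sub>v x t \<in> carrier_vec d" by (rule Nx_dim[OF x[OF t]])
  have Vn: "V *\<^sub>v (\<N> t *\<^sub>v x t) \<in> carrier_vec n" by (rule VNx_dim[OF x[OF t]])
  have "Mm t *\<^sub>v x t = Mm t *\<^sub>v (V *\<^sub>v (\<N> t *\<^sub>v x t) + w)"
    unfolding w_def x_split[OF x[OF t], symmetric] ..
  also have "\<dots> = Mm t *\<^sub>v (V *\<^sub>v (\<N> t *\<^sub>v x t)) + Mm t *\<^sub>v w" by (rule mult_add_distrib_mat_vec[OF Mm_dim Vn w])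
  also have "Mm t *\<^sub>v (V *\<^sub>v (\<N> t *\<^sub>v x t)) = (Mm t * V) *\<^sub>v (\<N> t *\<^sub>v x t)" by (rule assoc_mult_mat_vec[OF Mm_dim V_dim Ne, symmetric])
  finally have Mx: "Mm t *\<^sub>v x t = (Mm t * V) *\<^sub>v (\<N> t *\<^sub>v x t) + Mm t *\<^sub>v w" .
  have Mx2: "Mm t *\<^sub>v x t = (\<N> t * A) *\<^sub>v x t + mderiv \<N> t *\<^sub>v x t"
    unfolding Mm_def by (rule add_mult_distrib_mat_vec[OF NA_dim Nd_dim x[OF t]])
  have idx: "vec_index (a + b) i = vec_index a i + vec_index b i" if "b \<in> carrier_vec d" for a b :: "real vec"
    using i carrier_vecD[OF that] by (intro index_add_vec(1)) simp
  have c1: "mderiv \<N> t *\<^sub>v x t \<in> carrier_vec d" by (rule mult_mat_vec_carrier[OF Nd_dim x[OF t]])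
  have c2: "\<N> t *\<^sub>v f t (x t) u \<in> carrier_vec d" by (rule mult_mat_vec_carrier[OF N_dim fu])
  have c3: "Mm t *\<^sub>v w \<in> carrier_vec d" by (rule mult_mat_vec_carrier[OF Mm_dim w])
  have "(\<Sum>j<n. deriv (\<lambda>s. \<N> s $$ (i,j)) t * vec_index (x t) j + vec_index (Gc inverse t (x t)) j * \<N> t $$ (i,j))
    = vec_index (mderiv \<N> t *\<^sub>v x t) i + vec_index (\<N> t *\<^sub>v Gc inverse t (x t)) i"
    unfolding sum.distrib d1 d2 ..
  also have "vec_index (\<N> t *\<^sub>v Gc inverse t (x t)) i = vec_index ((\<N> t * A) *\<^sub>v x t) i + 0 + vec_index (\<N> t *\<^sub>v f t (x t) u) i"
    unfolding NG idx[OF c2] idx[OF zero_carrier_vec] index_zero_vec(1)[OF i] ..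
  also have "vec_index (mderiv \<N> t *\<^sub>v x t) i + (vec_index ((\<N> t * A) *\<^sub>v x t) i + 0 + vec_index (\<N> t *\<^sub>v f t (x t) u) i)
    = vec_index (Mm t *\<^sub>v x t) i + vec_index (\<N> t *\<^sub>v f t (x t) u) i"
    unfolding Mx2 idx[OF c1] by linarith
  also have "vec_index (Mm t *\<^sub>v x t) i = vec_index ((Mm t * V) *\<^sub>v (\<N> t *\<^sub>v x t)) i + vec_index (Mm t *\<^sub>v w) i"
    unfolding Mx idx[OF c3] ..
  finally show ?thesis using D1 unfolding u_def w_def by (simp only: add.assoc)
qed

lemma Q_bdd: "\<exists>q\<ge>0. \<forall>t. \<forall>i<d. \<forall>j<d. \<bar>(Mm t * V) $$ (i,j)\<bar> \<le> q"
proof -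
  obtain cm where cm: "cm \<ge> 0" "\<forall>t. \<forall>i<d. \<forall>j<n. \<bar>Mm t $$ (i,j)\<bar> \<le> cm" using Mm_bdd by blast
  obtain cv where cv: "cv \<ge> 0" "\<forall>i<n. \<forall>j<d. \<bar>V $$ (i,j)\<bar> \<le> cv" using mat_entries_bounded[of n d V] by blast
  show ?thesis
  proof (intro exI[of _ "real n * (cm * cv)"] conjI allI impI)
    show "real n * (cm * cv) \<ge> 0" using cm(1) cv(1) by simp
    fix t i j assume ij: "i < d" "j < d"
    have "\<bar>\<Sum>l<n. Mm t $$ (i,l) * V $$ (l,j)\<bar> \<le> (\<Sum>l<n. \<bar>Mm t $$ (i,l) * V $$ (l,j)\<bar>)" by (rule sum_abs)
    also have "\<dots> \<le> (\<Sum>l<n. cm * cv)"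
      unfolding abs_mult using cm cv ij by (intro sum_mono mult_mono) simp_all
    finally show "\<bar>(Mm t * V) $$ (i,j)\<bar> \<le> real n * (cm * cv)"
      unfolding mult_mat_index[OF Mm_dim V_dim ij] by simp
  qed
qed

lemma eta_bounded:
  "\<exists>Y. \<forall>a b y u. 0 \<le> a \<and> a \<le> b \<and> L2_set (y a) {..<d} \<le> Y0 \<and> (\<forall>t\<in>{a..b}. \<forall>i<d. \<bar>u t i\<bar> \<le> D \<and>
        ((\<lambda>s. y s i) has_real_derivative (\<Sum>j<d. (Mm t * V) $$ (i,j) * y t j) + u t i) (at t within {a..b}))
        \<longrightarrow> L2_set (y b) {..<d} \<le> Y"
proof -
  obtain q where q: "q \<ge> 0" "\<forall>t. \<forall>i<d. \<forall>j<d. \<bar>(Mm t * V) $$ (i,j)\<bar> \<le> q" using Q_bdd by blast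
  obtain M \<mu> where M: "M > 0" "\<mu> > 0" and st: "\<forall>\<eta> t0. t0 \<ge> 0 \<and> (\<forall>t\<ge>t0. \<eta> t \<in> carrier_vec d \<and> vec_has_deriv \<eta> ((Mm t * V) *\<^sub>v \<eta> t) (at t within {t0..}))
        \<longrightarrow> (\<forall>t\<ge>t0. vnorm (\<eta> t) \<le> M * exp (- \<mu> * (t - t0)) * vnorm (\<eta> t0))"
    using P4 unfolding unif_exp_stable_def Q_eq by blast
  show ?thesis
  proof (rule exp_stable_bounded_input[where Q = "\<lambda>t i j. (Mm t * V) $$ (i,j)" and q = q and M = M and \<mu> = \<mu>])
    show "continuous_on {0..} (\<lambda>t. (Mm t * V) $$ (i,j))" if "i < d" "j < d" for i j
      by (rule continuous_on_subset[OF Q_cont[OF that]]) simp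
    show "\<bar>(Mm t * V) $$ (i,j)\<bar> \<le> q" if "i < d" "j < d" for t i j using q that by blast
    fix z :: "real \<Rightarrow> nat \<Rightarrow> real" and t0 t :: real
    assume t0: "0 \<le> t0" "t0 \<le> t" and z: "\<And>t i. t0 \<le> t \<Longrightarrow> i < d \<Longrightarrow>
        ((\<lambda>s. z s i) has_real_derivative (\<Sum>j<d. (Mm t * V) $$ (i,j) * z t j)) (at t within {t0..})"
    define \<eta> where "\<eta> t = vec d (z t)" for t
    have \<eta>d: "\<eta> t \<in> carrier_vec d" for t by (simp add: \<eta>_def)
    have \<eta>i: "vec_index (\<eta> t) i = z t i" if "i < d" for t i unfolding \<eta>_def by (rule index_vec[OF that])
    have "vec_has_deriv \<eta> ((Mm t * V) *\<^sub>v \<eta> t) (at t within {t0..})" if "t0 \<le> t" for t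
      unfolding vec_has_deriv_iff[OF mult_mat_vec_carrier[OF Q_dim \<eta>d]]
    proof (intro allI impI)
      fix i assume i: "i < d"
      have "(\<Sum>j<d. (Mm t * V) $$ (i,j) * z t j) = vec_index ((Mm t * V) *\<^sub>v \<eta> t) i"
        unfolding mult_mat_vec_index[OF Q_dim \<eta>d i] by (rule sum.cong[OF refl]) (simp add: \<eta>i)
      then show "((\<lambda>s. vec_index (\<eta> s) i) has_real_derivative vec_index ((Mm t * V) *\<^sub>v \<eta> t) i) (at t within {t0..})"
        unfolding \<eta>i[OF i] using z[OF that i] by simp
    qed
    then have "vnorm (\<eta> t) \<le> M * exp (- \<mu> * (t - t0)) * vnorm (\<eta> t0)" using st t0 \<eta>d by blast
    moreover have "vnorm (\<eta> s) = L2_set (z s) {..<d}" for s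
      unfolding vnorm_eq[OF \<eta>d] by (rule L2_set_cong[OF refl]) (simp add: \<eta>i)
    ultimately show "L2_set (z t) {..<d} \<le> M * exp (- \<mu> * (t - t0)) * L2_set (z t0) {..<d}" by simp
  qed (use q M in simp_all)
qed

text \<open>The constant depends only on the bound of the output derivatives and on the size of the
  initial state, not on the interval or the solution. The funnel supplies the bound on the output
  derivatives later.\<close>

lemma state_bound:
  assumes co: "co \<ge> 0"
  shows "\<exists>X. \<forall>a b x. 0 \<le> a \<and> a \<le> b \<and> sol {a..b} x \<and> (\<forall>i<n. \<bar>vec_index (x a) i\<bar> \<le> Y0)
     \<and> (\<forall>t\<in>{a..b}. \<forall>k<r. \<forall>l<p. \<bar>outd (x t) k l\<bar> \<le> co) \<longrightarrow> (\<forall>i<n. \<bar>vec_index (x b) i\<bar> \<le> X)"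
proof -
  obtain c where c0: "c \<ge> 0" and c': "\<forall>t. \<forall>i<d. \<forall>j<n. \<bar>\<N> t $$ (i,j)\<bar> \<le> c"
    "\<forall>t. \<forall>i<n. \<forall>j<n. \<bar>Wt t $$ (i,j)\<bar> \<le> c"
    using lyapunov_bounds by (elim exE conjE)
  note c = c0 c'(1)[rule_format] c'(2)[rule_format]
  obtain cm where cm: "cm \<ge> 0" "\<forall>t. \<forall>i<d. \<forall>j<n. \<bar>Mm t $$ (i,j)\<bar> \<le> cm" using Mm_bdd by blast
  obtain cv where cv: "cv \<ge> 0" "\<forall>i<n. \<forall>j<d. \<bar>V $$ (i,j)\<bar> \<le> cv" using mat_entries_bounded[of n d V] by blast
  obtain cf where cf: "cf \<ge> 0" "\<forall>t x u i. x \<in> carrier_vec n \<longrightarrow> u \<in> carrier_vec m \<longrightarrow> i < n \<longrightarrow> \<bar>vec_index (f t x u) i\<bar> \<le> cf"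
    using f_bound by blast
  define cw where "cw = real n * (c * co)"
  define D where "D = real n * (cm * cw) + real n * (c * cf)"
  define Y1 where "Y1 = real d * (real n * (c * Y0))"
  obtain Y where Y: "\<forall>a b y u. 0 \<le> a \<and> a \<le> b \<and> L2_set (y a) {..<d} \<le> Y1 \<and> (\<forall>t\<in>{a..b}. \<forall>i<d. \<bar>u t i\<bar> \<le> D \<and>
        ((\<lambda>s. y s i) has_real_derivative (\<Sum>j<d. (Mm t * V) $$ (i,j) * y t j) + u t i) (at t within {a..b}))
        \<longrightarrow> L2_set (y b) {..<d} \<le> Y"
    using eta_bounded[of Y1 D] ..
  show ?thesis
  proof (intro exI[of _ "real d * (cv * Y) + cw"] allI impI, elim conjE)
    fix a b x i
    assume ab: "0 \<le> a" "a \<le> b" and s: "sol {a..b} x" and xa: "\<forall>i<n. \<bar>vec_index (x a) i\<bar> \<le> Y0"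
      and o: "\<forall>t\<in>{a..b}. \<forall>k<r. \<forall>l<p. \<bar>outd (x t) k l\<bar> \<le> co" and i: "i < n"
    have x: "x t \<in> carrier_vec n" if "t \<in> {a..b}" for t using s that by (simp add: sol_def)
    have aI: "a \<in> {a..b}" "b \<in> {a..b}" using ab by simp_all
    have wb: "\<bar>vec_index (wv t (x t)) i\<bar> \<le> cw" if "t \<in> {a..b}" "i < n" for t i
      unfolding cw_def by (rule wv_bound[OF x[OF that(1)] c(3) c(1) _ co that(2)]) (use o that in blast)+
    define y where "y t i = vec_index (\<N> t *\<^sub>v x t) i" for t i
    define u where "u t i = vec_index (Mm t *\<^sub>v wv t (x t)) i + vec_index (\<N> t *\<^sub>v f t (x t) (Uc inverse t (x t))) i" for t i
    have "L2_set (y b) {..<d} \<le> Y"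
    proof (rule Y[THEN spec[of _ a], THEN spec[of _ b], THEN spec[of _ y], THEN spec[of _ u], THEN mp], intro conjI ballI allI impI ab)
      have "L2_set (y a) {..<d} \<le> (\<Sum>i<d. \<bar>y a i\<bar>)" by (rule L2_set_le_sum_abs)
      also have "\<dots> \<le> (\<Sum>i<d. real n * (c * Y0))"
        unfolding y_def by (rule sum_mono, rule mult_mat_vec_bound[OF N_dim x[OF aI(1)] _ c(2) _ c(1)]) (use xa in simp_all)
      finally show "L2_set (y a) {..<d} \<le> Y1" by (simp add: Y1_def)
    next
      fix t i assume t: "t \<in> {a..b}" and i: "i < d"
      have "\<bar>vec_index (Mm t *\<^sub>v wv t (x t)) i\<bar> \<le> real n * (cm * cw)"
        by (rule mult_mat_vec_bound[OF Mm_dim wv_dim[OF x[OF t]] i _ wb[OF t] cm(1)]) (use cm(2) i in blast)+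
      moreover have "\<bar>vec_index (\<N> t *\<^sub>v f t (x t) (Uc inverse t (x t))) i\<bar> \<le> real n * (c * cf)"
        by (rule mult_mat_vec_bound[OF N_dim f_dim[OF x[OF t] Uc_dim] i c(2)[OF i] _ c(1)]) (use cf(2) x[OF t] Uc_dim in blast)+
      ultimately show "\<bar>u t i\<bar> \<le> D" unfolding u_def D_def by linarith
      show "((\<lambda>s. y s i) has_real_derivative (\<Sum>j<d. (Mm t * V) $$ (i,j) * y t j) + u t i) (at t within {a..b})"
        unfolding u_def y_def mult_mat_vec_index[OF Q_dim Nx_dim[OF x[OF t]] i, symmetric]
        by (rule Nx_derivative[OF s t i])
    qed
    moreover have "\<bar>y b j\<bar> \<le> L2_set (y b) {..<d}" if "j < d" for j
      unfolding L2_set_def real_sqrt_abs[symmetric] using that by (intro real_sqrt_le_mono member_le_sum) simp_all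
    ultimately have yb: "\<bar>vec_index (\<N> b *\<^sub>v x b) j\<bar> \<le> Y" if "j < d" for j
      unfolding y_def using that order_trans by blast
    have "\<bar>vec_index (V *\<^sub>v (\<N> b *\<^sub>v x b)) i\<bar> \<le> real d * (cv * Y)"
      by (rule mult_mat_vec_bound[OF V_dim Nx_dim[OF x[OF aI(2)]] i _ yb cv(1)]) (use cv(2) i in blast)+
    moreover have "vec_index (x b) i = vec_index (V *\<^sub>v (\<N> b *\<^sub>v x b)) i + vec_index (wv b (x b)) i"
      by (subst x_split[OF x[OF aI(2)], of b], rule index_add_vec(1)) (simp only: carrier_vecD[OF wv_dim[OF x[OF aI(2)]]] i)
    ultimately show "\<bar>vec_index (x b) i\<bar> \<le> real d * (cv * Y) + cw" using wb[OF aI(2) i] by linarith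
  qed
qed

subsection \<open>A priori bounds\<close>

definition Eq :: "real \<Rightarrow> real vec \<Rightarrow> nat \<Rightarrow> real" where
  "Eq t x i = (\<Sum>l<p. (evx inverse t x (errx p i l))\<^sup>2)"

lemma mg_Eq: "mg inverse t x i = 1 - (\<phi> i t)\<^sup>2 * Eq t x i"
  by (simp add: mg_def evx_def ev_margx Pt_0 Eq_def)

lemma Eq_nonneg: "Eq t x i \<ge> 0"
  unfolding Eq_def by (intro sum_nonneg) simp

lemma sol_subset: "sol I x \<Longrightarrow> J \<subseteq> I \<Longrightarrow> sol J x"
  unfolding sol_def using has_field_derivative_subset[of _ _ _ I J] by (simp add: subset_iff)

lemma Eq_bound:
  assumes "lam > 0" "lam \<le> \<phi> i t" "mg inverse t x i > 0"
  shows "Eq t x i \<le> 1 / lam\<^sup>2" "l < p \<Longrightarrow> \<bar>evx inverse t x (errx p i l)\<bar> \<le> 1 / lam"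
proof -
  have "lam\<^sup>2 * Eq t x i \<le> (\<phi> i t)\<^sup>2 * Eq t x i"
    using assms(1,2) Eq_nonneg by (intro mult_right_mono power_mono) auto
  also have "\<dots> < 1" using assms(3) by (simp add: mg_Eq)
  finally have 1: "Eq t x i * lam\<^sup>2 \<le> 1" by (simp add: mult.commute)
  then show e: "Eq t x i \<le> 1 / lam\<^sup>2" using assms(1) by (subst pos_le_divide_eq) simp_all
  assume l: "l < p"
  have "(evx inverse t x (errx p i l))\<^sup>2 \<le> Eq t x i" unfolding Eq_def using l by (intro member_le_sum) simp_all
  also have "\<dots> \<le> (1 / lam)\<^sup>2" using e by (simp add: power_divide)
  finally show "\<bar>evx inverse t x (errx p i l)\<bar> \<le> 1 / lam" using assms(1) abs_le_square_iff[of _ "1 / lam"] by simp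
qed

lemma evx_has_derivative:
  assumes s: "sol I x" and I: "I \<subseteq> {0..}" and t: "t \<in> I" and e: "lower p i e" "i < r"
    and inv: "all_inv (\<lambda>a. evx inverse t (x t) a \<noteq> 0) e"
  shows "((\<lambda>s. evx inverse s (x s) e) has_real_derivative evx inverse t (x t) (ediff e)) (at t within I)"
  unfolding evx_def
proof (rule ev_has_derivative[where i = i and p = p, OF _ _ _ e(1)])
  have t0: "0 \<le> t" using I t by auto
  show "((\<lambda>s. outd (x s) k l) has_real_derivative outd (x t) (Suc k) l) (at t within I)" if "k < i" "l < p" for k l
    using that e(2) by (intro sol_outd_derivative[OF s t]) simp_all
  show "((\<lambda>s. Rt s k l) has_real_derivative Rt t (Suc k) l) (at t within I)" if "k < i" "l < p" for k l
    using that e(2) by (intro has_field_derivative_subset[OF Rt_deriv[OF t0] I]) simp_all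
  show "((\<lambda>s. Pt s j k) has_real_derivative Pt t j (Suc k)) (at t within I)" if "j + k < i" for j k
    using that e(2) by (intro has_field_derivative_subset[OF Pt_deriv[OF t0] I]) simp_all
qed (use inv in \<open>simp add: evx_def\<close>)

lemma phi_derivative:
  assumes "0 \<le> a" "a \<le> t" "i < r"
  shows "(\<phi> i has_real_derivative Pt t i 1) (at t within {a..b})"
proof -
  have "((\<lambda>s. Pt s i 0) has_real_derivative Pt t i (Suc 0)) (at t within {0..})" by (rule Pt_deriv) (use assms in simp_all)
  then show ?thesis unfolding Pt_0 using assms by (auto intro: has_field_derivative_subset)
qed

text \<open>A matrix and its transpose have the same quadratic form, hence the factor 1/2.\<close>

lemma GK_pos:
  assumes e: "e \<in> carrier_vec p"
  shows "\<alpha> / 2 * (\<Sum>l<p. (vec_index e l)\<^sup>2) \<le> (\<Sum>l<p. vec_index e l * vec_index ((C * A ^\<^sub>m (r - 1) * B * L t * K t) *\<^sub>v e) l)"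
proof -
  define M where "M = C * A ^\<^sub>m (r - 1) * B * L t * K t"
  have M: "M \<in> carrier_mat p p" unfolding M_def
    by (rule mult_carrier_mat[OF mult_carrier_mat[OF mult_carrier_mat[OF CA_dim dims(2)] L_dim] K_dim])
  define S where "S = M + transpose_mat M - \<alpha> \<cdot>\<^sub>m 1\<^sub>m p"
  have S: "S \<in> carrier_mat p p" unfolding S_def using M by (intro minus_carrier_mat smult_carrier_mat one_carrier_mat)
  have Si: "S $$ (l,j) = M $$ (l,j) + M $$ (j,l) - (if l = j then \<alpha> else 0)" if "l < p" "j < p" for l j
    unfolding S_def using M that by simp
  have "0 \<le> scalar_prod e (S *\<^sub>v e)" using K_pos[OF e, of t] unfolding S_def M_def .
  also have "scalar_prod e (S *\<^sub>v e) = (\<Sum>l<p. vec_index e l * vec_index (S *\<^sub>v e) l)"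
    unfolding scalar_prod_def using S by (simp add: atLeast0LessThan)
  also have "\<dots> = (\<Sum>l<p. vec_index e l * (\<Sum>j<p. S $$ (l,j) * vec_index e j))"
    by (rule sum.cong[OF refl]) (simp only: mult_mat_vec_index[OF S e] lessThan_iff)
  also have "\<dots> = (\<Sum>l<p. \<Sum>j<p. vec_index e l * M $$ (l,j) * vec_index e j) + (\<Sum>l<p. \<Sum>j<p. vec_index e l * M $$ (j,l) * vec_index e j)
     - (\<Sum>l<p. \<Sum>j<p. if l = j then \<alpha> * (vec_index e l)\<^sup>2 else 0)"
    unfolding sum.distrib[symmetric] sum_subtractf[symmetric] sum_distrib_left
    by (intro sum.cong refl) (simp add: Si algebra_simps power2_eq_square)
  also have "(\<Sum>l<p. \<Sum>j<p. vec_index e l * M $$ (j,l) * vec_index e j) = (\<Sum>l<p. \<Sum>j<p. vec_index e l * M $$ (l,j) * vec_index e j)"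
    by (subst sum.swap) (simp add: ac_simps)
  also have "(\<Sum>l<p. \<Sum>j<p. vec_index e l * M $$ (l,j) * vec_index e j) = (\<Sum>l<p. vec_index e l * vec_index (M *\<^sub>v e) l)"
    by (rule sum.cong[OF refl]) (simp only: mult_mat_vec_index[OF M e] lessThan_iff sum_distrib_left mult.assoc)
  also have "(\<Sum>l<p. \<Sum>j<p. if l = j then \<alpha> * (vec_index e l)\<^sup>2 else 0) = \<alpha> * (\<Sum>l<p. (vec_index e l)\<^sup>2)"
    by (simp add: sum_distrib_left)
  finally show ?thesis unfolding M_def by simp
qed

lemma CA_rhs_last:
  assumes x: "x \<in> carrier_vec n" and l: "l < p"
  shows "vec_index ((C * A ^\<^sub>m (r - 1)) *\<^sub>v Gc iv t x) l = vec_index ((C * A ^\<^sub>m r) *\<^sub>v x) l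
     + vec_index ((C * A ^\<^sub>m (r - 1)) *\<^sub>v f t x (Uc iv t x)) l
     - iv (mg iv t x (r - 1)) * vec_index ((C * A ^\<^sub>m (r - 1) * B * L t * K t) *\<^sub>v Er iv t x (r - 1)) l"
proof -
  let ?e = "Er iv t x (r - 1)" and ?k = "iv (mg iv t x (r - 1))" and ?M = "C * A ^\<^sub>m (r - 1) * (B * L t)"
  have r1: "Suc (r - 1) = r" using r_pos by simp
  have M: "?M \<in> carrier_mat p m" by (rule mult_carrier_mat[OF CA_dim BL_dim])
  have Ke: "K t *\<^sub>v ?e \<in> carrier_vec m" by (rule mult_mat_vec_carrier[OF K_dim Er_dim])
  have Meq: "?M = C * A ^\<^sub>m (r - 1) * B * L t" by (rule assoc_mult_mat[OF CA_dim dims(2) L_dim, symmetric])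
  have MKe: "(?M * K t) *\<^sub>v ?e \<in> carrier_vec p" by (rule mult_mat_vec_carrier[OF mult_carrier_mat[OF M K_dim] Er_dim])
  have "?M *\<^sub>v Uc iv t x = (- ?k) \<cdot>\<^sub>v (?M *\<^sub>v (K t *\<^sub>v ?e))"
    unfolding Uc_def by (rule mult_mat_vec[OF M Ke])
  also have "?M *\<^sub>v (K t *\<^sub>v ?e) = (?M * K t) *\<^sub>v ?e" by (rule assoc_mult_mat_vec[OF M K_dim Er_dim, symmetric])
  finally have MU: "?M *\<^sub>v Uc iv t x = (- ?k) \<cdot>\<^sub>v ((?M * K t) *\<^sub>v ?e)" .
  have cf: "(C * A ^\<^sub>m (r - 1)) *\<^sub>v f t x (Uc iv t x) \<in> carrier_vec p" by (rule mult_mat_vec_carrier[OF CA_dim f_dim[OF x Uc_dim]])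
  have cu: "?M *\<^sub>v Uc iv t x \<in> carrier_vec p" by (rule mult_mat_vec_carrier[OF M Uc_dim])
  have idx: "vec_index (a + b) l = vec_index a l + vec_index b l" if "b \<in> carrier_vec p" for a b :: "real vec"
    using l carrier_vecD[OF that] by (intro index_add_vec(1)) simp
  have "vec_index (?M *\<^sub>v Uc iv t x) l = - ?k * vec_index ((?M * K t) *\<^sub>v ?e) l"
    unfolding MU by (rule index_smult_vec(1)) (simp only: carrier_vecD[OF MKe] l)
  moreover have "(C * A ^\<^sub>m (r - 1)) *\<^sub>v Gc iv t x = (C * A ^\<^sub>m r) *\<^sub>v x + ?M *\<^sub>v Uc iv t x + (C * A ^\<^sub>m (r - 1)) *\<^sub>v f t x (Uc iv t x)"
    using CA_rhs[OF x Uc_dim, of "r - 1" t iv t x] unfolding Gc_def r1 .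
  ultimately show ?thesis unfolding Meq[symmetric] by (simp only: idx[OF cf] idx[OF cu])
qed

section \<open>Bounds uniform over all solutions through one point\<close>

context
  fixes T :: real and \<xi> :: "real vec"
  assumes T: "T > 0" and \<xi>: "\<And>i. i < r \<Longrightarrow> mg inverse T \<xi> i > 0"
begin

text \<open>The bounds below quantify over every end time \<open>b\<close> and every solution from
  the fixed point (T, \<xi>), so that they apply to extensions that differ from a given solution.
  Positivity of \<open>T\<close> keeps the funnel functions away from 0.\<close>

definition from_xi :: "real \<Rightarrow> (real \<Rightarrow> real vec) \<Rightarrow> bool" where
  "from_xi b x \<longleftrightarrow> T \<le> b \<and> sol {T..b} x \<and> x T = \<xi>"

lemma from_xi_restrict: "from_xi b x \<Longrightarrow> T \<le> t \<Longrightarrow> t \<le> b \<Longrightarrow> from_xi t x"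
  unfolding from_xi_def by (auto intro: sol_subset)

lemma from_xi_pos: "from_xi b x \<Longrightarrow> T \<le> t \<Longrightarrow> t \<le> b \<Longrightarrow> i < r \<Longrightarrow> mg inverse t (x t) i > 0"
  unfolding from_xi_def sol_def by auto

lemma from_xi_nz: "from_xi b x \<Longrightarrow> T \<le> t \<Longrightarrow> t \<le> b \<Longrightarrow> i < r \<Longrightarrow> evx inverse t (x t) (margx p i) \<noteq> 0"
  using from_xi_pos[of b x t i] unfolding mg_def by simp

lemma level_less_1:
  assumes "\<beta> > 0" "b \<ge> 0" "i < r"
  shows "max ((\<phi> i T)\<^sup>2 * Eq T \<xi> i) (funnel_level p lam Lam c b \<beta>) < 1"
  using funnel_level_less_1[OF assms(1,2)] \<xi>[OF assms(3)] by (simp add: mg_Eq)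

lemma phi_bounds:
  "\<exists>lam Lam. lam > 0 \<and> (\<forall>t\<ge>T. \<forall>i<r. lam \<le> \<phi> i t \<and> \<phi> i t \<le> Lam \<and> \<bar>Pt t i 1\<bar> \<le> Lam)"
proof -
  obtain lam where lam: "lam > 0" "\<forall>t\<ge>T. \<forall>i<r. lam \<le> \<phi> i t" using phi_lower[OF T] by blast
  obtain c where c: "\<forall>t\<ge>0. \<forall>j<r. \<forall>k. j + k \<le> r \<longrightarrow> \<bar>Pt t j k\<bar> \<le> c" using Pt_bdd by blast
  have "lam \<le> \<phi> i t \<and> \<phi> i t \<le> c \<and> \<bar>Pt t i 1\<bar> \<le> c" if "T \<le> t" "i < r" for t i
  proof -
    have "\<bar>Pt t i 0\<bar> \<le> c" "\<bar>Pt t i 1\<bar> \<le> c" using c that T by simp_all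
    then show ?thesis using lam that by (auto simp: Pt_0)
  qed
  then show ?thesis using lam(1) by blast
qed

text \<open>The next error is bounded by its own funnel, so each gain is estimated without recourse
  to the others. In \<open>funnel_invariance\<close> the Lipschitz part is 0, \<beta> = 1, and
  1/lam^2 bounds the product of e_i and e_{i+1} through half the sum of their squares.\<close>

lemma low_margin:
  assumes i: "Suc i < r"
  shows "\<exists>\<delta>>0. \<forall>b x. from_xi b x \<longrightarrow> \<delta> \<le> mg inverse b (x b) i"
proof -
  obtain lam Lam where lam: "lam > 0" and ph: "\<And>t i. t \<ge> T \<Longrightarrow> i < r \<Longrightarrow> lam \<le> \<phi> i t \<and> \<phi> i t \<le> Lam \<and> \<bar>Pt t i 1\<bar> \<le> Lam"
    using phi_bounds by blast
  have ir: "i < r" using i by simp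
  define \<rho> where "\<rho> = max ((\<phi> i T)\<^sup>2 * Eq T \<xi> i) (funnel_level p lam Lam 0 (1 / lam\<^sup>2) 1)"
  have \<rho>: "\<rho> < 1" unfolding \<rho>_def by (rule level_less_1[OF _ _ ir]) simp_all
  have "1 - \<rho> \<le> mg inverse b (x b) i" if fx: "from_xi b x" for b x
  proof -
    have s: "sol {T..b} x" and Tb: "T \<le> b" and xT: "x T = \<xi>" using fx by (auto simp: from_xi_def)
    define e where "e t l = evx inverse t (x t) (errx p i l)" for t l
    define g' where "g' t l = evx inverse t (x t) (ediff (errx p i l))" for t l
    have "(\<phi> i b)\<^sup>2 * Eq b (x b) i \<le> max ((\<phi> i T)\<^sup>2 * Eq T (x T) i) (funnel_level p lam Lam 0 (1 / lam\<^sup>2) 1)"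
    proof (rule funnel_invariance[where e = e and g = e and g' = g' and h = "\<lambda>_ _. 0" and \<phi>' = "\<lambda>t. Pt t i 1", OF _ Tb lam])
      show "Eq t (x t) i = (\<Sum>l<p. (e t l)\<^sup>2)" for t by (simp add: Eq_def e_def)
      show "((\<lambda>s. e s l) has_real_derivative g' t l) (at t within {T..b})" if "T \<le> t" "t \<le> b" "l < p" for t l
        unfolding e_def g'_def
        by (rule evx_has_derivative[OF s _ _ lower_errx[OF that(3)] i])
          (use that T from_xi_nz[OF fx that(1,2)] ir in \<open>auto intro!: all_inv_errx\<close>)
      show "(\<phi> i has_real_derivative Pt t i 1) (at t within {T..b})" if "T \<le> t" "t \<le> b" for t
        by (rule phi_derivative) (use that T ir in simp_all)
      show "lam \<le> \<phi> i t \<and> \<phi> i t \<le> Lam \<and> \<bar>Pt t i 1\<bar> \<le> Lam" if "T \<le> t" "t \<le> b" for t by (rule ph[OF that(1) ir])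
      show "(\<phi> i t)\<^sup>2 * Eq t (x t) i < 1" if "T \<le> t" "t \<le> b" for t
        using from_xi_pos[OF fx that ir] by (simp add: mg_Eq)
      show "(\<Sum>l<p. e t l * g' t l) \<le> 1 / lam\<^sup>2 - 1 * (1 / (1 - (\<phi> i t)\<^sup>2 * Eq t (x t) i)) * Eq t (x t) i" if t: "T \<le> t" "t \<le> b" for t
      proof -
        define e2 where "e2 l = evx inverse t (x t) (errx p (Suc i) l)" for l
        define k where "k = inverse (mg inverse t (x t) i)"
        have g: "g' t l = e2 l - k * e t l" for l
          unfolding g'_def e2_def k_def e_def mg_def evx_def ev_errx_Suc by simp
        have "(\<Sum>l<p. e t l * g' t l) = (\<Sum>l<p. e t l * e2 l) - k * Eq t (x t) i"
          unfolding g Eq_def e_def[symmetric] by (simp add: right_diff_distrib sum_subtractf sum_distrib_left power2_eq_square ac_simps)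
        also have "(\<Sum>l<p. e t l * e2 l) \<le> (\<Sum>l<p. ((e t l)\<^sup>2 + (e2 l)\<^sup>2) / 2)"
        proof (rule sum_mono)
          fix l
          show "e t l * e2 l \<le> ((e t l)\<^sup>2 + (e2 l)\<^sup>2) / 2" using sum_squares_bound[of "e t l" "e2 l"] by simp
        qed
        also have "\<dots> = (Eq t (x t) i + Eq t (x t) (Suc i)) / 2"
          by (simp add: Eq_def e_def e2_def sum.distrib sum_divide_distrib[symmetric])
        also have "\<dots> \<le> 1 / lam\<^sup>2"
        proof -
          have "Eq t (x t) i \<le> 1 / lam\<^sup>2" "Eq t (x t) (Suc i) \<le> 1 / lam\<^sup>2"
            using Eq_bound(1)[OF lam _ from_xi_pos[OF fx t ir]] Eq_bound(1)[OF lam _ from_xi_pos[OF fx t i]] ph[OF t(1) ir] ph[OF t(1) i] by blast+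
          then have "Eq t (x t) i + Eq t (x t) (Suc i) \<le> 2 * (1 / lam\<^sup>2)" by linarith
          then show ?thesis by simp
        qed
        finally show ?thesis unfolding k_def mg_Eq by (simp add: inverse_eq_divide)
      qed
    qed simp_all
    then show ?thesis unfolding mg_Eq \<rho>_def xT by simp
  qed
  then show ?thesis using \<rho> by (intro exI[of _ "1 - \<rho>"]) simp
qed

lemma low_margins:
  "\<exists>\<delta>>0. \<forall>i b x. Suc i < r \<longrightarrow> from_xi b x \<longrightarrow> \<delta> \<le> mg inverse b (x b) i"
proof -
  have "k < r \<Longrightarrow> \<exists>\<delta>>0. \<forall>i<k. \<forall>b x. from_xi b x \<longrightarrow> \<delta> \<le> mg inverse b (x b) i" for k
  proof (induction k)
    case 0 then show ?case by (intro exI[of _ 1]) simp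
  next
    case (Suc k)
    then obtain \<delta> where \<delta>: "\<delta> > 0" "\<forall>i<k. \<forall>b x. from_xi b x \<longrightarrow> \<delta> \<le> mg inverse b (x b) i" by auto
    obtain \<delta>' where \<delta>': "\<delta>' > 0" "\<forall>b x. from_xi b x \<longrightarrow> \<delta>' \<le> mg inverse b (x b) k" using low_margin[OF Suc.prems] by blast
    have "min \<delta> \<delta>' \<le> mg inverse b (x b) i" if "i < Suc k" "from_xi b x" for i b x
      using that \<delta>(2) \<delta>'(2) by (cases "i = k") (auto simp: less_Suc_eq min_le_iff_disj)
    then show ?case using \<delta>(1) \<delta>'(1) by (intro exI[of _ "min \<delta> \<delta>'"]) simp
  qed
  from this[of "r - 1"] obtain \<delta> where \<delta>: "\<delta> > 0" "\<forall>i<r - 1. \<forall>b x. from_xi b x \<longrightarrow> \<delta> \<le> mg inverse b (x b) i"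
    using r_pos by auto
  then have "\<delta> \<le> mg inverse b (x b) i" if "Suc i < r" "from_xi b x" for i b x
    using that by (auto simp: less_diff_conv)
  then show ?thesis using \<delta>(1) by blast
qed

text \<open>The hypothesis \<open>inv\<close> expresses that the only inverses in \<open>e\<close>
  are gains of index below r - 1, the ones already bounded.\<close>

lemma evx_bounded:
  assumes e: "lower p i e" "i \<le> r" and inv: "\<And>Q. (\<And>j. Suc j < r \<Longrightarrow> Q (margx p j)) \<Longrightarrow> all_inv Q e"
  shows "\<exists>M. \<forall>b x. from_xi b x \<longrightarrow> (\<forall>k<i. \<forall>l<p. \<bar>outd (x b) k l\<bar> \<le> c) \<longrightarrow> \<bar>evx inverse b (x b) e\<bar> \<le> M"
proof -
  obtain cR where cR: "\<forall>t\<ge>0. \<forall>k<r. \<forall>l<p. \<bar>Rt t k l\<bar> \<le> cR" using Rt_bdd by blast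
  obtain cP where cP: "\<forall>t\<ge>0. \<forall>j<r. \<forall>k. j + k \<le> r \<longrightarrow> \<bar>Pt t j k\<bar> \<le> cP" using Pt_bdd by blast
  obtain \<delta> where \<delta>: "\<delta> > 0" "\<forall>i b x. Suc i < r \<longrightarrow> from_xi b x \<longrightarrow> \<delta> \<le> mg inverse b (x b) i" using low_margins by blast
  define c' where "c' = max (max c cR) (max cP (1 / \<delta>))"
  obtain M where M: "\<forall>iv Y R P. (\<forall>k<i. \<forall>l<p. \<bar>Y k l\<bar> \<le> c' \<and> \<bar>R k l\<bar> \<le> c') \<and> (\<forall>j k. j + k < i \<longrightarrow> \<bar>P j k\<bar> \<le> c')
      \<and> all_inv (\<lambda>a. \<bar>iv (ev iv Y R P a)\<bar> \<le> c') e \<longrightarrow> \<bar>ev iv Y R P e\<bar> \<le> M"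
    using ev_bounded[OF e(1), of c'] ..
  show ?thesis
  proof (intro exI[of _ M] allI impI)
    fix b x assume fx: "from_xi b x" and o: "\<forall>k<i. \<forall>l<p. \<bar>outd (x b) k l\<bar> \<le> c"
    have b0: "0 \<le> b" using fx T by (simp add: from_xi_def)
    show "\<bar>evx inverse b (x b) e\<bar> \<le> M"
      unfolding evx_def
    proof (rule M[THEN spec, THEN spec, THEN spec, THEN spec, THEN mp], intro conjI allI impI)
      show "\<bar>outd (x b) k l\<bar> \<le> c'" if "k < i" "l < p" for k l using o that by (auto simp: c'_def le_max_iff_disj)
      show "\<bar>Rt b k l\<bar> \<le> c'" if "k < i" "l < p" for k l using cR that e(2) b0 by (auto simp: c'_def le_max_iff_disj)
      show "\<bar>Pt b j k\<bar> \<le> c'" if "j + k < i" for j k using cP that e(2) b0 by (auto simp: c'_def le_max_iff_disj)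
      show "all_inv (\<lambda>a. \<bar>inverse (ev inverse (outd (x b)) (Rt b) (Pt b) a)\<bar> \<le> c') e"
      proof (rule inv)
        fix j assume j: "Suc j < r"
        have "\<delta> \<le> ev inverse (outd (x b)) (Rt b) (Pt b) (margx p j)" using \<delta>(2) j fx unfolding mg_def evx_def by blast
        then have "\<bar>inverse (ev inverse (outd (x b)) (Rt b) (Pt b) (margx p j))\<bar> \<le> 1 / \<delta>"
          using \<delta>(1) by (simp add: inverse_eq_divide frac_le)
        then show "\<bar>inverse (ev inverse (outd (x b)) (Rt b) (Pt b) (margx p j))\<bar> \<le> c'" by (simp add: c'_def)
      qed
    qed
  qed
qed

text \<open>Induction on the order: the output derivative of order i is e_i, bounded by the funnel,
  plus a reference derivative, minus a remainder in lower output derivatives and bounded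
  gains.\<close>

lemma outd_bounded:
  "\<exists>c\<ge>0. \<forall>b x. from_xi b x \<longrightarrow> (\<forall>k<r. \<forall>l<p. \<bar>outd (x b) k l\<bar> \<le> c)"
proof -
  obtain cR where cR: "\<forall>t\<ge>0. \<forall>k<r. \<forall>l<p. \<bar>Rt t k l\<bar> \<le> cR" using Rt_bdd by blast
  obtain lam Lam where lam: "lam > 0" and ph: "\<And>t i. t \<ge> T \<Longrightarrow> i < r \<Longrightarrow> lam \<le> \<phi> i t \<and> \<phi> i t \<le> Lam \<and> \<bar>Pt t i 1\<bar> \<le> Lam"
    using phi_bounds by blast
  have "i \<le> r \<Longrightarrow> \<exists>c\<ge>0. \<forall>b x. from_xi b x \<longrightarrow> (\<forall>k<i. \<forall>l<p. \<bar>outd (x b) k l\<bar> \<le> c)" for i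
  proof (induction i)
    case 0 then show ?case by (intro exI[of _ 0]) simp
  next
    case (Suc i)
    then obtain c where c: "c \<ge> 0" "\<forall>b x. from_xi b x \<longrightarrow> (\<forall>k<i. \<forall>l<p. \<bar>outd (x b) k l\<bar> \<le> c)" by auto
    have "\<exists>M. \<forall>b x. from_xi b x \<longrightarrow> (\<forall>k<i. \<forall>l<p. \<bar>outd (x b) k l\<bar> \<le> c) \<longrightarrow> \<bar>evx inverse b (x b) (rem_expr p i l)\<bar> \<le> M" if "l < p" for l
      by (rule evx_bounded[OF lower_rem[OF that]]) (use Suc.prems in \<open>auto intro!: all_inv_rem\<close>)
    then have "\<forall>l\<in>{..<p}. \<exists>M. \<forall>b x. from_xi b x \<longrightarrow> (\<forall>k<i. \<forall>l<p. \<bar>outd (x b) k l\<bar> \<le> c) \<longrightarrow> \<bar>evx inverse b (x b) (rem_expr p i l)\<bar> \<le> M" by simp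
    from bchoice[OF this] obtain M where M: "\<forall>l\<in>{..<p}. \<forall>b x. from_xi b x \<longrightarrow> (\<forall>k<i. \<forall>l<p. \<bar>outd (x b) k l\<bar> \<le> c) \<longrightarrow> \<bar>evx inverse b (x b) (rem_expr p i l)\<bar> \<le> M l" ..
    define c' where "c' = max c (1 / lam + cR + (\<Sum>l<p. \<bar>M l\<bar>))"
    have "\<bar>outd (x b) k l\<bar> \<le> c'" if fx: "from_xi b x" and k: "k < Suc i" and l: "l < p" for b x k l
    proof (cases "k = i")
      case True
      have Tb: "T \<le> b" using fx by (simp add: from_xi_def)
      have ir: "i < r" using Suc.prems by simp
      have "\<bar>evx inverse b (x b) (errx p i l)\<bar> \<le> 1 / lam"
        by (rule Eq_bound(2)[OF lam _ from_xi_pos[OF fx Tb order_refl ir] l]) (use ph[OF Tb ir] in simp)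
      moreover have "\<bar>Rt b i l\<bar> \<le> cR" using cR ir l Tb T by simp
      moreover have "\<bar>evx inverse b (x b) (rem_expr p i l)\<bar> \<le> M l" using M c(2) fx l by (simp only: lessThan_iff Ball_def) blast
      moreover have "\<bar>M l\<bar> \<le> (\<Sum>l<p. \<bar>M l\<bar>)" using l by (intro member_le_sum) simp_all
      moreover have "outd (x b) i l = evx inverse b (x b) (errx p i l) + Rt b i l - evx inverse b (x b) (rem_expr p i l)"
        unfolding evx_def ev_errx by simp
      ultimately show ?thesis unfolding True c'_def by linarith
    next
      case False
      then have "\<bar>outd (x b) k l\<bar> \<le> c" using c(2) fx k l by (simp add: less_Suc_eq)
      then show ?thesis by (simp add: c'_def)
    qed
    then show ?case using c(1) by (intro exI[of _ c']) (simp add: c'_def le_max_iff_disj)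
  qed
  then show ?thesis by simp
qed

lemma states_bounded: "\<exists>X. \<forall>b x. from_xi b x \<longrightarrow> (\<forall>i<n. \<bar>vec_index (x b) i\<bar> \<le> X)"
proof -
  obtain c where c: "c \<ge> 0" "\<forall>b x. from_xi b x \<longrightarrow> (\<forall>k<r. \<forall>l<p. \<bar>outd (x b) k l\<bar> \<le> c)" using outd_bounded by blast
  define Y0 where "Y0 = (\<Sum>i<n. \<bar>vec_index \<xi> i\<bar>)"
  obtain X where X: "\<forall>a b x. 0 \<le> a \<and> a \<le> b \<and> sol {a..b} x \<and> (\<forall>i<n. \<bar>vec_index (x a) i\<bar> \<le> Y0)
     \<and> (\<forall>t\<in>{a..b}. \<forall>k<r. \<forall>l<p. \<bar>outd (x t) k l\<bar> \<le> c) \<longrightarrow> (\<forall>i<n. \<bar>vec_index (x b) i\<bar> \<le> X)"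
    using state_bound[OF c(1), of Y0] ..
  have "\<forall>i<n. \<bar>vec_index (x b) i\<bar> \<le> X" if fx: "from_xi b x" for b x
  proof (rule X[THEN spec, THEN spec, THEN spec, THEN mp], intro conjI)
    show "0 \<le> T" using T by simp
    show "T \<le> b" "sol {T..b} x" using fx by (simp_all add: from_xi_def)
    have xT: "x T = \<xi>" using fx by (simp add: from_xi_def)
    show "\<forall>i<n. \<bar>vec_index (x T) i\<bar> \<le> Y0" unfolding xT Y0_def by (intro allI impI member_le_sum) simp_all
    show "\<forall>t\<in>{T..b}. \<forall>k<r. \<forall>l<p. \<bar>outd (x t) k l\<bar> \<le> c"
    proof
      fix t assume "t \<in> {T..b}"
      then have "from_xi t x" by (intro from_xi_restrict[OF fx]) simp_all
      then show "\<forall>k<r. \<forall>l<p. \<bar>outd (x t) k l\<bar> \<le> c" using c(2) by blast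
    qed
  qed
  then show ?thesis by blast
qed

text \<open>The reference derivative of order r - 1 is the Lipschitz part \<open>h\<close>. The
  bounded drift \<open>cs\<close> collects C A^r x, C A^(r-1) f and the derivative of the remainder;
  the first of these is why the whole state has to be bounded beforehand. The rate \<alpha>/2 comes
  from \<open>GK_pos\<close>.\<close>

lemma top_margin: "\<exists>\<delta>>0. \<forall>b x. from_xi b x \<longrightarrow> \<delta> \<le> mg inverse b (x b) (r - 1)"
proof -
  define q where "q = r - 1"
  have q: "Suc q = r" "q < r" using r_pos by (simp_all add: q_def)
  obtain lam Lam where lam: "lam > 0" and ph: "\<And>t i. t \<ge> T \<Longrightarrow> i < r \<Longrightarrow> lam \<le> \<phi> i t \<and> \<phi> i t \<le> Lam \<and> \<bar>Pt t i 1\<bar> \<le> Lam"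
    using phi_bounds by blast
  obtain c where c: "c \<ge> 0" "\<forall>b x. from_xi b x \<longrightarrow> (\<forall>k<r. \<forall>l<p. \<bar>outd (x b) k l\<bar> \<le> c)" using outd_bounded by blast
  obtain X where X: "\<forall>b x. from_xi b x \<longrightarrow> (\<forall>i<n. \<bar>vec_index (x b) i\<bar> \<le> X)" using states_bounded ..
  obtain ca where ca: "ca \<ge> 0" "\<forall>i<p. \<forall>j<n. \<bar>(C * A ^\<^sub>m r) $$ (i,j)\<bar> \<le> ca" using mat_entries_bounded[of p n "C * A ^\<^sub>m r"] by blast
  obtain cb where cb: "cb \<ge> 0" "\<forall>i<p. \<forall>j<n. \<bar>(C * A ^\<^sub>m q) $$ (i,j)\<bar> \<le> cb" using mat_entries_bounded[of p n "C * A ^\<^sub>m q"] by blast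
  obtain cf where cf: "cf \<ge> 0" "\<forall>t x u i. x \<in> carrier_vec n \<longrightarrow> u \<in> carrier_vec m \<longrightarrow> i < n \<longrightarrow> \<bar>vec_index (f t x u) i\<bar> \<le> cf"
    using f_bound by blast
  obtain cl where cl: "cl \<ge> 0" "\<forall>s\<ge>0. \<forall>t\<ge>0. \<forall>l<p. \<bar>Rt s (r - 1) l - Rt t (r - 1) l\<bar> \<le> cl * \<bar>s - t\<bar>" using Rt_lipschitz by blast
  have "\<exists>M. \<forall>b x. from_xi b x \<longrightarrow> (\<forall>k<r. \<forall>l<p. \<bar>outd (x b) k l\<bar> \<le> c) \<longrightarrow> \<bar>evx inverse b (x b) (ediff (rem_expr p q l))\<bar> \<le> M" if "l < p" for l
  proof (rule evx_bounded)
    show "lower p r (ediff (rem_expr p q l))" using lower_ediff[OF lower_rem[OF that, of q]] unfolding q(1) .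
    show "all_inv Q (ediff (rem_expr p q l))" if "\<And>j. Suc j < r \<Longrightarrow> Q (margx p j)" for Q
      by (rule all_inv_ediff[OF all_inv_rem]) (use that q in simp)
  qed simp
  then have "\<forall>l\<in>{..<p}. \<exists>M. \<forall>b x. from_xi b x \<longrightarrow> (\<forall>k<r. \<forall>l<p. \<bar>outd (x b) k l\<bar> \<le> c) \<longrightarrow> \<bar>evx inverse b (x b) (ediff (rem_expr p q l))\<bar> \<le> M" by simp
  from bchoice[OF this] obtain M where M: "\<forall>l\<in>{..<p}. \<forall>b x. from_xi b x \<longrightarrow> (\<forall>k<r. \<forall>l<p. \<bar>outd (x b) k l\<bar> \<le> c) \<longrightarrow> \<bar>evx inverse b (x b) (ediff (rem_expr p q l))\<bar> \<le> M l" ..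
  define cs where "cs = real n * (ca * max 0 X) + real n * (cb * cf) + (\<Sum>l<p. \<bar>M l\<bar>)"
  have cs: "cs \<ge> 0" unfolding cs_def using ca(1) cb(1) cf(1) by (intro add_nonneg_nonneg sum_nonneg) simp_all
  define D where "D = real p * (1 / lam * cs)"
  have D: "D \<ge> 0" unfolding D_def using cs lam by simp
  define \<rho> where "\<rho> = max ((\<phi> q T)\<^sup>2 * Eq T \<xi> q) (funnel_level p lam Lam cl D (\<alpha> / 2))"
  have \<rho>: "\<rho> < 1" unfolding \<rho>_def by (rule level_less_1[OF _ D q(2)]) (use alpha_pos in simp)
  have "1 - \<rho> \<le> mg inverse b (x b) q" if fx: "from_xi b x" for b x
  proof -
    have s: "sol {T..b} x" and Tb: "T \<le> b" and xT: "x T = \<xi>" using fx by (auto simp: from_xi_def)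
    have xd: "x t \<in> carrier_vec n" if "t \<in> {T..b}" for t using s that by (simp add: sol_def)
    define e where "e t l = evx inverse t (x t) (errx p q l)" for t l
    define g where "g t l = outd (x t) q l + evx inverse t (x t) (rem_expr p q l)" for t l
    define g' where "g' t l = vec_index ((C * A ^\<^sub>m q) *\<^sub>v Gc inverse t (x t)) l + evx inverse t (x t) (ediff (rem_expr p q l))" for t l
    have "(\<phi> q b)\<^sup>2 * Eq b (x b) q \<le> max ((\<phi> q T)\<^sup>2 * Eq T (x T) q) (funnel_level p lam Lam cl D (\<alpha> / 2))"
    proof (rule funnel_invariance[where e = e and g = g and g' = g' and h = "\<lambda>t. Rt t q" and \<phi>' = "\<lambda>t. Pt t q 1", OF _ Tb lam _ D])
      show "Eq t (x t) q = (\<Sum>l<p. (e t l)\<^sup>2)" for t by (simp add: Eq_def e_def)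
      show "\<alpha> / 2 > 0" using alpha_pos by simp
      show "e t l = g t l - Rt t q l" for t l unfolding e_def g_def evx_def ev_errx by simp
      show "((\<lambda>s. g s l) has_real_derivative g' t l) (at t within {T..b})" if t: "T \<le> t" "t \<le> b" and l: "l < p" for t l
        unfolding g_def g'_def
      proof (rule DERIV_add)
        have tI: "t \<in> {T..b}" using t by simp
        show "((\<lambda>s. outd (x s) q l) has_real_derivative vec_index ((C * A ^\<^sub>m q) *\<^sub>v Gc inverse t (x t)) l) (at t within {T..b})"
          unfolding outd_def
          by (rule mult_mat_vec_has_derivative[OF CA_dim xd Gc_dim[OF xd[OF tI]] _ tI l]) (use s tI in \<open>simp_all add: sol_def\<close>)
        show "((\<lambda>s. evx inverse s (x s) (rem_expr p q l)) has_real_derivative evx inverse t (x t) (ediff (rem_expr p q l))) (at t within {T..b})"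
        proof (rule evx_has_derivative[OF s _ tI lower_rem[OF l] q(2)])
          show "{T..b} \<subseteq> {0..}" using T by auto
          show "all_inv (\<lambda>a. evx inverse t (x t) a \<noteq> 0) (rem_expr p q l)"
            by (rule all_inv_rem, rule from_xi_nz[OF fx t]) (use q in simp)
        qed
      qed
      show "\<bar>Rt s q l - Rt t q l\<bar> \<le> cl * (s - t)" if "T \<le> t" "t \<le> s" "s \<le> b" "l < p" for s t l
        using cl(2)[rule_format, of s t l] that T unfolding q_def by simp
      show "(\<phi> q has_real_derivative Pt t q 1) (at t within {T..b})" if "T \<le> t" "t \<le> b" for t
        by (rule phi_derivative) (use that T q in simp_all)
      show "lam \<le> \<phi> q t \<and> \<phi> q t \<le> Lam \<and> \<bar>Pt t q 1\<bar> \<le> Lam" if "T \<le> t" "t \<le> b" for t by (rule ph[OF that(1) q(2)])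
      show "(\<phi> q t)\<^sup>2 * Eq t (x t) q < 1" if "T \<le> t" "t \<le> b" for t
        using from_xi_pos[OF fx that q(2)] by (simp add: mg_Eq)
      show "(\<Sum>l<p. e t l * g' t l) \<le> D - \<alpha> / 2 * (1 / (1 - (\<phi> q t)\<^sup>2 * Eq t (x t) q)) * Eq t (x t) q" if t: "T \<le> t" "t \<le> b" for t
      proof -
        have fxt: "from_xi t x" by (rule from_xi_restrict[OF fx t])
        have xt: "x t \<in> carrier_vec n" using xd t by simp
        define k where "k = inverse (mg inverse t (x t) q)"
        have k: "k > 0" unfolding k_def using from_xi_pos[OF fx t q(2)] by simp
        define v where "v l = vec_index ((C * A ^\<^sub>m r) *\<^sub>v x t) l + vec_index ((C * A ^\<^sub>m q) *\<^sub>v f t (x t) (Uc inverse t (x t))) l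
            + evx inverse t (x t) (ediff (rem_expr p q l))" for l
        define w where "w l = vec_index ((C * A ^\<^sub>m (r - 1) * B * L t * K t) *\<^sub>v Er inverse t (x t) q) l" for l
        have g: "g' t l = v l - k * w l" if "l < p" for l
          unfolding g'_def v_def w_def k_def q_def CA_rhs_last[OF xt that] by simp
        have vb: "\<bar>v l\<bar> \<le> cs" if l: "l < p" for l
        proof -
          have "\<bar>vec_index ((C * A ^\<^sub>m r) *\<^sub>v x t) l\<bar> \<le> real n * (ca * max 0 X)"
          proof (rule mult_mat_vec_bound[OF CA_dim xt l _ _ ca(1)])
            show "\<bar>(C * A ^\<^sub>m r) $$ (l,j)\<bar> \<le> ca" if "j < n" for j using ca(2) l that by blast
            show "\<bar>vec_index (x t) j\<bar> \<le> max 0 X" if "j < n" for j using X fxt that by (simp add: le_max_iff_disj)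
          qed
          moreover have "\<bar>vec_index ((C * A ^\<^sub>m q) *\<^sub>v f t (x t) (Uc inverse t (x t))) l\<bar> \<le> real n * (cb * cf)"
          proof (rule mult_mat_vec_bound[OF CA_dim f_dim[OF xt Uc_dim] l _ _ cb(1)])
            show "\<bar>(C * A ^\<^sub>m q) $$ (l,j)\<bar> \<le> cb" if "j < n" for j using cb(2) l that by blast
            show "\<bar>vec_index (f t (x t) (Uc inverse t (x t))) j\<bar> \<le> cf" if "j < n" for j using cf(2) xt Uc_dim that by blast
          qed
          moreover have "\<bar>evx inverse t (x t) (ediff (rem_expr p q l))\<bar> \<le> M l"
            using M[THEN bspec, of l, THEN spec, THEN spec, THEN mp, OF _ fxt, THEN mp] c(2) fxt l by simp
          moreover have "\<bar>M l\<bar> \<le> (\<Sum>l<p. \<bar>M l\<bar>)" using l by (intro member_le_sum) simp_all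
          ultimately show ?thesis unfolding v_def cs_def by linarith
        qed
        have eb: "\<bar>e t l\<bar> \<le> 1 / lam" if l: "l < p" for l
          unfolding e_def by (rule Eq_bound(2)[OF lam _ from_xi_pos[OF fx t q(2)] l]) (use ph[OF t(1) q(2)] in simp)
        have "(\<Sum>l<p. e t l * g' t l) = (\<Sum>l<p. e t l * v l) - k * (\<Sum>l<p. e t l * w l)"
          by (simp add: g right_diff_distrib sum_subtractf sum_distrib_left ac_simps)
        moreover have "(\<Sum>l<p. e t l * v l) \<le> D"
        proof -
          have "(\<Sum>l<p. e t l * v l) \<le> (\<Sum>l<p. 1 / lam * cs)"
          proof (rule sum_mono)
            fix l assume "l \<in> {..<p}"
            then have l: "l < p" by simp
            have "e t l * v l \<le> \<bar>e t l\<bar> * \<bar>v l\<bar>" unfolding abs_mult[symmetric] by (rule abs_ge_self)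
            also have "\<dots> \<le> 1 / lam * cs" using eb[OF l] vb[OF l] lam by (intro mult_mono) simp_all
            finally show "e t l * v l \<le> 1 / lam * cs" .
          qed
          then show ?thesis by (simp add: D_def)
        qed
        moreover have "\<alpha> / 2 * Eq t (x t) q \<le> (\<Sum>l<p. e t l * w l)"
          using GK_pos[OF Er_dim, of inverse t "x t" q t] unfolding w_def Eq_def e_def by (simp add: Er_def)
        then have "k * (\<alpha> / 2 * Eq t (x t) q) \<le> k * (\<Sum>l<p. e t l * w l)" using k by (intro mult_left_mono) simp_all
        moreover have "\<alpha> / 2 * (1 / (1 - (\<phi> q t)\<^sup>2 * Eq t (x t) q)) * Eq t (x t) q = k * (\<alpha> / 2 * Eq t (x t) q)"
          unfolding k_def mg_Eq by (simp add: inverse_eq_divide)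
        ultimately show ?thesis by linarith
      qed
    qed
    then show ?thesis unfolding mg_Eq \<rho>_def xT by simp
  qed
  then show ?thesis using \<rho> unfolding q_def by (intro exI[of _ "1 - \<rho>"]) simp
qed

lemma apriori:
  "\<exists>\<delta>>0. \<exists>X. \<forall>b x. from_xi b x \<longrightarrow> (\<forall>i<r. \<delta> \<le> mg inverse b (x b) i) \<and> (\<forall>i<n. \<bar>vec_index (x b) i\<bar> \<le> X)"
proof -
  obtain X where X: "\<forall>b x. from_xi b x \<longrightarrow> (\<forall>i<n. \<bar>vec_index (x b) i\<bar> \<le> X)" using states_bounded ..
  obtain \<delta>1 where \<delta>1: "\<delta>1 > 0" "\<forall>i b x. Suc i < r \<longrightarrow> from_xi b x \<longrightarrow> \<delta>1 \<le> mg inverse b (x b) i" using low_margins by blast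
  obtain \<delta>2 where \<delta>2: "\<delta>2 > 0" "\<forall>b x. from_xi b x \<longrightarrow> \<delta>2 \<le> mg inverse b (x b) (r - 1)" using top_margin by blast
  have "min \<delta>1 \<delta>2 \<le> mg inverse b (x b) i" if "i < r" "from_xi b x" for i b x
  proof (cases "Suc i < r")
    case True
    then show ?thesis using \<delta>1(2) that(2) by (simp add: min.coboundedI1)
  next
    case False
    then have "i = r - 1" using that(1) by simp
    then show ?thesis using \<delta>2(2) that(2) by (simp add: min.coboundedI2)
  qed
  then show ?thesis using X \<delta>1(1) \<delta>2(1) by (intro exI[of _ "min \<delta>1 \<delta>2"] conjI exI[of _ X]) simp_all
qed

end

end

section \<open>Extension of solutions\<close>

lemma all_inv_trivial: "(\<And>a. Q a) \<Longrightarrow> all_inv Q e"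
  by (induction e) auto

text \<open>Gives one-sided derivatives at the ends from the integral of the continuous
  \<open>h\<close>; it adds the right end point to a solution on a half-open interval.\<close>

lemma derivative_within_closed_interval:
  fixes g h :: "real \<Rightarrow> real"
  assumes gc: "continuous_on {a..b} g" and hc: "continuous_on {a..b} h"
    and d: "\<And>t. a < t \<Longrightarrow> t < b \<Longrightarrow> (g has_real_derivative h t) (at t)" and t: "t \<in> {a..b}"
  shows "(g has_real_derivative h t) (at t within {a..b})"
proof -
  have int: "(h has_integral (g s - g a)) {a..s}" if "s \<in> {a..b}" for s
  proof (rule fundamental_theorem_of_calculus_interior)
    show "a \<le> s" using that by simp
    show "continuous_on {a..s} g" by (rule continuous_on_subset[OF gc]) (use that in auto)
    show "(g has_vector_derivative h u) (at u)" if "u \<in> {a<..<s}" for u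
      using d[of u] that \<open>s \<in> {a..b}\<close> by (auto simp: has_real_derivative_iff_has_vector_derivative)
  qed
  have eq: "g s = g a + integral {a..s} h" if "s \<in> {a..b}" for s
    using integral_unique[OF int[OF that]] by simp
  have "((\<lambda>s. g a + integral {a..s} h) has_real_derivative h t) (at t within {a..b})"
    using integral_has_real_derivative[OF hc t] by (auto intro!: derivative_eq_intros)
  then show ?thesis unfolding has_field_derivative_def
    by (rule has_derivative_transform[OF t, rotated]) (rule eq)
qed

lemma has_real_derivative_Un:
  assumes "(g has_real_derivative D) (at t within S)" "(g has_real_derivative D) (at t within S')"
  shows "(g has_real_derivative D) (at t within (S \<union> S'))"
  using assms unfolding has_field_derivative_iff
  unfolding at_within_union by (rule filterlim_sup)

context funnel_system
begin

text \<open>Truncating the margins from below and the state makes the right-hand side continuous and bounded everywhere,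
  without changing it where the margins are at least \<open>\<delta>\<close> and the state is at most \<open>X\<close>.\<close>
definition cinv :: "real \<Rightarrow> real \<Rightarrow> real" where "cinv \<delta> z = inverse (max \<delta> z)"

definition clamp_vec :: "real \<Rightarrow> real vec \<Rightarrow> real vec" where
  "clamp_vec X x = vec n (\<lambda>i. max (- X) (min X (vec_index x i)))"

lemma cinv_cont: "\<delta> > 0 \<Longrightarrow> isCont (cinv \<delta>) z"
  unfolding cinv_def by (intro continuous_intros) auto

lemma cinv_eq: "\<delta> \<le> z \<Longrightarrow> cinv \<delta> z = inverse z"
  by (simp add: cinv_def max_absorb2)

lemma cinv_bound: "\<delta> > 0 \<Longrightarrow> \<bar>cinv \<delta> z\<bar> \<le> 1 / \<delta>"
  unfolding cinv_def by (simp add: inverse_eq_divide frac_le)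

lemma clamp_vec_dim: "clamp_vec X x \<in> carrier_vec n"
  by (simp add: clamp_vec_def)

lemma clamp_vec_index: "i < n \<Longrightarrow> vec_index (clamp_vec X x) i = max (- X) (min X (vec_index x i))"
  by (simp add: clamp_vec_def)

lemma clamp_vec_eq:
  assumes "x \<in> carrier_vec n" "\<And>i. i < n \<Longrightarrow> \<bar>vec_index x i\<bar> \<le> X"
  shows "clamp_vec X x = x"
proof (rule eq_vecI)
  show "dim_vec (clamp_vec X x) = dim_vec x" using carrier_vecD[OF assms(1)] by (simp add: clamp_vec_def)
  fix i assume "i < dim_vec x"
  then have i: "i < n" using carrier_vecD[OF assms(1)] by simp
  show "vec_index (clamp_vec X x) i = vec_index x i"
    unfolding clamp_vec_index[OF i] using assms(2)[OF i] by (simp add: abs_le_iff)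
qed

lemma evx_cinv:
  assumes "\<And>j. j < i \<Longrightarrow> \<delta> \<le> mg inverse t x j"
  shows "mg (cinv \<delta>) t x i = mg inverse t x i" "evx (cinv \<delta>) t x (errx p i l) = evx inverse t x (errx p i l)"
proof -
  have a: "\<And>j. j < i \<Longrightarrow> cinv \<delta> (ev inverse (outd x) (Rt t) (Pt t) (margx p j)) = inverse (ev inverse (outd x) (Rt t) (Pt t) (margx p j))"
    using assms unfolding mg_def evx_def by (rule cinv_eq)
  show "mg (cinv \<delta>) t x i = mg inverse t x i" unfolding mg_def evx_def
    by (rule ev_cong_inv[OF all_inv_margx]) (rule a)
  show "evx (cinv \<delta>) t x (errx p i l) = evx inverse t x (errx p i l)" unfolding evx_def
    by (rule ev_cong_inv[OF all_inv_errx]) (rule a)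
qed

text \<open>Here the bounds concern the truncated margins, which is all that is known about a
  solution of the truncated equation.\<close>

lemma evx_cinv':
  assumes "\<And>j. j < i \<Longrightarrow> \<delta> \<le> mg (cinv \<delta>) t x j"
  shows "mg inverse t x i = mg (cinv \<delta>) t x i"
proof -
  have a: "\<And>j. j < i \<Longrightarrow> inverse (ev (cinv \<delta>) (outd x) (Rt t) (Pt t) (margx p j)) = cinv \<delta> (ev (cinv \<delta>) (outd x) (Rt t) (Pt t) (margx p j))"
    using assms unfolding mg_def evx_def by (intro cinv_eq[symmetric])
  show ?thesis unfolding mg_def evx_def by (rule ev_cong_inv[OF all_inv_margx]) (rule a)
qed

lemma Uc_cinv:
  assumes "\<And>j. j < r \<Longrightarrow> \<delta> \<le> mg inverse t x j"
  shows "Uc (cinv \<delta>) t x = Uc inverse t x" "Gc (cinv \<delta>) t x = Gc inverse t x"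
proof -
  have r1: "r - 1 < r" using r_pos by simp
  have 1: "mg (cinv \<delta>) t x (r - 1) = mg inverse t x (r - 1)" by (rule evx_cinv(1)) (use assms in simp)
  have 2: "Er (cinv \<delta>) t x (r - 1) = Er inverse t x (r - 1)"
    unfolding Er_def by (rule arg_cong[where f = "vec p"], rule ext, rule evx_cinv(2)) (use assms in simp)
  show U: "Uc (cinv \<delta>) t x = Uc inverse t x" unfolding Uc_def 1 2 cinv_eq[OF assms[OF r1]] ..
  show "Gc (cinv \<delta>) t x = Gc inverse t x" unfolding Gc_def U ..
qed

text \<open>Clamped states have bounded output derivatives and truncated inverses are at most
  1/\<delta>. The bound serves twice: for Peano's theorem, and for boundedness of the input along
  global solutions, where the truncation is inactive.\<close>

lemma input_bound:
  assumes \<delta>: "\<delta> > 0"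
  shows "\<exists>c\<ge>0. \<forall>t\<ge>0. \<forall>x i. i < m \<longrightarrow> \<bar>vec_index (Uc (cinv \<delta>) t (clamp_vec X x)) i\<bar> \<le> c"
proof -
  define q where "q = r - 1"
  have q: "Suc q = r" "q < r" using r_pos by (simp_all add: q_def)
  have "\<forall>k\<in>{..<r}. \<exists>c. c \<ge> 0 \<and> (\<forall>i<p. \<forall>j<n. \<bar>(C * A ^\<^sub>m k) $$ (i,j)\<bar> \<le> c)"
    using mat_entries_bounded[of p n] by blast
  from bchoice[OF this] obtain cc where cc: "\<forall>k\<in>{..<r}. cc k \<ge> 0 \<and> (\<forall>i<p. \<forall>j<n. \<bar>(C * A ^\<^sub>m k) $$ (i,j)\<bar> \<le> cc k)" ..
  define co where "co = (\<Sum>k<r. real n * (cc k * \<bar>X\<bar>))"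
  have o: "\<bar>outd (clamp_vec X x) k l\<bar> \<le> co" if "k < r" "l < p" for x k l
  proof -
    have c0: "cc k \<ge> 0" and c1: "\<And>j. j < n \<Longrightarrow> \<bar>(C * A ^\<^sub>m k) $$ (l,j)\<bar> \<le> cc k" using cc that by simp_all
    have "\<bar>outd (clamp_vec X x) k l\<bar> \<le> real n * (cc k * \<bar>X\<bar>)"
      unfolding outd_def
    proof (rule mult_mat_vec_bound[OF CA_dim clamp_vec_dim that(2) c1 _ c0])
      fix j assume "j < n"
      then show "\<bar>vec_index (clamp_vec X x) j\<bar> \<le> \<bar>X\<bar>" unfolding clamp_vec_index[OF \<open>j < n\<close>] by linarith
    qed
    also have "\<dots> \<le> co" unfolding co_def using that cc by (intro member_le_sum) simp_all
    finally show ?thesis .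
  qed
  obtain cR where cR: "\<forall>t\<ge>0. \<forall>k<r. \<forall>l<p. \<bar>Rt t k l\<bar> \<le> cR" using Rt_bdd by blast
  obtain cP where cP: "\<forall>t\<ge>0. \<forall>j<r. \<forall>k. j + k \<le> r \<longrightarrow> \<bar>Pt t j k\<bar> \<le> cP" using Pt_bdd by blast
  define c' where "c' = max (max co cR) (max cP (1 / \<delta>))"
  have "\<exists>M. \<forall>t\<ge>0. \<forall>x. \<bar>evx (cinv \<delta>) t (clamp_vec X x) (errx p q l)\<bar> \<le> M" if l: "l < p" for l
  proof -
    obtain M where M: "\<forall>iv Y R P. (\<forall>k<r. \<forall>l<p. \<bar>Y k l\<bar> \<le> c' \<and> \<bar>R k l\<bar> \<le> c') \<and> (\<forall>j k. j + k < r \<longrightarrow> \<bar>P j k\<bar> \<le> c')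
      \<and> all_inv (\<lambda>a. \<bar>iv (ev iv Y R P a)\<bar> \<le> c') (errx p q l) \<longrightarrow> \<bar>ev iv Y R P (errx p q l)\<bar> \<le> M"
      using ev_bounded[OF lower_errx[OF l, of q], of c'] unfolding q(1) ..
    show ?thesis
    proof (intro exI[of _ M] allI impI)
      fix t :: real and x assume t: "0 \<le> t"
      show "\<bar>evx (cinv \<delta>) t (clamp_vec X x) (errx p q l)\<bar> \<le> M"
        unfolding evx_def
      proof (rule M[THEN spec, THEN spec, THEN spec, THEN spec, THEN mp], intro conjI allI impI)
        show "\<bar>outd (clamp_vec X x) k l\<bar> \<le> c'" if "k < r" "l < p" for k l using o[OF that, of x] by (simp add: c'_def le_max_iff_disj)
        show "\<bar>Rt t k l\<bar> \<le> c'" if "k < r" "l < p" for k l using cR that t by (simp add: c'_def le_max_iff_disj)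
        show "\<bar>Pt t j k\<bar> \<le> c'" if "j + k < r" for j k using cP that t by (simp add: c'_def le_max_iff_disj)
        show "all_inv (\<lambda>a. \<bar>cinv \<delta> (ev (cinv \<delta>) (outd (clamp_vec X x)) (Rt t) (Pt t) a)\<bar> \<le> c') (errx p q l)"
          by (rule all_inv_trivial) (use cinv_bound[OF \<delta>] in \<open>simp add: c'_def le_max_iff_disj\<close>)
      qed
    qed
  qed
  then have "\<forall>l\<in>{..<p}. \<exists>M. \<forall>t\<ge>0. \<forall>x. \<bar>evx (cinv \<delta>) t (clamp_vec X x) (errx p q l)\<bar> \<le> M" by simp
  from bchoice[OF this] obtain M where M: "\<forall>l\<in>{..<p}. \<forall>t\<ge>0. \<forall>x. \<bar>evx (cinv \<delta>) t (clamp_vec X x) (errx p q l)\<bar> \<le> M l" ..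
  define ce where "ce = (\<Sum>l<p. \<bar>M l\<bar>)"
  have ce0: "ce \<ge> 0" unfolding ce_def by (intro sum_nonneg) simp
  have ce: "\<bar>vec_index (Er (cinv \<delta>) t (clamp_vec X x) q) l\<bar> \<le> ce" if "0 \<le> t" "l < p" for t x l
  proof -
    have "\<bar>evx (cinv \<delta>) t (clamp_vec X x) (errx p q l)\<bar> \<le> M l" using M that by simp
    also have "\<dots> \<le> \<bar>M l\<bar>" by (rule abs_ge_self)
    also have "\<dots> \<le> ce" unfolding ce_def using that by (intro member_le_sum) simp_all
    finally show ?thesis unfolding Er_def using that by simp
  qed
  have dK: "dim_row (K t) = m" "dim_col (K t) = p" for t using carrier_matD[OF K_dim[of t]] by blast+
  obtain ck where ck: "\<forall>t\<in>UNIV. \<forall>i<m. \<forall>j<p. \<bar>K t $$ (i,j)\<bar> \<le> ck" using K_bdd unfolding mat_bounded_def dK ..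
  define ck' where "ck' = max 0 ck"
  have ck': "ck' \<ge> 0" "\<And>t i j. i < m \<Longrightarrow> j < p \<Longrightarrow> \<bar>K t $$ (i,j)\<bar> \<le> ck'" using ck by (simp_all add: ck'_def le_max_iff_disj)
  show ?thesis
  proof (intro exI[of _ "1 / \<delta> * (real p * (ck' * ce))"] conjI allI impI)
    show "1 / \<delta> * (real p * (ck' * ce)) \<ge> 0" using \<delta> ck'(1) ce0 by simp
    fix t :: real and x i assume t: "0 \<le> t" and i: "i < m"
    let ?e = "Er (cinv \<delta>) t (clamp_vec X x) q"
    have b: "\<bar>vec_index (K t *\<^sub>v ?e) i\<bar> \<le> real p * (ck' * ce)"
      by (rule mult_mat_vec_bound[OF K_dim Er_dim i ck'(2)[OF i] ce[OF t] ck'(1)])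
    have "vec_index (Uc (cinv \<delta>) t (clamp_vec X x)) i = - cinv \<delta> (mg (cinv \<delta>) t (clamp_vec X x) q) * vec_index (K t *\<^sub>v ?e) i"
      unfolding Uc_def q_def by (rule index_smult_vec(1)) (simp add: dK i)
    then have "\<bar>vec_index (Uc (cinv \<delta>) t (clamp_vec X x)) i\<bar> = \<bar>cinv \<delta> (mg (cinv \<delta>) t (clamp_vec X x) q)\<bar> * \<bar>vec_index (K t *\<^sub>v ?e) i\<bar>"
      by (simp only: abs_mult abs_minus)
    also have "\<dots> \<le> 1 / \<delta> * (real p * (ck' * ce))"
      using cinv_bound[OF \<delta>] b \<delta> by (intro mult_mono) simp_all
    finally show "\<bar>vec_index (Uc (cinv \<delta>) t (clamp_vec X x)) i\<bar> \<le> 1 / \<delta> * (real p * (ck' * ce))" .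
  qed
qed

lemma BL_bound: "\<exists>c\<ge>0. \<forall>t. \<forall>i<n. \<forall>j<m. \<bar>(B * L t) $$ (i,j)\<bar> \<le> c"
proof -
  obtain cb where cb: "cb \<ge> 0" "\<forall>i<n. \<forall>j<m. \<bar>B $$ (i,j)\<bar> \<le> cb" using mat_entries_bounded[of n m B] by blast
  have "\<exists>c. \<forall>z\<in>{..<m} \<times> {..<m}. \<forall>t\<in>UNIV. \<bar>L t $$ z\<bar> \<le> c"
    by (rule uniform_bound_finite) (use L_bdd in auto)
  then obtain cl where cl: "\<forall>z\<in>{..<m} \<times> {..<m}. \<forall>t\<in>UNIV. \<bar>L t $$ z\<bar> \<le> cl" ..
  have cl': "\<bar>L t $$ (i,j)\<bar> \<le> max 0 cl" if "i < m" "j < m" for i j t using cl that by (auto simp: le_max_iff_disj)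
  show ?thesis
  proof (intro exI[of _ "real m * (cb * max 0 cl)"] conjI allI impI)
    show "real m * (cb * max 0 cl) \<ge> 0" using cb(1) by simp
    fix t i j assume ij: "i < n" "j < m"
    have "\<bar>\<Sum>k<m. B $$ (i,k) * L t $$ (k,j)\<bar> \<le> (\<Sum>k<m. \<bar>B $$ (i,k) * L t $$ (k,j)\<bar>)" by (rule sum_abs)
    also have "\<dots> \<le> (\<Sum>k<m. cb * max 0 cl)"
      unfolding abs_mult using cb cl' ij by (intro sum_mono mult_mono) simp_all
    finally show "\<bar>(B * L t) $$ (i,j)\<bar> \<le> real m * (cb * max 0 cl)" unfolding BL_index[OF ij] by simp
  qed
qed

lemma rhs_bound:
  assumes \<delta>: "\<delta> > 0"
  shows "\<exists>c. \<forall>t\<ge>0. \<forall>x i. i < n \<longrightarrow> \<bar>vec_index (Gc (cinv \<delta>) t (clamp_vec X x)) i\<bar> \<le> c"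
proof -
  obtain cu where cu: "cu \<ge> 0" "\<forall>t\<ge>0. \<forall>x i. i < m \<longrightarrow> \<bar>vec_index (Uc (cinv \<delta>) t (clamp_vec X x)) i\<bar> \<le> cu" using input_bound[OF \<delta>, of X] by blast
  obtain cf where cf: "cf \<ge> 0" "\<forall>t x u i. x \<in> carrier_vec n \<longrightarrow> u \<in> carrier_vec m \<longrightarrow> i < n \<longrightarrow> \<bar>vec_index (f t x u) i\<bar> \<le> cf"
    using f_bound by blast
  obtain ca where ca: "ca \<ge> 0" "\<forall>i<n. \<forall>j<n. \<bar>A $$ (i,j)\<bar> \<le> ca" using mat_entries_bounded[of n n A] by blast
  obtain cb where cb: "cb \<ge> 0" "\<forall>t. \<forall>i<n. \<forall>j<m. \<bar>(B * L t) $$ (i,j)\<bar> \<le> cb" using BL_bound by blast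
  show ?thesis
  proof (intro exI[of _ "real n * (ca * \<bar>X\<bar>) + real m * (cb * cu) + cf"] allI impI)
    fix t :: real and x i assume t: "0 \<le> t" and i: "i < n"
    let ?x = "clamp_vec X x" and ?u = "Uc (cinv \<delta>) t (clamp_vec X x)"
    have "\<bar>vec_index (A *\<^sub>v ?x) i\<bar> \<le> real n * (ca * \<bar>X\<bar>)"
    proof (rule mult_mat_vec_bound[OF dims(1) clamp_vec_dim i _ _ ca(1)])
      show "\<bar>A $$ (i,j)\<bar> \<le> ca" if "j < n" for j using ca(2) i that by blast
      show "\<bar>vec_index ?x j\<bar> \<le> \<bar>X\<bar>" if "j < n" for j unfolding clamp_vec_index[OF that] by linarith
    qed
    moreover have "\<bar>vec_index ((B * L t) *\<^sub>v ?u) i\<bar> \<le> real m * (cb * cu)"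
      by (rule mult_mat_vec_bound[OF BL_dim Uc_dim i _ _ cb(1)]) (use cb(2) cu(2) i t in blast)+
    moreover have "\<bar>vec_index (f t ?x ?u) i\<bar> \<le> cf" using cf(2) clamp_vec_dim Uc_dim i by blast
    ultimately show "\<bar>vec_index (Gc (cinv \<delta>) t ?x) i\<bar> \<le> real n * (ca * \<bar>X\<bar>) + real m * (cb * cu) + cf"
      unfolding Gc_index[OF clamp_vec_dim i] by linarith
  qed
qed

section \<open>Continuation beyond a closed interval and closing at the right end\<close>

lemma glue_derivative:
  assumes T: "0 \<le> T" and J: "{0..T} \<subseteq> J" "J \<subseteq> {0..}" and t: "t \<in> J"
    and l: "t \<le> T \<Longrightarrow> (g has_real_derivative D) (at t within {0..T})"
    and u: "T \<le> t \<Longrightarrow> (g has_real_derivative D) (at t within {T..})"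
  shows "(g has_real_derivative D) (at t within J)"
proof -
  consider "t < T" | "t = T" | "t > T" by linarith
  then show ?thesis
  proof cases
    case 1
    have "at t within J = at t within {0..T}"
      by (rule at_within_nhd[of _ "{..<T}"]) (use 1 J in auto)
    then show ?thesis using l 1 by simp
  next
    case 2
    have "J = {0..T} \<union> (J \<inter> {T..})" using J T by auto
    moreover have "(g has_real_derivative D) (at t within ({0..T} \<union> (J \<inter> {T..})))"
      by (rule has_real_derivative_Un[OF l has_field_derivative_subset[OF u]]) (use 2 in auto)
    ultimately show ?thesis by simp
  next
    case 3
    have "at t within J = at t within (J \<inter> {T..})"
      by (rule at_within_nhd[of _ "{T<..}"]) (use 3 in auto)
    moreover have "(g has_real_derivative D) (at t within (J \<inter> {T..}))"
      by (rule has_field_derivative_subset[OF u]) (use 3 in auto)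
    ultimately show ?thesis by simp
  qed
qed

text \<open>The truncated equation is solved on the whole half-line after \<open>T\<close>. Either
  no truncation level is ever met, or the first time \<open>d\<close> at which one is met is
  positive distance away and the function is a genuine solution up to and including
  \<open>d\<close>. Recording which level is met at \<open>d\<close> prepares a contradiction with
  the a priori bounds.\<close>

lemma extension_step:
  assumes T: "0 \<le> T" and s: "sol {0..T} x" and \<delta>: "\<delta> > 0"
    and m0: "\<And>i. i < r \<Longrightarrow> \<delta> < mg inverse T (x T) i" and X0: "\<And>i. i < n \<Longrightarrow> \<bar>vec_index (x T) i\<bar> < X"
  shows "\<exists>x'. (\<forall>t\<in>{0..T}. x' t = x t) \<and> (sol {0..} x' \<or> (\<exists>d>T. sol {0..d} x' \<and>
     ((\<exists>i<r. mg inverse d (x' d) i \<le> \<delta>) \<or> (\<exists>i<n. X \<le> \<bar>vec_index (x' d) i\<bar>))))"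
proof -
  define F where "F t y i = vec_index (Gc (cinv \<delta>) t (clamp_vec X (vec n y))) i" for t y i
  obtain y where y0: "\<And>i. i < n \<Longrightarrow> y T i = vec_index (x T) i"
    and y: "\<And>t i. T \<le> t \<Longrightarrow> i < n \<Longrightarrow> ((\<lambda>s. y s i) has_real_derivative F t (y t) i) (at t within {T..})"
  proof (rule peano_existence[of T n F "vec_index (x T)"])
    fix \<tau> :: "nat \<Rightarrow> real" and t and Z :: "nat \<Rightarrow> nat \<Rightarrow> real" and z :: "nat \<Rightarrow> real" and i
    assume \<tau>: "\<And>k. T \<le> \<tau> k" "\<tau> \<longlonglongrightarrow> t" and Z: "\<And>j. j < n \<Longrightarrow> (\<lambda>k. Z k j) \<longlonglongrightarrow> z j" and i: "i < n"
    show "(\<lambda>k. F (\<tau> k) (Z k) i) \<longlonglongrightarrow> F t z i"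
      unfolding F_def
    proof (rule Gc_tendsto[OF clamp_vec_dim clamp_vec_dim _ _ \<tau>(2) cinv_cont[OF \<delta>] i])
      show "0 \<le> \<tau> k" for k using \<tau>(1)[of k] T by linarith
      show "(\<lambda>k. vec_index (clamp_vec X (vec n (Z k))) j) \<longlonglongrightarrow> vec_index (clamp_vec X (vec n z)) j" if "j < n" for j
        unfolding clamp_vec_index[OF that] index_vec[OF that] by (intro tendsto_max tendsto_min tendsto_const Z[OF that])
    qed
  next
    obtain c where c: "\<forall>t\<ge>0. \<forall>x i. i < n \<longrightarrow> \<bar>vec_index (Gc (cinv \<delta>) t (clamp_vec X x)) i\<bar> \<le> c" using rhs_bound[OF \<delta>, of X] ..
    show "\<exists>c. \<forall>t\<in>{T..T'}. \<forall>y. \<forall>i<n. \<bar>F t y i\<bar> \<le> c" for T'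
      unfolding F_def by (rule exI[of _ c]) (use c T in simp)
  qed (rule that)
  define x' where "x' t = (if t \<le> T then x t else vec n (y t))" for t
  have xd: "x t \<in> carrier_vec n" if "t \<in> {0..T}" for t using s that by (simp add: sol_def)
  have TI: "T \<in> {0..T}" using T by simp
  have x'lo: "x' t = x t" if "t \<le> T" for t using that by (simp add: x'_def)
  have yT: "vec n (y T) = x T"
    by (rule eq_vecI) (use carrier_vecD[OF xd[OF TI]] y0 in simp_all)
  have x'hi: "x' t = vec n (y t)" if "T \<le> t" for t
  proof (cases "t = T")
    case True then show ?thesis using yT by (simp add: x'_def)
  qed (use that in \<open>simp add: x'_def\<close>)
  have x'd: "x' t \<in> carrier_vec n" if "0 \<le> t" for t
    using xd[of t] that by (cases "t \<le> T") (simp_all add: x'_def)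
  have x'der: "((\<lambda>s. vec_index (x' s) i) has_real_derivative vec_index (Gc (cinv \<delta>) t (clamp_vec X (x' t))) i) (at t within {T..})"
    if t: "T \<le> t" and i: "i < n" for t i
  proof -
    have eq: "vec_index (x' s) i = y s i" if "s \<in> {T..}" for s using x'hi[of s] that i by simp
    have "((\<lambda>s. y s i) has_real_derivative vec_index (Gc (cinv \<delta>) t (clamp_vec X (x' t))) i) (at t within {T..})"
      using y[OF t i] unfolding F_def x'hi[OF t] .
    then show ?thesis unfolding has_field_derivative_def
      by (rule has_derivative_transform[rotated 2]) (use t eq in simp_all)
  qed
  have xc: "continuous_on {T..} (\<lambda>s. vec_index (x' s) i)" if "i < n" for i
    by (rule DERIV_continuous_on[OF x'der[OF _ that]]) simp
  have mc: "continuous_on {T..} (\<lambda>t. mg (cinv \<delta>) t (x' t) j)" if "j < r" for j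
    by (rule continuous_along(2)[OF _ _ xc cinv_cont[OF \<delta>] that]) (use T x'd in auto)
  define ok where "ok t \<longleftrightarrow> (\<forall>i<r. \<delta> \<le> mg (cinv \<delta>) t (x' t) i) \<and> (\<forall>i<n. \<bar>vec_index (x' t) i\<bar> \<le> X)" for t
  have ok_mg: "mg inverse t (x' t) i = mg (cinv \<delta>) t (x' t) i" if "ok t" "i < r" for t i
    by (rule evx_cinv') (use that in \<open>simp add: ok_def\<close>)
  have ok_sol: "sol J x'" if J: "{0..T} \<subseteq> J" "J \<subseteq> {0..}" and o: "\<And>t. t \<in> J \<Longrightarrow> T \<le> t \<Longrightarrow> ok t" for J
    unfolding sol_def
  proof (intro conjI ballI allI impI)
    fix t assume t: "t \<in> J"
    have t0: "0 \<le> t" using t J by auto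
    show "x' t \<in> carrier_vec n" by (rule x'd[OF t0])
    show "mg inverse t (x' t) i > 0" if i: "i < r" for i
    proof (cases "t \<le> T")
      case True
      then show ?thesis using s t0 i unfolding x'lo[OF True] sol_def by simp
    next
      case False
      then have "ok t" using o t by simp
      then show ?thesis using ok_mg[OF _ i] i \<delta> unfolding ok_def by force
    qed
    show "((\<lambda>s. vec_index (x' s) i) has_real_derivative vec_index (Gc inverse t (x' t)) i) (at t within J)" if i: "i < n" for i
    proof (rule glue_derivative[OF T J t])
      assume tT: "t \<le> T"
      then have tI: "t \<in> {0..T}" using t0 by simp
      have "((\<lambda>s. vec_index (x s) i) has_real_derivative vec_index (Gc inverse t (x' t)) i) (at t within {0..T})"
        using s tI i unfolding x'lo[OF tT] sol_def by blast
      then show "((\<lambda>s. vec_index (x' s) i) has_real_derivative vec_index (Gc inverse t (x' t)) i) (at t within {0..T})"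
        unfolding has_field_derivative_def by (rule has_derivative_transform[OF tI, rotated]) (simp add: x'_def)
    next
      assume tT: "T \<le> t"
      have okt: "ok t" by (rule o[OF t tT])
      have "clamp_vec X (x' t) = x' t" by (rule clamp_vec_eq[OF x'd[OF t0]]) (use okt in \<open>simp add: ok_def\<close>)
      moreover have "Gc (cinv \<delta>) t (x' t) = Gc inverse t (x' t)"
        by (rule Uc_cinv(2)) (use okt ok_mg[OF okt] in \<open>simp add: ok_def\<close>)
      ultimately show "((\<lambda>s. vec_index (x' s) i) has_real_derivative vec_index (Gc inverse t (x' t)) i) (at t within {T..})"
        using x'der[OF tT i] by simp
    qed
  qed
  \<comment> \<open>With nonstrict inequalities this set is closed, so its infimum is attained,
    while at an attained level the truncated and the true equation still agree.\<close>
  define bad where "bad = {t\<in>{T..}. \<exists>i<r. mg (cinv \<delta>) t (x' t) i \<le> \<delta>} \<union> {t\<in>{T..}. \<exists>i<n. X \<le> \<bar>vec_index (x' t) i\<bar>}"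
  have ok_good: "ok t" if "T \<le> t" "t \<notin> bad" for t
    using that unfolding bad_def ok_def by (auto simp: not_le less_imp_le)
  show ?thesis
  proof (cases "bad = {}")
    case True
    have "sol {0..} x'" by (rule ok_sol) (use T ok_good True in auto)
    then show ?thesis using x'lo by (intro exI[of _ x']) auto
  next
    case False
    have c1: "closed (\<Union>i\<in>{..<r}. {T..} \<inter> (\<lambda>t. mg (cinv \<delta>) t (x' t) i) -` {..\<delta>})"
      by (intro closed_UN ballI continuous_closed_preimage mc) simp_all
    have c2: "closed (\<Union>i\<in>{..<n}. {T..} \<inter> (\<lambda>t. \<bar>vec_index (x' t) i\<bar>) -` {X..})"
      by (intro closed_UN ballI continuous_closed_preimage continuous_on_rabs xc) simp_all
    have "bad = (\<Union>i\<in>{..<r}. {T..} \<inter> (\<lambda>t. mg (cinv \<delta>) t (x' t) i) -` {..\<delta>}) \<union> (\<Union>i\<in>{..<n}. {T..} \<inter> (\<lambda>t. \<bar>vec_index (x' t) i\<bar>) -` {X..})"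
      unfolding bad_def by auto
    then have clb: "closed bad" using c1 c2 by (simp only: closed_Un)
    have bb: "bdd_below bad" unfolding bad_def by (intro bdd_belowI[of _ T]) auto
    define d where "d = Inf bad"
    have dbad: "d \<in> bad" unfolding d_def by (rule closed_contains_Inf[OF False bb clb])
    have mT: "mg (cinv \<delta>) T (x' T) i = mg inverse T (x T) i" if "i < r" for i
      unfolding x'lo[OF order_refl] by (rule evx_cinv(1)) (use m0 that in \<open>simp add: less_imp_le\<close>)
    have Tbad: "T \<notin> bad"
      unfolding bad_def using mT m0 X0 x'lo[of T] by (auto simp: not_le)
    have dT: "d > T"
    proof -
      have "T \<le> d" using dbad by (auto simp: bad_def)
      moreover have "d \<noteq> T" using dbad Tbad by auto
      ultimately show ?thesis by simp
    qed
    have below: "ok t" if "T \<le> t" "t < d" for t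
      using ok_good[OF that(1)] cInf_lower[OF _ bb, of t] that unfolding d_def by force
    have cl: "closure {T..<d} = {T..d}" using dT by simp
    have okd: "ok d"
      unfolding ok_def
    proof (intro conjI allI impI)
      fix i assume i: "i < r"
      show "\<delta> \<le> mg (cinv \<delta>) d (x' d) i"
        by (rule continuous_ge_on_closure[of "{T..<d}" "\<lambda>t. mg (cinv \<delta>) t (x' t) i"])
          (use below dT i continuous_on_subset[OF mc[OF i]] in \<open>auto simp: cl ok_def\<close>)
    next
      fix i assume i: "i < n"
      show "\<bar>vec_index (x' d) i\<bar> \<le> X"
        by (rule continuous_le_on_closure[of "{T..<d}" "\<lambda>t. \<bar>vec_index (x' t) i\<bar>"])
          (use below dT i continuous_on_subset[OF continuous_on_rabs[OF xc[OF i]]] in \<open>auto simp: cl ok_def\<close>)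
    qed
    have "sol {0..d} x'"
    proof (rule ok_sol)
      show "ok t" if "t \<in> {0..d}" "T \<le> t" for t using below[of t] okd that by (cases "t = d") auto
    qed (use dT in auto)
    moreover have "(\<exists>i<r. mg inverse d (x' d) i \<le> \<delta>) \<or> (\<exists>i<n. X \<le> \<bar>vec_index (x' d) i\<bar>)"
      using dbad ok_mg[OF okd] unfolding bad_def by auto
    moreover have "\<forall>t\<in>{0..T}. x' t = x t" using x'lo by simp
    ultimately show ?thesis using dT by blast
  qed
qed

text \<open>The a priori bounds \<delta> and X hold for every solution through (T, x T). Truncating
  at \<delta>/2 and X + 1 leaves a strict gap, so the level at which \<open>extension_step\<close>
  would stop is never met.\<close>

lemma global_extension:
  assumes T: "T > 0" and s: "sol {0..T} x"
  shows "\<exists>x'. sol {0..} x' \<and> (\<forall>t\<in>{0..T}. x' t = x t)"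
proof -
  have pos: "mg inverse T (x T) i > 0" if "i < r" for i using s T that by (simp add: sol_def)
  have fxi: "from_xi T (x T) b z \<longleftrightarrow> T \<le> b \<and> sol {T..b} z \<and> z T = x T" for b z
    by (rule from_xi_def[OF T pos])
  obtain \<delta> X where \<delta>: "\<delta> > 0" and ap: "\<forall>b z. from_xi T (x T) b z \<longrightarrow> (\<forall>i<r. \<delta> \<le> mg inverse b (z b) i) \<and> (\<forall>i<n. \<bar>vec_index (z b) i\<bar> \<le> X)"
    using apriori[OF T pos] by blast
  have "from_xi T (x T) T x" unfolding fxi using sol_subset[OF s, of "{T..T}"] T by simp
  then have 0: "\<forall>i<r. \<delta> \<le> mg inverse T (x T) i" "\<forall>i<n. \<bar>vec_index (x T) i\<bar> \<le> X" using ap by blast+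
  obtain x' where x': "\<forall>t\<in>{0..T}. x' t = x t" and alt: "sol {0..} x' \<or> (\<exists>d>T. sol {0..d} x' \<and>
     ((\<exists>i<r. mg inverse d (x' d) i \<le> \<delta>/2) \<or> (\<exists>i<n. X + 1 \<le> \<bar>vec_index (x' d) i\<bar>)))"
    using extension_step[of T x "\<delta>/2" "X + 1"] T s \<delta> 0 by force
  have "\<not> (\<exists>d>T. sol {0..d} x' \<and> ((\<exists>i<r. mg inverse d (x' d) i \<le> \<delta>/2) \<or> (\<exists>i<n. X + 1 \<le> \<bar>vec_index (x' d) i\<bar>)))"
  proof (intro notI, elim exE conjE)
    fix d assume d: "d > T" "sol {0..d} x'" and b: "(\<exists>i<r. mg inverse d (x' d) i \<le> \<delta>/2) \<or> (\<exists>i<n. X + 1 \<le> \<bar>vec_index (x' d) i\<bar>)"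
    have "from_xi T (x T) d x'"
      unfolding fxi using d T x' sol_subset[OF d(2), of "{T..d}"] by auto
    then have "\<forall>i<r. \<delta> \<le> mg inverse d (x' d) i" "\<forall>i<n. \<bar>vec_index (x' d) i\<bar> \<le> X" using ap by blast+
    then show False using b \<delta> by force
  qed
  then show ?thesis using alt x' by blast
qed

text \<open>The a priori bounds make the right-hand side bounded near \<open>c\<close>, so
  \<open>x\<close> is Lipschitz there and has a limit. Continuity at \<open>c\<close> is argued with
  the truncated inverse, since the margins at \<open>c\<close> are known to be positive only after
  passing to the limit.\<close>

lemma close_solution:
  assumes c: "c > 0" and s: "sol {0..<c} x"
  shows "\<exists>x'. sol {0..c} x' \<and> (\<forall>t\<in>{0..<c}. x' t = x t)"
proof -
  define T where "T = c / 2"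
  have T: "T > 0" "T < c" using c by (simp_all add: T_def)
  have pos: "mg inverse T (x T) i > 0" if "i < r" for i using s T that by (simp add: sol_def)
  have fxi: "from_xi T (x T) b z \<longleftrightarrow> T \<le> b \<and> sol {T..b} z \<and> z T = x T" for b z
    by (rule from_xi_def[OF T(1) pos])
  obtain \<delta> X where \<delta>: "\<delta> > 0" and ap: "\<forall>b z. from_xi T (x T) b z \<longrightarrow> (\<forall>i<r. \<delta> \<le> mg inverse b (z b) i) \<and> (\<forall>i<n. \<bar>vec_index (z b) i\<bar> \<le> X)"
    using apriori[OF T(1) pos] by blast
  have xd: "x t \<in> carrier_vec n" if "t \<in> {0..<c}" for t using s that by (simp add: sol_def)
  have bd: "(\<forall>i<r. \<delta> \<le> mg inverse t (x t) i)" "(\<forall>i<n. \<bar>vec_index (x t) i\<bar> \<le> X)" if "t \<in> {T..<c}" for t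
  proof -
    have "from_xi T (x T) t x" unfolding fxi using that T by (auto intro!: sol_subset[OF s])
    then show "(\<forall>i<r. \<delta> \<le> mg inverse t (x t) i)" "(\<forall>i<n. \<bar>vec_index (x t) i\<bar> \<le> X)" using ap by blast+
  qed
  obtain cG where cG: "\<forall>t\<ge>0. \<forall>x i. i < n \<longrightarrow> \<bar>vec_index (Gc (cinv \<delta>) t (clamp_vec X x)) i\<bar> \<le> cG" using rhs_bound[OF \<delta>, of X] ..
  have Gb: "\<bar>vec_index (Gc inverse t (x t)) i\<bar> \<le> max 0 cG" if t: "t \<in> {T..<c}" and i: "i < n" for t i
  proof -
    have t0: "0 \<le> t" "t \<in> {0..<c}" using t T by auto
    have "clamp_vec X (x t) = x t" by (rule clamp_vec_eq[OF xd[OF t0(2)]]) (use bd(2)[OF t] in blast)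
    moreover have "Gc (cinv \<delta>) t (x t) = Gc inverse t (x t)" by (rule Uc_cinv(2)) (use bd(1)[OF t] in blast)
    ultimately show ?thesis using cG[rule_format, OF t0(1) i, of "x t"] by simp
  qed
  have "\<exists>g. continuous_on {T..c} g \<and> (\<forall>t\<in>{T..<c}. g t = vec_index (x t) i)" if i: "i < n" for i
  proof -
    have "(max 0 cG)-lipschitz_on {T..<c} (\<lambda>t. vec_index (x t) i)"
    proof (rule lipschitz_onI)
      fix a b assume ab: "a \<in> {T..<c}" "b \<in> {T..<c}"
      have "norm (vec_index (x a) i - vec_index (x b) i) \<le> max 0 cG * norm (a - b)"
      proof (rule field_differentiable_bound[of "{T..<c}" "\<lambda>t. vec_index (x t) i" "\<lambda>t. vec_index (Gc inverse t (x t)) i"])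
        show "((\<lambda>t. vec_index (x t) i) has_field_derivative vec_index (Gc inverse z (x z)) i) (at z within {T..<c})" if "z \<in> {T..<c}" for z
          by (rule has_field_derivative_subset[of _ _ _ "{0..<c}"]) (use s that T i in \<open>auto simp: sol_def\<close>)
      qed (use Gb i ab in auto)
      then show "dist (vec_index (x a) i) (vec_index (x b) i) \<le> max 0 cG * dist a b" by (simp add: dist_real_def)
    qed simp
    then have "uniformly_continuous_on {T..<c} (\<lambda>t. vec_index (x t) i)" by (rule lipschitz_on_uniformly_continuous)
    from uniformly_continuous_on_extension_on_closure[OF this]
    obtain g where "uniformly_continuous_on (closure {T..<c}) g" "\<And>t. t \<in> {T..<c} \<Longrightarrow> vec_index (x t) i = g t" by metis
    moreover have "closure {T..<c} = {T..c}" using T by simp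
    ultimately show ?thesis using uniformly_continuous_imp_continuous by (intro exI[of _ g]) auto
  qed
  then have "\<forall>i\<in>{..<n}. \<exists>g. continuous_on {T..c} g \<and> (\<forall>t\<in>{T..<c}. g t = vec_index (x t) i)" by simp
  from bchoice[OF this] obtain g where g: "\<forall>i\<in>{..<n}. continuous_on {T..c} (g i) \<and> (\<forall>t\<in>{T..<c}. g i t = vec_index (x t) i)" ..
  define x' where "x' t = (if t < c then x t else vec n (\<lambda>i. g i c))" for t
  have x'lo: "x' t = x t" if "t < c" for t using that by (simp add: x'_def)
  have x'd: "x' t \<in> carrier_vec n" if "t \<in> {0..c}" for t
    using xd[of t] that by (cases "t < c") (simp_all add: x'_def)
  have xc: "continuous_on {T..c} (\<lambda>t. vec_index (x' t) i)" if "i < n" for i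
  proof (rule continuous_on_eq)
    show "continuous_on {T..c} (g i)" using g that by blast
    show "g i t = vec_index (x' t) i" if "t \<in> {T..c}" for t
      using g that \<open>i < n\<close> by (cases "t < c") (auto simp: x'_def)
  qed
  have Tc: "{T..c} \<subseteq> {0..c}" using T by auto
  have mc: "continuous_on {T..c} (\<lambda>t. mg (cinv \<delta>) t (x' t) j)" if "j < r" for j
    by (rule continuous_along(2)[OF _ _ xc cinv_cont[OF \<delta>] that]) (use T x'd in auto)
  have Gcont: "continuous_on {T..c} (\<lambda>t. vec_index (Gc (cinv \<delta>) t (x' t)) i)" if "i < n" for i
    by (rule continuous_along(1)[OF _ _ xc cinv_cont[OF \<delta>] that]) (use T x'd in auto)
  have mlo: "mg (cinv \<delta>) t (x' t) j = mg inverse t (x t) j" if "t \<in> {T..<c}" "j < r" for t j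
    using evx_cinv(1)[of j \<delta> t "x t"] bd(1)[OF that(1)] that x'lo[of t] by simp
  have cl: "closure {T..<c} = {T..c}" using T by simp
  have mgc: "\<delta> \<le> mg (cinv \<delta>) t (x' t) j" if "t \<in> {T..c}" "j < r" for t j
    by (rule continuous_ge_on_closure[of "{T..<c}" "\<lambda>t. mg (cinv \<delta>) t (x' t) j"])
      (use mc[OF that(2)] that mlo bd(1) in \<open>auto simp: cl\<close>)
  have mgi: "mg inverse t (x' t) j = mg (cinv \<delta>) t (x' t) j" if "t \<in> {T..c}" "j < r" for t j
    by (rule evx_cinv') (use mgc that in simp)
  have Geq: "Gc (cinv \<delta>) t (x' t) = Gc inverse t (x' t)" if "t \<in> {T..c}" for t
    by (rule Uc_cinv(2)) (use mgc mgi that in simp)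
  have "sol {0..c} x'"
    unfolding sol_def
  proof (intro conjI ballI allI impI)
    fix t assume t: "t \<in> {0..c}"
    show "x' t \<in> carrier_vec n" by (rule x'd[OF t])
    show "mg inverse t (x' t) i > 0" if i: "i < r" for i
    proof (cases "t < c")
      case True
      then show ?thesis using s t i x'lo[OF True] by (simp add: sol_def)
    next
      case False
      then have "t \<in> {T..c}" using t T by simp
      then show ?thesis using mgi mgc i \<delta> by force
    qed
    show "((\<lambda>s. vec_index (x' s) i) has_real_derivative vec_index (Gc inverse t (x' t)) i) (at t within {0..c})" if i: "i < n" for i
    proof (cases "t < c")
      case True
      have tI: "t \<in> {0..<c}" using t True by simp
      have "((\<lambda>s. vec_index (x s) i) has_real_derivative vec_index (Gc inverse t (x' t)) i) (at t within {0..<c})"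
        using s tI i unfolding x'lo[OF True] sol_def by blast
      then have "((\<lambda>s. vec_index (x' s) i) has_real_derivative vec_index (Gc inverse t (x' t)) i) (at t within {0..<c})"
        unfolding has_field_derivative_def by (rule has_derivative_transform[OF tI, rotated]) (simp add: x'_def)
      moreover have "at t within {0..c} = at t within {0..<c}"
        by (rule at_within_nhd[of _ "{..<c}"]) (use True in auto)
      ultimately show ?thesis by simp
    next
      case False
      then have tc: "t = c" "t \<in> {T..c}" using t T by simp_all
      have "((\<lambda>s. vec_index (x' s) i) has_real_derivative vec_index (Gc (cinv \<delta>) t (x' t)) i) (at t within {T..c})"
      proof (rule derivative_within_closed_interval[OF xc[OF i] Gcont[OF i] _ tc(2)])
        fix u assume u: "T < u" "u < c"
        then have uI: "u \<in> {0..<c}" "u \<in> {T..c}" using T by auto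
        have "((\<lambda>s. vec_index (x s) i) has_real_derivative vec_index (Gc inverse u (x' u)) i) (at u within {0..<c})"
          using s uI i unfolding x'lo[OF u(2)] sol_def by blast
        then have "((\<lambda>s. vec_index (x' s) i) has_real_derivative vec_index (Gc inverse u (x' u)) i) (at u within {0..<c})"
          unfolding has_field_derivative_def by (rule has_derivative_transform[OF uI(1), rotated]) (simp add: x'_def)
        moreover have "at u within {0..<c} = at u" by (rule at_within_interior) (use u T in simp)
        ultimately show "((\<lambda>s. vec_index (x' s) i) has_real_derivative vec_index (Gc (cinv \<delta>) u (x' u)) i) (at u)"
          unfolding Geq[OF uI(2)] by simp
      qed
      moreover have "at t within {0..c} = at t within {T..c}"
        by (rule at_within_nhd[of _ "{T<..}"]) (use tc T in auto)
      ultimately show ?thesis unfolding Geq[OF tc(2)] by simp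
    qed
  qed
  then show ?thesis using x'lo by (intro exI[of _ x']) auto
qed

end

section \<open>Global solutions\<close>

lemma vnorm_bound:
  assumes v: "v \<in> carrier_vec k" and c: "\<And>i. i < k \<Longrightarrow> \<bar>vec_index v i\<bar> \<le> c"
  shows "vnorm v \<le> real k * c"
proof -
  have "vnorm v \<le> (\<Sum>i<k. \<bar>vec_index v i\<bar>)" unfolding vnorm_eq[OF v] by (rule L2_set_le_sum_abs)
  also have "\<dots> \<le> (\<Sum>i<k. c)" by (rule sum_mono) (use c in simp)
  finally show ?thesis by simp
qed

context funnel_system
begin

section \<open>The initial condition and the Taylor polynomial of the output\<close>

lemma tdom_infinity: "tdom \<infinity> = {0..}"
  by (auto simp: tdom_def)

lemma tdom_ereal: "tdom (ereal c) = {0..<c}"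
  by (auto simp: tdom_def)

text \<open>The derivative of order \<open>k\<close> of the polynomial \<open>init_out\<close>; for
  k < r its value at 0 is the output derivative belonging to the initial state.\<close>

definition jet :: "real \<Rightarrow> nat \<Rightarrow> nat \<Rightarrow> real" where
  "jet t k l = (\<Sum>j<r - k. t ^ j / fact j * outd x0 (j + k) l)"

lemma jet_0: "k < r \<Longrightarrow> jet 0 k l = outd x0 k l"
proof -
  assume "k < r"
  then have "r - k = Suc (r - Suc k)" by simp
  then show ?thesis by (simp add: jet_def sum.lessThan_Suc_shift del: sum.lessThan_Suc)
qed

lemma jet_derivative:
  assumes "Suc k < r"
  shows "((\<lambda>s. jet s k l) has_real_derivative jet t (Suc k) l) (at t within S)"
proof -
  have rk: "r - k = Suc (r - Suc k)" using assms by simp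
  have one: "((\<lambda>s. s ^ Suc j / fact (Suc j) * c) has_real_derivative t ^ j / fact j * c) (at t within S)" for j and c :: real
  proof -
    have "((\<lambda>s. s ^ Suc j / fact (Suc j) * c) has_real_derivative (1 + real j) * t ^ j / fact (Suc j) * c) (at t within S)"
      using DERIV_cmult_right[OF DERIV_cdivide[OF DERIV_power_Suc[OF DERIV_ident]]] by (simp only: mult_1)
    moreover have "(1 + real j) * t ^ j / fact (Suc j) = t ^ j / fact j"
      by (simp add: divide_simps)
    ultimately show ?thesis by (simp only:)
  qed
  have "((\<lambda>s. outd x0 k l + (\<Sum>j<r - Suc k. s ^ Suc j / fact (Suc j) * outd x0 (Suc j + k) l)) has_real_derivative
     0 + (\<Sum>j<r - Suc k. t ^ j / fact j * outd x0 (Suc j + k) l)) (at t within S)"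
    by (intro DERIV_add DERIV_const DERIV_sum one)
  then show ?thesis
    unfolding jet_def rk sum.lessThan_Suc_shift by (simp del: fact_Suc power_Suc)
qed

lemma jet_tendsto: "((\<lambda>s. jet s k l) \<longlongrightarrow> jet t k l) (at t within S)"
  unfolding jet_def by (intro tendsto_intros) auto

lemma init_out_dim: "init_out A C r x0 t \<in> carrier_vec p"
  using dims by (simp add: init_out_def)

lemma init_out_jet: "l < p \<Longrightarrow> vec_index (init_out A C r x0 t) l = jet t 0 l"
  using dims by (simp add: init_out_def jet_def outd_def del: index_mult_mat_vec)

text \<open>Errors at \<open>t\<close> depend only on the signal near \<open>t\<close>. The initial
  condition is stated on the half-line, whereas the margins of the Taylor polynomial are controlled
  only near 0; this connects the two.\<close>

lemma err_local:
  assumes "0 \<le> t" "t < b"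
  shows "err yref \<phi> {0..} y i t = err yref \<phi> (tdom (ereal b)) y i t"
  using assms
proof (induction i arbitrary: t)
  case (Suc i)
  have nhd: "at t within {0..} = at t within {0..<b}"
    by (rule at_within_nhd[of _ "{..<b}"]) (use Suc.prems in auto)
  have "vector_derivative (\<lambda>s. vec_index (err yref \<phi> {0..} y i s) j) (at t within {0..<b})
      = vector_derivative (\<lambda>s. vec_index (err yref \<phi> {0..<b} y i s) j) (at t within {0..<b})" for j
    by (rule vector_derivative_cong_eq[OF always_eventually])
      (use Suc in \<open>auto simp: tdom_ereal\<close>)
  then have "vderiv {0..} (err yref \<phi> {0..} y i) t = vderiv {0..<b} (err yref \<phi> {0..<b} y i) t"
    unfolding vderiv_def nhd using Suc.IH[OF Suc.prems] by (simp add: tdom_ereal)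
  then show ?case using Suc.IH[OF Suc.prems] by (simp add: tdom_ereal)
qed simp

text \<open>Strong induction: positive margins of smaller index at 0 stay positive for the Taylor
  polynomial on some [0, b), where its errors are then given by the expressions. At 0 the jet of the
  polynomial agrees with that of the initial state.\<close>

lemma initial_margin:
  assumes init: "\<And>i. i < r \<Longrightarrow> \<phi> i 0 * vnorm (err yref \<phi> {0..} (init_out A C r x0) i 0) < 1"
  shows "i < r \<Longrightarrow> mg inverse 0 x0 i > 0"
proof (induction i rule: less_induct)
  case (less i)
  define M where "M t j = ev inverse (jet t) (Rt t) (Pt t) (margx p j)" for t j
  have M0: "M 0 j = mg inverse 0 x0 j" if "j < r" for j
    unfolding M_def mg_def evx_def by (rule ev_cong[OF lower_margx]) (use that jet_0 in simp)
  have Mpos: "M 0 j > 0" if "j < i" for j using less.IH[OF that] less.prems that M0[of j] by simp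
  have "eventually (\<lambda>t. 0 < M t j) (at 0 within {0..})" if j: "j < i" for j
  proof (rule order_tendstoD(1)[OF _ Mpos[OF j]])
    show "((\<lambda>t. M t j) \<longlongrightarrow> M 0 j) (at 0 within {0..})"
      unfolding M_def
    proof (rule ev_tendsto[OF jet_tendsto _ _ lower_margx])
      fix k l assume "k < Suc j" "l < p"
      then show "((\<lambda>s. Rt s k l) \<longlongrightarrow> Rt 0 k l) (at 0 within {0..})"
        using Rt_cont[of k l] j less.prems by (simp add: continuous_on_def)
    next
      fix a k assume "a + k < Suc j"
      then show "((\<lambda>s. Pt s a k) \<longlongrightarrow> Pt 0 a k) (at 0 within {0..})"
        using Pt_cont[of a k] j less.prems by (simp add: continuous_on_def)
    next
      show "all_inv (\<lambda>a. isCont inverse (ev inverse (jet 0) (Rt 0) (Pt 0) a)) (margx p j)"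
      proof (rule all_inv_margx, rule isCont_inverse_real)
        show "ev inverse (jet 0) (Rt 0) (Pt 0) (margx p a) \<noteq> 0" if "a < j" for a
          using Mpos[of a] that j by (simp add: M_def)
      qed
    qed
  qed
  then have "eventually (\<lambda>t. \<forall>j\<in>{..<i}. 0 < M t j) (at 0 within {0..})"
    by (intro eventually_ball_finite) simp_all
  then obtain b where b: "b > 0" "\<forall>t\<in>{0..}. t \<noteq> 0 \<and> dist t 0 < b \<longrightarrow> (\<forall>j\<in>{..<i}. 0 < M t j)"
    unfolding eventually_at by blast
  have nz: "M t j \<noteq> 0" if "t \<in> tdom (ereal b)" "j < i" for t j
    using that b(2) Mpos[OF that(2)] by (cases "t = 0") (force simp: tdom_ereal dist_real_def)+
  have 0: "0 \<in> tdom (ereal b)" using b by (simp add: tdom_ereal)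
  let ?e = "err yref \<phi> {0..} (init_out A C r x0) i 0"
  have "?e = err yref \<phi> (tdom (ereal b)) (init_out A C r x0) i 0"
    by (rule err_local) (use b in simp_all)
  also have "\<dots> = vec p (\<lambda>l. ev inverse (jet 0) (Rt 0) (Pt 0) (errx p i l))"
    by (rule err_eq_ev[OF init_out_dim init_out_jet jet_derivative nz[unfolded M_def] less.prems 0])
  finally have eq: "?e = vec p (\<lambda>l. ev inverse (jet 0) (Rt 0) (Pt 0) (errx p i l))" .
  have "0 \<le> \<phi> i 0 * vnorm ?e"
    using phi_nonneg[OF less.prems, of 0] by (simp add: vnorm_def sum_nonneg)
  then have "(\<phi> i 0 * vnorm ?e)\<^sup>2 < 1"
    using init[OF less.prems] by (simp add: power_less_one_iff abs_square_less_1)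
  moreover have "(vnorm ?e)\<^sup>2 = (\<Sum>l<p. (ev inverse (jet 0) (Rt 0) (Pt 0) (errx p i l))\<^sup>2)"
    unfolding eq by (simp add: vnorm_def sum_nonneg)
  ultimately have "M 0 i > 0" by (simp add: M_def ev_margx Pt_0 power_mult_distrib)
  then show ?case using M0 less.prems by simp
qed

section \<open>Existence, maximality and the final bounds\<close>

lemma positive_lower_bound:
  fixes g :: "nat \<Rightarrow> real"
  assumes "\<And>i. i < r \<Longrightarrow> g i > 0"
  shows "\<exists>\<delta>>0. \<forall>i<r. \<delta> < g i"
proof -
  have "g ` {..<r} \<noteq> {}" using r_pos by (auto simp: lessThan_empty_iff)
  then have pos: "Min (g ` {..<r}) > 0" using assms by (subst Min_gr_iff) auto
  have "Min (g ` {..<r}) / 2 < g i" if "i < r" for i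
  proof -
    have "Min (g ` {..<r}) \<le> g i" using that by (intro Min_le) auto
    then show ?thesis using pos by linarith
  qed
  then show ?thesis using pos by (intro exI[of _ "Min (g ` {..<r}) / 2"]) simp
qed

text \<open>The a priori bounds start at positive times only. A first extension from time 0 uses
  levels strictly inside the initial inequalities, and \<open>global_extension\<close> continues
  from the positive time it reaches.\<close>

lemma initial_value_problem:
  assumes "\<And>i. i < r \<Longrightarrow> mg inverse 0 x0 i > 0"
  shows "\<exists>x. sol {0..} x \<and> x 0 = x0"
proof -
  obtain \<delta> where \<delta>: "\<delta> > 0" "\<forall>i<r. \<delta> < mg inverse 0 x0 i" using positive_lower_bound[of "mg inverse 0 x0", OF assms] by blast
  \<comment> \<open>On the one-point interval the derivative condition is vacuous, so the constant
    initial state is a solution to be extended.\<close>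
  have bot: "at (0::real) within {0..0} = bot" by (simp add: at_within_def)
  have s: "sol {0..0} (\<lambda>_. x0)"
    unfolding sol_def has_field_derivative_iff using dims(4) assms bot by simp
  have X: "\<bar>vec_index x0 i\<bar> < 1 + (\<Sum>i<n. \<bar>vec_index x0 i\<bar>)" if "i < n" for i
    using member_le_sum[of i "{..<n}" "\<lambda>i. \<bar>vec_index x0 i\<bar>"] that by simp
  have "\<exists>x'. (\<forall>t\<in>{0..0}. x' t = x0) \<and> (sol {0..} x' \<or> (\<exists>d>0. sol {0..d} x' \<and>
     ((\<exists>i<r. mg inverse d (x' d) i \<le> \<delta>) \<or> (\<exists>i<n. 1 + (\<Sum>i<n. \<bar>vec_index x0 i\<bar>) \<le> \<bar>vec_index (x' d) i\<bar>))))"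
    by (rule extension_step[OF order_refl s \<delta>(1)]) (use \<delta>(2) X in simp_all)
  then obtain x where x: "x 0 = x0" and "sol {0..} x \<or> (\<exists>d>0. sol {0..d} x)" by auto
  then show ?thesis
  proof (elim disjE exE conjE)
    fix d :: real assume d: "0 < d" "sol {0..d} x"
    obtain x' where "sol {0..} x'" "\<forall>t\<in>{0..d}. x' t = x t" using global_extension[OF d] by blast
    then show ?thesis using x d by (intro exI[of _ x']) simp
  qed blast
qed

lemma cl_solution_global:
  "sol {0..} x \<Longrightarrow> x 0 = x0 \<Longrightarrow> cl_solution n A B C L f yref \<phi> K r x0 \<infinity> x"
  by (rule sol_imp_cl_solution) (simp_all add: tdom_infinity)

text \<open>Since \<open>global_extension\<close> starts from a closed interval, a finite right end
  point is first added to the solution.\<close>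

lemma cl_solution_extends:
  assumes cl: "cl_solution n A B C L f yref \<phi> K r x0 w x"
  shows "\<exists>x'. cl_solution n A B C L f yref \<phi> K r x0 \<infinity> x' \<and> (\<forall>t\<in>tdom w. x' t = x t)"
proof (cases w)
  case (real c)
  note s = cl_solution_imp_sol[OF cl]
  have c: "c > 0" using s(1) real by simp
  obtain x1 where x1: "sol {0..c} x1" "\<forall>t\<in>{0..<c}. x1 t = x t"
    using close_solution[OF c] s(3) unfolding real tdom_ereal by blast
  obtain x2 where x2: "sol {0..} x2" "\<forall>t\<in>{0..c}. x2 t = x1 t" using global_extension[OF c x1(1)] by blast
  have eq: "\<forall>t\<in>tdom w. x2 t = x t" using x1 x2 by (simp add: real tdom_ereal)
  moreover have "x2 0 = x0" using eq s(2) c by (simp add: real tdom_ereal)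
  ultimately show ?thesis using cl_solution_global[OF x2(1)] by blast
next
  case PInf
  then show ?thesis using cl by auto
next
  case MInf
  then show ?thesis using cl_solution_imp_sol(1)[OF cl] by simp
qed

lemma cl_maximal_global:
  "cl_solution n A B C L f yref \<phi> K r x0 \<infinity> x \<Longrightarrow> cl_maximal n A B C L f yref \<phi> K r x0 \<infinity> x"
  by (simp add: cl_maximal_def)

lemma cl_maximal_infinite:
  assumes "cl_maximal n A B C L f yref \<phi> K r x0 w x"
  shows "w = \<infinity>"
proof (rule ccontr)
  assume "w \<noteq> \<infinity>"
  moreover obtain x' where "cl_solution n A B C L f yref \<phi> K r x0 \<infinity> x'" "\<forall>t\<in>tdom w. x' t = x t"
    using cl_solution_extends assms unfolding cl_maximal_def by blast
  ultimately show False using assms unfolding cl_maximal_def by (meson ereal_infty_less(1))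
qed

lemma global_bounds:
  assumes s: "sol {0..} x"
  shows "\<exists>\<delta>>0. \<exists>X. \<forall>t\<ge>0. (\<forall>i<r. \<delta> \<le> mg inverse t (x t) i) \<and> (\<forall>i<n. \<bar>vec_index (x t) i\<bar> \<le> X)"
proof -
  have pos: "mg inverse t (x t) i > 0" if "0 \<le> t" "i < r" for t i using s that by (simp add: sol_def)
  \<comment> \<open>Any positive time would do: after it the a priori bounds apply, before it
    compactness of [0, T].\<close>
  define T :: real where "T = 1"
  have T: "T > 0" by (simp add: T_def)
  have posT: "mg inverse T (x T) i > 0" if "i < r" for i using pos that T by simp
  obtain \<delta> X where \<delta>: "\<delta> > 0" and ap: "\<forall>b z. from_xi T (x T) b z \<longrightarrow> (\<forall>i<r. \<delta> \<le> mg inverse b (z b) i) \<and> (\<forall>i<n. \<bar>vec_index (z b) i\<bar> \<le> X)"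
    using apriori[OF T posT] by blast
  have fxi: "from_xi T (x T) b z \<longleftrightarrow> T \<le> b \<and> sol {T..b} z \<and> z T = x T" for b z
    by (rule from_xi_def[OF T posT])
  have late: "(\<forall>i<r. \<delta> \<le> mg inverse t (x t) i) \<and> (\<forall>i<n. \<bar>vec_index (x t) i\<bar> \<le> X)" if "T \<le> t" for t
    using ap[rule_format, of t x] that T sol_subset[OF s, of "{T..t}"] unfolding fxi by auto
  have "\<exists>c>0. \<forall>t\<in>{0..T}. c \<le> mg inverse t (x t) i" if i: "i < r" for i
  proof -
    have "continuous_on {0..T} (\<lambda>t. mg inverse t (x t) i)"
      by (rule continuous_on_subset[OF sol_G_continuous(2)[OF s _ i]]) auto
    from continuous_attains_inf[OF _ _ this] obtain t where "t \<in> {0..T}" "\<forall>u\<in>{0..T}. mg inverse t (x t) i \<le> mg inverse u (x u) i" using T by auto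
    then show ?thesis using pos[of t i] i by auto
  qed
  then have "\<forall>i\<in>{..<r}. \<exists>c. c > 0 \<and> (\<forall>t\<in>{0..T}. c \<le> mg inverse t (x t) i)" by simp
  from bchoice[OF this] obtain c where c: "\<forall>i\<in>{..<r}. c i > 0 \<and> (\<forall>t\<in>{0..T}. c i \<le> mg inverse t (x t) i)" ..
  obtain c0 where c0: "c0 > 0" "\<forall>i<r. c0 < c i" using positive_lower_bound[of c] c by auto
  have "\<exists>c. \<forall>i\<in>{..<n}. \<forall>t\<in>{0..T}. \<bar>vec_index (x t) i\<bar> \<le> c"
  proof (rule uniform_bound_finite)
    fix i assume "i \<in> {..<n}"
    then have "continuous_on {0..T} (\<lambda>t. \<bar>vec_index (x t) i\<bar>)"
      by (intro continuous_on_rabs continuous_on_subset[OF sol_continuous[OF s]]) auto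
    from continuous_attains_sup[OF _ _ this] show "\<exists>c. \<forall>t\<in>{0..T}. \<bar>vec_index (x t) i\<bar> \<le> c" using T by auto
  qed simp
  then obtain X1 where X1: "\<forall>i\<in>{..<n}. \<forall>t\<in>{0..T}. \<bar>vec_index (x t) i\<bar> \<le> X1" ..
  have "(\<forall>i<r. min \<delta> c0 \<le> mg inverse t (x t) i) \<and> (\<forall>i<n. \<bar>vec_index (x t) i\<bar> \<le> max X X1)" if "0 \<le> t" for t
  proof (cases "T \<le> t")
    case True
    then show ?thesis using late by (auto simp: min_le_iff_disj le_max_iff_disj)
  next
    case False
    then have t: "t \<in> {0..T}" using that by simp
    have "min \<delta> c0 \<le> mg inverse t (x t) i" if "i < r" for i
    proof -
      have "min \<delta> c0 \<le> c0" "c0 < c i" "c i \<le> mg inverse t (x t) i" using c0 c t that by auto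
      then show ?thesis by linarith
    qed
    then show ?thesis using X1 t by (auto simp: le_max_iff_disj)
  qed
  then show ?thesis using \<delta> c0(1) by (intro exI[of _ "min \<delta> c0"] conjI exI[of _ "max X X1"]) simp_all
qed

text \<open>A margin of at least \<delta> means \<phi> |e| <= s with s = sqrt (1 - \<delta>), so |e|
  stays below 1/\<phi> by at least (1 - s)/\<phi>. Here \<open>lam\<close> is an upper bound of the
  funnel function, which makes the gap uniform in time.\<close>

lemma margin_gap:
  assumes m: "\<delta> \<le> mg inverse t (x t) i" and \<delta>: "\<delta> > 0" and lam: "0 < \<phi> i t" "\<phi> i t \<le> lam"
  shows "vnorm (Er inverse t (x t) i) \<le> 1 / \<phi> i t - (1 - sqrt (1 - \<delta>)) / lam"
proof -
  define s where "s = sqrt (1 - \<delta>)"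
  have s1: "s \<le> 1" using \<delta> by (simp add: s_def)
  have "\<phi> i t * vnorm (Er inverse t (x t) i) \<le> s"
    unfolding s_def by (rule real_le_rsqrt) (use m in \<open>simp add: mg_eq power_mult_distrib\<close>)
  then have "vnorm (Er inverse t (x t) i) \<le> s / \<phi> i t" using lam(1) by (simp add: pos_le_divide_eq mult.commute)
  also have "\<dots> = 1 / \<phi> i t - (1 - s) / \<phi> i t" by (simp add: diff_divide_distrib)
  also have "\<dots> \<le> 1 / \<phi> i t - (1 - s) / lam"
    using divide_left_mono[OF lam(2), of "1 - s"] s1 lam by simp
  finally show ?thesis by (simp add: s_def)
qed

lemma global_solution_properties:
  assumes cl: "cl_solution n A B C L f yref \<phi> K r x0 \<infinity> x"
  defines "y \<equiv> (\<lambda>t. C *\<^sub>v x t)"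
  shows "\<exists>c. \<forall>t\<ge>0. vnorm (ctrl yref \<phi> K r (tdom \<infinity>) y t) \<le> c"
    and "i < r \<Longrightarrow> \<exists>c. \<forall>t\<ge>0. \<bar>gain yref \<phi> (tdom \<infinity>) y i t\<bar> \<le> c"
    and "\<exists>c. \<forall>t\<ge>0. vnorm (x t) \<le> c"
    and "i < r \<Longrightarrow> \<exists>\<epsilon>>0. \<forall>t>0. vnorm (err yref \<phi> (tdom \<infinity>) y i t) \<le> 1 / \<phi> i t - \<epsilon>"
    and "\<forall>t\<ge>0. \<phi> 0 t * vnorm (err yref \<phi> (tdom \<infinity>) y 0 t) < 1"
proof -
  have s: "sol (tdom \<infinity>) x" by (rule cl_solution_imp_sol(3)[OF cl])
  have x: "x t \<in> carrier_vec n" if "0 \<le> t" for t using s that by (simp add: sol_def tdom_infinity)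
  have r0: "0 < r" using r_pos by simp
  obtain \<delta> X where \<delta>: "\<delta> > 0"
    and b: "\<forall>t\<ge>0. (\<forall>i<r. \<delta> \<le> mg inverse t (x t) i) \<and> (\<forall>i<n. \<bar>vec_index (x t) i\<bar> \<le> X)"
    using global_bounds[of x] s unfolding tdom_infinity by blast
  have mb: "\<delta> \<le> mg inverse t (x t) i" if "0 \<le> t" "i < r" for t i using b that by blast
  have Xb: "\<bar>vec_index (x t) i\<bar> \<le> X" if "0 \<le> t" "i < n" for t i using b that by blast
  have T: "t \<in> tdom \<infinity>" if "0 \<le> t" for t using that by (simp add: tdom_infinity)
  note err = sol_err[OF s T, folded y_def]
  obtain cu where cu: "\<forall>t\<ge>0. \<forall>x i. i < m \<longrightarrow> \<bar>vec_index (Uc (cinv \<delta>) t (clamp_vec X x)) i\<bar> \<le> cu"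
    using input_bound[OF \<delta>, of X] by blast
  show "\<exists>c. \<forall>t\<ge>0. vnorm (ctrl yref \<phi> K r (tdom \<infinity>) y t) \<le> c"
  proof (intro exI allI impI)
    fix t :: real assume t: "0 \<le> t"
    have cx: "clamp_vec X (x t) = x t" by (rule clamp_vec_eq[OF x[OF t] Xb[OF t]])
    have U: "Uc (cinv \<delta>) t (x t) = Uc inverse t (x t)" by (rule Uc_cinv(1)[OF mb[OF t]])
    show "vnorm (ctrl yref \<phi> K r (tdom \<infinity>) y t) \<le> real m * cu"
      unfolding err(3)[OF t r0]
      by (rule vnorm_bound[OF Uc_dim]) (use cu[rule_format, OF t, of _ "x t"] in \<open>simp add: cx U\<close>)
  qed
  show "\<exists>c. \<forall>t\<ge>0. \<bar>gain yref \<phi> (tdom \<infinity>) y i t\<bar> \<le> c" if i: "i < r"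
  proof (intro exI allI impI)
    fix t :: real assume t: "0 \<le> t"
    have "inverse (mg inverse t (x t) i) \<le> inverse \<delta>" by (rule le_imp_inverse_le[OF mb[OF t i] \<delta>])
    moreover have "inverse (mg inverse t (x t) i) \<ge> 0" using mb[OF t i] \<delta> by simp
    ultimately show "\<bar>gain yref \<phi> (tdom \<infinity>) y i t\<bar> \<le> inverse \<delta>" unfolding err(2)[OF t i] by simp
  qed
  show "\<exists>c. \<forall>t\<ge>0. vnorm (x t) \<le> c"
    by (intro exI[of _ "real n * X"] allI impI vnorm_bound x Xb)
  show "\<exists>\<epsilon>>0. \<forall>t>0. vnorm (err yref \<phi> (tdom \<infinity>) y i t) \<le> 1 / \<phi> i t - \<epsilon>" if i: "i < r"
  proof -
    obtain c where c: "\<forall>t\<ge>0. \<forall>j<r. \<forall>k. j + k \<le> r \<longrightarrow> \<bar>Pt t j k\<bar> \<le> c" using Pt_bdd by blast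
    \<comment> \<open>The maximum with 1 keeps the denominator of the gap positive.\<close>
    have phi_le: "\<phi> i t \<le> max 1 c" if "0 \<le> t" for t
      using c[rule_format, OF that i, of 0] i by (simp add: Pt_0)
    show ?thesis
    proof (intro exI[of _ "(1 - sqrt (1 - \<delta>)) / max 1 c"] conjI allI impI)
      show "(1 - sqrt (1 - \<delta>)) / max 1 c > 0" using \<delta> by (intro divide_pos_pos) simp_all
      fix t :: real assume t: "0 < t"
      then have t0: "0 \<le> t" by simp
      show "vnorm (err yref \<phi> (tdom \<infinity>) y i t) \<le> 1 / \<phi> i t - (1 - sqrt (1 - \<delta>)) / max 1 c"
        unfolding err(1)[OF t0 i] by (rule margin_gap[where x = x, OF mb[OF t0 i] \<delta> phi_pos[OF i t] phi_le[OF t0]])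
    qed
  qed
  have "\<forall>i<r. \<forall>t\<in>tdom \<infinity>. \<phi> i t * vnorm (err yref \<phi> (tdom \<infinity>) y i t) < 1"
    using cl unfolding cl_solution_def Let_def y_def by blast
  then show "\<forall>t\<ge>0. \<phi> 0 t * vnorm (err yref \<phi> (tdom \<infinity>) y 0 t) < 1" using r0 T by blast
qed

end

theorem theorem2:
  fixes n m p r :: nat
    and A B C V :: "real mat" and x0 :: "real vec"
    and f :: "real \<Rightarrow> real vec \<Rightarrow> real vec \<Rightarrow> real vec"
    and L K :: "real \<Rightarrow> real mat"
    and yref :: "real \<Rightarrow> real vec"
    and \<phi> :: "nat \<Rightarrow> real \<Rightarrow> real"
    and \<alpha> :: real
  assumes mp: "m \<ge> p"
    and dims: "A \<in> carrier_mat n n" "B \<in> carrier_mat n m" "C \<in> carrier_mat p n" "x0 \<in> carrier_vec n"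
    and f_dim: "\<forall>t x u. x \<in> carrier_vec n \<longrightarrow> u \<in> carrier_vec m \<longrightarrow> f t x u \<in> carrier_vec n"
    and f_cont: "vfun_continuous n m f"
    and f_bdd: "\<exists>c. \<forall>t x u. x \<in> carrier_vec n \<longrightarrow> u \<in> carrier_vec m \<longrightarrow> vnorm (f t x u) \<le> c"
    \<comment> \<open>(P1)\<close>
    and P1_smooth: "smooth_matfun m m L"
    and P1_bdd: "\<forall>k\<le>n. \<forall>i<m. \<forall>j<m. \<exists>c. \<forall>t. \<bar>(deriv ^^ k) (\<lambda>s. L s $$ (i,j)) t\<bar> \<le> c"
    and P1_rank: "\<exists>q. q \<ge> p \<and> (\<forall>t. rank_mat (B * L t) = q)"
    \<comment> \<open>(P2)\<close>
    and r_pos: "r \<ge> 1"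
    and P2_BL: "\<forall>k. k + 2 \<le> r \<longrightarrow> (\<forall>t. C * A ^\<^sub>m k * (B * L t) = 0\<^sub>m p m)"
    and P2_f: "\<forall>k. k + 2 \<le> r \<longrightarrow> (\<forall>t x u. x \<in> carrier_vec n \<longrightarrow> u \<in> carrier_vec m
                  \<longrightarrow> (C * A ^\<^sub>m k) *\<^sub>v f t x u = 0\<^sub>v p)"
    and P2_rank: "\<forall>t. rank_mat (C * A ^\<^sub>m (r - 1) * B * L t) = p"
    \<comment> \<open>the matrix V\<close>
    and V_dim: "V \<in> carrier_mat n (n - p * r)"
    and V_im: "{V *\<^sub>v v | v. v \<in> carrier_vec (n - p * r)} = mat_kernel (calC p n r A C)"
    \<comment> \<open>(P3), (P4)\<close>
    and P3: "lyapunov_transformation n (calU n m p r A B C V L)"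
    and P4: "unif_exp_stable (n - p * r) (Qfun n m p r A B C V L)"
    \<comment> \<open>reference and funnel functions\<close>
    and yref_W: "W_inf r p yref"
    and phi_Phi: "\<forall>i<r. \<phi> i \<in> Phi (r - i)"
    \<comment> \<open>the gain matrix K\<close>
    and K_smooth: "smooth_matfun m p K"
    and K_bdd: "mat_bounded K UNIV"
    and alpha_pos: "\<alpha> > 0"
    and K_pos: "\<forall>t. \<forall>v\<in>carrier_vec p.
        scalar_prod v ((C * A ^\<^sub>m (r - 1) * B * L t * K t + transpose_mat (C * A ^\<^sub>m (r - 1) * B * L t * K t)
                        - \<alpha> \<cdot>\<^sub>m 1\<^sub>m p) *\<^sub>v v) \<ge> 0"
    and K_N: "\<forall>t. Nfun n m p r A B C V L t * K t = 0\<^sub>m (n - p * r) p"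
    \<comment> \<open>initial condition\<close>
    and init: "\<forall>i<r. \<phi> i 0 * vnorm (err yref \<phi> {0..} (init_out A C r x0) i 0) < 1"
  shows "(\<exists>w x. cl_solution n A B C L f yref \<phi> K r x0 w x)
    \<and> (\<forall>w x. cl_solution n A B C L f yref \<phi> K r x0 w x \<longrightarrow>
          (\<exists>w' x'. w \<le> w' \<and> (\<forall>t\<in>tdom w. x' t = x t) \<and> cl_maximal n A B C L f yref \<phi> K r x0 w' x'))
    \<and> (\<forall>w x. cl_maximal n A B C L f yref \<phi> K r x0 w x \<longrightarrow>
          (let S = tdom w; y = (\<lambda>t. C *\<^sub>v x t) in
           w = \<infinity>
           \<and> (\<exists>c. \<forall>t\<ge>0. vnorm (ctrl yref \<phi> K r S y t) \<le> c)
           \<and> (\<forall>i<r. \<exists>c. \<forall>t\<ge>0. \<bar>gain yref \<phi> S y i t\<bar> \<le> c)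
           \<and> (\<exists>c. \<forall>t\<ge>0. vnorm (x t) \<le> c)
           \<and> (\<forall>i<r. \<exists>\<epsilon>>0. \<forall>t>0. vnorm (err yref \<phi> S y i t) \<le> 1 / \<phi> i t - \<epsilon>)
           \<and> (\<forall>t\<ge>0. \<phi> 0 t * vnorm (err yref \<phi> S y 0 t) < 1)))"
proof -
  have L_bdd: "\<exists>c. \<forall>t. \<bar>L t $$ (i,j)\<bar> \<le> c" if "i < m" "j < m" for i j
    using P1_bdd[rule_format, of 0 i j] that by simp
  interpret funnel_system n m p r A B C V x0 f L K yref \<phi> \<alpha>
    by (rule funnel_system.intro)
      (rule dims f_dim[rule_format] f_cont f_bdd P1_smooth L_bdd r_pos P2_BL[rule_format] P2_f[rule_format] V_dim V_im P3 P4
        yref_W phi_Phi[rule_format] K_smooth K_bdd alpha_pos K_pos[rule_format] K_N[rule_format]; assumption)+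
  have m: "mg inverse 0 x0 i > 0" if "i < r" for i
    by (rule initial_margin[OF _ that]) (use init in blast)
  have "\<exists>x. sol {0..} x \<and> x 0 = x0" by (rule initial_value_problem) (rule m)
  then obtain z where z: "cl_solution n A B C L f yref \<phi> K r x0 \<infinity> z"
    using cl_solution_global by blast
  show ?thesis
  proof (intro conjI allI impI)
    show "\<exists>w x. cl_solution n A B C L f yref \<phi> K r x0 w x" using z by blast
    show "\<exists>w' x'. w \<le> w' \<and> (\<forall>t\<in>tdom w. x' t = x t) \<and> cl_maximal n A B C L f yref \<phi> K r x0 w' x'"
      if "cl_solution n A B C L f yref \<phi> K r x0 w x" for w x
      using cl_solution_extends[OF that] cl_maximal_global by (intro exI[of _ \<infinity>]) auto
    fix w x assume max: "cl_maximal n A B C L f yref \<phi> K r x0 w x"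
    have w: "w = \<infinity>" by (rule cl_maximal_infinite[OF max])
    then have cl: "cl_solution n A B C L f yref \<phi> K r x0 \<infinity> x" using max by (simp add: cl_maximal_def)
    show "let S = tdom w; y = (\<lambda>t. C *\<^sub>v x t) in
           w = \<infinity>
           \<and> (\<exists>c. \<forall>t\<ge>0. vnorm (ctrl yref \<phi> K r S y t) \<le> c)
           \<and> (\<forall>i<r. \<exists>c. \<forall>t\<ge>0. \<bar>gain yref \<phi> S y i t\<bar> \<le> c)
           \<and> (\<exists>c. \<forall>t\<ge>0. vnorm (x t) \<le> c)
           \<and> (\<forall>i<r. \<exists>\<epsilon>>0. \<forall>t>0. vnorm (err yref \<phi> S y i t) \<le> 1 / \<phi> i t - \<epsilon>)
           \<and> (\<forall>t\<ge>0. \<phi> 0 t * vnorm (err yref \<phi> S y 0 t) < 1)"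
      unfolding Let_def w using global_solution_properties[OF cl] by (intro conjI allI impI refl) blast+
  qed
qed

end
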